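(* Let $\Omega\subseteq\mathbb{R}^N$, $N\ge 2$, be a bounded domain with Lipschitz boundary $\partial\Omega$. For $i=1,2$ let $p_i,q_i\in C(\overline\Omega)$ satisfy $1<p_i(x)<N$ and $p_i(x)<q_i(x)<p_i^*(x):=\frac{Np_i(x)}{N-p_i(x)}$ for all $x\in\overline\Omega$, and let $\mu_i\in L^\infty(\Omega)$ with $\mu_i\ge 0$. Let $f_i\colon\Omega\times\mathbb{R}\times\mathbb{R}\times\mathbb{R}^N\times\mathbb{R}^N\to\mathbb{R}$ ($i=1,2$) be Carathéodory functions. Suppose there exist $\hat\varphi_i,\hat\psi_i\in L^{p_i'(\cdot)}(\Omega)$ ($i=1,2$) such that $0\le\hat\varphi_i\le\hat\psi_i$, $\hat\varphi_i\not\equiv0$, and $$\hat\varphi_i(x)\le f_i(x,s_1,s_2,\xi_1,\xi_2)\le\hat\psi_i(x)$$ for a.a. $x\in\Omega$ and for all $(s_1,s_2,\xi_1,\xi_2)\in[0,+\infty)\times[0,+\infty)\times\mathbb{R}^N\times\mathbb{R}^N$. Then there exists a weak solution $(u_1,u_2)\in\mathcal{W}_0$ of the Dirichlet system (D) defined in the context.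
   Context: Notation. For $r\in C(\overline\Omega)$ with $r>1$ on $\overline\Omega$, $L^{r(\cdot)}(\Omega)$ is the variable exponent Lebesgue space of measurable $u\colon\Omega\to\mathbb{R}$ with $\int_\Omega|u|^{r(x)}\,dx<\infty$, and $r'$ is the conjugate exponent, $\frac1{r(x)}+\frac1{r'(x)}=1$. For $i=1,2$ let $\mathcal{H}_i(x,t)=t^{p_i(x)}+\mu_i(x)t^{q_i(x)}$ for $x\in\Omega$, $t\ge0$, and $\rho_{\mathcal{H}_i}(u)=\int_\Omega\mathcal{H}_i(x,|u|)\,dx$. The Musielak-Orlicz space is $L^{\mathcal{H}_i}(\Omega)=\{u\text{ measurable}:\rho_{\mathcal{H}_i}(u)<\infty\}$ with Luxemburg norm $\|u\|_{\mathcal{H}_i}=\inf\{\tau>0:\rho_{\mathcal{H}_i}(u/\tau)\le1\}$, and the Musielak-Orlicz Sobolev space is $W^{1,\mathcal{H}_i}(\Omega)=\{u\in L^{\mathcal{H}_i}(\Omega):|\nabla u|\in L^{\mathcal{H}_i}(\Omega)\}$ with norm $\|u\|_{\mathcal{H}_i}+\|\,|\nabla u|\,\|_{\mathcal{H}_i}$; $W^{1,\mathcal{H}_i}_0(\Omega)$ is the completion of $C_0^\infty(\Omega)$ in $W^{1,\mathcal{H}_i}(\Omega)$. Set $\mathcal{W}_0=W^{1,\mathcal{H}_1}_0(\Omega)\times W^{1,\mathcal{H}_2}_0(\Omega)$. The Dirichlet system (D) is: for $i=1,2$, $$-\operatorname{div}\big(|\nabla u_i|^{p_i(x)-2}\nabla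 u_i+\mu_i(x)|\nabla u_i|^{q_i(x)-2}\nabla u_i\big)=f_i(x,u_1,u_2,\nabla u_1,\nabla u_2)\ \text{ in }\Omega,\qquad u_i=0\ \text{ on }\partial\Omega.$$ Weak solution: $(u_1,u_2)\in\mathcal{W}_0$ is a weak solution of (D) if for all $(v_1,v_2)\in\mathcal{W}_0$ and $i=1,2$ $$\int_\Omega\big(|\nabla u_i|^{p_i(x)-2}\nabla u_i+\mu_i(x)|\nabla u_i|^{q_i(x)-2}\nabla u_i\big)\cdot\nabla v_i\,dx=\int_\Omega f_i(x,u_1,u_2,\nabla u_1,\nabla u_2)v_i\,dx,$$ all integrals being finite. *)

theory Defs
  imports "HOL-Analysis.Analysis"
begin

text \<open>Functions on a domain \<open>\<Omega>\<close> are total functions of which only the values on \<open>\<Omega>\<close> matter.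
  Elements of function spaces are representatives, not classes modulo null sets.\<close>

section \<open>Domains\<close>

text \<open>Near each boundary point \<open>\<Omega>\<close> lies strictly above the graph of a Lipschitz function \<open>\<gamma>\<close> over
  the hyperplane orthogonal to a unit vector \<open>e\<close>, which is the last axis of a rotated coordinate
  system; \<open>x - (x \<bullet> e) *\<^sub>R e\<close> stands for the remaining coordinates of \<open>x\<close>.\<close>

definition lipschitz_boundary :: "'a::euclidean_space set \<Rightarrow> bool" where
  "lipschitz_boundary \<Omega> \<longleftrightarrow>
    (\<forall>z \<in> frontier \<Omega>. \<exists>r>0. \<exists>e L. \<exists>\<gamma> :: 'a \<Rightarrow> real.
       norm e = 1 \<and> L-lipschitz_on {y. y \<bullet> e = 0} \<gamma> \<and>
       \<Omega> \<inter> ball z r = {x \<in> ball z r. \<gamma> (x - (x \<bullet> e) *\<^sub>R e) < x \<bullet> e})"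

definition bounded_lipschitz_domain :: "'a::euclidean_space set \<Rightarrow> bool" where
  "bounded_lipschitz_domain \<Omega> \<longleftrightarrow>
    open \<Omega> \<and> connected \<Omega> \<and> \<Omega> \<noteq> {} \<and> bounded \<Omega> \<and> lipschitz_boundary \<Omega>"


section \<open>Musielak-Orlicz spaces\<close>

text \<open>The modular takes values in \<open>[0, \<infinity>]\<close>, hence the nonnegative integral.\<close>

definition modular :: "'a::euclidean_space set \<Rightarrow> ('a \<Rightarrow> real \<Rightarrow> real) \<Rightarrow> ('a \<Rightarrow> real) \<Rightarrow> ennreal" where
  "modular \<Omega> \<Phi> u = (\<integral>\<^sup>+ x. ennreal (\<Phi> x \<bar>u x\<bar>) \<partial>lebesgue_on \<Omega>)"

definition musielak_orlicz :: "'a::euclidean_space set \<Rightarrow> ('a \<Rightarrow> real \<Rightarrow> real) \<Rightarrow> ('a \<Rightarrow> real) set" where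
  "musielak_orlicz \<Omega> \<Phi> = {u \<in> borel_measurable (lebesgue_on \<Omega>). modular \<Omega> \<Phi> u < \<infinity>}"

definition luxemburg_norm :: "'a::euclidean_space set \<Rightarrow> ('a \<Rightarrow> real \<Rightarrow> real) \<Rightarrow> ('a \<Rightarrow> real) \<Rightarrow> real" where
  "luxemburg_norm \<Omega> \<Phi> u = Inf {\<tau>. 0 < \<tau> \<and> modular \<Omega> \<Phi> (\<lambda>x. u x / \<tau>) \<le> 1}"

definition double_phase :: "('a \<Rightarrow> real) \<Rightarrow> ('a \<Rightarrow> real) \<Rightarrow> ('a \<Rightarrow> real) \<Rightarrow> 'a \<Rightarrow> real \<Rightarrow> real" where
  "double_phase p q \<mu> x t = t powr p x + \<mu> x * t powr q x"

definition variable_lebesgue :: "'a::euclidean_space set \<Rightarrow> ('a \<Rightarrow> real) \<Rightarrow> ('a \<Rightarrow> real) set" where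
  "variable_lebesgue \<Omega> r = musielak_orlicz \<Omega> (\<lambda>x t. t powr r x)"

text \<open>The solution \<open>r'\<close> of \<open>1 / r x + 1 / r' x = 1\<close> for \<open>r x > 1\<close>.\<close>

definition conjugate_exponent :: "('a \<Rightarrow> real) \<Rightarrow> 'a \<Rightarrow> real" where
  "conjugate_exponent r x = r x / (r x - 1)"

definition L_infinity :: "'a::euclidean_space set \<Rightarrow> ('a \<Rightarrow> real) set" where
  "L_infinity \<Omega> = {u \<in> borel_measurable (lebesgue_on \<Omega>). \<exists>C. AE x in lebesgue_on \<Omega>. \<bar>u x\<bar> \<le> C}"


section \<open>Test functions and weak gradients\<close>

definition partial_derivative :: "'n \<Rightarrow> (real^'n::finite \<Rightarrow> real) \<Rightarrow> real^'n \<Rightarrow> real" where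
  "partial_derivative i \<phi> x = frechet_derivative \<phi> (at x) (axis i 1)"

primrec C_k :: "nat \<Rightarrow> (real^'n::finite \<Rightarrow> real) \<Rightarrow> bool" where
  "C_k 0 \<phi> \<longleftrightarrow> continuous_on UNIV \<phi>"
| "C_k (Suc k) \<phi> \<longleftrightarrow>
    (\<forall>x. \<phi> differentiable (at x)) \<and> (\<forall>i. C_k k (partial_derivative i \<phi>))"

definition test_functions :: "(real^'n::finite) set \<Rightarrow> (real^'n \<Rightarrow> real) set" where
  "test_functions \<Omega> =
    {\<phi>. (\<forall>k. C_k k \<phi>) \<and> compact (closure {x. \<phi> x \<noteq> 0}) \<and> closure {x. \<phi> x \<noteq> 0} \<subseteq> \<Omega>}"

definition locally_integrable ::
    "'a::euclidean_space set \<Rightarrow> ('a \<Rightarrow> 'b::{banach, second_countable_topology}) \<Rightarrow> bool" where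
  "locally_integrable \<Omega> u \<longleftrightarrow> (\<forall>K. compact K \<and> K \<subseteq> \<Omega> \<longrightarrow> set_integrable lebesgue K u)"

definition has_weak_gradient ::
    "(real^'n::finite) set \<Rightarrow> (real^'n \<Rightarrow> real) \<Rightarrow> (real^'n \<Rightarrow> real^'n) \<Rightarrow> bool" where
  "has_weak_gradient \<Omega> u g \<longleftrightarrow>
    locally_integrable \<Omega> u \<and> locally_integrable \<Omega> g \<and>
    (\<forall>\<phi> \<in> test_functions \<Omega>. \<forall>i.
       (LINT x|lebesgue_on \<Omega>. u x * partial_derivative i \<phi> x) =
       - (LINT x|lebesgue_on \<Omega>. g x $ i * \<phi> x))"

text \<open>For open \<open>\<Omega>\<close> the weak gradient is unique up to a null set, so the choice is immaterial
  wherever only integrals or almost-everywhere properties are considered.\<close>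

definition weak_gradient ::
    "(real^'n::finite) set \<Rightarrow> (real^'n \<Rightarrow> real) \<Rightarrow> real^'n \<Rightarrow> real^'n" where
  "weak_gradient \<Omega> u = (SOME g. has_weak_gradient \<Omega> u g)"


section \<open>Musielak-Orlicz Sobolev spaces\<close>

definition musielak_sobolev ::
    "(real^'n::finite) set \<Rightarrow> (real^'n \<Rightarrow> real \<Rightarrow> real) \<Rightarrow> (real^'n \<Rightarrow> real) set" where
  "musielak_sobolev \<Omega> \<Phi> =
    {u \<in> musielak_orlicz \<Omega> \<Phi>. (\<exists>g. has_weak_gradient \<Omega> u g) \<and>
       (\<lambda>x. norm (weak_gradient \<Omega> u x)) \<in> musielak_orlicz \<Omega> \<Phi>}"

definition sobolev_norm ::
    "(real^'n::finite) set \<Rightarrow> (real^'n \<Rightarrow> real \<Rightarrow> real) \<Rightarrow> (real^'n \<Rightarrow> real) \<Rightarrow> real" where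
  "sobolev_norm \<Omega> \<Phi> u =
    luxemburg_norm \<Omega> \<Phi> u + luxemburg_norm \<Omega> \<Phi> (\<lambda>x. norm (weak_gradient \<Omega> u x))"

text \<open>The completion of the test functions inside the (complete) Sobolev space, that is, their
  closure in the Sobolev norm.\<close>

definition musielak_sobolev_0 ::
    "(real^'n::finite) set \<Rightarrow> (real^'n \<Rightarrow> real \<Rightarrow> real) \<Rightarrow> (real^'n \<Rightarrow> real) set" where
  "musielak_sobolev_0 \<Omega> \<Phi> =
    {u \<in> musielak_sobolev \<Omega> \<Phi>.
       \<forall>\<epsilon>>0. \<exists>\<phi> \<in> test_functions \<Omega>. sobolev_norm \<Omega> \<Phi> (\<lambda>x. u x - \<phi> x) < \<epsilon>}"


section \<open>The Dirichlet system\<close>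

definition caratheodory ::
    "(real^'n::finite) set \<Rightarrow>
     (real^'n \<Rightarrow> real \<Rightarrow> real \<Rightarrow> real^'n \<Rightarrow> real^'n \<Rightarrow> real) \<Rightarrow> bool" where
  "caratheodory \<Omega> f \<longleftrightarrow>
    (\<forall>s\<^sub>1 s\<^sub>2 \<xi>\<^sub>1 \<xi>\<^sub>2. (\<lambda>x. f x s\<^sub>1 s\<^sub>2 \<xi>\<^sub>1 \<xi>\<^sub>2) \<in> borel_measurable (lebesgue_on \<Omega>)) \<and>
    (AE x in lebesgue_on \<Omega>. continuous_on UNIV (\<lambda>(s\<^sub>1, s\<^sub>2, \<xi>\<^sub>1, \<xi>\<^sub>2). f x s\<^sub>1 s\<^sub>2 \<xi>\<^sub>1 \<xi>\<^sub>2))"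

text \<open>The flux vanishes at \<open>\<xi> = 0\<close>, also when an exponent is below 2.\<close>

definition double_phase_flux ::
    "(real^'n::finite \<Rightarrow> real) \<Rightarrow> (real^'n \<Rightarrow> real) \<Rightarrow> (real^'n \<Rightarrow> real) \<Rightarrow>
     real^'n \<Rightarrow> real^'n \<Rightarrow> real^'n" where
  "double_phase_flux p q \<mu> x \<xi> =
    (norm \<xi> powr (p x - 2)) *\<^sub>R \<xi> + (\<mu> x * norm \<xi> powr (q x - 2)) *\<^sub>R \<xi>"

text \<open>One weak equation with right-hand side \<open>F\<close>, tested with \<open>v\<close>; Bochner integrals
  default to 0, so finiteness is stated through integrability.\<close>

definition weak_equation ::
    "(real^'n::finite) set \<Rightarrow> (real^'n \<Rightarrow> real) \<Rightarrow> (real^'n \<Rightarrow> real) \<Rightarrow> (real^'n \<Rightarrow> real) \<Rightarrow>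
     (real^'n \<Rightarrow> real) \<Rightarrow> (real^'n \<Rightarrow> real) \<Rightarrow> (real^'n \<Rightarrow> real) \<Rightarrow> bool" where
  "weak_equation \<Omega> p q \<mu> F u v \<longleftrightarrow>
    integrable (lebesgue_on \<Omega>)
      (\<lambda>x. double_phase_flux p q \<mu> x (weak_gradient \<Omega> u x) \<bullet> weak_gradient \<Omega> v x) \<and>
    integrable (lebesgue_on \<Omega>) (\<lambda>x. F x * v x) \<and>
    (LINT x|lebesgue_on \<Omega>.
       double_phase_flux p q \<mu> x (weak_gradient \<Omega> u x) \<bullet> weak_gradient \<Omega> v x) =
    (LINT x|lebesgue_on \<Omega>. F x * v x)"

text \<open>The data of the two equations are families indexed by \<open>1\<close> and \<open>2\<close>; other indices are unused.\<close>

definition system_space ::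
    "(real^'n::finite) set \<Rightarrow> (nat \<Rightarrow> real^'n \<Rightarrow> real) \<Rightarrow> (nat \<Rightarrow> real^'n \<Rightarrow> real) \<Rightarrow>
     (nat \<Rightarrow> real^'n \<Rightarrow> real) \<Rightarrow> ((real^'n \<Rightarrow> real) \<times> (real^'n \<Rightarrow> real)) set" where
  "system_space \<Omega> p q \<mu> =
    musielak_sobolev_0 \<Omega> (double_phase (p 1) (q 1) (\<mu> 1)) \<times>
    musielak_sobolev_0 \<Omega> (double_phase (p 2) (q 2) (\<mu> 2))"

definition weak_solution ::
    "(real^'n::finite) set \<Rightarrow> (nat \<Rightarrow> real^'n \<Rightarrow> real) \<Rightarrow> (nat \<Rightarrow> real^'n \<Rightarrow> real) \<Rightarrow>
     (nat \<Rightarrow> real^'n \<Rightarrow> real) \<Rightarrow>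
     (nat \<Rightarrow> real^'n \<Rightarrow> real \<Rightarrow> real \<Rightarrow> real^'n \<Rightarrow> real^'n \<Rightarrow> real) \<Rightarrow>
     (real^'n \<Rightarrow> real) \<Rightarrow> (real^'n \<Rightarrow> real) \<Rightarrow> bool" where
  "weak_solution \<Omega> p q \<mu> f u\<^sub>1 u\<^sub>2 \<longleftrightarrow>
    (u\<^sub>1, u\<^sub>2) \<in> system_space \<Omega> p q \<mu> \<and>
    (\<forall>(v\<^sub>1, v\<^sub>2) \<in> system_space \<Omega> p q \<mu>.
       weak_equation \<Omega> (p 1) (q 1) (\<mu> 1)
         (\<lambda>x. f 1 x (u\<^sub>1 x) (u\<^sub>2 x) (weak_gradient \<Omega> u\<^sub>1 x) (weak_gradient \<Omega> u\<^sub>2 x)) u\<^sub>1 v\<^sub>1 \<and>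
       weak_equation \<Omega> (p 2) (q 2) (\<mu> 2)
         (\<lambda>x. f 2 x (u\<^sub>1 x) (u\<^sub>2 x) (weak_gradient \<Omega> u\<^sub>1 x) (weak_gradient \<Omega> u\<^sub>2 x)) u\<^sub>2 v\<^sub>2)"

end

theory Submission
  imports Defs "HOL-Computational_Algebra.Polynomial" "HOL-Complex_Analysis.Great_Picard"
      "HOL-Library.Diagonal_Subsequence"
begin

text \<open>For a fixed source \<open>F\<close> with \<open>0 \<le> F \<le> \<psi>\<close> the Dirichlet problem is the Euler-Lagrange equation of a
  strictly convex coercive energy. Its minimizer is nonnegative, since replacing \<open>u\<close> by \<open>\<bar>u\<bar>\<close> does not
  increase the energy. Uniform convexity bounds the distance of the minimizers of two sources by the
  pairing of the difference of the sources with the difference of the minimizers; together with the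
  compact embedding of the zero trace space this makes the solution operator continuous and compact.
  Composed with the superposition operator of \<open>(f\<^sub>1, f\<^sub>2)\<close>, truncated to the values between \<open>0\<close> and
  \<open>\<psi>\<^sub>i\<close>, it maps the convex set of pairs of sources with \<open>0 \<le> F\<^sub>i \<le> \<psi>\<^sub>i\<close> into itself, and
  Schauder's theorem in \<open>L\<^sup>1\<close> gives a fixed point. The truncation is inactive there because the
  minimizers are nonnegative.\<close>

section \<open>Test functions\<close>

text \<open>The exponents are merely continuous, so tools that rest on log-Hoelder continuity, such
  as bounds for maximal functions, are out of reach. Subcriticality takes their place: on small
  balls \<open>q\<close> stays below the Sobolev conjugate of \<open>p\<close> at neighbouring
  points, and then a bound on the integral of |grad \<phi>|^p bounds that of |\<phi>|^q. Since \<mu>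
  is bounded, this is a Poincare inequality for the whole modular, although the weight of the q-part
  of the gradient may vanish. Estimates are proved for test functions and carried to the zero trace
  space by approximation. They concern the modular, which is not homogeneous; smallness and
  boundedness are therefore separate statements, linked by scaling with the extreme exponents. Weak
  convergence is avoided: minimizing sequences and sequences of minimizers are shown to be Cauchy
  through the convexity defect at midpoints. Gradients then converge almost everywhere along
  subsequences, which the dependence of the sources on gradients requires, and domination by the
  bounds \<psi> turns this into L1 convergence of sources.\<close>

lemma partial_derivative_eqI:
  assumes "(f has_derivative D) (at x)"
  shows "partial_derivative i f x = D (axis i 1)"
  using frechet_derivative_at[OF assms] by (simp add: partial_derivative_def)

lemma C_k_SucD: "C_k (Suc k) f \<Longrightarrow> C_k k f"
proof (induction k arbitrary: f)
  case 0
  then show ?case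
    by (auto intro!: continuous_at_imp_continuous_on differentiable_imp_continuous_within)
next
  case (Suc k)
  then show ?case by auto
qed

lemma C_k_const: "C_k k (\<lambda>x::real^'n::finite. c)"
proof (induction k arbitrary: c)
  case (Suc k)
  have "partial_derivative i (\<lambda>x::real^'n. c) = (\<lambda>x. 0)" for i
    by (rule ext, subst partial_derivative_eqI[where D="\<lambda>h. 0"]) auto
  with Suc show ?case by simp
qed simp

lemma C_k_coord: "C_k k (\<lambda>x::real^'n::finite. x $ i)"
proof (cases k)
  case 0
  then show ?thesis by (simp add: continuous_on_component)
next
  case (Suc l)
  have d: "((\<lambda>x::real^'n. x $ i) has_derivative (\<lambda>h. h $ i)) (at x)" for x
    by (intro bounded_linear_imp_has_derivative bounded_linear_vec_nth)
  then have "partial_derivative j (\<lambda>x::real^'n. x $ i) = (\<lambda>x. axis j 1 $ i)" for j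
    by (intro ext) (rule partial_derivative_eqI)
  moreover have "(\<lambda>x::real^'n. x $ i) differentiable (at x)" for x using d by (rule differentiableI)
  ultimately show ?thesis using Suc by (simp add: C_k_const)
qed

lemma C_k_add: "C_k k f \<Longrightarrow> C_k k g \<Longrightarrow> C_k k (\<lambda>x. f x + g x)"
proof (induction k arbitrary: f g)
  case 0
  then show ?case by (simp add: continuous_on_add continuous_on_mult)
next
  case (Suc k)
  have "partial_derivative i (\<lambda>x. f x + g x) =
      (\<lambda>x. partial_derivative i f x + partial_derivative i g x)" for i
  proof
    fix x
    have "f differentiable at x" "g differentiable at x" using Suc.prems by auto
    then have "((\<lambda>x. f x + g x) has_derivative
        (\<lambda>h. frechet_derivative f (at x) h + frechet_derivative g (at x) h)) (at x)"
      by (intro has_derivative_add) (simp_all add: frechet_derivative_works)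
    then show "partial_derivative i (\<lambda>x. f x + g x) x = partial_derivative i f x + partial_derivative i g x"
      by (subst partial_derivative_eqI) (auto simp: partial_derivative_def)
  qed
  then show ?case using Suc by (auto intro!: differentiable_add)
qed

lemma partial_derivative_mult:
  assumes "f differentiable at x" "g differentiable at x"
  shows "partial_derivative i (\<lambda>x. f x * g x) x =
      f x * partial_derivative i g x + partial_derivative i f x * g x"
proof -
  have "((\<lambda>x. f x * g x) has_derivative
      (\<lambda>h. f x * frechet_derivative g (at x) h + frechet_derivative f (at x) h * g x)) (at x)"
    using assms by (intro has_derivative_mult) (simp_all add: frechet_derivative_works)
  then show ?thesis by (subst partial_derivative_eqI) (auto simp: partial_derivative_def)
qed

lemma C_k_mult: "C_k k f \<Longrightarrow> C_k k g \<Longrightarrow> C_k k (\<lambda>x. f x * g x)"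
proof (induction k arbitrary: f g)
  case 0
  then show ?case by (simp add: continuous_on_add continuous_on_mult)
next
  case (Suc k)
  have "partial_derivative i (\<lambda>x. f x * g x) =
      (\<lambda>x. f x * partial_derivative i g x + partial_derivative i f x * g x)" for i
    using Suc.prems by (auto intro!: partial_derivative_mult)
  then show ?case using Suc C_k_SucD[OF Suc.prems(1)] C_k_SucD[OF Suc.prems(2)]
    by (auto intro!: differentiable_mult C_k_add)
qed

lemma C_k_prod: "finite I \<Longrightarrow> (\<And>i. i \<in> I \<Longrightarrow> C_k k (f i)) \<Longrightarrow> C_k k (\<lambda>x. \<Prod>i\<in>I. f i x)"
  by (induction I rule: finite_induct) (simp_all add: C_k_const C_k_mult)

text \<open>The class \<open>S\<close> is closed under differentiation, so the chain rule can be iterated.\<close>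
lemma C_k_compose:
  fixes f :: "real^'n \<Rightarrow> real"
  assumes S: "\<And>h. h \<in> S \<Longrightarrow> \<exists>h'\<in>S. \<forall>t\<in>U. (h has_field_derivative h' t) (at t)"
    and f: "\<And>k. C_k k f" and U: "\<And>x. f x \<in> U" and h: "h \<in> S"
  shows "C_k k (\<lambda>x. h (f x))"
  using h
proof (induction k arbitrary: h)
  case 0
  obtain h' where h': "\<forall>t\<in>U. (h has_field_derivative h' t) (at t)" using S[OF 0] by blast
  have "isCont (\<lambda>x. h (f x)) x" for x
  proof (rule isCont_o2[where f=f and g=h])
    show "isCont f x" using f[of 0] by (simp add: continuous_on_eq_continuous_at)
    show "isCont h (f x)" using h' U DERIV_isCont by blast
  qed
  then show ?case by (simp add: continuous_at_imp_continuous_on)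
next
  case (Suc k)
  obtain h' where h': "h' \<in> S" "\<forall>t\<in>U. (h has_field_derivative h' t) (at t)"
    using S[OF Suc.prems] by blast
  have d: "((\<lambda>x. h (f x)) has_derivative (\<lambda>v. h' (f x) * frechet_derivative f (at x) v)) (at x)" for x
  proof -
    have "f differentiable at x" using f[of 1] by simp
    then have "(f has_derivative frechet_derivative f (at x)) (at x)"
      by (simp add: frechet_derivative_works)
    from has_derivative_compose[OF this h'(2)[rule_format, OF U, unfolded has_field_derivative_def]]
    show ?thesis by simp
  qed
  have "partial_derivative i (\<lambda>x. h (f x)) = (\<lambda>x. h' (f x) * partial_derivative i f x)" for i
    by (rule ext) (simp add: partial_derivative_eqI[OF d] partial_derivative_def)
  moreover have "C_k k (partial_derivative i f)" for i using f[of "Suc k"] by simp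
  ultimately show ?case using Suc.IH[OF h'(1)] d by (auto intro!: C_k_mult simp: differentiable_def)
qed

text \<open>Polynomials in 1 / t are carried along so that the family is closed under
  differentiation and \<open>range flat_exp\<close> can serve as the class \<open>S\<close> of
  \<open>C_k_compose\<close>. For a = 1 this is the usual function that is flat at 0 and tends to 1
  at infinity.\<close>

definition flat_exp :: "real poly \<Rightarrow> real \<Rightarrow> real" where
  "flat_exp a t = (if t > 0 then poly a (1 / t) * exp (- (1 / t)) else 0)"

lemma poly_over_exp_tendsto_0: "((\<lambda>y. poly a y * exp (- y)) \<longlongrightarrow> (0::real)) at_top"
proof -
  have "((\<lambda>y. \<Sum>i\<le>degree a. coeff a i * (y ^ i / exp y)) \<longlongrightarrow> (\<Sum>i\<le>degree a. coeff a i * 0)) at_top"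
    by (intro tendsto_sum tendsto_mult tendsto_const tendsto_power_div_exp_0)
  then show ?thesis
    by (simp add: poly_altdef exp_minus divide_inverse sum_distrib_right mult.assoc)
qed

text \<open>In the variable y = 1 / t one has d/dt = - y^2 d/dy, which sends a(y) exp(-y) to y^2
  (a(y) - a'(y)) exp(-y). At t = 0 both one-sided difference quotients tend to 0, because
  exponential decay beats every polynomial.\<close>

lemma flat_exp_DERIV:
  "(flat_exp a has_field_derivative flat_exp ([:0, 0, 1:] * (a - pderiv a)) t) (at t)"
proof -
  consider "t > 0" | "t < 0" | "t = 0" by linarith
  then show ?thesis
  proof cases
    case 1
    have "((\<lambda>t. poly a (1/t) * exp (- (1/t))) has_field_derivative
        flat_exp ([:0, 0, 1:] * (a - pderiv a)) t) (at t)"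
      using 1 by (auto intro!: derivative_eq_intros simp: flat_exp_def field_simps power2_eq_square)
    moreover have "\<forall>\<^sub>F s in nhds t. flat_exp a s = poly a (1/s) * exp (- (1/s))"
      using eventually_nhds_in_open[of "{0<..}" t] 1 by (auto simp: flat_exp_def elim!: eventually_mono)
    ultimately show ?thesis by (subst DERIV_cong_ev) (auto simp: )
  next
    case 2
    have "\<forall>\<^sub>F s in nhds t. flat_exp a s = 0"
      using eventually_nhds_in_open[of "{..<0}" t] 2 by (auto simp: flat_exp_def elim!: eventually_mono)
    then show ?thesis using 2 by (subst DERIV_cong_ev[where g="\<lambda>_. 0"]) (auto simp: flat_exp_def)
  next
    case 3
    have "((\<lambda>s. flat_exp a s / s) \<longlongrightarrow> 0) (at_right 0)"
    proof -
      \<comment> \<open>With y = 1 / s the quotient \<open>flat_exp a s / s\<close> is y a(y)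
        exp(-y), and \<open>pCons 0 a\<close> is the polynomial y a(y).\<close>
      have "((\<lambda>s. poly (pCons 0 a) (inverse s) * exp (- inverse s)) \<longlongrightarrow> 0) (at_right (0::real))"
        by (rule filterlim_compose[OF poly_over_exp_tendsto_0 filterlim_inverse_at_top_right])
      then show ?thesis
        by (rule Lim_transform_eventually)
           (auto simp: flat_exp_def divide_inverse eventually_at_filter)
    qed
    moreover have "((\<lambda>s. flat_exp a s / s) \<longlongrightarrow> 0) (at_left 0)"
      by (rule Lim_transform_eventually[OF tendsto_const]) (auto simp: flat_exp_def eventually_at_filter)
    ultimately have "((\<lambda>s. flat_exp a s / s) \<longlongrightarrow> 0) (at 0)"
      by (simp add: filterlim_split_at)
    then show ?thesis using 3 by (simp add: DERIV_def flat_exp_def)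
  qed
qed

lemma C_k_flat_exp:
  assumes "\<And>k. C_k k f"
  shows "C_k k (\<lambda>x. flat_exp a (f x))"
proof (rule C_k_compose[where S="range flat_exp" and U=UNIV and f=f and h="flat_exp a"])
  fix h assume "h \<in> range flat_exp"
  then obtain b where h: "h = flat_exp b" by blast
  show "\<exists>h'\<in>range flat_exp. \<forall>t\<in>UNIV. (h has_field_derivative h' t) (at t)"
    unfolding h by (intro bexI[of _ "flat_exp ([:0, 0, 1:] * (b - pderiv b))"] ballI flat_exp_DERIV rangeI)
qed (use assms in simp_all)

section \<open>Gradients, supports and bounds of test functions\<close>

definition gradient :: "(real^'n::finite \<Rightarrow> real) \<Rightarrow> real^'n \<Rightarrow> real^'n" where
  "gradient \<phi> x = (\<chi> i. partial_derivative i \<phi> x)"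

lemma gradient_nth [simp]: "gradient \<phi> x $ i = partial_derivative i \<phi> x"
  by (simp add: gradient_def)

lemma has_derivative_gradient:
  assumes "\<phi> differentiable at x"
  shows "(\<phi> has_derivative (\<lambda>h. gradient \<phi> x \<bullet> h)) (at x)"
proof -
  let ?D = "frechet_derivative \<phi> (at x)"
  have D: "(\<phi> has_derivative ?D) (at x)" using assms by (simp add: frechet_derivative_works)
  then interpret linear ?D by (rule has_derivative_linear)
  have "?D h = gradient \<phi> x \<bullet> h" for h
  proof -
    have "?D h = ?D (\<Sum>i\<in>UNIV. h $ i *s axis i 1)" by (simp add: basis_expansion)
    also have "\<dots> = (\<Sum>i\<in>UNIV. h $ i * partial_derivative i \<phi> x)"
      by (simp add: sum scale partial_derivative_def scalar_mult_eq_scaleR)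
    finally show ?thesis by (simp add: inner_vec_def mult.commute)
  qed
  then have "?D = (\<lambda>h. gradient \<phi> x \<bullet> h)" by (rule ext)
  with D show ?thesis by simp
qed

text \<open>Any compact set outside of which \<phi> vanishes may replace the closed support, so
  sums, products and derivatives need no computation of closures.\<close>

lemma test_functions_iff:
  assumes "open \<Omega>"
  shows "\<phi> \<in> test_functions \<Omega> \<longleftrightarrow>
    (\<forall>k. C_k k \<phi>) \<and> (\<exists>K. compact K \<and> K \<subseteq> \<Omega> \<and> (\<forall>x. x \<notin> K \<longrightarrow> \<phi> x = 0))"
proof (intro iffI conjI; (elim conjE exE)?)
  assume *: "\<phi> \<in> test_functions \<Omega>"
  then show "\<forall>k. C_k k \<phi>" by (simp add: test_functions_def)
  show "\<exists>K. compact K \<and> K \<subseteq> \<Omega> \<and> (\<forall>x. x \<notin> K \<longrightarrow> \<phi> x = 0)"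
    using * closure_subset[of "{x. \<phi> x \<noteq> 0}"]
    by (intro exI[of _ "closure {x. \<phi> x \<noteq> 0}"]) (auto simp: test_functions_def)
next
  fix K assume K: "\<forall>k. C_k k \<phi>" "compact K" "K \<subseteq> \<Omega>" "\<forall>x. x \<notin> K \<longrightarrow> \<phi> x = 0"
  have sub: "closure {x. \<phi> x \<noteq> 0} \<subseteq> K"
    using K by (intro closure_minimal) (auto simp: compact_imp_closed)
  then have "bounded {x. \<phi> x \<noteq> 0}"
    using compact_imp_bounded[OF K(2)] closure_subset bounded_subset by (metis)
  then have "compact (closure {x. \<phi> x \<noteq> 0})" by simp
  then show "\<phi> \<in> test_functions \<Omega>" using K sub by (auto simp: test_functions_def)
qed

lemma test_zero: "(\<lambda>x. 0) \<in> test_functions \<Omega>"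
  by (auto simp: test_functions_def C_k_const)

lemma test_combination:
  assumes "open \<Omega>" "\<phi> \<in> test_functions \<Omega>" "\<eta> \<in> test_functions \<Omega>"
  shows "(\<lambda>x. a * \<phi> x + b * \<eta> x) \<in> test_functions \<Omega>"
proof -
  from assms obtain K1 K2 where K: "compact K1" "K1 \<subseteq> \<Omega>" "\<forall>x. x \<notin> K1 \<longrightarrow> \<phi> x = 0"
    "compact K2" "K2 \<subseteq> \<Omega>" "\<forall>x. x \<notin> K2 \<longrightarrow> \<eta> x = 0"
    by (metis test_functions_iff)
  have "\<exists>K. compact K \<and> K \<subseteq> \<Omega> \<and> (\<forall>x. x \<notin> K \<longrightarrow> a * \<phi> x + b * \<eta> x = 0)"
    using K by (intro exI[of _ "K1 \<union> K2"]) (auto intro: compact_Un)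
  then show ?thesis using assms by (auto simp: test_functions_iff intro!: C_k_add C_k_mult C_k_const)
qed

lemma test_mult:
  assumes "open \<Omega>" "\<phi> \<in> test_functions \<Omega>" "\<eta> \<in> test_functions \<Omega>"
  shows "(\<lambda>x. \<phi> x * \<eta> x) \<in> test_functions \<Omega>"
proof -
  from assms obtain K1 where K: "compact K1" "K1 \<subseteq> \<Omega>" "\<forall>x. x \<notin> K1 \<longrightarrow> \<phi> x = 0"
    by (metis test_functions_iff)
  then have "\<exists>K. compact K \<and> K \<subseteq> \<Omega> \<and> (\<forall>x. x \<notin> K \<longrightarrow> \<phi> x * \<eta> x = 0)" by auto
  then show ?thesis using assms by (auto simp: test_functions_iff intro!: C_k_mult)
qed

lemma test_C_k: "\<phi> \<in> test_functions \<Omega> \<Longrightarrow> C_k k \<phi>"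
  by (simp add: test_functions_def)

lemma test_differentiable: "\<phi> \<in> test_functions \<Omega> \<Longrightarrow> \<phi> differentiable at x"
  using test_C_k[of \<phi> \<Omega> "Suc 0"] by simp

lemma test_has_derivative:
  "\<phi> \<in> test_functions \<Omega> \<Longrightarrow> (\<phi> has_derivative (\<lambda>h. gradient \<phi> x \<bullet> h)) (at x within S)"
  by (rule has_derivative_at_withinI[OF has_derivative_gradient[OF test_differentiable]])

lemma test_continuous: "\<phi> \<in> test_functions \<Omega> \<Longrightarrow> continuous_on UNIV \<phi>"
  using test_C_k[of \<phi> \<Omega> 0] by simp

lemma gradient_combination:
  assumes "\<phi> \<in> test_functions \<Omega>" "\<eta> \<in> test_functions \<Omega>"
  shows "gradient (\<lambda>x. a * \<phi> x + b * \<eta> x) x = a *\<^sub>R gradient \<phi> x + b *\<^sub>R gradient \<eta> x"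
proof -
  have "((\<lambda>x. a * \<phi> x + b * \<eta> x) has_derivative
      (\<lambda>h. a * (gradient \<phi> x \<bullet> h) + b * (gradient \<eta> x \<bullet> h))) (at x)"
    using assms by (intro has_derivative_add has_derivative_mult_right has_derivative_gradient
        test_differentiable)
  from partial_derivative_eqI[OF this] show ?thesis
    by (simp add: vec_eq_iff inner_axis)
qed

lemma test_partial:
  assumes "open \<Omega>" "\<phi> \<in> test_functions \<Omega>"
  shows "partial_derivative i \<phi> \<in> test_functions \<Omega>"
proof -
  from assms obtain K where K: "compact K" "K \<subseteq> \<Omega>" "\<forall>x. x \<notin> K \<longrightarrow> \<phi> x = 0"
    by (metis test_functions_iff)
  have "partial_derivative i \<phi> x = 0" if "x \<notin> K" for x
  proof -
    \<comment> \<open>The complement of \<open>K\<close> is open and \<phi> vanishes on it, so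
      \<phi> is locally constant there.\<close>
    have "(\<phi> has_derivative (\<lambda>h. 0)) (at x)"
    proof (rule has_derivative_transform_within_open[OF has_derivative_const])
      show "open (- K)" using K by (simp add: compact_imp_closed open_Compl)
    qed (use that K in auto)
    from partial_derivative_eqI[OF this] show ?thesis by simp
  qed
  moreover have "\<forall>k. C_k k (partial_derivative i \<phi>)"
    using assms C_k.simps(2)[of _ \<phi>] unfolding test_functions_def by blast
  ultimately show ?thesis using K assms(1) by (auto simp: test_functions_iff)
qed

lemma gradient_continuous: "open \<Omega> \<Longrightarrow> \<phi> \<in> test_functions \<Omega> \<Longrightarrow> continuous_on UNIV (gradient \<phi>)"
  unfolding gradient_def [abs_def]
  by (intro continuous_on_vec_lambda test_continuous[OF test_partial])

lemma test_outside: "\<phi> \<in> test_functions \<Omega> \<Longrightarrow> x \<notin> \<Omega> \<Longrightarrow> \<phi> x = 0"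
  using closure_subset[of "{x. \<phi> x \<noteq> 0}"] by (auto simp: test_functions_def)

lemma gradient_outside: "open \<Omega> \<Longrightarrow> \<phi> \<in> test_functions \<Omega> \<Longrightarrow> x \<notin> \<Omega> \<Longrightarrow> gradient \<phi> x = 0"
  by (simp add: vec_eq_iff) (blast intro: test_outside[OF test_partial])

lemma test_bounded:
  assumes "open \<Omega>" "\<phi> \<in> test_functions \<Omega>"
  obtains B where "B \<ge> 0" "\<And>x. \<bar>\<phi> x\<bar> \<le> B"
proof -
  from assms obtain K where K: "compact K" "K \<subseteq> \<Omega>" "\<forall>x. x \<notin> K \<longrightarrow> \<phi> x = 0"
    by (metis test_functions_iff)
  have "compact (\<phi> ` K)" using K test_continuous[OF assms(2)]
    by (intro compact_continuous_image) (auto intro: continuous_on_subset)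
  then obtain B where "\<forall>y\<in>\<phi> ` K. norm y \<le> B" using compact_imp_bounded bounded_iff by metis
  then have "\<bar>\<phi> x\<bar> \<le> max B 0" for x using K(3) by (cases "x \<in> K") auto
  then show ?thesis by (intro that[of "max B 0"]) auto
qed

lemma gradient_bounded:
  assumes "open \<Omega>" "\<phi> \<in> test_functions \<Omega>"
  obtains B where "B \<ge> 0" "\<And>x. norm (gradient \<phi> x) \<le> B"
proof -
  have "\<exists>B. \<forall>x. \<bar>partial_derivative i \<phi> x\<bar> \<le> B" for i
    using test_bounded[OF assms(1) test_partial[OF assms]] by metis
  then obtain B where B: "\<And>i x. \<bar>partial_derivative i \<phi> x\<bar> \<le> B i" by metis
  have "norm (gradient \<phi> x) \<le> (\<Sum>i\<in>UNIV. B i)" for x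
    using norm_le_l1_cart[of "gradient \<phi> x"] sum_mono[of UNIV "\<lambda>i. \<bar>partial_derivative i \<phi> x\<bar>" B] B
    by simp
  moreover from this have "0 \<le> (\<Sum>i\<in>UNIV. B i)" using norm_ge_zero order_trans by blast
  ultimately show ?thesis by (rule that[rotated])
qed

lemma test_integrable:
  assumes "open \<Omega>" "\<phi> \<in> test_functions \<Omega>"
  shows "integrable lborel \<phi>"
proof -
  from assms obtain K where K: "compact K" "K \<subseteq> \<Omega>" "\<forall>x. x \<notin> K \<longrightarrow> \<phi> x = 0"
    by (metis test_functions_iff)
  have "integrable lborel (\<lambda>x. indicator K x *\<^sub>R \<phi> x)"
    using K test_continuous[OF assms(2)] by (intro borel_integrable_compact) (auto intro: continuous_on_subset)
  also have "(\<lambda>x. indicator K x *\<^sub>R \<phi> x) = \<phi>" using K by (auto simp: indicator_def fun_eq_iff)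
  finally show ?thesis .
qed

lemma test_borel: "\<phi> \<in> test_functions \<Omega> \<Longrightarrow> \<phi> \<in> borel_measurable borel"
  by (simp add: borel_measurable_continuous_onI test_continuous)

lemma gradient_borel: "open \<Omega> \<Longrightarrow> \<phi> \<in> test_functions \<Omega> \<Longrightarrow> gradient \<phi> \<in> borel_measurable borel"
  by (simp add: borel_measurable_continuous_onI gradient_continuous)

lemma borel_imp_lebesgue_on: "f \<in> borel_measurable borel \<Longrightarrow> f \<in> borel_measurable (lebesgue_on S)"
  by (intro measurable_restrict_space1 measurable_completion) simp

section \<open>Integration by parts for test functions\<close>

lemma integral_lebesgue_on_eq_lborel:
  fixes f :: "'a::euclidean_space \<Rightarrow> 'b::{banach, second_countable_topology}"
  assumes "S \<in> sets lebesgue" "f \<in> borel_measurable borel" "\<And>x. x \<notin> S \<Longrightarrow> f x = 0"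
  shows "integral\<^sup>L (lebesgue_on S) f = integral\<^sup>L lborel f"
    and "integrable (lebesgue_on S) f \<longleftrightarrow> integrable lborel f"
proof -
  have eq: "(\<lambda>x. indicator S x *\<^sub>R f x) = f" using assms(3) by (auto simp: indicator_def)
  show "integral\<^sup>L (lebesgue_on S) f = integral\<^sup>L lborel f"
    using assms by (simp add: integral_restrict_space eq integral_completion)
  show "integrable (lebesgue_on S) f \<longleftrightarrow> integrable lborel f"
    using assms by (simp add: integrable_restrict_space eq integrable_completion)
qed

text \<open>Difference quotients of \<theta> have integral 0 by translation invariance of Lebesgue
  measure, and they converge to the partial derivative under a common bound supported in a ball.
  Neither Fubini nor one-dimensional slices are involved.\<close>

lemma integral_partial_derivative:
  fixes \<theta> :: "real^'n::finite \<Rightarrow> real"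
  assumes "open \<Omega>" "bounded \<Omega>" "\<theta> \<in> test_functions \<Omega>"
  shows "(LINT x|lborel. partial_derivative i \<theta> x) = 0"
proof -
  define e :: "real^'n" where "e = axis i 1"
  have ne: "norm e = 1" by (simp add: e_def)
  obtain B where B: "B \<ge> 0" "\<And>x. norm (gradient \<theta> x) \<le> B" using gradient_bounded[OF assms(1,3)] by blast
  obtain R where R: "\<And>x. x \<in> \<Omega> \<Longrightarrow> norm x \<le> R" using assms(2) by (auto simp: bounded_iff)
  note [measurable] = test_borel[OF assms(3)] test_borel[OF test_partial[OF assms(1,3)]]
  define d where "d n x = real (Suc n) * (\<theta> (e /\<^sub>R Suc n + x) - \<theta> x)" for n x
  have int: "integrable lborel \<theta>" by (rule test_integrable[OF assms(1,3)])
  have shift: "integrable lborel (\<lambda>x. \<theta> (a + x)) \<and> (LINT x|lborel. \<theta> (a + x)) = (LINT x|lborel. \<theta> x)" for a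
    using int integrable_distr_eq[of "(+) a" lborel borel \<theta>] integral_distr[of "(+) a" lborel borel \<theta>]
    by (simp add: lborel_distr_plus)
  have "(\<lambda>n. LINT x|lborel. d n x) \<longlonglongrightarrow> (LINT x|lborel. partial_derivative i \<theta> x)"
  proof (rule integral_dominated_convergence)
    \<comment> \<open>The shifts have norm at most 1, so the quotients vanish outside the ball of
      radius R + 1; inside, the mean value inequality bounds them by \<open>B\<close>.\<close>
    show "integrable lborel (\<lambda>x::real^'n. B * indicat_real (cball 0 (R + 1)) x)"
      by (intro integrable_mult_right integrable_real_indicator) (auto simp:
          emeasure_lborel_cball_finite[unfolded infinity_ennreal_def])
    show "AE x in lborel. (\<lambda>n. d n x) \<longlonglongrightarrow> partial_derivative i \<theta> x"
    proof (rule AE_I2)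
      fix x
      have "((\<lambda>t. \<theta> (x + t *\<^sub>R e)) has_vector_derivative gradient \<theta> x \<bullet> e) (at 0)"
      proof -
        have "(\<theta> has_derivative (\<lambda>h. gradient \<theta> x \<bullet> h)) (at (x + 0 *\<^sub>R e))"
          using test_has_derivative[OF assms(3), of x UNIV] by simp
        moreover have "((\<lambda>t. x + t *\<^sub>R e) has_derivative (\<lambda>t. t *\<^sub>R e)) (at 0)"
          by (auto intro!: derivative_eq_intros)
        ultimately have "((\<lambda>t. \<theta> (x + t *\<^sub>R e)) has_derivative (\<lambda>t. gradient \<theta> x \<bullet> (t *\<^sub>R e))) (at 0)"
          by (rule has_derivative_compose[rotated])
        then show ?thesis by (simp add: has_vector_derivative_def)
      qed
      then have "((\<lambda>t. (\<theta> (x + t *\<^sub>R e) - \<theta> x) / t) \<longlongrightarrow> gradient \<theta> x \<bullet> e) (at 0)"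
        by (simp add: has_real_derivative_iff_has_vector_derivative[symmetric] DERIV_def)
      moreover have "filterlim (\<lambda>n. inverse (real (Suc n))) (at 0) sequentially"
        using LIMSEQ_inverse_real_of_nat by (auto simp: filterlim_at)
      ultimately have "(\<lambda>n. (\<theta> (x + inverse (real (Suc n)) *\<^sub>R e) - \<theta> x) / inverse (real (Suc n)))
          \<longlonglongrightarrow> gradient \<theta> x \<bullet> e"
        by (rule filterlim_compose)
      then show "(\<lambda>n. d n x) \<longlonglongrightarrow> partial_derivative i \<theta> x"
        by (simp add: d_def inner_axis e_def field_simps)
    qed
    show "AE x in lborel. norm (d n x) \<le> B * indicator (cball 0 (R + 1)) x" for n
    proof (rule AE_I2)
      fix x
      have n1: "norm (e /\<^sub>R Suc n) = 1 / Suc n" using ne by (simp add: divide_inverse)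
      have n2: "norm (e /\<^sub>R Suc n) \<le> 1" using n1 by simp
      show "norm (d n x) \<le> B * indicator (cball 0 (R + 1)) x"
      proof (cases "x \<in> cball 0 (R + 1)")
        case True
        have "norm (\<theta> (e /\<^sub>R Suc n + x) - \<theta> x) \<le> B * norm (e /\<^sub>R Suc n + x - x)"
        proof (rule differentiable_bound[where S=UNIV and f'="\<lambda>x h. gradient \<theta> x \<bullet> h"])
          show "(\<theta> has_derivative (\<lambda>h. gradient \<theta> y \<bullet> h)) (at y within UNIV)" for y
            by (rule test_has_derivative[OF assms(3)])
          show "onorm (\<lambda>h. gradient \<theta> y \<bullet> h) \<le> B" for y
            proof (rule onorm_le)
            fix h show "norm (gradient \<theta> y \<bullet> h) \<le> B * norm h"
              using Cauchy_Schwarz_ineq2[of "gradient \<theta> y" h] mult_right_mono[OF B(2)[of y], of "norm h"]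
                  by simp
          qed
        qed auto
        then have "norm (\<theta> (e /\<^sub>R Suc n + x) - \<theta> x) \<le> B / Suc n" using n1 by simp
        from mult_left_mono[OF this, of "real (Suc n)"]
        show ?thesis using True by (simp add: d_def abs_mult del: of_nat_Suc)
      next
        case False
        have "x \<notin> \<Omega>" using False R[of x] by auto
        moreover have "e /\<^sub>R Suc n + x \<notin> \<Omega>"
          using False R[of "e /\<^sub>R Suc n + x"] n2 norm_triangle_ineq4[of "e /\<^sub>R Suc n + x" "e /\<^sub>R Suc n"] by auto
        ultimately show ?thesis using False test_outside[OF assms(3)] by (simp add: d_def)
      qed
    qed
  qed (auto simp: d_def)
  moreover have "(LINT x|lborel. d n x) = 0" for n
    using shift int by (simp add: d_def)
  ultimately show ?thesis by (simp add: LIMSEQ_const_iff)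
qed

lemma test_integration_by_parts:
  assumes "open \<Omega>" "bounded \<Omega>" "\<phi> \<in> test_functions \<Omega>" "\<eta> \<in> test_functions \<Omega>"
  shows "(LINT x|lebesgue_on \<Omega>. \<phi> x * partial_derivative i \<eta> x) =
      - (LINT x|lebesgue_on \<Omega>. partial_derivative i \<phi> x * \<eta> x)"
proof -
  note t = test_mult[OF assms(1)]
  note p = test_partial[OF assms(1)]
  have 1: "(LINT x|lebesgue_on \<Omega>. f x) = (LINT x|lborel. f x)" if "f \<in> test_functions \<Omega>" for f
    using that assms(1) by (intro integral_lebesgue_on_eq_lborel test_borel test_outside[OF that]) auto
  have "0 = (LINT x|lborel. partial_derivative i (\<lambda>x. \<phi> x * \<eta> x) x)"
    using integral_partial_derivative[OF assms(1,2) t[OF assms(3,4)]] by simp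
  also have "\<dots> = (LINT x|lborel. \<phi> x * partial_derivative i \<eta> x + partial_derivative i \<phi> x * \<eta> x)"
    by (simp add: partial_derivative_mult test_differentiable[OF assms(3)] test_differentiable[OF assms(4)])
  also have "\<dots> = (LINT x|lborel. \<phi> x * partial_derivative i \<eta> x) +
      (LINT x|lborel. partial_derivative i \<phi> x * \<eta> x)"
    using assms t p by (intro Bochner_Integration.integral_add test_integrable) auto
  finally show ?thesis using 1[OF t[OF assms(3) p[OF assms(4)]]] 1[OF t[OF p[OF assms(3)] assms(4)]] by simp
qed

section \<open>Weak gradients\<close>

lemma C_k_power: "C_k k f \<Longrightarrow> C_k k (\<lambda>x. f x ^ m)"
  by (induction m) (auto intro: C_k_const C_k_mult)

text \<open>A smooth substitute for \<open>\<bar>\<phi>\<bar>\<close> with the same support and no larger gradient.\<close>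
definition smooth_abs :: "real \<Rightarrow> ('a \<Rightarrow> real) \<Rightarrow> 'a \<Rightarrow> real" where
  "smooth_abs \<epsilon> \<phi> x = sqrt ((\<phi> x)\<^sup>2 + \<epsilon>\<^sup>2) - \<epsilon>"

text \<open>The square root is smooth only away from 0, but its argument stays at least
  \<epsilon>^2. The functions c t^a on t > 0 form a class closed under differentiation, which is
  what \<open>C_k_compose\<close> asks for.\<close>

lemma smooth_abs_test:
  fixes \<phi> :: "real^'n::finite \<Rightarrow> real"
  assumes \<Omega>: "open \<Omega>" and \<phi>: "\<phi> \<in> test_functions \<Omega>" and e: "\<epsilon> > 0"
  shows "smooth_abs \<epsilon> \<phi> \<in> test_functions \<Omega>"
proof -
  define S where "S = range (\<lambda>(c::real, a::real) t::real. c * t powr a)"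
  have cl: "\<exists>h'\<in>S. \<forall>t\<in>{0<..}. (h has_field_derivative h' t) (at t)" if "h \<in> S" for h
  proof -
    from that obtain c a where h: "h = (\<lambda>t. c * t powr a)" by (auto simp: S_def)
    have "\<forall>t\<in>{0<..}. (h has_field_derivative (c * a) * t powr (a - 1)) (at t)"
      by (auto simp: h intro!: derivative_eq_intros)
    moreover have "(\<lambda>t. (c * a) * t powr (a - 1)) \<in> S" by (auto simp: S_def)
    ultimately show ?thesis by (rule bexI[where x="\<lambda>t. (c * a) * t powr (a - 1)"])
  qed
  have sq: "C_k k (\<lambda>x. (\<phi> x)\<^sup>2 + \<epsilon>\<^sup>2)" for k
    using test_C_k[OF \<phi>] by (intro C_k_add C_k_power C_k_const)
  have pos: "(\<phi> x)\<^sup>2 + \<epsilon>\<^sup>2 \<in> {0<..}" for x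
    using e by (simp add: add_nonneg_pos)
  have "C_k k (\<lambda>x. (\<lambda>t. 1 * t powr (1/2)) ((\<phi> x)\<^sup>2 + \<epsilon>\<^sup>2))" for k
    by (rule C_k_compose[OF cl sq pos]) (auto simp: S_def intro!: image_eqI[of _ _ "(1, 1/2)"])
  then have "C_k k (\<lambda>x. 1 * ((\<phi> x)\<^sup>2 + \<epsilon>\<^sup>2) powr (1/2) + (- \<epsilon>))" for k
    by (intro C_k_add C_k_const) simp
  moreover have "smooth_abs \<epsilon> \<phi> = (\<lambda>x. 1 * ((\<phi> x)\<^sup>2 + \<epsilon>\<^sup>2) powr (1/2) + (- \<epsilon>))"
    by (auto simp: smooth_abs_def powr_half_sqrt)
  ultimately have Ck: "C_k k (smooth_abs \<epsilon> \<phi>)" for k by simp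
  from \<Omega> \<phi> obtain K where K: "compact K" "K \<subseteq> \<Omega>" "\<forall>x. x \<notin> K \<longrightarrow> \<phi> x = 0"
    by (metis test_functions_iff)
  then have "\<forall>x. x \<notin> K \<longrightarrow> smooth_abs \<epsilon> \<phi> x = 0" using e by (auto simp: smooth_abs_def)
  with Ck K \<Omega> show ?thesis by (auto simp: test_functions_iff)
qed

lemma smooth_abs_nonneg: "\<epsilon> > 0 \<Longrightarrow> 0 \<le> smooth_abs \<epsilon> \<phi> x"
  using real_sqrt_le_mono[of "\<epsilon>\<^sup>2" "(\<phi> x)\<^sup>2 + \<epsilon>\<^sup>2"] by (simp add: smooth_abs_def)

lemma smooth_abs_ge: "\<epsilon> > 0 \<Longrightarrow> \<phi> x - \<epsilon> \<le> smooth_abs \<epsilon> \<phi> x"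
  using real_sqrt_le_mono[of "(\<phi> x)\<^sup>2" "(\<phi> x)\<^sup>2 + \<epsilon>\<^sup>2"] by (simp add: smooth_abs_def)

text \<open>The chain rule multiplies the gradient by \<phi> / sqrt (\<phi>^2 + \<epsilon>^2), a
  factor of modulus at most 1.\<close>

lemma norm_gradient_smooth_abs_le:
  fixes \<phi> :: "real^'n::finite \<Rightarrow> real"
  assumes \<phi>: "\<phi> \<in> test_functions \<Omega>" and e: "\<epsilon> > 0"
  shows "norm (gradient (smooth_abs \<epsilon> \<phi>) x) \<le> norm (gradient \<phi> x)"
proof -
  have pos: "0 < (\<phi> x)\<^sup>2 + \<epsilon>\<^sup>2" using e by (simp add: add_nonneg_pos)
  define c where "c = \<phi> x / sqrt ((\<phi> x)\<^sup>2 + \<epsilon>\<^sup>2)"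
  have d: "(smooth_abs \<epsilon> \<phi> has_derivative (\<lambda>h. c * (gradient \<phi> x \<bullet> h))) (at x)"
  proof -
    have "((\<lambda>t. sqrt (t\<^sup>2 + \<epsilon>\<^sup>2) - \<epsilon>) has_field_derivative c) (at (\<phi> x))"
      using pos by (auto intro!: derivative_eq_intros simp: c_def divide_simps)
    from has_derivative_compose[OF test_has_derivative[OF \<phi>] this[unfolded has_field_derivative_def]]
    show ?thesis by (simp add: smooth_abs_def [abs_def])
  qed
  have "gradient (smooth_abs \<epsilon> \<phi>) x = c *\<^sub>R gradient \<phi> x"
    using partial_derivative_eqI[OF d] by (simp add: vec_eq_iff inner_axis)
  moreover have "\<bar>c\<bar> \<le> 1"
    using pos by (simp add: c_def abs_divide real_le_rsqrt)
  ultimately show ?thesis by (simp add: mult_left_le_one_le)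
qed

text \<open>Each factor is positive exactly when its coordinate lies strictly between the two
  bounds. The scale \<open>m\<close> sharpens the bump: as it grows the product tends to the
  indicator of the open box, so integrals over boxes become limits of integrals against test
  functions.\<close>

lemma bump_test:
  fixes a b :: "real^'n::finite"
  assumes \<Omega>: "open \<Omega>" and ab: "cbox a b \<subseteq> \<Omega>" "\<And>i. a $ i < b $ i" and m: "m > 0"
  shows bump_test_functions: "(\<lambda>x. \<Prod>i\<in>UNIV. flat_exp 1 (m * ((x $ i - a $ i) *
      (b $ i - x $ i)))) \<in> test_functions \<Omega>"
      (is "?f \<in> _")
    and bump_outside: "x \<notin> box a b \<Longrightarrow> (\<Prod>i\<in>UNIV. flat_exp 1 (m * ((x $ i - a $ i) * (b $ i - x $ i)))) = 0"
proof -
  have out: "?f x = 0" if "x \<notin> box a b" for x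
  proof -
    from that obtain i where i: "x $ i \<le> a $ i \<or> b $ i \<le> x $ i" by (auto simp: mem_box_cart not_less)
    have "(x $ i - a $ i) * (b $ i - x $ i) \<le> 0"
      using i ab(2)[of i] by (auto simp: mult_le_0_iff)
    then have "m * ((x $ i - a $ i) * (b $ i - x $ i)) \<le> 0" using m by (simp add: mult_le_0_iff)
    then have "flat_exp 1 (m * ((x $ i - a $ i) * (b $ i - x $ i))) = 0" by (simp add: flat_exp_def)
    then show ?thesis by (simp add: prod_zero_iff) blast
  qed
  then show "x \<notin> box a b \<Longrightarrow> ?f x = 0" .
  have lin: "C_k k (\<lambda>x::real^'n. (x $ i + (- c)))" for k i c by (intro C_k_add C_k_coord C_k_const)
  have "C_k k (\<lambda>x::real^'n. m * ((x $ i + (- (a $ i))) * ((-1) * (x $ i + (- (b $ i))))))" for k i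
    by (intro C_k_mult lin C_k_const)
  then have q: "C_k k (\<lambda>x::real^'n. m * ((x $ i - a $ i) * (b $ i - x $ i)))" for k i by simp
  have "C_k k ?f" for k by (intro C_k_prod C_k_flat_exp q) auto
  moreover have "?f x = 0" if "x \<notin> cbox a b" for x using out that box_subset_cbox by blast
  ultimately show "?f \<in> test_functions \<Omega>" using \<Omega> ab(1)
      by (auto simp: test_functions_iff intro!: exI[of _ "cbox a b"])
qed

lemma bump_le_1: "0 \<le> (\<Prod>i\<in>I. flat_exp 1 (f i)) \<and> (\<Prod>i\<in>I. flat_exp 1 (f i)) \<le> 1"
  by (auto intro!: prod_nonneg prod_le_1 simp: flat_exp_def)

lemma bump_tendsto_1:
  fixes a b :: "real^'n::finite"
  assumes "x \<in> box a b"
  shows "(\<lambda>m. \<Prod>i\<in>UNIV. flat_exp 1 (real (Suc m) * ((x $ i - a $ i) * (b $ i - x $ i)))) \<longlonglongrightarrow> 1"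
proof -
  have "(\<lambda>m. flat_exp 1 (real (Suc m) * ((x $ i - a $ i) * (b $ i - x $ i)))) \<longlonglongrightarrow> 1" for i
  proof -
    define c where "c = (x $ i - a $ i) * (b $ i - x $ i)"
    have c: "c > 0" using assms by (auto simp: c_def mem_box_cart)
    have "(\<lambda>m. exp (- (inverse (real (Suc m)) / c))) \<longlonglongrightarrow> exp (- (0 / c))"
      using LIMSEQ_inverse_real_of_nat c by (intro tendsto_intros) auto
    moreover have "flat_exp 1 (real (Suc m) * c) = exp (- (inverse (real (Suc m)) / c))" for m
      using c by (simp add: flat_exp_def divide_simps)
    ultimately show ?thesis by (simp add: c_def)
  qed
  then have "(\<lambda>m. \<Prod>i\<in>UNIV. flat_exp 1 (real (Suc m) * ((x $ i - a $ i) * (b $ i - x $ i)))) \<longlonglongrightarrow>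
      (\<Prod>i\<in>(UNIV::'n set). 1)"
    by (intro tendsto_prod)
  then show ?thesis by simp
qed

lemma fundamental_lemma_box:
  fixes u :: "real^'n::finite \<Rightarrow> real"
  assumes \<Omega>: "open \<Omega>" and u: "integrable (lebesgue_on (cbox a b)) u" and ab: "cbox a b \<subseteq> \<Omega>" "\<And>i. a $ i < b $ i"
    and zero: "\<And>\<eta>. \<eta> \<in> test_functions \<Omega> \<Longrightarrow> (LINT x|lebesgue_on \<Omega>. u x * \<eta> x) = 0"
  shows "(LINT x|lebesgue. indicator (box a b) x *\<^sub>R u x) = 0"
proof -
  define \<beta> where "\<beta> m x = (\<Prod>i\<in>UNIV. flat_exp 1 (real (Suc m) * ((x $ i - a $ i) * (b $ i - x $ i))))" for m
      and x :: "real^'n"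
  have t: "\<beta> m \<in> test_functions \<Omega>" for m
    unfolding \<beta>_def [abs_def] by (rule bump_test_functions[OF \<Omega> ab], simp)
  have out: "\<beta> m x = 0" if "x \<notin> box a b" for m x
    using bump_outside[OF \<Omega> ab _ that, of "real (Suc m)"] by (simp add: \<beta>_def)
  have ui: "integrable lebesgue (\<lambda>x. indicator (cbox a b) x *\<^sub>R u x)"
    using u by (subst (asm) integrable_restrict_space) auto
  have [measurable]: "\<beta> m \<in> borel_measurable lebesgue" for m
    using test_borel[OF t] by (simp add: measurable_completion)
  have "(\<lambda>m. LINT x|lebesgue. (indicator (cbox a b) x *\<^sub>R u x) * \<beta> m x) \<longlonglongrightarrow>
      (LINT x|lebesgue. (indicator (cbox a b) x *\<^sub>R u x) * indicator (box a b) x)"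
  proof (rule integral_dominated_convergence)
    show "integrable lebesgue (\<lambda>x. norm (indicator (cbox a b) x *\<^sub>R u x))" using ui by (rule integrable_norm)
    show "AE x in lebesgue. (\<lambda>m. (indicator (cbox a b) x *\<^sub>R u x) * \<beta> m x) \<longlonglongrightarrow>
        (indicator (cbox a b) x *\<^sub>R u x) * indicator (box a b) x"
    proof (intro AE_I2 tendsto_mult tendsto_const)
      show "(\<lambda>m. \<beta> m x) \<longlonglongrightarrow> indicator (box a b) x" for x
      proof (cases "x \<in> box a b")
        case True
        then show ?thesis using bump_tendsto_1[OF True] by (simp add: \<beta>_def)
      next
        case False
        then show ?thesis using out[OF False] by simp
      qed
    qed
    show "AE x in lebesgue. norm ((indicator (cbox a b) x *\<^sub>R u x) * \<beta> m x) \<le>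
        norm (indicator (cbox a b) x *\<^sub>R u x)" for m
    proof (rule AE_I2)
      fix x
      have "0 \<le> \<beta> m x \<and> \<beta> m x \<le> 1" unfolding \<beta>_def by (rule bump_le_1)
      then have "\<bar>\<beta> m x\<bar> \<le> 1" by simp
      from mult_left_mono[OF this, of "\<bar>indicator (cbox a b) x *\<^sub>R u x\<bar>"]
      show "norm ((indicator (cbox a b) x *\<^sub>R u x) * \<beta> m x) \<le> norm (indicator (cbox a b) x *\<^sub>R u x)"
        by (simp add: abs_mult)
    qed
    show "(\<lambda>x. (indicator (cbox a b) x *\<^sub>R u x) * indicator (box a b) x) \<in> borel_measurable lebesgue"
      using borel_measurable_integrable[OF ui] by (intro borel_measurable_times borel_measurable_indicator) auto
    show "(\<lambda>x. (indicator (cbox a b) x *\<^sub>R u x) * \<beta> m x) \<in> borel_measurable lebesgue" for m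
      using borel_measurable_integrable[OF ui] by (intro borel_measurable_times) auto
  qed
  moreover have "(LINT x|lebesgue. (indicator (cbox a b) x *\<^sub>R u x) * \<beta> m x) = 0" for m
  proof -
    have "(indicator (cbox a b) x *\<^sub>R u x) * \<beta> m x = indicator \<Omega> x *\<^sub>R (u x * \<beta> m x)" for x
      using out[of x m] ab box_subset_cbox[of a b] by (cases "x \<in> box a b") (auto simp: indicator_def)
    then have "(LINT x|lebesgue. (indicator (cbox a b) x *\<^sub>R u x) * \<beta> m x) =
        (LINT x|lebesgue_on \<Omega>. u x * \<beta> m x)"
      using \<Omega> by (simp only:) (simp add: integral_restrict_space)
    then show ?thesis using zero[OF t] by simp
  qed
  ultimately have "(LINT x|lebesgue. (indicator (cbox a b) x *\<^sub>R u x) * indicator (box a b) x) = 0"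
    by (simp add: LIMSEQ_const_iff)
  moreover have "(indicator (cbox a b) x *\<^sub>R u x) * indicator (box a b) x = indicator (box a b) x *\<^sub>R u x" for x
    using box_subset_cbox[of a b] by (auto simp: indicator_def)
  ultimately show ?thesis by (simp only:)
qed

text \<open>On a closed box inside \<Omega>, the function cut off by 0 has integral 0 over every
  box, since boxes intersect in boxes. Lebesgue differentiation recovers a function almost
  everywhere from its means over small cubes, so it vanishes there; countably many closed boxes make
  up \<Omega>.\<close>

lemma fundamental_lemma:
  fixes u :: "real^'n::finite \<Rightarrow> real"
  assumes \<Omega>: "open \<Omega>" and u: "locally_integrable \<Omega> u"
    and zero: "\<And>\<eta>. \<eta> \<in> test_functions \<Omega> \<Longrightarrow> (LINT x|lebesgue_on \<Omega>. u x * \<eta> x) = 0"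
  shows "AE x in lebesgue_on \<Omega>. u x = 0"
proof -
  have uK: "integrable lebesgue (\<lambda>x. indicator K x *\<^sub>R u x)" if "compact K" "K \<subseteq> \<Omega>" for K
    using u that by (auto simp: locally_integrable_def set_integrable_def)
  have local: "AE x in lebesgue. x \<in> cbox c d \<longrightarrow> u x = 0" if cd: "cbox c d \<subseteq> \<Omega>" for c d
  proof -
    define v where "v x = indicator (cbox c d) x *\<^sub>R u x" for x
    have v: "integrable lebesgue v" unfolding v_def using uK[OF compact_cbox cd] .
    have vi: "v integrable_on cbox a b" for a b
    proof -
      have "integrable lebesgue (\<lambda>x. indicator (cbox a b) x *\<^sub>R v x)"
        using v by (rule integrable_mult_indicator[rotated]) auto
      then have "v absolutely_integrable_on cbox a b" by (simp add: set_integrable_def)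
      then show ?thesis by (simp add: absolutely_integrable_on_def)
    qed
    have v0: "integral (cbox a b) v = 0" for a b
    proof -
      have "v absolutely_integrable_on cbox a b"
        using integrable_mult_indicator[OF _ v, of "cbox a b"] by (simp add: set_integrable_def)
      then have "integral (cbox a b) v = (LINT x|lebesgue. indicator (cbox a b) x *\<^sub>R v x)"
        using set_lebesgue_integral_eq_integral(2) by (fastforce simp: set_lebesgue_integral_def)
      also have "(\<lambda>x. indicator (cbox a b) x *\<^sub>R v x) = (\<lambda>x. indicator (cbox a b \<inter> cbox c d) x *\<^sub>R u x)"
        by (auto simp: v_def indicator_def)
      also obtain a' b' where ab': "cbox a b \<inter> cbox c d = cbox a' b'" by (rule that[OF Int_interval])
      also have "(LINT x|lebesgue. indicator (cbox a' b') x *\<^sub>R u x) = 0"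
      \<comment> \<open>The intersection may be flat or empty and is then a null set; only boxes
        with interior need the bumps.\<close>
      proof (cases "\<forall>i. a' $ i < b' $ i")
        case True
        have sub: "cbox a' b' \<subseteq> \<Omega>" using ab' cd by auto
        have "integrable (lebesgue_on (cbox a' b')) u" using uK[OF compact_cbox sub]
            by (subst integrable_restrict_space) auto
        from fundamental_lemma_box[OF \<Omega> this sub _ zero] True
        have "(LINT x|lebesgue. indicator (box a' b') x *\<^sub>R u x) = 0" by blast
        moreover have "(LINT x|lebesgue. indicator (box a' b') x *\<^sub>R u x) =
            (LINT x|lebesgue. indicator (cbox a' b') x *\<^sub>R u x)"
        proof (rule integral_cong_AE)
          show "(\<lambda>x. indicator (cbox a' b') x *\<^sub>R u x) \<in> borel_measurable lebesgue"
            using uK[OF compact_cbox sub] by (rule borel_measurable_integrable)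
          have "integrable lebesgue (\<lambda>x. indicator (box a' b') x *\<^sub>R (indicator (cbox a' b') x *\<^sub>R u x))"
            using uK[OF compact_cbox sub] by (rule integrable_mult_indicator[rotated]) auto
          moreover have "(\<lambda>x. indicator (box a' b') x *\<^sub>R (indicator (cbox a' b') x *\<^sub>R u x)) =
              (\<lambda>x. indicator (box a' b') x *\<^sub>R u x)"
            using box_subset_cbox[of a' b'] by (auto simp: indicator_def fun_eq_iff)
          ultimately show "(\<lambda>x. indicator (box a' b') x *\<^sub>R u x) \<in> borel_measurable lebesgue"
            using borel_measurable_integrable by metis
          have "AE x in lebesgue. x \<notin> frontier (cbox a' b')"
            using negligible_frontier_interval[of a' b']
                by (intro AE_not_in) (simp add: negligible_iff_null_sets frontier_cbox)
          then show "AE x in lebesgue. indicator (box a' b') x *\<^sub>R u x = indicator (cbox a' b') x *\<^sub>R u x"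
            by (auto simp: frontier_cbox indicator_def split: if_splits elim!: eventually_mono intro:
                box_subset_cbox[THEN subsetD])
        qed
        ultimately show ?thesis by simp
      next
        case False
        then have "interior (cbox a' b') = {}" by (auto simp: interval_eq_empty_cart not_less)
        then have "negligible (cbox a' b')" using negligible_interval(1) by auto
        then have "AE x in lebesgue. x \<notin> cbox a' b'"
          by (intro AE_not_in) (simp add: negligible_iff_null_sets)
        then have "AE x in lebesgue. indicator (cbox a' b') x *\<^sub>R u x = 0"
          by (auto elim!: eventually_mono)
        then show ?thesis by (rule integral_eq_zero_AE)
      qed
      finally show ?thesis .
    qed
    obtain N where N: "negligible N" "\<And>x e. \<lbrakk>x \<notin> N; 0 < e\<rbrakk> \<Longrightarrow>
        \<exists>d>0. \<forall>h. 0 < h \<and> h < d \<longrightarrow> norm (integral (cbox x (x + h *\<^sub>R One)) v /\<^sub>R h ^ DIM(real^'n) - v x) < e"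
      using integrable_ccontinuous_explicit[OF vi] by blast
    have "v x = 0" if xN: "x \<notin> N" for x
    proof (rule ccontr)
      assume "v x \<noteq> 0"
      then obtain d where d: "d > 0" "\<forall>h. 0 < h \<and> h < d \<longrightarrow>
          norm (integral (cbox x (x + h *\<^sub>R One)) v /\<^sub>R h ^ DIM(real^'n) - v x) < \<bar>v x\<bar>"
        using N(2)[OF xN, of "\<bar>v x\<bar>"] by auto
      from d(2)[rule_format, of "d/2"] d(1) v0 show False by auto
    qed
    moreover have "AE x in lebesgue. x \<notin> N" using N(1) by (intro AE_not_in) (simp add: negligible_iff_null_sets)
    ultimately show ?thesis by (auto simp: v_def indicator_def elim!: eventually_mono split: if_splits)
  qed
  obtain \<D> where D: "countable \<D>" "\<D> \<subseteq> Pow \<Omega>" "\<And>X. X \<in> \<D> \<Longrightarrow> \<exists>a b. X = cbox a b" "\<Union>\<D> = \<Omega>"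
    using open_countable_Union_open_cbox[OF \<Omega>] by metis
  have "AE x in lebesgue. \<forall>X\<in>\<D>. x \<in> X \<longrightarrow> u x = 0"
  proof (subst AE_ball_countable[OF D(1)], intro ballI)
    fix X assume "X \<in> \<D>"
    moreover then obtain a b where "X = cbox a b" using D(3) by blast
    ultimately show "AE x in lebesgue. x \<in> X \<longrightarrow> u x = 0" using D(2) local[of a b] by auto
  qed
  then have "AE x in lebesgue. x \<in> \<Omega> \<longrightarrow> u x = 0" using D(4) by (auto elim!: eventually_mono)
  then show ?thesis using \<Omega> by (subst AE_restrict_space_iff) auto
qed

section \<open>Calculus of weak gradients\<close>

lemma locally_integrable_diff:
  fixes u v :: "'a::euclidean_space \<Rightarrow> 'b::{banach, second_countable_topology}"
  assumes "locally_integrable \<Omega> u" "locally_integrable \<Omega> v"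
  shows "locally_integrable \<Omega> (\<lambda>x. u x - v x)"
  using assms by (auto simp: locally_integrable_def intro: set_integral_diff)

lemma locally_integrable_nth:
  fixes g :: "real^'n::finite \<Rightarrow> real^'n"
  assumes "locally_integrable \<Omega> g"
  shows "locally_integrable \<Omega> (\<lambda>x. g x $ i)"
  unfolding locally_integrable_def
proof (intro allI impI)
  fix K assume "compact K \<and> K \<subseteq> \<Omega>"
  then have "integrable lebesgue (\<lambda>x. indicator K x *\<^sub>R g x)"
    using assms by (auto simp: locally_integrable_def set_integrable_def)
  from integrable_bounded_linear[OF bounded_linear_vec_nth this, of i]
  show "set_integrable lebesgue K (\<lambda>x. g x $ i)" by (simp add: set_integrable_def)
qed

lemma locally_integrable_mult_test:
  fixes u :: "real^'n::finite \<Rightarrow> real"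
  assumes \<Omega>: "open \<Omega>" and u: "locally_integrable \<Omega> u" and \<phi>: "\<phi> \<in> test_functions \<Omega>"
  shows "integrable (lebesgue_on \<Omega>) (\<lambda>x. u x * \<phi> x)"
proof -
  from \<Omega> \<phi> obtain K where K: "compact K" "K \<subseteq> \<Omega>" "\<forall>x. x \<notin> K \<longrightarrow> \<phi> x = 0"
    by (metis test_functions_iff)
  obtain B where B: "\<And>x. \<bar>\<phi> x\<bar> \<le> B" using test_bounded[OF \<Omega> \<phi>] by blast
  have uK: "integrable lebesgue (\<lambda>x. indicator K x *\<^sub>R u x)"
    using u K by (auto simp: locally_integrable_def set_integrable_def)
  have [measurable]: "\<phi> \<in> borel_measurable lebesgue"
    using test_borel[OF \<phi>] by (simp add: measurable_completion)
  have "integrable lebesgue (\<lambda>x. (indicator K x *\<^sub>R u x) * \<phi> x)"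
  proof (rule Bochner_Integration.integrable_bound)
    show "integrable lebesgue (\<lambda>x. B * (indicator K x *\<^sub>R u x))" using uK by (rule integrable_mult_right)
    show "(\<lambda>x. (indicator K x *\<^sub>R u x) * \<phi> x) \<in> borel_measurable lebesgue"
      using borel_measurable_integrable[OF uK] by (intro borel_measurable_times) auto
    show "AE x in lebesgue. norm ((indicator K x *\<^sub>R u x) * \<phi> x) \<le> norm (B * (indicator K x *\<^sub>R u x))"
    proof (rule AE_I2)
      fix x
      show "norm ((indicator K x *\<^sub>R u x) * \<phi> x) \<le> norm (B * (indicator K x *\<^sub>R u x))"
        using mult_right_mono[OF B[of x], of "\<bar>indicator K x * u x\<bar>"] B[of x]
        by (simp add: abs_mult mult.commute)
    qed
  qed
  also have "(\<lambda>x. (indicator K x *\<^sub>R u x) * \<phi> x) = (\<lambda>x. indicator \<Omega> x *\<^sub>R (u x * \<phi> x))"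
    using K by (auto simp: indicator_def fun_eq_iff)
  finally show ?thesis using \<Omega> by (subst integrable_restrict_space) auto
qed

lemma has_weak_gradient_diff:
  assumes \<Omega>: "open \<Omega>" and u: "has_weak_gradient \<Omega> u g" and v: "has_weak_gradient \<Omega> v h"
  shows "has_weak_gradient \<Omega> (\<lambda>x. u x - v x) (\<lambda>x. g x - h x)"
  unfolding has_weak_gradient_def
proof (intro conjI ballI allI)
  fix \<phi> i assume \<phi>: "\<phi> \<in> test_functions \<Omega>"
  note li = u[unfolded has_weak_gradient_def] v[unfolded has_weak_gradient_def]
  note t = test_partial[OF \<Omega> \<phi>, of i]
  note m = locally_integrable_mult_test[OF \<Omega> _ t] locally_integrable_mult_test[OF \<Omega> locally_integrable_nth \<phi>]
  have "(LINT x|lebesgue_on \<Omega>. (u x - v x) * partial_derivative i \<phi> x) =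
      (LINT x|lebesgue_on \<Omega>. u x * partial_derivative i \<phi> x) - (LINT x|lebesgue_on \<Omega>. v x *
          partial_derivative i \<phi> x)"
    using li m by (simp add: left_diff_distrib)
  also have "\<dots> = - (LINT x|lebesgue_on \<Omega>. g x $ i * \<phi> x) - - (LINT x|lebesgue_on \<Omega>. h x $ i * \<phi> x)"
    using li \<phi> by simp
  also have "\<dots> = - (LINT x|lebesgue_on \<Omega>. (g x - h x) $ i * \<phi> x)"
    using li m by (simp add: left_diff_distrib)
  finally show "(LINT x|lebesgue_on \<Omega>. (u x - v x) * partial_derivative i \<phi> x) =
      - (LINT x|lebesgue_on \<Omega>. (g x - h x) $ i * \<phi> x)" .
qed (use u v in \<open>auto simp: has_weak_gradient_def intro: locally_integrable_diff\<close>)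

lemma has_weak_gradient_unique:
  assumes \<Omega>: "open \<Omega>" and "has_weak_gradient \<Omega> u g" "has_weak_gradient \<Omega> u h"
  shows "AE x in lebesgue_on \<Omega>. g x = h x"
proof -
  from has_weak_gradient_diff[OF assms]
  have d: "has_weak_gradient \<Omega> (\<lambda>x. 0) (\<lambda>x. g x - h x)" by simp
  have "AE x in lebesgue_on \<Omega>. (g x - h x) $ i = 0" for i
  proof (rule fundamental_lemma[OF \<Omega>])
    show "locally_integrable \<Omega> (\<lambda>x. (g x - h x) $ i)"
      using d by (intro locally_integrable_nth) (simp add: has_weak_gradient_def)
    fix \<eta> assume "\<eta> \<in> test_functions \<Omega>"
    with d show "(LINT x|lebesgue_on \<Omega>. (g x - h x) $ i * \<eta> x) = 0" by (simp add: has_weak_gradient_def)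
  qed
  then have "AE x in lebesgue_on \<Omega>. \<forall>i. (g x - h x) $ i = 0" by (simp add: AE_all_countable)
  then show ?thesis by (auto simp: vec_eq_iff elim!: eventually_mono)
qed

text \<open>\<open>weak_gradient\<close> is a choice among all weak gradients. Uniqueness ties it to
  any gradient constructed by hand, and this removes the choice from later arguments.\<close>

lemma weak_gradient_AE_eq:
  assumes "open \<Omega>" "has_weak_gradient \<Omega> u g"
  shows "AE x in lebesgue_on \<Omega>. weak_gradient \<Omega> u x = g x"
  using assms(2) unfolding weak_gradient_def
  by (intro has_weak_gradient_unique[OF assms(1) _ assms(2)]) (rule someI[where P="has_weak_gradient \<Omega> u"])

lemma integrable_imp_locally_integrable:
  fixes u :: "'a::euclidean_space \<Rightarrow> 'b::{banach, second_countable_topology}"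
  assumes "open \<Omega>" "integrable (lebesgue_on \<Omega>) u"
  shows "locally_integrable \<Omega> u"
  unfolding locally_integrable_def
proof (intro allI impI)
  fix K assume K: "compact K \<and> K \<subseteq> \<Omega>"
  have "integrable lebesgue (\<lambda>x. indicator \<Omega> x *\<^sub>R u x)"
    using assms by (subst (asm) integrable_restrict_space) auto
  from integrable_mult_indicator[OF _ this, of K]
  have "integrable lebesgue (\<lambda>x. indicator K x *\<^sub>R (indicator \<Omega> x *\<^sub>R u x))"
    using K by (auto simp: compact_imp_closed lmeasurable_compact fmeasurableD)
  also have "(\<lambda>x. indicator K x *\<^sub>R (indicator \<Omega> x *\<^sub>R u x)) = (\<lambda>x. indicator K x *\<^sub>R u x)"
    using K by (auto simp: indicator_def fun_eq_iff)
  finally show "set_integrable lebesgue K u" by (simp add: set_integrable_def)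
qed

section \<open>Ray averages\<close>

lemma nn_integral_lebesgue_on:
  assumes "S \<in> sets borel"
  shows "(\<integral>\<^sup>+x. f x \<partial>lebesgue_on S) = (\<integral>\<^sup>+x. f x * indicator S x \<partial>lborel)"
  using assms by (simp add: nn_integral_restrict_space nn_integral_completion)

lemma nn_integral_lborel_scale:
  fixes a :: "'a::euclidean_space \<Rightarrow> ennreal"
  assumes [measurable]: "a \<in> borel_measurable borel" and s: "s > 0"
  shows "(\<integral>\<^sup>+z. a (x + s *\<^sub>R z) \<partial>lborel) = ennreal (s powr - real DIM('a)) * (\<integral>\<^sup>+y. a y \<partial>lborel)"
proof -
  have "(\<integral>\<^sup>+y. a y \<partial>lborel) = (\<integral>\<^sup>+y. a y \<partial>density (distr lborel borel (\<lambda>z. x + s *\<^sub>R z)) (\<lambda>_. ennreal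
      (\<bar>s\<bar> ^ DIM('a))))"
    using lborel_affine[of s x] s by simp
  also have "\<dots> = ennreal (s ^ DIM('a)) * (\<integral>\<^sup>+z. a (x + s *\<^sub>R z) \<partial>lborel)"
    using s by (simp add: nn_integral_density nn_integral_distr nn_integral_cmult)
  finally have "ennreal (s powr - real DIM('a)) * (\<integral>\<^sup>+y. a y \<partial>lborel) =
      ennreal (s powr - real DIM('a) * s ^ DIM('a)) * (\<integral>\<^sup>+z. a (x + s *\<^sub>R z) \<partial>lborel)"
    using s by (simp add: ennreal_mult mult.assoc)
  also have "s powr - real DIM('a) * s ^ DIM('a) = 1"
    using s by (simp add: powr_minus powr_realpow)
  finally show ?thesis by simp
qed

lemma nn_integral_lborel_translate:
  fixes a :: "'a::euclidean_space \<Rightarrow> ennreal"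
  assumes [measurable]: "a \<in> borel_measurable borel"
  shows "(\<integral>\<^sup>+x. a (x + v) \<partial>lborel) = (\<integral>\<^sup>+x. a x \<partial>lborel)"
  using nn_integral_lborel_scale[OF assms, of 1 v] by (simp add: add.commute)

text \<open>Averages along the rays \<open>x + s z\<close> with directions \<open>z\<close> in a unit cube away from the origin; they
  replace the Riesz potential and need no polar coordinates.\<close>

definition unit_box :: "'a::euclidean_space set" where
  "unit_box = cbox One (2 *\<^sub>R One)"

lemma unit_box_measurable [measurable]: "unit_box \<in> sets borel"
  by (simp add: unit_box_def)

lemma emeasure_unit_box: "emeasure lborel (unit_box :: 'a::euclidean_space set) = 1"
  unfolding unit_box_def by (subst emeasure_lborel_cbox) (auto simp: inner_diff_left)

lemma norm_unit_box:
  assumes "z \<in> (unit_box :: 'a::euclidean_space set)"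
  shows "1 \<le> norm z" "norm z \<le> 2 * real DIM('a)"
proof -
  have b: "1 \<le> z \<bullet> b \<and> z \<bullet> b \<le> 2" if "b \<in> Basis" for b
    using assms that by (auto simp: unit_box_def mem_box)
  obtain b :: 'a where "b \<in> Basis" using nonempty_Basis by blast
  with b Basis_le_norm[of b z] show "1 \<le> norm z" by force
  have "norm z \<le> (\<Sum>b\<in>Basis. \<bar>z \<bullet> b\<bar>)" by (rule norm_le_l1)
  also have "\<dots> \<le> (\<Sum>b\<in>(Basis::'a set). 2)" using b by (intro sum_mono) force
  finally show "norm z \<le> 2 * real DIM('a)" by (simp add: mult.commute)
qed

definition ray_average :: "(real \<Rightarrow> ennreal) \<Rightarrow> ('a::euclidean_space \<Rightarrow> ennreal) \<Rightarrow> 'a \<Rightarrow> ennreal" where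
  "ray_average w a x = (\<integral>\<^sup>+s. \<integral>\<^sup>+z. w s * a (x + s *\<^sub>R z) * indicator unit_box z \<partial>lborel \<partial>lborel)"

lemma ray_average_measurable [measurable]:
  assumes [measurable]: "w \<in> borel_measurable borel" "a \<in> borel_measurable borel"
  shows "ray_average w a \<in> borel_measurable borel"
  unfolding ray_average_def [abs_def] by measurable

text \<open>For fixed \<open>s\<close> and \<open>z\<close> the integral over \<open>x\<close> is
  translation invariant, and the cube of directions has measure 1. In L1 a ray average costs only
  the mass of its weight.\<close>

lemma nn_integral_ray_average:
  fixes a :: "'a::euclidean_space \<Rightarrow> ennreal"
  assumes [measurable]: "w \<in> borel_measurable borel" "a \<in> borel_measurable borel"
  shows "(\<integral>\<^sup>+x. ray_average w a x \<partial>lborel) = (\<integral>\<^sup>+s. w s \<partial>lborel) * (\<integral>\<^sup>+x. a x \<partial>lborel)"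
proof -
  have "(\<integral>\<^sup>+x. ray_average w a x \<partial>lborel) =
      (\<integral>\<^sup>+s. \<integral>\<^sup>+x. \<integral>\<^sup>+z. w s * a (x + s *\<^sub>R z) * indicator unit_box z \<partial>lborel \<partial>lborel \<partial>lborel)"
    unfolding ray_average_def by (rule lborel_pair.Fubini') measurable
  also have "\<dots> = (\<integral>\<^sup>+s. \<integral>\<^sup>+z. \<integral>\<^sup>+x. w s * a (x + s *\<^sub>R z) * indicator unit_box z \<partial>lborel \<partial>lborel \<partial>lborel)"
    by (intro nn_integral_cong lborel_pair.Fubini') measurable
  also have "\<dots> = (\<integral>\<^sup>+s. \<integral>\<^sup>+z. (w s * (\<integral>\<^sup>+x. a x \<partial>lborel)) * indicator (unit_box::'a set) z \<partial>lborel \<partial>lborel)"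
    by (simp add: nn_integral_multc nn_integral_cmult nn_integral_lborel_translate)
  also have "\<dots> = (\<integral>\<^sup>+s. w s * (\<integral>\<^sup>+x. a x \<partial>lborel) \<partial>lborel)"
    by (simp add: nn_integral_cmult_indicator emeasure_unit_box)
  also have "\<dots> = (\<integral>\<^sup>+s. w s \<partial>lborel) * (\<integral>\<^sup>+x. a x \<partial>lborel)"
    by (rule nn_integral_multc) measurable
  finally show ?thesis .
qed

text \<open>The pointwise counterpart: substituting y = x + s z in the directions produces the
  Jacobian s^(-N), so a bound at every point costs this additional singularity in the
  weight.\<close>

lemma ray_average_le:
  fixes a :: "'a::euclidean_space \<Rightarrow> ennreal"
  assumes [measurable]: "w \<in> borel_measurable borel" "a \<in> borel_measurable borel" and w: "\<And>s. s \<le> 0 \<Longrightarrow> w s = 0"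
  shows "ray_average w a x \<le> (\<integral>\<^sup>+s. w s * ennreal (s powr - real DIM('a)) \<partial>lborel) * (\<integral>\<^sup>+x. a x \<partial>lborel)"
proof -
  have "ray_average w a x \<le> (\<integral>\<^sup>+s. w s * ennreal (s powr - real DIM('a)) * (\<integral>\<^sup>+x. a x \<partial>lborel) \<partial>lborel)"
    unfolding ray_average_def
  proof (rule nn_integral_mono)
    fix s :: real
    show "(\<integral>\<^sup>+z. w s * a (x + s *\<^sub>R z) * indicator unit_box z \<partial>lborel) \<le>
        w s * ennreal (s powr - real DIM('a)) * (\<integral>\<^sup>+x. a x \<partial>lborel)"
    proof (cases "s > 0")
      case True
      have "(\<integral>\<^sup>+z. w s * a (x + s *\<^sub>R z) * indicator unit_box z \<partial>lborel) \<le>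
          (\<integral>\<^sup>+z. w s * a (x + s *\<^sub>R z) \<partial>lborel)"
        by (intro nn_integral_mono) (auto simp: indicator_def)
      also have "\<dots> = w s * ennreal (s powr - real DIM('a)) * (\<integral>\<^sup>+x. a x \<partial>lborel)"
        using True by (simp add: nn_integral_cmult nn_integral_lborel_scale mult.assoc)
      finally show ?thesis .
    qed (simp add: w)
  qed
  also have "\<dots> = (\<integral>\<^sup>+s. w s * ennreal (s powr - real DIM('a)) \<partial>lborel) * (\<integral>\<^sup>+x. a x \<partial>lborel)"
    by (rule nn_integral_multc) measurable
  finally show ?thesis .
qed

lemma test_ray_bound:
  fixes \<phi> :: "real^'n::finite \<Rightarrow> real"
  assumes \<Omega>: "open \<Omega>" and \<phi>: "\<phi> \<in> test_functions \<Omega>" and t: "0 \<le> t"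
  shows "ennreal \<bar>\<phi> (x + t *\<^sub>R z) - \<phi> x\<bar> \<le>
    (\<integral>\<^sup>+s. ennreal (norm z) * ennreal (norm (gradient \<phi> (x + s *\<^sub>R z))) * indicator {0..t} s \<partial>lborel)"
proof -
  let ?f = "\<lambda>s. gradient \<phi> (x + s *\<^sub>R z) \<bullet> z"
  let ?g = "\<lambda>s. norm z * norm (gradient \<phi> (x + s *\<^sub>R z))"
  have cont: "continuous_on S (\<lambda>s. gradient \<phi> (x + s *\<^sub>R z))" for S
    by (rule continuous_on_compose2[OF gradient_continuous[OF \<Omega> \<phi>]]) (auto intro!: continuous_intros)
  have f: "(?f has_integral (\<phi> (x + t *\<^sub>R z) - \<phi> (x + 0 *\<^sub>R z))) {0..t}"
  proof (rule fundamental_theorem_of_calculus[OF t])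
    fix s
    have "((\<lambda>s. x + s *\<^sub>R z) has_derivative (\<lambda>h. h *\<^sub>R z)) (at s within {0..t})"
      by (auto intro!: derivative_eq_intros)
    from has_derivative_compose[OF this test_has_derivative[OF \<phi>]]
    show "((\<lambda>s. \<phi> (x + s *\<^sub>R z)) has_vector_derivative ?f s) (at s within {0..t})"
      by (simp add: has_vector_derivative_def)
  qed
  have gi: "?g integrable_on {0..t}"
    using cont by (intro integrable_continuous_interval continuous_intros)
  have "norm (integral {0..t} ?f) \<le> integral {0..t} ?g"
  proof (rule integral_norm_bound_integral[OF _ gi])
    show "?f integrable_on {0..t}" using f by blast
    show "norm (?f s) \<le> ?g s" for s using Cauchy_Schwarz_ineq2[of "gradient \<phi> (x + s *\<^sub>R z)" z]
        by (simp add: mult.commute)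
  qed
  then have "\<bar>\<phi> (x + t *\<^sub>R z) - \<phi> x\<bar> \<le> integral {0..t} ?g" using integral_unique[OF f] by simp
  then have "ennreal \<bar>\<phi> (x + t *\<^sub>R z) - \<phi> x\<bar> \<le> ennreal (integral {0..t} ?g)" by (rule ennreal_leI)
  also have "\<dots> = (\<integral>\<^sup>+s. ennreal (?g s) * indicator {0..t} s \<partial>lborel)"
    using gi by (intro nn_integral_has_integral_lebesgue'[symmetric] integrable_integral) auto
  finally show ?thesis by (simp add: ennreal_mult)
qed

lemma test_average_ray_bound:
  fixes \<phi> :: "real^'n::finite \<Rightarrow> real"
  assumes \<Omega>: "open \<Omega>" and \<phi>: "\<phi> \<in> test_functions \<Omega>" and t: "0 \<le> t"
  shows "(\<integral>\<^sup>+z. ennreal \<bar>\<phi> (x + t *\<^sub>R z) - \<phi> x\<bar> * indicator unit_box z \<partial>lborel) \<le>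
     ennreal (2 * real CARD('n)) * ray_average (indicator {0<..t}) (\<lambda>y. ennreal (norm (gradient \<phi> y))) x"
proof -
  note [measurable] = gradient_borel[OF \<Omega> \<phi>] test_borel[OF \<phi>]
  let ?g = "\<lambda>y. ennreal (norm (gradient \<phi> y))"
  let ?c = "ennreal (2 * real CARD('n))"
  have "(\<integral>\<^sup>+z. ennreal \<bar>\<phi> (x + t *\<^sub>R z) - \<phi> x\<bar> * indicator unit_box z \<partial>lborel) \<le>
      (\<integral>\<^sup>+z. \<integral>\<^sup>+s. ?c * (indicator {0<..t} s * ?g (x + s *\<^sub>R z) * indicator unit_box z) \<partial>lborel \<partial>lborel)"
  proof (rule nn_integral_mono)
    fix z :: "real^'n"
    show "ennreal \<bar>\<phi> (x + t *\<^sub>R z) - \<phi> x\<bar> * indicator unit_box z \<le>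
      (\<integral>\<^sup>+s. ?c * (indicator {0<..t} s * ?g (x + s *\<^sub>R z) * indicator unit_box z) \<partial>lborel)"
    proof (cases "z \<in> unit_box")
      case True
      have "ennreal \<bar>\<phi> (x + t *\<^sub>R z) - \<phi> x\<bar> \<le>
          (\<integral>\<^sup>+s. ennreal (norm z) * ?g (x + s *\<^sub>R z) * indicator {0..t} s \<partial>lborel)"
        by (rule test_ray_bound[OF \<Omega> \<phi> t])
      also have "\<dots> \<le> (\<integral>\<^sup>+s. ?c * (indicator {0<..t} s * ?g (x + s *\<^sub>R z) * indicator unit_box z) \<partial>lborel)"
      proof (rule nn_integral_mono_AE)
        \<comment> \<open>The null set {0} is dropped to pass from the closed interval to the
          half-open one on which all weights below live.\<close>
        have "AE s in lborel. s \<noteq> (0::real)" by (rule AE_lborel_singleton)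
        moreover have "ennreal (norm z) \<le> ?c" using norm_unit_box(2)[OF True] by (intro ennreal_leI) simp
        ultimately show "AE s in lborel. ennreal (norm z) * ?g (x + s *\<^sub>R z) * indicator {0..t} s \<le>
            ?c * (indicator {0<..t} s * ?g (x + s *\<^sub>R z) * indicator unit_box z)"
          using True by (auto elim!: eventually_mono simp: indicator_def intro: mult_right_mono)
      qed
      finally show ?thesis using True by simp
    qed simp
  qed
  also have "\<dots> = (\<integral>\<^sup>+s. \<integral>\<^sup>+z. ?c * (indicator {0<..t} s * ?g (x + s *\<^sub>R z) * indicator unit_box z) \<partial>lborel
      \<partial>lborel)"
    by (rule lborel_pair.Fubini') measurable
  also have "\<dots> = ?c * ray_average (indicator {0<..t}) ?g x"
    unfolding ray_average_def by (simp add: nn_integral_cmult)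
  finally show ?thesis .
qed

text \<open>\<open>R\<close> exceeds every distance within \<Omega> and directions have norm at
  least 1, so each ray from \<open>x\<close> has left \<Omega> at parameter \<open>R\<close>, where
  \<phi> vanishes. Averaging over a cube of measure 1 leaves the left side unchanged.\<close>

lemma test_representation:
  fixes \<phi> :: "real^'n::finite \<Rightarrow> real"
  assumes \<Omega>: "open \<Omega>" and \<phi>: "\<phi> \<in> test_functions \<Omega>" and R: "\<And>x y. x \<in> \<Omega> \<Longrightarrow> y \<in> \<Omega> \<Longrightarrow> dist x y < R" "0 \<le> R"
    and x: "x \<in> \<Omega>"
  shows "ennreal \<bar>\<phi> x\<bar> \<le>
     ennreal (2 * real CARD('n)) * ray_average (indicator {0<..R}) (\<lambda>y. ennreal (norm (gradient \<phi> y))) x"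
proof -
  have z: "\<phi> (x + R *\<^sub>R z) = 0" if "z \<in> unit_box" for z
  proof -
    have "dist x (x + R *\<^sub>R z) \<ge> R" using norm_unit_box(1)[OF that] R(2) mult_left_mono[of 1 "norm z" R]
        by (simp add: dist_norm)
    then have "x + R *\<^sub>R z \<notin> \<Omega>" using R(1)[OF x] by fastforce
    then show ?thesis by (rule test_outside[OF \<phi>])
  qed
  have "ennreal \<bar>\<phi> x\<bar> = (\<integral>\<^sup>+z. ennreal \<bar>\<phi> x\<bar> * indicator (unit_box :: (real^'n) set) z \<partial>lborel)"
    by (simp add: nn_integral_cmult_indicator emeasure_unit_box)
  also have "\<dots> = (\<integral>\<^sup>+z. ennreal \<bar>\<phi> (x + R *\<^sub>R z) - \<phi> x\<bar> * indicator unit_box z \<partial>lborel)"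
    by (intro nn_integral_cong) (auto simp: indicator_def z)
  also have "\<dots> \<le> ennreal (2 * real CARD('n)) * ray_average (indicator {0<..R}) (\<lambda>y. ennreal (norm
      (gradient \<phi> y))) x"
    by (rule test_average_ray_bound[OF \<Omega> \<phi> R(2)])
  finally show ?thesis .
qed

section \<open>A Sobolev inequality for variable exponents\<close>

text \<open>With \<open>\<theta> = max (1 / r) (1 / \<sigma>)\<close>, the left side is at most
  \<open>G powr (1/\<sigma>) * X powr (1/\<sigma>) * Y powr (\<theta> - 1/\<sigma>) * Z powr (1 - \<theta>)\<close> for the three
  summands \<open>X\<close>, \<open>Y\<close>, \<open>Z\<close> of the right side; this is where subcriticality enters.\<close>
lemma subcritical_split:
  fixes s e \<Gamma> G r \<sigma> N :: real
  assumes s: "0 < s" "s \<le> 1" and e: "0 < e" "e < 1" and \<Gamma>: "1 \<le> \<Gamma>" and G: "1 \<le> G"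
    and r: "1 \<le> r" and \<sigma>: "1 \<le> \<sigma>" and N: "0 \<le> N" and sub: "N * (1 / r - 1 / \<sigma>) \<le> 1 - e"
  shows "\<Gamma> powr (1 / r) \<le> G powr (1 / \<sigma>) * (s powr (e - 1) * \<Gamma> / G + s powr (N + e - 1) * \<Gamma> + s powr (e - 1))"
proof -
  define X where "X = s powr (e - 1) * \<Gamma> / G"
  define Y where "Y = s powr (N + e - 1) * \<Gamma>"
  define Z where "Z = s powr (e - 1)"
  define \<alpha> where "\<alpha> = 1 / \<sigma>"
  \<comment> \<open>The maximum serves two ends: \<theta> at least 1 / r lets the power of \<Gamma>
    be raised from 1 / r to \<theta>, and \<theta> at least \<alpha> keeps the exponent \<beta>
    nonnegative.\<close>
  define \<theta> where "\<theta> = max (1 / r) \<alpha>"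
  define \<beta> where "\<beta> = \<theta> - \<alpha>"
  define \<gamma> where "\<gamma> = 1 - \<theta>"
  have pos: "X > 0" "Y > 0" "Z > 0" using s \<Gamma> G by (auto simp: X_def Y_def Z_def)
  have nn: "0 \<le> \<alpha>" "0 \<le> \<beta>" "0 \<le> \<gamma>" using r \<sigma> by (auto simp: \<alpha>_def \<beta>_def \<gamma>_def \<theta>_def)
  have lnX: "ln X = (e - 1) * ln s + ln \<Gamma> - ln G" using s \<Gamma> G by (simp add: X_def ln_div ln_mult ln_powr)
  have lnY: "ln Y = (N + e - 1) * ln s + ln \<Gamma>" using s \<Gamma> by (simp add: Y_def ln_mult ln_powr)
  have lnZ: "ln Z = (e - 1) * ln s" using s by (simp add: Z_def ln_powr)
  have N\<beta>: "N * \<beta> \<le> 1 - e" using sub e by (auto simp: \<beta>_def \<theta>_def \<alpha>_def max_def)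
  have "\<Gamma> powr (1 / r) \<le> \<Gamma> powr \<theta>" using \<Gamma> by (intro powr_mono) (auto simp: \<theta>_def)
  also have "\<dots> \<le> G powr \<alpha> * (X powr \<alpha> * Y powr \<beta> * Z powr \<gamma>)"
  proof -
    \<comment> \<open>The powers of \<open>s\<close> in the product collect to the exponent e - 1 +
      N \<beta>, which subcriticality makes nonpositive. As s is at most 1, they can only increase
      the product.\<close>
    have "ln s * (e - 1 + N * \<beta>) \<ge> 0" using s N\<beta> by (intro mult_nonpos_nonpos) auto
    moreover have "\<alpha> * ln G + (\<alpha> * ln X + \<beta> * ln Y + \<gamma> * ln Z) = \<theta> * ln \<Gamma> + ln s * (e - 1 + N * \<beta>)"
      unfolding lnX lnY lnZ \<gamma>_def \<beta>_def by (simp add: algebra_simps)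
    ultimately have "\<theta> * ln \<Gamma> \<le> \<alpha> * ln G + (\<alpha> * ln X + \<beta> * ln Y + \<gamma> * ln Z)" by simp
    then have "exp (\<theta> * ln \<Gamma>) \<le> exp (\<alpha> * ln G + (\<alpha> * ln X + \<beta> * ln Y + \<gamma> * ln Z))" by simp
    then show ?thesis using pos \<Gamma> G by (simp add: powr_def exp_add)
  qed
  also have "\<dots> \<le> G powr \<alpha> * (X + Y + Z)"
  proof (rule mult_left_mono)
    \<comment> \<open>The exponents are nonnegative and sum to 1, so the product is at most the sum:
      a crude weighted mean inequality.\<close>
    have "X powr \<alpha> * Y powr \<beta> * Z powr \<gamma> \<le> (X + Y + Z) powr \<alpha> * (X + Y + Z) powr \<beta> * (X + Y + Z) powr \<gamma>"
      using pos nn by (intro mult_mono powr_mono2) auto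
    also have "\<dots> = (X + Y + Z) powr 1" by (simp add: powr_add[symmetric] \<beta>_def \<gamma>_def)
    also have "\<dots> = X + Y + Z" using pos by (simp add: powr_one)
    finally show "X powr \<alpha> * Y powr \<beta> * Z powr \<gamma> \<le> X + Y + Z" .
  qed simp
  finally show ?thesis by (simp add: X_def Y_def Z_def \<alpha>_def)
qed

text \<open>A Hedberg-type argument. Let \<Gamma> be |grad \<phi>|^p cut off where the gradient is
  below 1, \<open>A x\<close> its ray average for the weight s^(e-1), and G = 1 + A x. The bound of
  \<open>subcritical_split\<close> is integrated over the rays from \<open>x\<close>. Its three
  summands stay bounded: the first by A x / G, the second by \<open>ray_average_le\<close>, the
  third because s^(e-1) is integrable near 0. Hence |\<phi> x| is at most C G^(1/q x), and the power
  q x turns this into an integrable multiple of 1 + A x.\<close>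

lemma sobolev_test:
  fixes \<Omega> :: "(real^'n::finite) set" and p q :: "real^'n \<Rightarrow> real"
  assumes \<Omega>: "open \<Omega>" "bounded \<Omega>"
    and p: "continuous_on \<Omega> p" "\<And>x. x \<in> \<Omega> \<Longrightarrow> 1 \<le> p x"
    and q: "\<And>x. x \<in> \<Omega> \<Longrightarrow> 1 \<le> q x \<and> q x \<le> P"
    and e: "0 < e" "e < 1" and \<delta>: "0 < \<delta>"
    and sub: "\<And>x y. x \<in> \<Omega> \<Longrightarrow> y \<in> \<Omega> \<Longrightarrow> dist x y \<le> \<delta> \<Longrightarrow> real CARD('n) * (1 / p y - 1 / q x) \<le> 1 - e"
  shows "\<exists>C\<ge>0. \<forall>\<phi>\<in>test_functions \<Omega>.
    (\<integral>\<^sup>+x. ennreal (norm (gradient \<phi> x) powr p x) \<partial>lebesgue_on \<Omega>) \<le> 1 \<longrightarrow>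
    (\<integral>\<^sup>+x. ennreal (\<bar>\<phi> x\<bar> powr q x) \<partial>lebesgue_on \<Omega>) \<le> ennreal C"
proof -
  define N where "N = real CARD('n)"
  have N: "1 \<le> N" by (simp add: N_def Suc_leI)
  obtain r where r: "\<And>x. x \<in> \<Omega> \<Longrightarrow> norm x \<le> r" using \<Omega>(2) by (auto simp: bounded_iff)
  define R where "R = 2 * \<bar>r\<bar> + 1"
  have R: "dist x y < R" if "x \<in> \<Omega>" "y \<in> \<Omega>" for x y
    using r[OF that(1)] r[OF that(2)] norm_triangle_ineq4[of x y] by (simp add: R_def dist_norm)
  have R0: "0 \<le> R" by (simp add: R_def)
  \<comment> \<open>Directions have norm at most 2 N, so a point x + s z further than \<delta> from
    \<open>x\<close>, or a parameter above 1, forces s to be at least \<open>s0\<close>.\<close>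
  define s0 where "s0 = min 1 (\<delta> / (2 * N))"
  have s0: "0 < s0" "s0 \<le> 1" using \<delta> N by (auto simp: s0_def)
  \<comment> \<open>Makes C0 s^(N+e-1) at least 1 for s at least \<open>s0\<close>, so that far from
    \<open>x\<close> the crude bound of \<Gamma>^(1/p) by \<Gamma> is absorbed by the second
    summand.\<close>
  define C0 where "C0 = s0 powr - (N + e - 1)"
  have C0: "1 \<le> C0" using s0 N e powr_mono2'[of "- (N + e - 1)" s0 1] by (simp add: C0_def)
  define w1 where "w1 s = ennreal (s powr (e - 1)) * indicator {0<..R} s" for s
  define w2 where "w2 s = ennreal (s powr (N + e - 1)) * indicator {0<..R} s" for s
  have [measurable]: "w1 \<in> borel_measurable borel" "w2 \<in> borel_measurable borel"
    unfolding w1_def [abs_def] w2_def [abs_def] by measurable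
  define \<kappa> where "\<kappa> = R powr e / e"
  have \<kappa>0: "0 \<le> \<kappa>" using e by (simp add: \<kappa>_def)
  have \<kappa>: "(\<integral>\<^sup>+s. w1 s \<partial>lborel) \<le> ennreal \<kappa>"
  proof -
    have "(\<integral>\<^sup>+s. w1 s \<partial>lborel) \<le> (\<integral>\<^sup>+s. ennreal (s powr (e - 1)) * indicator {0..R} s \<partial>lborel)"
      by (intro nn_integral_mono) (auto simp: w1_def indicator_def)
    also have "\<dots> = ennreal \<kappa>"
      using has_integral_powr_from_0[of "e - 1" R] e R0
      by (intro nn_integral_has_integral_lebesgue') (auto simp: \<kappa>_def)
    finally show ?thesis .
  qed
  \<comment> \<open>The additional s^N in \<open>w2\<close> cancels the Jacobian s^(-N) of
    \<open>ray_average_le\<close>.\<close>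
  have w2: "w2 s * ennreal (s powr - N) = w1 s" for s
    by (auto simp: w1_def w2_def indicator_def ennreal_mult[symmetric] powr_add[symmetric])
  define V where "V = measure lborel \<Omega>"
  have V: "emeasure lborel \<Omega> = ennreal V"
    using emeasure_bounded_finite[OF \<Omega>(2)] by (simp add: V_def emeasure_eq_ennreal_measure)
  define C where "C = 2 * N * (R + C0 * (1 + 2 * \<kappa>))"
  have C: "0 \<le> C" using N R0 C0 \<kappa>0 by (simp add: C_def)
  define C' where "C' = (1 + C) powr P * (V + \<kappa>)"
  show ?thesis
  proof (intro exI[of _ C'] conjI ballI impI)
    show "0 \<le> C'" using \<kappa>0 by (simp add: C'_def V_def)
    fix \<phi> assume \<phi>: "\<phi> \<in> test_functions \<Omega>"
    assume one: "(\<integral>\<^sup>+x. ennreal (norm (gradient \<phi> x) powr p x) \<partial>lebesgue_on \<Omega>) \<le> 1"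
    define g where "g y = norm (gradient \<phi> y)" for y
    have gm [measurable]: "g \<in> borel_measurable borel"
      unfolding g_def [abs_def] using gradient_borel[OF \<Omega>(1) \<phi>] by measurable
    \<comment> \<open>Continuity of \<open>p\<close> is known on \<Omega> only; extension by 0 makes
      it Borel measurable on the whole space.\<close>
    define p' where "p' y = indicator \<Omega> y *\<^sub>R p y" for y
    have [measurable]: "p' \<in> borel_measurable borel"
      unfolding p'_def [abs_def] using \<Omega>(1) p(1) by (intro borel_measurable_continuous_on_indicator) auto
    have [measurable]: "\<Omega> \<in> sets borel" using \<Omega>(1) by simp
    \<comment> \<open>Where the gradient is below 1, the summand 1 in \<open>point\<close> suffices;
      elsewhere \<Gamma> is at least 1, as \<open>subcritical_split\<close> demands.\<close>
    define \<Gamma> where "\<Gamma> y = (if y \<in> \<Omega> \<and> 1 \<le> g y then g y powr p' y else 0)" for y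
    have [measurable]: "\<Gamma> \<in> borel_measurable borel" unfolding \<Gamma>_def [abs_def] by measurable
    have \<Gamma>0: "0 \<le> \<Gamma> y" for y by (simp add: \<Gamma>_def)
    have \<Gamma>1: "(\<integral>\<^sup>+y. ennreal (\<Gamma> y) \<partial>lborel) \<le> 1"
    proof -
      have "(\<integral>\<^sup>+y. ennreal (\<Gamma> y) \<partial>lborel) \<le>
          (\<integral>\<^sup>+y. ennreal (norm (gradient \<phi> y) powr p y) * indicator \<Omega> y \<partial>lborel)"
        by (intro nn_integral_mono) (auto simp: \<Gamma>_def g_def p'_def indicator_def)
      also have "\<dots> \<le> 1" using one by (simp add: nn_integral_lebesgue_on)
      finally show ?thesis .
    qed
    define A where "A = ray_average w1 (\<lambda>y. ennreal (\<Gamma> y))"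
    have [measurable]: "A \<in> borel_measurable borel" unfolding A_def by measurable
    have A\<kappa>: "(\<integral>\<^sup>+x. A x \<partial>lborel) \<le> ennreal \<kappa>"
    proof -
      have "(\<integral>\<^sup>+x. A x \<partial>lborel) = (\<integral>\<^sup>+s. w1 s \<partial>lborel) * (\<integral>\<^sup>+y. ennreal (\<Gamma> y) \<partial>lborel)"
        unfolding A_def by (rule nn_integral_ray_average) measurable
      also have "\<dots> \<le> ennreal \<kappa> * 1" using \<kappa> \<Gamma>1 by (intro mult_mono) auto
      finally show ?thesis by simp
    qed
    have B: "ray_average w2 (\<lambda>y. ennreal (\<Gamma> y)) x \<le> ennreal \<kappa>" for x
    proof -
      have "ray_average w2 (\<lambda>y. ennreal (\<Gamma> y)) x \<le>
          (\<integral>\<^sup>+s. w2 s * ennreal (s powr - real DIM(real^'n)) \<partial>lborel) * (\<integral>\<^sup>+y. ennreal (\<Gamma> y) \<partial>lborel)"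
        by (rule ray_average_le) (measurable, auto simp: w2_def)
      also have "\<dots> = (\<integral>\<^sup>+s. w1 s \<partial>lborel) * (\<integral>\<^sup>+y. ennreal (\<Gamma> y) \<partial>lborel)"
        using w2 by (simp add: N_def)
      also have "\<dots> \<le> ennreal \<kappa> * 1" using \<kappa> \<Gamma>1 by (intro mult_mono) auto
      finally show ?thesis by simp
    qed
    have point: "g (x + s *\<^sub>R z) \<le> 1 + C0 * G powr (1 / q x) *
        (s powr (e - 1) * \<Gamma> (x + s *\<^sub>R z) / G + s powr (N + e - 1) * \<Gamma> (x + s *\<^sub>R z) + s powr (e - 1))"
      if x: "x \<in> \<Omega>" and s: "0 < s" and z: "z \<in> unit_box" and G: "1 \<le> G" for x s z G
    proof -
      define y where "y = x + s *\<^sub>R z"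
      let ?rhs = "s powr (e - 1) * \<Gamma> y / G + s powr (N + e - 1) * \<Gamma> y + s powr (e - 1)"
      have rhs0: "0 \<le> G powr (1 / q x) * ?rhs" using \<Gamma>0[of y] G
          by (intro mult_nonneg_nonneg add_nonneg_nonneg) auto
      have K0: "0 \<le> C0 * G powr (1 / q x) * ?rhs" using mult_nonneg_nonneg[OF _ rhs0, of C0] C0
          by (simp add: mult.assoc)
      have "g y \<le> 1 + C0 * G powr (1 / q x) * ?rhs"
      proof (cases "y \<in> \<Omega> \<and> 1 \<le> g y")
        case False
        then have "g y \<le> 1" using gradient_outside[OF \<Omega>(1) \<phi>, of y] by (auto simp: g_def)
        with K0 show ?thesis by simp
      next
        case True
        then have \<Gamma>y: "\<Gamma> y = g y powr p y" by (simp add: \<Gamma>_def p'_def)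
        have py: "1 \<le> p y" using p(2) True by blast
        have ge: "1 \<le> \<Gamma> y" unfolding \<Gamma>y using True py by (simp add: ge_one_powr_ge_zero)
        have gy: "g y = \<Gamma> y powr (1 / p y)" unfolding \<Gamma>y using True py by (simp add: powr_powr)
        have qx: "1 \<le> q x" using q x by blast
        have "\<Gamma> y powr (1 / p y) \<le> C0 * (G powr (1 / q x) * ?rhs)"
        proof (cases "dist x y \<le> \<delta> \<and> s \<le> 1")
          case near: True
          have "\<Gamma> y powr (1 / p y) \<le> G powr (1 / q x) * ?rhs"
            by (rule subcritical_split) (use s near e ge G py qx N sub[of x y] x True N_def in auto)
          also have "\<dots> \<le> C0 * (G powr (1 / q x) * ?rhs)" using mult_right_mono[OF C0 rhs0] by simp
          finally show ?thesis .
        next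
          case far: False
          have "s0 \<le> s"
          proof (cases "s \<le> 1")
            case True
            then have "\<delta> < dist x y" using far by simp
            also have "\<dots> = s * norm z" using s by (simp add: y_def dist_norm)
            also have "\<dots> \<le> s * (2 * N)" using norm_unit_box(2)[OF z] s
                by (intro mult_left_mono) (auto simp: N_def)
            finally have "\<delta> / (2 * N) < s" using N by (simp add: divide_less_eq)
            then show ?thesis by (simp add: s0_def)
          qed (auto simp: s0_def)
          then have "s0 powr (N + e - 1) \<le> s powr (N + e - 1)" using s0 N e by (intro powr_mono2) auto
          then have "C0 * s0 powr (N + e - 1) \<le> C0 * s powr (N + e - 1)" using C0 by (intro mult_left_mono) auto
          then have c1: "1 \<le> C0 * s powr (N + e - 1)" using s0 by (simp add: C0_def powr_add[symmetric])
          have "\<Gamma> y powr (1 / p y) \<le> \<Gamma> y powr 1" using ge py by (intro powr_mono) auto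
          also have "\<dots> \<le> (C0 * s powr (N + e - 1)) * \<Gamma> y" using c1 ge mult_right_mono[OF c1, of "\<Gamma> y"] by simp
          also have "\<dots> \<le> C0 * (1 * ?rhs)" using C0 ge G by (simp add: mult.assoc)
          also have "\<dots> \<le> C0 * (G powr (1 / q x) * ?rhs)"
            using C0 G ge qx by (intro mult_left_mono mult_right_mono) (auto simp: ge_one_powr_ge_zero)
          finally show ?thesis .
        qed
        then show ?thesis using gy by (simp add: mult.assoc)
      qed
      then show ?thesis by (simp add: y_def)
    qed
    have bound: "ennreal (\<bar>\<phi> x\<bar> powr q x) \<le> ennreal ((1 + C) powr P) * (1 + A x)"
      if x: "x \<in> \<Omega>" and fin: "A x < \<infinity>" for x
    proof -
      define a where "a = enn2real (A x)"
      have a: "0 \<le> a" "A x = ennreal a" using fin by (auto simp: a_def)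
      \<comment> \<open>This \<open>G\<close> depends on \<open>x\<close>. It keeps K / G * a below
        \<open>K\<close>, and its power 1 / q x returns to 1 + A x when the estimate is raised to
        the power q x.\<close>
      define G where "G = 1 + a"
      have G: "1 \<le> G" using a by (simp add: G_def)
      have qx: "1 \<le> q x" "q x \<le> P" using q x by auto
      define K where "K = C0 * G powr (1 / q x)"
      have K: "0 \<le> K" using C0 by (simp add: K_def)
      have G1: "1 \<le> G powr (1 / q x)" using G qx by (simp add: ge_one_powr_ge_zero)
      have "ray_average (indicator {0<..R}) (\<lambda>y. ennreal (g y)) x \<le>
          (\<integral>\<^sup>+s. \<integral>\<^sup>+z. (indicator {0<..R} s * 1 * indicator unit_box z + ennreal (K / G) * (w1 s * ennreal
              (\<Gamma> (x + s *\<^sub>R z)) * indicator unit_box z))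
             + (ennreal K * (w2 s * ennreal (\<Gamma> (x + s *\<^sub>R z)) * indicator unit_box z) + ennreal K * (w1 s *
                 1 * indicator unit_box z)) \<partial>lborel \<partial>lborel)"
        unfolding ray_average_def
      proof (intro nn_integral_mono)
        fix s :: real and z :: "real^'n"
        let ?y = "x + s *\<^sub>R z"
        show "indicator {0<..R} s * ennreal (g ?y) * indicator unit_box z \<le>
          (indicator {0<..R} s * 1 * indicator unit_box z + ennreal (K / G) * (w1 s * ennreal (\<Gamma> ?y) *
              indicator unit_box z))
             + (ennreal K * (w2 s * ennreal (\<Gamma> ?y) * indicator unit_box z) + ennreal K * (w1 s * 1 *
                 indicator unit_box z))"
        proof (cases "s \<in> {0<..R} \<and> z \<in> unit_box")
          case True
          then have "g ?y \<le> 1 + K * (s powr (e - 1) * \<Gamma> ?y / G + s powr (N + e - 1) * \<Gamma> ?y + s powr (e - 1))"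
            using point[OF x _ _ G, of s z] by (simp add: K_def)
          also have "\<dots> = (1 + (K / G) * (s powr (e - 1) * \<Gamma> ?y)) + (K * (s powr
              (N + e - 1) * \<Gamma> ?y) + K * s powr (e - 1))"
            by (simp add: algebra_simps)
          finally have "ennreal (g ?y) \<le> ennreal ((1 + (K / G) * (s powr (e - 1) * \<Gamma> ?y)) + (K * (s powr
              (N + e - 1) * \<Gamma> ?y) + K * s powr (e - 1)))"
            by (rule ennreal_leI)
          also have "\<dots> = (1 + ennreal (K / G) * (ennreal (s powr (e - 1)) * ennreal (\<Gamma> ?y))) +
              (ennreal K * (ennreal (s powr (N + e - 1)) * ennreal (\<Gamma> ?y)) + ennreal K * ennreal (s powr (e
                  - 1)))"
            using K G \<Gamma>0[of ?y] by (simp add: ennreal_plus[symmetric] ennreal_mult[symmetric] del: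
                ennreal_plus ennreal_1 add: ennreal_1[symmetric])
          finally show ?thesis using True by (simp add: w1_def w2_def)
        qed auto
      qed
      also have "\<dots> = (ray_average (indicator {0<..R}) (\<lambda>_. 1) x + ennreal (K / G) * ray_average w1
          (\<lambda>y. ennreal (\<Gamma> y)) x) +
          (ennreal K * ray_average w2 (\<lambda>y. ennreal (\<Gamma> y)) x + ennreal K * ray_average w1 (\<lambda>_. 1) x)"
        unfolding ray_average_def by (simp add: nn_integral_add nn_integral_cmult)
      also have "\<dots> \<le> (ennreal R + ennreal (K / G) * ennreal a) +
          (ennreal K * ennreal \<kappa> + ennreal K * ennreal \<kappa>)"
      proof -
        have 1: "ray_average w (\<lambda>_. 1) x = (\<integral>\<^sup>+s. w s \<partial>lborel)" if "w \<in> borel_measurable borel" for w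
          using that by (simp add: ray_average_def nn_integral_cmult_indicator emeasure_unit_box)
        have "ray_average (indicator {0<..R}) (\<lambda>_. 1) x = ennreal R" using R0 by (subst 1) auto
        moreover have "ray_average w1 (\<lambda>_. 1) x \<le> ennreal \<kappa>" using \<kappa> by (subst 1) auto
        ultimately show ?thesis using a(2) B[of x] by (intro add_mono mult_left_mono) (auto simp: A_def)
      qed
      also have "\<dots> = ennreal (R + K / G * a + (K * \<kappa> + K * \<kappa>))"
        using R0 K G a \<kappa>0 by (simp add: ennreal_plus[symmetric] ennreal_mult[symmetric] del: ennreal_plus)
      also have "\<dots> \<le> ennreal ((R + C0 * (1 + 2 * \<kappa>)) * G powr (1 / q x))"
      proof (rule ennreal_leI)
        have "K / G * a \<le> K" using K G a by (simp add: G_def divide_le_eq mult_left_mono)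
        moreover have "R \<le> R * G powr (1 / q x)" using mult_left_mono[OF G1 R0] by simp
        ultimately show "R + K / G * a + (K * \<kappa> + K * \<kappa>) \<le> (R + C0 * (1 + 2 * \<kappa>)) * G powr (1 / q x)"
          by (simp add: K_def algebra_simps)
      qed
      finally have ra: "ray_average (indicator {0<..R}) (\<lambda>y. ennreal (g y)) x \<le>
          ennreal ((R + C0 * (1 + 2 * \<kappa>)) * G powr (1 / q x))" .
      have "ennreal \<bar>\<phi> x\<bar> \<le> ennreal (2 * N) * ray_average (indicator {0<..R}) (\<lambda>y. ennreal (g y)) x"
        using test_representation[OF \<Omega>(1) \<phi> R R0 x] by (simp add: g_def N_def)
      also have "\<dots> \<le> ennreal (2 * N) * ennreal ((R + C0 * (1 + 2 * \<kappa>)) * G powr (1 / q x))"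
        by (rule mult_left_mono[OF ra]) simp
      also have "\<dots> = ennreal (C * G powr (1 / q x))"
        using N R0 C0 \<kappa>0 by (simp add: ennreal_mult[symmetric] C_def mult.assoc)
      finally have "\<bar>\<phi> x\<bar> \<le> C * G powr (1 / q x)" using C by (simp add: ennreal_le_iff)
      then have "\<bar>\<phi> x\<bar> powr q x \<le> (C * G powr (1 / q x)) powr q x" using qx by (intro powr_mono2) auto
      also have "\<dots> = C powr q x * G" using C G qx by (simp add: powr_mult powr_powr)
      also have "\<dots> \<le> (1 + C) powr P * G"
      proof (rule mult_right_mono)
        have "C powr q x \<le> (1 + C) powr q x" using C qx by (intro powr_mono2) auto
        also have "\<dots> \<le> (1 + C) powr P" using C qx by (intro powr_mono) auto
        finally show "C powr q x \<le> (1 + C) powr P" .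
      qed (use G in simp)
      finally have "ennreal (\<bar>\<phi> x\<bar> powr q x) \<le> ennreal ((1 + C) powr P * G)" by (rule ennreal_leI)
      also have "\<dots> = ennreal ((1 + C) powr P) * (1 + A x)"
        using a G by (simp add: ennreal_mult G_def ennreal_plus del: ennreal_1 add: ennreal_1[symmetric])
      finally show ?thesis .
    qed
    have "AE x in lborel. A x \<noteq> \<infinity>"
      using A\<kappa> by (intro nn_integral_PInf_AE) (auto simp: top_unique)
    then have "(\<integral>\<^sup>+x. ennreal (\<bar>\<phi> x\<bar> powr q x) * indicator \<Omega> x \<partial>lborel) \<le>
        (\<integral>\<^sup>+x. ennreal ((1 + C) powr P) * (indicator \<Omega> x + A x) \<partial>lborel)"
    proof (intro nn_integral_mono_AE, elim eventually_mono)
      fix x assume "A x \<noteq> \<infinity>"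
      then show "ennreal (\<bar>\<phi> x\<bar> powr q x) * indicator \<Omega> x \<le> ennreal ((1 + C) powr P) * (indicator \<Omega> x + A x)"
        using bound[of x] by (cases "x \<in> \<Omega>") (auto simp: less_top)
    qed
    also have "\<dots> = ennreal ((1 + C) powr P) * (ennreal V + (\<integral>\<^sup>+x. A x \<partial>lborel))"
      using V by (simp add: nn_integral_cmult nn_integral_add)
    also have "\<dots> \<le> ennreal ((1 + C) powr P) * (ennreal V + ennreal \<kappa>)"
      using A\<kappa> by (intro mult_left_mono add_left_mono) auto
    also have "\<dots> = ennreal C'"
      using \<kappa>0 by (simp add: C'_def V_def ennreal_mult ennreal_plus)
    finally show "(\<integral>\<^sup>+x. ennreal (\<bar>\<phi> x\<bar> powr q x) \<partial>lebesgue_on \<Omega>) \<le> ennreal C'"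
      by (simp add: nn_integral_lebesgue_on)
  qed
qed

section \<open>Compactness of test functions with bounded gradients\<close>

text \<open>Plays the part of convolution with a mollifier. The cube lies off the origin so that the
  approximation error is governed by the ray bound for test functions.\<close>

definition box_average :: "real \<Rightarrow> ('a::euclidean_space \<Rightarrow> real) \<Rightarrow> 'a \<Rightarrow> real" where
  "box_average \<delta> \<phi> x = (LINT z|lborel. indicator unit_box z *\<^sub>R \<phi> (x + \<delta> *\<^sub>R z))"

lemma test_shift_integrable:
  fixes \<phi> :: "real^'n::finite \<Rightarrow> real"
  assumes \<Omega>: "open \<Omega>" and \<phi>: "\<phi> \<in> test_functions \<Omega>"
  shows "integrable lborel (\<lambda>z. indicator unit_box z *\<^sub>R \<phi> (x + \<delta> *\<^sub>R z))"
proof -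
  have "continuous_on S (\<lambda>z. \<phi> (x + \<delta> *\<^sub>R z))" for S
    by (rule continuous_on_compose2[OF test_continuous[OF \<phi>]]) (auto intro!: continuous_intros)
  then show ?thesis by (intro borel_integrable_compact) (auto simp: unit_box_def)
qed

text \<open>Integrating the ray bound over \<open>x\<close> turns the weight
  \<open>indicator {0<..\<delta>}\<close> into the factor \<delta>, with the L1 norm of the gradient
  as the only other quantity.\<close>

lemma box_average_error:
  fixes \<phi> :: "real^'n::finite \<Rightarrow> real"
  assumes \<Omega>: "open \<Omega>" and \<phi>: "\<phi> \<in> test_functions \<Omega>" and \<delta>: "0 \<le> \<delta>"
  shows "(\<integral>\<^sup>+x. ennreal \<bar>\<phi> x - box_average \<delta> \<phi> x\<bar> \<partial>lborel) \<le>
    ennreal (2 * real CARD('n)) * (ennreal \<delta> * (\<integral>\<^sup>+x. ennreal (norm (gradient \<phi> x)) \<partial>lborel))"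
proof -
  note [measurable] = gradient_borel[OF \<Omega> \<phi>] test_borel[OF \<phi>]
  have "ennreal \<bar>\<phi> x - box_average \<delta> \<phi> x\<bar> \<le>
     ennreal (2 * real CARD('n)) * ray_average (indicator {0<..\<delta>}) (\<lambda>y. ennreal (norm (gradient \<phi> y))) x" for x
  proof -
    have i1: "integrable lborel (\<lambda>z::real^'n. indicator unit_box z *\<^sub>R \<phi> x)"
      by (intro integrable_real_indicator integrable_scaleR_left) (auto simp: emeasure_unit_box)
    note i2 = test_shift_integrable[OF \<Omega> \<phi>, of x \<delta>]
    have "(LINT z|lborel. indicator (unit_box :: (real^'n) set) z *\<^sub>R \<phi> x) = \<phi> x"
      by (simp add: measure_def emeasure_unit_box)
    then have "box_average \<delta> \<phi> x - \<phi> x = (LINT z|lborel. indicator unit_box z *\<^sub>R \<phi>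
        (x + \<delta> *\<^sub>R z) - indicator unit_box z *\<^sub>R \<phi> x)"
      using i1 i2 by (simp add: box_average_def)
    then have "ennreal \<bar>\<phi> x - box_average \<delta> \<phi> x\<bar> =
        ennreal (norm (LINT z|lborel. indicator unit_box z *\<^sub>R \<phi> (x + \<delta> *\<^sub>R z) - indicator unit_box z *\<^sub>R \<phi> x))"
      by (metis abs_minus_commute real_norm_def)
    also have "\<dots> \<le> (\<integral>\<^sup>+z. ennreal (norm (indicator unit_box z *\<^sub>R \<phi>
        (x + \<delta> *\<^sub>R z) - indicator unit_box z *\<^sub>R \<phi> x)) \<partial>lborel)"
      using i1 i2 by (intro integral_norm_bound_ennreal Bochner_Integration.integrable_diff)
    also have "\<dots> = (\<integral>\<^sup>+z. ennreal \<bar>\<phi> (x + \<delta> *\<^sub>R z) - \<phi> x\<bar> * indicator unit_box z \<partial>lborel)"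
      by (intro nn_integral_cong) (auto simp: indicator_def)
    also have "\<dots> \<le> ennreal (2 * real CARD('n)) * ray_average (indicator {0<..\<delta>}) (\<lambda>y. ennreal (norm
        (gradient \<phi> y))) x"
      by (rule test_average_ray_bound[OF \<Omega> \<phi> \<delta>])
    finally show ?thesis .
  qed
  then have "(\<integral>\<^sup>+x. ennreal \<bar>\<phi> x - box_average \<delta> \<phi> x\<bar> \<partial>lborel) \<le>
     (\<integral>\<^sup>+x. ennreal (2 * real CARD('n)) * ray_average (indicator {0<..\<delta>}) (\<lambda>y. ennreal (norm (gradient \<phi>
         y))) x \<partial>lborel)"
    by (intro nn_integral_mono)
  also have "\<dots> = ennreal (2 * real CARD('n)) * (ennreal \<delta> * (\<integral>\<^sup>+x. ennreal (norm (gradient \<phi> x)) \<partial>lborel))"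
    using \<delta> by (simp add: nn_integral_cmult nn_integral_ray_average)
  finally show ?thesis .
qed

text \<open>Joining the two points by a segment and integrating over the cube leaves, after scaling
  by \<delta>, only the L1 norm of the gradient. At a fixed scale the averages are equi-Lipschitz
  although the functions themselves are not.\<close>

lemma box_average_lipschitz:
  fixes \<phi> :: "real^'n::finite \<Rightarrow> real"
  assumes \<Omega>: "open \<Omega>" and \<phi>: "\<phi> \<in> test_functions \<Omega>" and \<delta>: "0 < \<delta>"
    and M: "(\<integral>\<^sup>+x. ennreal (norm (gradient \<phi> x)) \<partial>lborel) \<le> ennreal M" "0 \<le> M"
  shows "\<bar>box_average \<delta> \<phi> x - box_average \<delta> \<phi> y\<bar> \<le> norm (x - y) * (\<delta> powr - real CARD('n) * M)"
proof -
  note [measurable] = gradient_borel[OF \<Omega> \<phi>] test_borel[OF \<phi>]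
  note i = test_shift_integrable[OF \<Omega> \<phi>]
  let ?g = "\<lambda>y. ennreal (norm (gradient \<phi> y))"
  have sc: "(\<integral>\<^sup>+z. ?g (w + \<delta> *\<^sub>R z) \<partial>lborel) = ennreal (\<delta> powr - real CARD('n)) * (\<integral>\<^sup>+x. ?g x \<partial>lborel)" for w
    using nn_integral_lborel_scale[of ?g \<delta> w] \<delta> by simp
  have "ennreal \<bar>box_average \<delta> \<phi> x - box_average \<delta> \<phi> y\<bar> =
      ennreal (norm (LINT z|lborel. indicator unit_box z *\<^sub>R \<phi> (x + \<delta> *\<^sub>R z) - indicator unit_box z *\<^sub>R \<phi> (y
          + \<delta> *\<^sub>R z)))"
    using i by (simp add: box_average_def)
  also have "\<dots> \<le> (\<integral>\<^sup>+z. ennreal (norm (indicator unit_box z *\<^sub>R \<phi> (x + \<delta> *\<^sub>R z) - indicator unit_box z *\<^sub>R \<phi>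
      (y + \<delta> *\<^sub>R z))) \<partial>lborel)"
    using i by (intro integral_norm_bound_ennreal Bochner_Integration.integrable_diff)
  also have "\<dots> \<le> (\<integral>\<^sup>+z. \<integral>\<^sup>+s. ennreal (norm (x - y)) * ?g ((y + s *\<^sub>R
      (x - y)) + \<delta> *\<^sub>R z) * indicator {0..1} s \<partial>lborel \<partial>lborel)"
  proof (rule nn_integral_mono)
    fix z
    have "ennreal (norm (indicator unit_box z *\<^sub>R \<phi> (x + \<delta> *\<^sub>R z) - indicator unit_box z *\<^sub>R \<phi> (y + \<delta> *\<^sub>R z))) \<le>
        ennreal \<bar>\<phi> ((y + \<delta> *\<^sub>R z) + 1 *\<^sub>R (x - y)) - \<phi> (y + \<delta> *\<^sub>R z)\<bar>"
      by (intro ennreal_leI) (auto simp: indicator_def algebra_simps)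
    also have "\<dots> \<le> (\<integral>\<^sup>+s. ennreal (norm (x - y)) * ?g ((y + \<delta> *\<^sub>R z) + s *\<^sub>R
        (x - y)) * indicator {0..1} s \<partial>lborel)"
      by (rule test_ray_bound[OF \<Omega> \<phi>]) simp
    finally show "ennreal (norm (indicator unit_box z *\<^sub>R \<phi> (x + \<delta> *\<^sub>R z) - indicator unit_box z *\<^sub>R \<phi>
        (y + \<delta> *\<^sub>R z))) \<le>
        (\<integral>\<^sup>+s. ennreal (norm (x - y)) * ?g ((y + s *\<^sub>R (x - y)) + \<delta> *\<^sub>R z) * indicator {0..1} s \<partial>lborel)"
      by (simp add: add.assoc add.commute[of "\<delta> *\<^sub>R z"])
  qed
  also have "\<dots> = (\<integral>\<^sup>+s. \<integral>\<^sup>+z. ennreal (norm (x - y)) * ?g ((y + s *\<^sub>R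
      (x - y)) + \<delta> *\<^sub>R z) * indicator {0..1} s \<partial>lborel \<partial>lborel)"
    by (rule lborel_pair.Fubini') measurable
  also have "\<dots> = (\<integral>\<^sup>+s. (ennreal (norm (x - y)) * (ennreal (\<delta> powr - real CARD('n)) *
      (\<integral>\<^sup>+x. ?g x \<partial>lborel))) * indicator {0..1::real} s \<partial>lborel)"
    by (simp add: nn_integral_multc nn_integral_cmult sc)
  also have "\<dots> = ennreal (norm (x - y)) * (ennreal (\<delta> powr - real CARD('n)) * (\<integral>\<^sup>+x. ?g x \<partial>lborel))"
    by (simp add: nn_integral_cmult_indicator)
  also have "\<dots> \<le> ennreal (norm (x - y)) * (ennreal (\<delta> powr - real CARD('n)) * ennreal M)"
    using M(1) by (intro mult_left_mono) auto
  also have "\<dots> = ennreal (norm (x - y) * (\<delta> powr - real CARD('n) * M))"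
    using M(2) by (simp add: ennreal_mult)
  finally show ?thesis using M(2) by (simp add: ennreal_le_iff)
qed

lemma box_average_continuous:
  fixes \<phi> :: "real^'n::finite \<Rightarrow> real"
  assumes \<Omega>: "open \<Omega>" and \<phi>: "\<phi> \<in> test_functions \<Omega>" and \<delta>: "0 < \<delta>"
    and M: "(\<integral>\<^sup>+x. ennreal (norm (gradient \<phi> x)) \<partial>lborel) \<le> ennreal M" "0 \<le> M"
  shows "continuous_on UNIV (box_average \<delta> \<phi>)"
proof -
  have "(\<delta> powr - real CARD('n) * M)-lipschitz_on UNIV (box_average \<delta> \<phi>)"
    using box_average_lipschitz[OF assms] M(2)
    by (intro lipschitz_onI) (auto simp: dist_norm mult.commute)
  then show ?thesis by (rule lipschitz_on_continuous_on)
qed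

text \<open>Arzela-Ascoli applies to the averages at a fixed scale, and each function is close to
  its average in L1 uniformly along the sequence. Half of \<open>e\<close> pays for two such errors,
  the other half for the uniform distance of the averages on \<Omega>.\<close>

lemma rellich_step:
  fixes \<phi> :: "nat \<Rightarrow> real^'n::finite \<Rightarrow> real"
  assumes \<Omega>: "open \<Omega>" "bounded \<Omega>" and \<phi>: "\<And>n. \<phi> n \<in> test_functions \<Omega>"
    and M: "\<And>n. (\<integral>\<^sup>+x. ennreal (norm (gradient (\<phi> n) x)) \<partial>lborel) \<le> ennreal M" "0 \<le> M" and e: "0 < e"
  shows "\<exists>r::nat\<Rightarrow>nat. strict_mono r \<and> (\<exists>N. \<forall>m\<ge>N. \<forall>n\<ge>N. (\<integral>\<^sup>+x. ennreal \<bar>\<phi> (r m) x - \<phi> (r n) x\<bar> \<partial>lborel) \<le>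
      ennreal e)"
proof -
  define N where "N = real CARD('n)"
  have N: "0 < N" by (simp add: N_def)
  \<comment> \<open>Turns the error 2 N \<delta> M of \<open>box_average_error\<close> into at most
    e / 4; the summand 1 covers M = 0.\<close>
  define \<delta> where "\<delta> = e / (8 * N * (M + 1))"
  have \<delta>: "0 < \<delta>" using e N M by (simp add: \<delta>_def)
  define L where "L = \<delta> powr - N * M"
  have L: "0 \<le> L" using M by (simp add: L_def)
  obtain r0 where r0: "\<And>x. x \<in> \<Omega> \<Longrightarrow> norm x \<le> r0" using \<Omega>(2) by (auto simp: bounded_iff)
  define R where "R = \<bar>r0\<bar>"
  have R: "\<And>x. x \<in> \<Omega> \<Longrightarrow> norm x \<le> R" using r0 by (force simp: R_def)
  let ?A = "\<lambda>n. box_average \<delta> (\<phi> n)"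
  have lip: "\<bar>?A n x - ?A n y\<bar> \<le> norm (x - y) * L" for n x y
    using box_average_lipschitz[OF \<Omega>(1) \<phi> \<delta> M] by (simp add: L_def N_def)
  \<comment> \<open>So far out that the shifted cube at \<open>x0\<close> misses \<Omega>. All
    averages vanish there, and the Lipschitz bound becomes a uniform bound on the ball.\<close>
  obtain x0 :: "real^'n" where x0: "norm x0 = R + 2 * N * \<delta> + 1"
    using vector_choose_size[of "R + 2 * N * \<delta> + 1"] N \<delta> by (auto simp: R_def)
  have A0: "?A n x0 = 0" for n
  proof -
    have "\<phi> n (x0 + \<delta> *\<^sub>R z) = 0" if "z \<in> unit_box" for z
    proof (rule test_outside[OF \<phi>])
      have "norm (\<delta> *\<^sub>R z) \<le> 2 * N * \<delta>" using norm_unit_box(2)[OF that] \<delta> by (simp add: N_def mult.commute)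
      then have "norm (x0 + \<delta> *\<^sub>R z) > R" using norm_diff_ineq[of x0 "\<delta> *\<^sub>R z"] x0 by simp
      then show "x0 + \<delta> *\<^sub>R z \<notin> \<Omega>" using R by fastforce
    qed
    then have "(\<lambda>z. indicator unit_box z *\<^sub>R \<phi> n (x0 + \<delta> *\<^sub>R z)) = (\<lambda>z. 0)" by (auto simp: indicator_def)
    then show ?thesis by (simp add: box_average_def)
  qed
  obtain g k where k: "strict_mono (k :: nat \<Rightarrow> nat)" and
    unif: "\<And>e. 0 < e \<Longrightarrow> \<exists>N. \<forall>n x. n \<ge> N \<and> x \<in> cball 0 R \<longrightarrow> norm (?A (k n) x - g x) < e"
  proof (rule Arzela_Ascoli[of "cball 0 R" ?A "(R + norm x0) * L"])
    fix n and x :: "real^'n" assume x: "x \<in> cball 0 R"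
    have "norm (?A n x) \<le> norm (x - x0) * L" using lip[of n x x0] A0[of n] by simp
    also have "\<dots> \<le> (R + norm x0) * L"
      using x L norm_triangle_ineq4[of x x0] by (intro mult_right_mono) auto
    finally show "norm (?A n x) \<le> (R + norm x0) * L" .
  next
    fix x :: "real^'n" and e :: real assume e: "0 < e"
    have "norm (?A n x - ?A n y) < e" if "norm (x - y) < e / (L + 1)" for n y
    proof -
      have "norm (?A n x - ?A n y) \<le> norm (x - y) * L" using lip by simp
      also have "\<dots> \<le> norm (x - y) * (L + 1)" by (simp add: mult_left_mono)
      also have "\<dots> < e" using that L by (simp add: less_divide_eq)
      finally show ?thesis .
    qed
    then show "\<exists>d. 0 < d \<and> (\<forall>n y. y \<in> cball 0 R \<and> norm (x - y) < d \<longrightarrow> norm (?A n x - ?A n y) < e)"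
      using e L by (intro exI[of _ "e / (L + 1)"]) auto
  qed auto
  define V where "V = measure lborel \<Omega>"
  have V: "emeasure lborel \<Omega> = ennreal V" "0 \<le> V"
    using emeasure_bounded_finite[OF \<Omega>(2)] by (simp_all add: V_def emeasure_eq_ennreal_measure)
  define \<eta> where "\<eta> = e / (4 * (V + 1))"
  have \<eta>: "0 < \<eta>" using e V by (simp add: \<eta>_def)
  obtain n0 where n0: "\<And>n x. n \<ge> n0 \<Longrightarrow> x \<in> cball 0 R \<Longrightarrow> norm (?A (k n) x - g x) < \<eta>"
    using unif[OF \<eta>] by blast
  have [measurable]: "\<phi> n \<in> borel_measurable borel" "?A n \<in> borel_measurable borel" "\<Omega> \<in> sets borel" for n
    using test_borel[OF \<phi>] box_average_continuous[OF \<Omega>(1) \<phi> \<delta> M] \<Omega>(1)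
        by (auto intro: borel_measurable_continuous_onI)
  have err: "(\<integral>\<^sup>+x. ennreal \<bar>\<phi> n x - ?A n x\<bar> \<partial>lborel) \<le> ennreal (e / 4)" for n
  proof -
    have "(\<integral>\<^sup>+x. ennreal \<bar>\<phi> n x - ?A n x\<bar> \<partial>lborel) \<le>
        ennreal (2 * N) * (ennreal \<delta> * (\<integral>\<^sup>+x. ennreal (norm (gradient (\<phi> n) x)) \<partial>lborel))"
      using box_average_error[OF \<Omega>(1) \<phi>] \<delta> by (simp add: N_def)
    also have "\<dots> \<le> ennreal (2 * N) * (ennreal \<delta> * ennreal M)" using M(1) by (intro mult_left_mono) auto
    also have "\<dots> = ennreal (2 * N * (\<delta> * M))" using N \<delta> M by (simp add: ennreal_mult)
    also have "\<dots> \<le> ennreal (e / 4)"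
    proof (rule ennreal_leI)
      have "2 * N * (e / (8 * N * D) * M) = e / 4 * (M / D)" if "D > 0" for D using N that
          by (simp add: field_simps)
      from this[of "M + 1"] have "2 * N * (\<delta> * M) = e / 4 * (M / (M + 1))" using M by (simp add: \<delta>_def)
      also have "\<dots> \<le> e / 4 * 1" using e M by (intro mult_left_mono) (auto simp: divide_le_eq)
      finally show "2 * N * (\<delta> * M) \<le> e / 4" by simp
    qed
    finally show ?thesis .
  qed
  have "(\<integral>\<^sup>+x. ennreal \<bar>\<phi> (k m) x - \<phi> (k n) x\<bar> \<partial>lborel) \<le> ennreal e" if mn: "m \<ge> n0" "n \<ge> n0" for m n
  proof -
    have "(\<integral>\<^sup>+x. ennreal \<bar>\<phi> (k m) x - \<phi> (k n) x\<bar> \<partial>lborel) \<le>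
        (\<integral>\<^sup>+x. (ennreal \<bar>\<phi> (k m) x - ?A (k m) x\<bar> + ennreal \<bar>\<phi> (k n) x - ?A (k n) x\<bar>) + ennreal (2 * \<eta>) *
            indicator \<Omega> x \<partial>lborel)"
    proof (rule nn_integral_mono)
      fix x
      show "ennreal \<bar>\<phi> (k m) x - \<phi> (k n) x\<bar> \<le>
        (ennreal \<bar>\<phi> (k m) x - ?A (k m) x\<bar> + ennreal \<bar>\<phi> (k n) x - ?A (k n) x\<bar>) + ennreal (2 * \<eta>) * indicator \<Omega> x"
      proof (cases "x \<in> \<Omega>")
        case True
        then have "x \<in> cball 0 R" using R by simp
        then have "\<bar>\<phi> (k m) x - \<phi> (k n) x\<bar> \<le> (\<bar>\<phi> (k m) x - ?A (k m) x\<bar> + \<bar>\<phi> (k n) x - ?A (k n) x\<bar>) + 2 * \<eta>"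
          using n0[OF mn(1), of x] n0[OF mn(2), of x] by (simp add: abs_le_iff) linarith
        then show ?thesis using True \<eta> by (simp add: ennreal_plus[symmetric] del: ennreal_plus)
      qed (simp add: test_outside[OF \<phi>])
    qed
    also have "\<dots> = ((\<integral>\<^sup>+x. ennreal \<bar>\<phi> (k m) x - ?A (k m) x\<bar> \<partial>lborel) + (\<integral>\<^sup>+x. ennreal \<bar>\<phi> (k n) x - ?A
        (k n) x\<bar> \<partial>lborel)) + ennreal (2 * \<eta>) * ennreal V"
      using V by (simp add: nn_integral_add nn_integral_cmult_indicator)
    also have "\<dots> \<le> (ennreal (e / 4) + ennreal (e / 4)) + ennreal (2 * \<eta>) * ennreal V"
      using err by (intro add_mono) auto
    also have "\<dots> = ennreal (e / 4 + e / 4 + 2 * \<eta> * V)"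
      using e \<eta> V by (simp add: ennreal_plus[symmetric] ennreal_mult[symmetric] del: ennreal_plus)
    also have "\<dots> \<le> ennreal e"
    proof (rule ennreal_leI)
      have "2 * (e / (4 * D)) * V = e / 2 * (V / D)" for D by simp
      then have "2 * \<eta> * V = e / 2 * (V / (V + 1))" unfolding \<eta>_def .
      also have "\<dots> \<le> e / 2 * 1" using e V by (intro mult_left_mono) (auto simp: divide_le_eq)
      finally show "e / 4 + e / 4 + 2 * \<eta> * V \<le> e" by simp
    qed
    finally show ?thesis .
  qed
  with k show ?thesis by blast
qed

text \<open>A diagonal sequence through the tolerances 1 / (k + 1) of
  \<open>rellich_step\<close>.\<close>

lemma rellich_test:
  fixes \<phi> :: "nat \<Rightarrow> real^'n::finite \<Rightarrow> real"
  assumes \<Omega>: "open \<Omega>" "bounded \<Omega>" and \<phi>: "\<And>n. \<phi> n \<in> test_functions \<Omega>"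
    and M: "\<And>n. (\<integral>\<^sup>+x. ennreal (norm (gradient (\<phi> n) x)) \<partial>lborel) \<le> ennreal M" "0 \<le> M"
  shows "\<exists>r::nat\<Rightarrow>nat. strict_mono r \<and>
    (\<forall>e>0. \<exists>N. \<forall>m\<ge>N. \<forall>n\<ge>N. (\<integral>\<^sup>+x. ennreal \<bar>\<phi> (r m) x - \<phi> (r n) x\<bar> \<partial>lborel) \<le> ennreal e)"
proof -
  define P where "P k s \<longleftrightarrow> (\<exists>N. \<forall>m\<ge>N. \<forall>n\<ge>N.
      (\<integral>\<^sup>+x. ennreal \<bar>\<phi> (s m) x - \<phi> (s n) x\<bar> \<partial>lborel) \<le> ennreal (inverse (real (Suc
          k))))" for k and s :: "nat \<Rightarrow> nat"
  interpret subseqs P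
  proof
    fix k and s :: "nat \<Rightarrow> nat"
    show "\<exists>r'. strict_mono r' \<and> P k (s \<circ> r')"
      using rellich_step[OF \<Omega>, of "\<lambda>n. \<phi> (s n)" M "inverse (real (Suc k))"] \<phi> M
      by (simp add: P_def del: of_nat_Suc)
  qed
  have "P k (diagseq \<circ> ((+) (Suc k)))" for k
  proof (rule diagseq_holds)
    fix r s :: "nat \<Rightarrow> nat" and n assume r: "strict_mono r" and P: "P n s"
    from P obtain N where N: "\<forall>m\<ge>N. \<forall>l\<ge>N. (\<integral>\<^sup>+x. ennreal \<bar>\<phi> (s m) x - \<phi> (s l) x\<bar> \<partial>lborel) \<le>
        ennreal (inverse (real (Suc n)))"
      unfolding P_def by blast
    show "P n (s \<circ> r)" unfolding P_def
    proof (intro exI[of _ N] allI impI)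
      fix m l assume "N \<le> m" "N \<le> l"
      then have "N \<le> r m" "N \<le> r l" using seq_suble[OF r, of m] seq_suble[OF r, of l] by auto
      with N show "(\<integral>\<^sup>+x. ennreal \<bar>\<phi> ((s \<circ> r) m) x - \<phi> ((s \<circ> r) l) x\<bar> \<partial>lborel) \<le>
          ennreal (inverse (real (Suc n)))"
        unfolding o_def by blast
    qed
  qed
  then have N: "\<exists>N. \<forall>m\<ge>N. \<forall>n\<ge>N. (\<integral>\<^sup>+x. ennreal \<bar>\<phi> (diagseq (Suc k + m)) x - \<phi> (diagseq
      (Suc k + n)) x\<bar> \<partial>lborel) \<le> ennreal (inverse (real (Suc k)))" for k
    by (simp add: P_def)
  have "\<exists>N. \<forall>m\<ge>N. \<forall>n\<ge>N. (\<integral>\<^sup>+x. ennreal \<bar>\<phi> (diagseq m) x - \<phi> (diagseq n) x\<bar> \<partial>lborel) \<le> ennreal e"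
      if e0: "e > 0" for e
  proof -
    obtain k where k: "inverse (real (Suc k)) < e" using reals_Archimedean[OF e0] by blast
    obtain N where N: "\<forall>m\<ge>N. \<forall>n\<ge>N. (\<integral>\<^sup>+x. ennreal \<bar>\<phi> (diagseq (Suc k + m)) x - \<phi> (diagseq
        (Suc k + n)) x\<bar> \<partial>lborel) \<le> ennreal (inverse (real (Suc k)))"
      using N by blast
    show ?thesis
    proof (intro exI[of _ "Suc k + N"] allI impI)
      fix m n assume mn: "Suc k + N \<le> m" "Suc k + N \<le> n"
      have "(\<integral>\<^sup>+x. ennreal \<bar>\<phi> (diagseq m) x - \<phi> (diagseq n) x\<bar> \<partial>lborel) \<le> ennreal (inverse (real (Suc k)))"
        using N[rule_format, of "m - Suc k" "n - Suc k"] mn by simp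
      also have "\<dots> \<le> ennreal e" using k by (intro ennreal_leI) simp
      finally show "(\<integral>\<^sup>+x. ennreal \<bar>\<phi> (diagseq m) x - \<phi> (diagseq n) x\<bar> \<partial>lborel) \<le> ennreal e" .
    qed
  qed
  then show ?thesis using subseq_diagseq by blast
qed

section \<open>Convexity and Young inequalities\<close>

lemma powr_above_tangent:
  fixes m t p :: real
  assumes p: "1 < p" and m: "0 < m" and t: "0 \<le> t" "t \<noteq> m"
  shows "m powr p + p * m powr (p - 1) * (t - m) < t powr p"
proof -
  have cont: "continuous_on {a..b} (\<lambda>x. x powr p)" if "0 \<le> a" for a b :: real
    using that p by (intro continuous_on_powr' continuous_intros) auto
  have der: "DERIV (\<lambda>x. x powr p) x :> p * x powr (p - 1)" if "0 < x" for x
    using that by (auto intro!: derivative_eq_intros)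
  show ?thesis
  proof (cases "t < m")
    case True
    have "\<exists>l z. t < z \<and> z < m \<and> DERIV (\<lambda>x. x powr p) z :> l \<and> m powr p - t powr p = (m - t) * l"
    proof (rule MVT[OF True cont])
      show "(\<lambda>x. x powr p) differentiable (at x)" if "t < x" for x
        using der[of x] that t by (auto simp: real_differentiable_def)
    qed (use t in auto)
    then obtain z l where lz: "t < z" "z < m" "DERIV (\<lambda>x. x powr p) z :> l" "m powr p - t powr p =
        (m - t) * l" by blast
    have "l = p * z powr (p - 1)" using DERIV_unique[OF lz(3) der] lz(1) t by simp
    then have z: "t < z" "z < m" "m powr p - t powr p = (m - t) * (p * z powr (p - 1))" using lz by auto
    have "z powr (p - 1) < m powr (p - 1)" using z t p by (intro powr_less_mono2) auto
    then have "(m - t) * (p * z powr (p - 1)) < (m - t) * (p * m powr (p - 1))"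
      using True p by simp
    then show ?thesis using z(3) by (simp add: algebra_simps)
  next
    case False
    then have mt: "m < t" using t by simp
    obtain z where z: "m < z" "z < t" "t powr p - m powr p = (t - m) * (p * z powr (p - 1))"
      using MVT2[OF mt, of "\<lambda>x. x powr p" "\<lambda>x. p * x powr (p - 1)"] der m by force
    have "m powr (p - 1) < z powr (p - 1)" using z m p by (intro powr_less_mono2) auto
    then have "(t - m) * (p * m powr (p - 1)) < (t - m) * (p * z powr (p - 1))"
      using mt p by simp
    then show ?thesis using z(3) by (simp add: algebra_simps)
  qed
qed

text \<open>Different lengths are separated by strict convexity of t^p at the mean length. For equal
  lengths the parallelogram law makes the midpoint strictly shorter.\<close>

lemma norm_powr_midpoint_less:
  fixes a b :: "'b::euclidean_space"
  assumes p: "1 < p" and ab: "a \<noteq> b"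
  shows "2 * norm ((a + b) /\<^sub>R 2) powr p < norm a powr p + norm b powr p"
proof (cases "norm a = norm b")
  case False
  define m where "m = (norm a + norm b) / 2"
  have "a \<noteq> 0 \<or> b \<noteq> 0" using False by auto
  then have m: "0 < m" by (auto simp: m_def add_pos_nonneg add_nonneg_pos)
  have "norm a \<noteq> m" "norm b \<noteq> m" using False by (auto simp: m_def)
  from powr_above_tangent[OF p m norm_ge_zero this(1)] powr_above_tangent[OF p m norm_ge_zero this(2)]
  have "2 * m powr p + p * m powr (p - 1) * ((norm a - m) + (norm b - m)) < norm a powr p + norm b powr p"
    by (simp add: algebra_simps)
  moreover have "(norm a - m) + (norm b - m) = 0" by (simp add: m_def)
  moreover have "norm ((a + b) /\<^sub>R 2) powr p \<le> m powr p"
    using p norm_triangle_ineq[of a b] by (intro powr_mono2) (auto simp: m_def)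
  ultimately show ?thesis by simp
next
  case True
  have "norm (a + b) ^ 2 + norm (a - b) ^ 2 = 4 * norm a ^ 2"
    using True by (simp add: power2_norm_eq_inner algebra_simps inner_commute) (simp add: norm_eq)
  moreover have "0 < norm (a - b) ^ 2" using ab by simp
  ultimately have "norm (a + b) ^ 2 < 4 * norm a ^ 2" by linarith
  then have "norm (a + b) ^ 2 < (2 * norm a) ^ 2" by (simp add: power_mult_distrib)
  then have "norm (a + b) < 2 * norm a" by (rule power_less_imp_less_base) simp
  then have "norm ((a + b) /\<^sub>R 2) powr p < norm a powr p" using p by (intro powr_less_mono2) auto
  then show ?thesis using True by simp
qed

lemma norm_powr_midpoint_le:
  fixes a b :: "'b::euclidean_space"
  assumes p: "1 < p"
  shows "2 * norm ((a + b) /\<^sub>R 2) powr p \<le> norm a powr p + norm b powr p"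
proof (cases "a = b")
  case True
  then have "(a + b) /\<^sub>R 2 = b" by (simp add: scaleR_2[symmetric])
  then show ?thesis using True by simp
qed (use norm_powr_midpoint_less[OF p, of a b] in simp)

text \<open>Takes the place of the triangle inequality for modulars: the factor of the main term can
  be brought close to 1 at the price of a large factor on the perturbation. Comparing
  \<open>t\<close> with \<kappa> s decides which term dominates.\<close>

lemma powr_add_le_weighted:
  fixes s t p P \<kappa> :: real
  assumes "0 \<le> s" "0 \<le> t" "0 < p" "p \<le> P" "0 < \<kappa>"
  shows "(s + t) powr p \<le> (1 + \<kappa>) powr P * s powr p + (1 + 1 / \<kappa>) powr P * t powr p"
proof (cases "t \<le> \<kappa> * s")
  case True
  have "(s + t) powr p \<le> ((1 + \<kappa>) * s) powr p" using assms True by (intro powr_mono2) (auto simp: algebra_simps)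
  also have "\<dots> = (1 + \<kappa>) powr p * s powr p" using assms by (simp add: powr_mult)
  also have "\<dots> \<le> (1 + \<kappa>) powr P * s powr p" using assms by (intro mult_right_mono powr_mono) auto
  finally show ?thesis by (rule order_trans) simp
next
  case False
  have "(s + t) powr p \<le> ((1 + 1 / \<kappa>) * t) powr p" using assms False
      by (intro powr_mono2) (auto simp: field_simps)
  also have "\<dots> = (1 + 1 / \<kappa>) powr p * t powr p" using assms by (simp add: powr_mult)
  also have "\<dots> \<le> (1 + 1 / \<kappa>) powr P * t powr p" using assms by (intro mult_right_mono powr_mono) auto
  finally show ?thesis by (rule order_trans) simp
qed

text \<open>Uniform convexity of \<open>t powr p\<close>, uniformly in the exponent: off the cone \<open>norm (a - b) \<le> \<kappa> * (norm a + norm b)\<close>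
  the convexity defect is bounded below by compactness and homogeneity.\<close>
lemma powr_uniformly_convex:
  fixes p0 P \<epsilon> :: real
  assumes p0: "1 < p0" "p0 \<le> P" and \<epsilon>: "0 < \<epsilon>"
  shows "\<exists>C\<ge>0. \<forall>p\<in>{p0..P}. \<forall>a b::'b::euclidean_space.
    norm (a - b) powr p \<le> \<epsilon> * (norm a powr p + norm b powr p) + C * (norm a powr p + norm b powr p - 2 *
        norm ((a + b) /\<^sub>R 2) powr p)"
proof -
  \<comment> \<open>Inside the cone the difference is at most \<kappa> 2^P times the two powers,
    since \<kappa> at most 1 gives \<kappa>^p at most \<kappa>; this choice absorbs it into the
    \<epsilon>-term.\<close>
  define \<kappa> where "\<kappa> = min 1 (\<epsilon> / 2 powr P)"
  have \<kappa>: "0 < \<kappa>" "\<kappa> \<le> 1" "\<kappa> * 2 powr P \<le> \<epsilon>" using \<epsilon> by (auto simp: \<kappa>_def min_def field_simps)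
  define F where "F p a b = norm a powr p + norm b powr p - 2 * norm ((a + b) /\<^sub>R 2) powr p" for p and a b :: 'b
  have F0: "0 \<le> F p a b" if "p \<in> {p0..P}" for p a b
    using norm_powr_midpoint_le[of p a b] that p0 by (simp add: F_def)
  \<comment> \<open>The exponent is one of the coordinates, so compactness yields a lower bound that
    is uniform in it. The normalization keeps away from the origin and is undone by
    homogeneity.\<close>
  define S where "S = {(p::real, a::'b, b::'b). p \<in> {p0..P} \<and> norm a + norm b = 1 \<and> \<kappa> \<le> norm (a - b)}"
  have "compact S"
  proof (rule compact_eq_bounded_closed[THEN iffD2, OF conjI])
    have "norm a \<le> 1" "norm b \<le> 1" if "norm a + norm b = 1" for a b :: 'b
      using that norm_ge_zero[of a] norm_ge_zero[of b] by linarith+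
    then have "S \<subseteq> {p0..P} \<times> (cball 0 1 \<times> cball 0 1)" by (auto simp: S_def)
    then show "bounded S" by (rule bounded_subset[rotated]) (intro bounded_Times bounded_cball
        bounded_closed_interval)
    have "S = {x. p0 \<le> fst x} \<inter> {x. fst x \<le> P} \<inter> {x. norm (fst (snd x)) + norm (snd (snd x)) = 1} \<inter> {x. \<kappa> \<le>
        norm (fst (snd x) - snd (snd x))}"
      by (auto simp: S_def)
    also have "closed \<dots>"
      by (intro closed_Int closed_Collect_le closed_Collect_eq continuous_intros)
    finally show "closed S" .
  qed
  have "\<exists>d>0. \<forall>(p, a, b)\<in>S. d \<le> F p a b"
  proof (cases "S = {}")
    case True
    then show ?thesis by (intro exI[of _ 1]) auto
  next
    case False
    have "continuous_on S (\<lambda>x. norm (fst (snd x)) powr fst x + norm (snd (snd x)) powr fst x - 2 * norm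
        ((fst (snd x) + snd (snd x)) /\<^sub>R 2) powr fst x)"
      using p0 by (intro continuous_intros continuous_on_powr') (auto simp: S_def)
    then have "continuous_on S (\<lambda>(p, a, b). F p a b)" by (simp add: F_def case_prod_beta)
    from continuous_attains_inf[OF \<open>compact S\<close> False this]
    obtain x where x: "x \<in> S" "\<forall>y\<in>S. (\<lambda>(p, a, b). F p a b) x \<le> (\<lambda>(p, a, b). F p a b) y" by blast
    obtain p a b where xe: "x = (p, a, b)" by (cases x) auto
    have "a \<noteq> b" using x(1) \<kappa>(1) by (auto simp: S_def xe)
    then have "0 < F p a b" using norm_powr_midpoint_less[of p a b] x(1) p0 by (simp add: F_def S_def xe)
    then show ?thesis using x(2) by (intro exI[of _ "F p a b"]) (auto simp: xe)
  qed
  then obtain d where d: "0 < d" "\<And>p a b. (p, a, b) \<in> S \<Longrightarrow> d \<le> F p a b" by blast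
  have "norm (a - b) powr p \<le> \<epsilon> * (norm a powr p + norm b powr p) + 1 / d * F p a b" if p: "p \<in> {p0..P}"
      for p a b
  proof (cases "norm (a - b) \<le> \<kappa> * (norm a + norm b)")
    case True
    have "norm (a - b) powr p \<le> (\<kappa> * (norm a + norm b)) powr p" using p p0 True by (intro powr_mono2) auto
    also have "\<dots> = \<kappa> powr p * (norm a + norm b) powr p" using \<kappa> by (simp add: powr_mult)
    also have "\<dots> \<le> \<kappa> powr 1 * (2 powr P * norm a powr p + 2 powr P * norm b powr p)"
      using p p0 \<kappa> powr_add_le_weighted[of "norm a" "norm b" p P 1] by (intro mult_mono powr_mono') auto
    also have "\<dots> = (\<kappa> * 2 powr P) * (norm a powr p + norm b powr p)" using \<kappa> by (simp add: algebra_simps)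
    also have "\<dots> \<le> \<epsilon> * (norm a powr p + norm b powr p)" using \<kappa>(3) by (intro mult_right_mono) auto
    finally have "norm (a - b) powr p \<le> \<epsilon> * (norm a powr p + norm b powr p)" .
    moreover have "0 \<le> 1 / d * F p a b" using F0[OF p, of a b] d(1) by simp
    ultimately show ?thesis by linarith
  next
    case False
    define s where "s = norm a + norm b"
    have "a \<noteq> 0 \<or> b \<noteq> 0" using False by auto
    then have s: "0 < s" by (auto simp: s_def add_pos_nonneg add_nonneg_pos)
    have "(p, a /\<^sub>R s, b /\<^sub>R s) \<in> S"
    proof -
      have "norm (a /\<^sub>R s) + norm (b /\<^sub>R s) = 1"
        using s by (simp add: s_def divide_inverse[symmetric] add_divide_distrib[symmetric] mult.commute[of
            "inverse _"])
      moreover have "norm (a /\<^sub>R s - b /\<^sub>R s) = norm (a - b) / s"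
        using s by (simp add: scaleR_diff_right[symmetric] divide_inverse mult.commute)
      moreover have "\<kappa> \<le> norm (a - b) / s" using False s by (simp add: s_def le_divide_eq)
      ultimately show ?thesis using p by (simp add: S_def)
    qed
    then have "d * s powr p \<le> F p (a /\<^sub>R s) (b /\<^sub>R s) * s powr p" using d(2) by (intro mult_right_mono) auto
    also have "\<dots> = F p a b"
    proof -
      have sc: "norm (c /\<^sub>R s) powr p * s powr p = norm c powr p" for c :: 'b
      proof -
        have "norm (c /\<^sub>R s) * s = norm c" using s by (simp add: field_simps)
        then have "(norm (c /\<^sub>R s) * s) powr p = norm c powr p" by (simp only:)
        then show ?thesis using s by (simp only: powr_mult norm_ge_zero less_imp_le)
      qed
      have "(a /\<^sub>R s + b /\<^sub>R s) /\<^sub>R 2 = ((a + b) /\<^sub>R 2) /\<^sub>R s" by (simp add: scaleR_add_right mult.commute)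
      then show ?thesis using sc[of a] sc[of b] sc[of "(a + b) /\<^sub>R 2"] by (simp add: F_def algebra_simps)
    qed
    finally have "s powr p \<le> 1 / d * F p a b" using d(1) by (simp add: field_simps)
    moreover have "norm (a - b) powr p \<le> s powr p"
      using p p0 norm_triangle_ineq4[of a b] by (intro powr_mono2) (auto simp: s_def)
    moreover have "0 \<le> \<epsilon> * (norm a powr p + norm b powr p)" using \<epsilon> by simp
    ultimately show ?thesis by linarith
  qed
  then show ?thesis using d(1) by (intro exI[of _ "1 / d"]) (auto simp: F_def)
qed

text \<open>No calculus: either s is at most \<epsilon> t^(p-1) and the product is below the first
  term, or t is at most (s / \<epsilon>)^(1/(p-1)) and it is below the second.\<close>

lemma young_weighted:
  fixes s t p \<epsilon> :: real
  assumes p: "1 < p" and st: "0 \<le> s" "0 \<le> t" and \<epsilon>: "0 < \<epsilon>"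
  shows "s * t \<le> \<epsilon> * t powr p + (1 / \<epsilon>) powr (1 / (p - 1)) * s powr (p / (p - 1))"
proof (cases "s \<le> \<epsilon> * t powr (p - 1)")
  case True
  have "s * t \<le> \<epsilon> * t powr (p - 1) * t" using True st by (intro mult_right_mono) auto
  also have "\<dots> = \<epsilon> * t powr p" using st powr_mult_base[of t "p - 1"]
      by (simp add: mult.commute mult.left_commute)
  finally show ?thesis by (rule order_trans) simp
next
  case False
  then have "t powr (p - 1) \<le> s / \<epsilon>" using \<epsilon> by (simp add: field_simps)
  then have "(t powr (p - 1)) powr (1 / (p - 1)) \<le> (s / \<epsilon>) powr (1 / (p - 1))" using p
      by (intro powr_mono2) auto
  then have "t \<le> (s / \<epsilon>) powr (1 / (p - 1))" using p st by (simp add: powr_powr)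
  then have "s * t \<le> s * (s / \<epsilon>) powr (1 / (p - 1))" using st by (intro mult_left_mono) auto
  also have "\<dots> = (1 / \<epsilon>) powr (1 / (p - 1)) * (s * s powr (1 / (p - 1)))"
    using st \<epsilon> by (simp add: powr_divide)
  also have "s * s powr (1 / (p - 1)) = s powr (1 + 1 / (p - 1))" using st by (simp add: powr_mult_base)
  also have "1 + 1 / (p - 1) = p / (p - 1)" using p by (simp add: field_simps)
  finally show ?thesis by (rule order_trans) (use \<epsilon> in simp)
qed

lemma young_small_power:
  fixes p0 P \<epsilon> :: real
  assumes p0: "1 < p0" and \<epsilon>: "0 < \<epsilon>"
  shows "\<exists>C\<ge>0. \<forall>p\<in>{p0..P}. \<forall>s\<ge>0. \<forall>t\<ge>0. s * t \<le> \<epsilon> * t powr p + C * s powr (p / (p - 1))"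
proof (intro exI conjI ballI allI impI)
  \<comment> \<open>The base is 1 + 1 / \<epsilon> instead of 1 / \<epsilon> so that it exceeds 1
    and the exponent 1 / (p - 1) is worst at p = p0.\<close>
  let ?C = "(1 + 1 / \<epsilon>) powr (1 / (p0 - 1))"
  show "0 \<le> ?C" by simp
  fix p s t :: real assume p: "p \<in> {p0..P}" and st: "0 \<le> s" "0 \<le> t"
  have "(1 / \<epsilon>) powr (1 / (p - 1)) \<le> (1 + 1 / \<epsilon>) powr (1 / (p - 1))"
    using p p0 \<epsilon> by (intro powr_mono2) auto
  also have "\<dots> \<le> ?C" using p p0 \<epsilon> by (intro powr_mono) (auto simp: frac_le)
  finally have "(1 / \<epsilon>) powr (1 / (p - 1)) * s powr (p / (p - 1)) \<le> ?C * s powr (p / (p - 1))"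
    by (rule mult_right_mono) simp
  then show "s * t \<le> \<epsilon> * t powr p + ?C * s powr (p / (p - 1))"
    using young_weighted[of p s t \<epsilon>] p p0 st \<epsilon> by simp
qed

lemma young_small_conjugate:
  fixes p0 P \<epsilon> :: real
  assumes p0: "1 < p0" "p0 \<le> P" and \<epsilon>: "0 < \<epsilon>"
  shows "\<exists>C\<ge>0. \<forall>p\<in>{p0..P}. \<forall>s\<ge>0. \<forall>t\<ge>0. s * t \<le> C * t powr p + \<epsilon> * s powr (p / (p - 1))"
proof -
  \<comment> \<open>\<open>young_weighted\<close> with weight 1 / l puts l^(1/(p-1)) in front of the
    power of \<open>s\<close>. As l is at most 1, this is largest at p = P, where it is at most
    \<epsilon>.\<close>
  define l where "l = min 1 (\<epsilon> powr (P - 1))"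
  have l: "0 < l" "l \<le> 1" using \<epsilon> by (auto simp: l_def)
  have "s * t \<le> 1 / l * t powr p + \<epsilon> * s powr (p / (p - 1))" if p: "p \<in> {p0..P}" and st: "0 \<le> s" "0 \<le> t"
      for p s t
  proof -
    have "l powr (1 / (p - 1)) \<le> l powr (1 / (P - 1))" using p p0 l by (intro powr_mono') (auto simp: frac_le)
    also have "\<dots> \<le> (\<epsilon> powr (P - 1)) powr (1 / (P - 1))" using p0 l by (intro powr_mono2) (auto simp: l_def)
    also have "\<dots> = \<epsilon>" using p0 \<epsilon> by (simp add: powr_powr)
    finally have "l powr (1 / (p - 1)) * s powr (p / (p - 1)) \<le> \<epsilon> * s powr (p / (p - 1))"
        by (rule mult_right_mono) simp
    then show ?thesis using young_weighted[of p s t "1 / l"] p p0 st l by simp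
  qed
  then show ?thesis using l by (intro exI[of _ "1 / l"]) auto
qed

section \<open>The double phase modular\<close>

text \<open>On balls of radius \<open>\<delta>\<close> the exponents oscillate so little that \<open>q\<close> stays below the Sobolev
  conjugate of \<open>p\<close> across different points, with a margin \<open>e\<close>.\<close>
locale double_phase_setup =
  fixes \<Omega> :: "(real^'n::finite) set" and p q \<mu> :: "real^'n \<Rightarrow> real" and p0 P m0 e \<delta> :: real
  assumes open_dom: "open \<Omega>" and bounded_dom: "bounded \<Omega>"
    and p_cont: "continuous_on \<Omega> p" and q_cont: "continuous_on \<Omega> q"
    and mu_meas [measurable]: "\<mu> \<in> borel_measurable (lebesgue_on \<Omega>)"
    and p0: "1 < p0" "p0 \<le> P"
    and exps: "\<And>x. x \<in> \<Omega> \<Longrightarrow> p0 \<le> p x \<and> p x \<le> q x \<and> q x \<le> P"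
    and mu: "\<And>x. x \<in> \<Omega> \<Longrightarrow> 0 \<le> \<mu> x \<and> \<mu> x \<le> m0"
    and e: "0 < e" "e < 1" and \<delta>: "0 < \<delta>"
    and subcritical: "\<And>x y. x \<in> \<Omega> \<Longrightarrow> y \<in> \<Omega> \<Longrightarrow> dist x y \<le> \<delta> \<Longrightarrow> real CARD('n) * (1 / p y - 1 / q x) \<le> 1 - e"
begin

abbreviation "L \<equiv> lebesgue_on \<Omega>"
abbreviation "H \<equiv> double_phase p q \<mu>"

text \<open>The energy density: its derivative in \<open>t\<close> is t^(p-1) + \<mu> t^(q-1), the
  length of the flux. It lies between H / P and H, so bounds on the modular and on the energy are
  interchangeable.\<close>

definition E :: "real^'n \<Rightarrow> real \<Rightarrow> real" where
  "E x t = t powr p x / p x + \<mu> x * t powr q x / q x"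

lemma space_L [simp]: "space L = \<Omega>" by simp

lemma dom_sets [measurable, simp]: "\<Omega> \<in> sets lebesgue" "\<Omega> \<in> sets borel"
  using open_dom by auto

lemma emeasure_L: "emeasure L \<Omega> = ennreal (measure L \<Omega>)" "emeasure L \<Omega> < \<infinity>"
proof -
  have "emeasure L \<Omega> = emeasure lborel \<Omega>" by (simp add: emeasure_restrict_space)
  then show "emeasure L \<Omega> < \<infinity>" using emeasure_bounded_finite[OF bounded_dom] by simp
  then show "emeasure L \<Omega> = ennreal (measure L \<Omega>)" by (simp add: emeasure_eq_ennreal_measure)
qed

lemma finite_measure_L: "finite_measure L"
  by (rule finite_measureI) (use emeasure_L(2) in auto)

sublocale L: finite_measure L by (rule finite_measure_L)

lemma p_meas [measurable]: "p \<in> borel_measurable L" and q_meas [measurable]: "q \<in> borel_measurable L"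
  using p_cont q_cont by (auto intro: continuous_imp_measurable_on_sets_lebesgue)

lemma H_measurable [measurable (raw)]: "w \<in> borel_measurable L \<Longrightarrow> (\<lambda>x. H x (w x)) \<in> borel_measurable L"
  unfolding double_phase_def
  by (intro borel_measurable_add powr_real_measurable borel_measurable_times p_meas q_meas mu_meas)

lemma E_measurable [measurable (raw)]: "w \<in> borel_measurable L \<Longrightarrow> (\<lambda>x. E x (w x)) \<in> borel_measurable L"
  unfolding E_def
  by (intro borel_measurable_add powr_real_measurable borel_measurable_times borel_measurable_divide p_meas
      q_meas mu_meas)

section \<open>Growth, scaling and convexity of the integrand\<close>

lemma exps': assumes "x \<in> \<Omega>" shows "1 < p x" "p x \<le> P" "1 < q x" "q x \<le> P" "p0 \<le> p x" "p0 \<le> q x"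
  using exps[OF assms] p0 by auto

lemma H_nonneg: "x \<in> \<Omega> \<Longrightarrow> 0 \<le> H x t"
  using mu by (simp add: double_phase_def)

lemma H_zero [simp]: "H x 0 = 0" by (simp add: double_phase_def)

lemma H_mono: assumes "x \<in> \<Omega>" "0 \<le> s" "s \<le> t" shows "H x s \<le> H x t"
  unfolding double_phase_def using assms mu exps'[OF assms(1)]
  by (intro add_mono mult_left_mono powr_mono2) auto

lemma H_scale_small:
  assumes x: "x \<in> \<Omega>" and c: "0 \<le> c" "c \<le> 1" and t: "0 \<le> t"
  shows "H x (c * t) \<le> c powr p0 * H x t"
proof -
  have "H x (c * t) = c powr p x * t powr p x + c powr q x * (\<mu> x * t powr q x)"
    using c t by (simp add: double_phase_def powr_mult)
  also have "\<dots> \<le> c powr p0 * t powr p x + c powr p0 * (\<mu> x * t powr q x)"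
    using c mu[OF x] exps'[OF x] by (intro add_mono mult_right_mono powr_mono') auto
  finally show ?thesis by (simp add: double_phase_def distrib_left)
qed

lemma H_scale_large:
  assumes x: "x \<in> \<Omega>" and c: "1 \<le> c" and t: "0 \<le> t"
  shows "H x (c * t) \<le> c powr P * H x t"
proof -
  have "H x (c * t) = c powr p x * t powr p x + c powr q x * (\<mu> x * t powr q x)"
    using c t by (simp add: double_phase_def powr_mult)
  also have "\<dots> \<le> c powr P * t powr p x + c powr P * (\<mu> x * t powr q x)"
    using c mu[OF x] exps'[OF x] by (intro add_mono mult_right_mono powr_mono) auto
  finally show ?thesis by (simp add: double_phase_def distrib_left)
qed

lemma H_scale:
  assumes x: "x \<in> \<Omega>" and t: "0 \<le> t" "0 \<le> c"
  shows "H x (c * t) \<le> (1 + c) powr P * H x t"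
  using H_mono[OF x, of "c * t" "(1 + c) * t"] H_scale_large[OF x, of "1 + c" t] t by (simp add: algebra_simps)

lemma H_add:
  assumes x: "x \<in> \<Omega>" and st: "0 \<le> s" "0 \<le> t" and k: "0 < \<kappa>"
  shows "H x (s + t) \<le> (1 + \<kappa>) powr P * H x s + (1 + 1 / \<kappa>) powr P * H x t"
proof -
  have "\<mu> x * (s + t) powr q x \<le> \<mu> x * ((1 + \<kappa>) powr P * s powr q x + (1 + 1 / \<kappa>) powr P * t powr q x)"
    using mu[OF x] exps'[OF x] st k by (intro mult_left_mono powr_add_le_weighted) auto
  moreover have "(s + t) powr p x \<le> (1 + \<kappa>) powr P * s powr p x + (1 + 1 / \<kappa>) powr P * t powr p x"
    using exps'[OF x] st k by (intro powr_add_le_weighted) auto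
  ultimately show ?thesis by (simp add: double_phase_def algebra_simps)
qed

lemma E_nonneg: "x \<in> \<Omega> \<Longrightarrow> 0 \<le> E x t"
  using mu exps'[of x] by (simp add: E_def)

lemma E_zero [simp]: "E x 0 = 0" by (simp add: E_def)

lemma E_mono: assumes "x \<in> \<Omega>" "0 \<le> s" "s \<le> t" shows "E x s \<le> E x t"
  unfolding E_def using assms mu exps'[OF assms(1)]
  by (intro add_mono divide_right_mono mult_left_mono powr_mono2) auto

lemma E_add:
  assumes x: "x \<in> \<Omega>" and st: "0 \<le> s" "0 \<le> t" and k: "0 < \<kappa>"
  shows "E x (s + t) \<le> (1 + \<kappa>) powr P * E x s + (1 + 1 / \<kappa>) powr P * E x t"
proof -
  have "\<mu> x * (s + t) powr q x / q x \<le> \<mu> x * ((1 + \<kappa>) powr P * s powr q x +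
      (1 + 1 / \<kappa>) powr P * t powr q x) / q x"
    using mu[OF x] exps'[OF x] st k by (intro divide_right_mono mult_left_mono powr_add_le_weighted) auto
  moreover have "(s + t) powr p x / p x \<le> ((1 + \<kappa>) powr P * s powr p x + (1 + 1 / \<kappa>) powr P * t powr p x) / p x"
    using exps'[OF x] st k by (intro divide_right_mono powr_add_le_weighted) auto
  ultimately show ?thesis by (simp add: E_def algebra_simps add_divide_distrib)
qed

lemma E_le_H: assumes "x \<in> \<Omega>" shows "E x t \<le> H x t"
proof -
  have "t powr p x / p x \<le> t powr p x / 1" "\<mu> x * t powr q x / q x \<le> \<mu> x * t powr q x / 1"
    using exps'[OF assms] mu[OF assms] by (intro divide_left_mono; auto)+
  then show ?thesis by (simp add: E_def double_phase_def)
qed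

lemma H_le_E: assumes "x \<in> \<Omega>" shows "H x t \<le> P * E x t"
proof -
  have "a \<le> P * (a / r)" if "0 \<le> a" "1 < r" "r \<le> P" for a r
    using that mult_right_mono[of r P a] by (simp add: field_simps)
  from this[of "t powr p x" "p x"] this[of "\<mu> x * t powr q x" "q x"] show ?thesis
    using exps'[OF assms] mu[OF assms] by (simp add: E_def double_phase_def distrib_left)
qed

text \<open>The constant of \<open>powr_uniformly_convex\<close> is uniform over the interval of
  exponents, so it serves p x and q x at all points at once. The factor \<open>P\<close> passes from
  the defect of t^r to that of t^r / r.\<close>

lemma H_uniformly_convex:
  assumes \<epsilon>: "0 < \<epsilon>"
  shows "\<exists>C\<ge>0. \<forall>x\<in>\<Omega>. \<forall>a b::'b::euclidean_space.
    H x (norm (a - b)) \<le> \<epsilon> * (H x (norm a) + H x (norm b)) + C * (E x (norm a) + E x (norm b) - 2 * E x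
        (norm ((a + b) /\<^sub>R 2)))"
proof -
  obtain C where C: "0 \<le> C" "\<And>r a b::'b. r \<in> {p0..P} \<Longrightarrow>
      norm (a - b) powr r \<le> \<epsilon> * (norm a powr r + norm b powr r) + C * (norm a powr r + norm b powr r - 2 *
          norm ((a + b) /\<^sub>R 2) powr r)"
    using powr_uniformly_convex[OF p0 \<epsilon>, where 'b='b] by blast
  have main: "norm (a - b) powr r \<le> \<epsilon> * (norm a powr r + norm b powr r) + C * P *
      (norm a powr r / r + norm b powr r / r - 2 * (norm ((a + b) /\<^sub>R 2) powr r / r))"
    if r: "r \<in> {p0..P}" for r and a b :: 'b
  proof -
    define D where "D = norm a powr r + norm b powr r - 2 * norm ((a + b) /\<^sub>R 2) powr r"
    have D: "0 \<le> D" using norm_powr_midpoint_le[of r a b] r p0 by (simp add: D_def)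
    have "r * D \<le> P * D" using r D by (intro mult_right_mono) auto
    then have "D \<le> P * (D / r)" using r p0 by (simp add: le_divide_eq mult.commute)
    then have "C * D \<le> C * (P * (D / r))" using C(1) by (rule mult_left_mono)
    also have "\<dots> = C * P * (norm a powr r / r + norm b powr r / r - 2 * (norm ((a + b) /\<^sub>R 2) powr r / r))"
      by (simp add: D_def diff_divide_distrib add_divide_distrib)
    finally show ?thesis using C(2)[OF r, of a b] by (simp add: D_def)
  qed
  show ?thesis
  proof (intro exI[of _ "C * P"] conjI ballI allI)
    show "0 \<le> C * P" using C(1) p0 by simp
    fix x and a b :: 'b assume x: "x \<in> \<Omega>"
    have "p x \<in> {p0..P}" "q x \<in> {p0..P}" using exps'[OF x] by auto
    from main[OF this(1), of a b] mult_left_mono[OF main[OF this(2), of a b], of "\<mu> x"] mu[OF x]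
    show "H x (norm (a - b)) \<le> \<epsilon> * (H x (norm a) + H x (norm b)) + C * P * (E x (norm a) + E x
        (norm b) - 2 * E x (norm ((a + b) /\<^sub>R 2)))"
      by (simp add: double_phase_def E_def algebra_simps)
  qed
qed

text \<open>For t > c one has t at most t / c, which is at most (t / c)^p, and pulling out 1 / c
  costs at most the power \<open>P\<close>. The free parameter \<open>c\<close> is what makes L1
  norms small, and not just finite, when the modular is small.\<close>

lemma le_H:
  assumes x: "x \<in> \<Omega>" and t: "0 \<le> t" and c: "0 < c" "c \<le> 1"
  shows "t \<le> c + (1 / c) powr P * H x t"
proof (cases "t \<le> c")
  case True
  then show ?thesis using H_nonneg[OF x, of t] by (simp add: add_increasing2)
next
  case False
  have "t \<le> t / c" using c t by (simp add: le_divide_eq mult_left_le)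
  also have "\<dots> = (t / c) powr 1" using c t by simp
  also have "\<dots> \<le> (t / c) powr p x" using exps'[OF x] False c by (intro powr_mono) auto
  also have "\<dots> \<le> H x (1 / c * t)" using mu[OF x] by (simp add: double_phase_def)
  also have "\<dots> \<le> (1 / c) powr P * H x t" using c t by (intro H_scale_large[OF x]) auto
  finally show ?thesis using c by simp
qed

lemma powr_le_H: "x \<in> \<Omega> \<Longrightarrow> t powr p x \<le> H x t"
  using mu by (simp add: double_phase_def)

text \<open>Vector-valued, so that it covers functions and gradients alike. Convergence is measured
  by this modular; by \<open>mH_scale_small\<close> and \<open>mH_scale_large\<close> it is the
  convergence of the Luxemburg norm, without an infimum.\<close>

definition mH :: "(real^'n \<Rightarrow> 'b::euclidean_space) \<Rightarrow> ennreal" where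
  "mH w = (\<integral>\<^sup>+x. ennreal (H x (norm (w x))) \<partial>L)"

lemma mH_mono:
  assumes "AE x in L. norm (v x) \<le> norm (w x)"
  shows "mH v \<le> mH w"
  unfolding mH_def
proof (rule nn_integral_mono_AE)
  show "AE x in L. ennreal (H x (norm (v x))) \<le> ennreal (H x (norm (w x)))"
    using assms AE_space by eventually_elim (auto intro!: ennreal_leI H_mono)
qed

lemma mH_cong_AE: "AE x in L. v x = w x \<Longrightarrow> mH v = mH w"
  by (intro antisym mH_mono) (auto elim: eventually_mono)

lemma mH_zero [simp]: "mH (\<lambda>x. 0) = 0" by (simp add: mH_def)

lemma mH_minus [simp]: "mH (\<lambda>x. - w x) = mH w" by (simp add: mH_def)

lemma mH_diff_commute: "mH (\<lambda>x. v x - w x) = mH (\<lambda>x. w x - v x)" by (simp add: mH_def norm_minus_commute)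

lemma mH_add_weighted:
  assumes [measurable]: "u \<in> borel_measurable L" "v \<in> borel_measurable L" and k: "0 < \<kappa>"
  shows "mH (\<lambda>x. u x + v x) \<le> ennreal ((1 + \<kappa>) powr P) * mH u + ennreal ((1 + 1 / \<kappa>) powr P) * mH v"
proof -
  have "mH (\<lambda>x. u x + v x) \<le>
      (\<integral>\<^sup>+x. ennreal ((1 + \<kappa>) powr P) * ennreal (H x (norm (u x))) + ennreal ((1 + 1 / \<kappa>) powr P) * ennreal
          (H x (norm (v x))) \<partial>L)"
    unfolding mH_def
  proof (rule nn_integral_mono)
    fix x assume "x \<in> space L"
    then have x: "x \<in> \<Omega>" by simp
    have "H x (norm (u x + v x)) \<le> H x (norm (u x) + norm (v x))"
        by (intro H_mono[OF x] norm_triangle_ineq) auto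
    also have "\<dots> \<le> (1 + \<kappa>) powr P * H x (norm (u x)) + (1 + 1 / \<kappa>) powr P * H x (norm (v x))"
      by (rule H_add[OF x _ _ k]) auto
    finally show "ennreal (H x (norm (u x + v x))) \<le>
        ennreal ((1 + \<kappa>) powr P) * ennreal (H x (norm (u x))) + ennreal ((1 + 1 / \<kappa>) powr P) * ennreal (H x
        (norm (v x)))"
      using H_nonneg[OF x] by (simp add: ennreal_plus[symmetric] ennreal_mult[symmetric] del: ennreal_plus)
  qed
  also have "\<dots> = ennreal ((1 + \<kappa>) powr P) * mH u + ennreal ((1 + 1 / \<kappa>) powr P) * mH v"
    unfolding mH_def by (simp add: nn_integral_add nn_integral_cmult)
  finally show ?thesis .
qed

lemma mH_add:
  assumes "u \<in> borel_measurable L" "v \<in> borel_measurable L"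
  shows "mH (\<lambda>x. u x + v x) \<le> ennreal (2 powr P) * (mH u + mH v)"
  using mH_add_weighted[OF assms, of 1] by (simp add: distrib_left)

lemma mH_scale_aux:
  assumes [measurable]: "w \<in> borel_measurable L"
      and c: "\<And>x. x \<in> \<Omega> \<Longrightarrow> H x (\<bar>c\<bar> * norm (w x)) \<le> K * H x (norm (w x))" and K: "0 \<le> K"
  shows "mH (\<lambda>x. c *\<^sub>R w x) \<le> ennreal K * mH w"
proof -
  have "mH (\<lambda>x. c *\<^sub>R w x) \<le> (\<integral>\<^sup>+x. ennreal K * ennreal (H x (norm (w x))) \<partial>L)"
    unfolding mH_def using c K by (intro nn_integral_mono) (auto simp: ennreal_mult[symmetric] H_nonneg
        intro!: ennreal_leI)
  also have "\<dots> = ennreal K * mH w" unfolding mH_def by (simp add: nn_integral_cmult)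
  finally show ?thesis .
qed

lemma mH_scale_small:
  assumes "w \<in> borel_measurable L" "0 \<le> c" "c \<le> 1"
  shows "mH (\<lambda>x. c *\<^sub>R w x) \<le> ennreal (c powr p0) * mH w"
  using assms by (intro mH_scale_aux) (auto intro: H_scale_small)

lemma mH_scale_large:
  assumes "w \<in> borel_measurable L" "1 \<le> c"
  shows "mH (\<lambda>x. c *\<^sub>R w x) \<le> ennreal (c powr P) * mH w"
  using assms by (intro mH_scale_aux) (auto intro: H_scale_large)

lemma mH_scale:
  assumes "w \<in> borel_measurable L"
  shows "mH (\<lambda>x. c *\<^sub>R w x) \<le> ennreal ((1 + \<bar>c\<bar>) powr P) * mH w"
  using assms by (intro mH_scale_aux) (auto intro: H_scale)

lemma mH_bounded:
  assumes [measurable]: "w \<in> borel_measurable L" and B: "\<And>x. norm (w x) \<le> B"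
  shows "mH w < \<infinity>"
proof -
  have "mH w \<le> (\<integral>\<^sup>+x. ennreal ((1 + m0) * (1 + B) powr P) \<partial>L)"
    unfolding mH_def
  proof (intro nn_integral_mono ennreal_leI)
    fix x assume "x \<in> space L"
    then have x: "x \<in> \<Omega>" by simp
    have *: "norm (w x) powr r \<le> (1 + B) powr P" if "1 < r" "r \<le> P" for r
    proof -
      have "norm (w x) powr r \<le> (1 + B) powr r" using that B[of x] by (intro powr_mono2) auto
      also have "\<dots> \<le> (1 + B) powr P" using that B[of x] norm_ge_zero[of "w x"] by (intro powr_mono) linarith+
      finally show ?thesis .
    qed
    have "H x (norm (w x)) \<le> (1 + B) powr P + m0 * (1 + B) powr P"
      unfolding double_phase_def using mu[OF x] exps'[OF x] * by (intro add_mono mult_mono) auto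
    then show "H x (norm (w x)) \<le> (1 + m0) * (1 + B) powr P" by (simp add: algebra_simps)
  qed
  also have "\<dots> < \<infinity>" using emeasure_L(2) by (simp add: ennreal_mult_less_top)
  finally show ?thesis .
qed

lemma H_integrable:
  assumes [measurable]: "w \<in> borel_measurable L" and "mH w < \<infinity>"
  shows "integrable L (\<lambda>x. H x (norm (w x)))" "mH w = ennreal (LINT x|L. H x (norm (w x)))"
proof -
  have nn: "AE x in L. 0 \<le> H x (norm (w x))" by (rule AE_I2) (simp add: H_nonneg)
  show i: "integrable L (\<lambda>x. H x (norm (w x)))"
    using assms(2) nn by (intro integrableI_nonneg) (auto simp: mH_def)
  show "mH w = ennreal (LINT x|L. H x (norm (w x)))"
    unfolding mH_def using i nn by (rule nn_integral_eq_integral)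
qed

lemma integrable_if_mH:
  assumes [measurable]: "w \<in> borel_measurable L" and "mH w < \<infinity>"
  shows "integrable L w"
proof (rule Bochner_Integration.integrable_bound)
  show "integrable L (\<lambda>x. 1 + H x (norm (w x)))"
    using H_integrable(1)[OF assms] by (intro Bochner_Integration.integrable_add L.integrable_const)
  show "AE x in L. norm (w x) \<le> norm (1 + H x (norm (w x)))"
  proof (rule AE_I2)
    fix x assume "x \<in> space L"
    then show "norm (w x) \<le> norm (1 + H x (norm (w x)))"
        using le_H[of x "norm (w x)" 1] H_nonneg[of x "norm (w x)"] by simp
  qed
qed (rule assms(1))

text \<open>\<open>le_H\<close> is integrated: \<open>c\<close> is chosen so that its share c
  |\<Omega>| is at most \<epsilon> / 2, and then the modular so small that (1 / c)^P times it is at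
  most \<epsilon> / 2 as well.\<close>

lemma L1_small:
  assumes \<epsilon>: "0 < \<epsilon>"
  shows "\<exists>\<eta>>0. \<forall>w::real^'n \<Rightarrow> 'b::euclidean_space. w \<in> borel_measurable L \<longrightarrow> mH w \<le> ennreal \<eta> \<longrightarrow>
      (\<integral>\<^sup>+x. ennreal (norm (w x)) \<partial>L) \<le> ennreal \<epsilon>"
proof -
  define V where "V = measure L \<Omega>"
  have V: "0 \<le> V" by (simp add: V_def)
  define c where "c = min 1 (\<epsilon> / (2 * (V + 1)))"
  have c: "0 < c" "c \<le> 1" using \<epsilon> V by (auto simp: c_def)
  have cV: "c * V \<le> \<epsilon> / 2"
  proof -
    have "c * V \<le> \<epsilon> / (2 * (V + 1)) * (V + 1)" using V c \<epsilon> by (intro mult_mono) (auto simp: c_def)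
    also have "\<dots> = \<epsilon> / 2"
    proof -
      have "\<epsilon> / (2 * D) * D = \<epsilon> / 2" if "0 < D" for D using that by (simp add: field_simps)
      from this[of "V + 1"] V show ?thesis by simp
    qed
    finally show ?thesis .
  qed
  define K where "K = (1 / c) powr P"
  have K: "0 < K" using c by (simp add: K_def)
  show ?thesis
  proof (intro exI[of _ "\<epsilon> / (2 * K)"] conjI allI impI)
    show "0 < \<epsilon> / (2 * K)" using \<epsilon> K by simp
    fix w :: "real^'n \<Rightarrow> 'b" assume [measurable]: "w \<in> borel_measurable L" and w: "mH w \<le> ennreal (\<epsilon> / (2 * K))"
    have "(\<integral>\<^sup>+x. ennreal (norm (w x)) \<partial>L) \<le> (\<integral>\<^sup>+x. ennreal c + ennreal K * ennreal (H x (norm (w x))) \<partial>L)"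
    proof (rule nn_integral_mono)
      fix x assume "x \<in> space L"
      then have x: "x \<in> \<Omega>" by simp
      show "ennreal (norm (w x)) \<le> ennreal c + ennreal K * ennreal (H x (norm (w x)))"
        using le_H[OF x norm_ge_zero c, of "w x"] H_nonneg[OF x, of "norm (w x)"] c K
        by (simp add: ennreal_plus[symmetric] ennreal_mult[symmetric] K_def del: ennreal_plus)
    qed
    also have "\<dots> = ennreal c * ennreal V + ennreal K * mH w"
      using emeasure_L(1) by (simp add: nn_integral_add nn_integral_cmult mH_def V_def)
    also have "\<dots> \<le> ennreal c * ennreal V + ennreal K * ennreal (\<epsilon> / (2 * K))"
      using w by (intro add_left_mono mult_left_mono) auto
    also have "\<dots> = ennreal (c * V + \<epsilon> / 2)"
      using c V K \<epsilon> by (simp add: ennreal_plus[symmetric] ennreal_mult[symmetric] del: ennreal_plus)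
    also have "\<dots> \<le> ennreal \<epsilon>" using cV by (intro ennreal_leI) simp
    finally show "(\<integral>\<^sup>+x. ennreal (norm (w x)) \<partial>L) \<le> ennreal \<epsilon>" .
  qed
qed

text \<open>Modular Cauchy sequences are Cauchy in L1, which supplies a limit almost everywhere
  along a subsequence. Fatou's lemma in the second index then shows that the whole sequence
  converges to it in the modular.\<close>

lemma mH_complete:
  fixes w :: "nat \<Rightarrow> real^'n \<Rightarrow> 'b::euclidean_space"
  assumes w [measurable]: "\<And>n. w n \<in> borel_measurable L" and fin: "\<And>n. mH (w n) < \<infinity>"
    and cauchy: "\<And>\<epsilon>. 0 < \<epsilon> \<Longrightarrow> \<exists>N. \<forall>m\<ge>N. \<forall>n\<ge>N. mH (\<lambda>x. w m x - w n x) \<le> ennreal \<epsilon>"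
  obtains r v where "strict_mono (r::nat\<Rightarrow>nat)" "v \<in> borel_measurable L" "AE x in L. (\<lambda>n. w (r n) x) \<longlonglongrightarrow> v x"
    "\<And>\<epsilon>. 0 < \<epsilon> \<Longrightarrow> \<exists>N. \<forall>n\<ge>N. mH (\<lambda>x. w n x - v x) \<le> ennreal \<epsilon>"
proof -
  have int: "integrable L (w n)" for n by (rule integrable_if_mH[OF w fin])
  have L1: "\<exists>N. \<forall>i\<ge>N. \<forall>j\<ge>N. (LINT x|L. norm (w i x - w j x)) < \<epsilon>" if "0 < \<epsilon>" for \<epsilon>
  proof -
    have "0 < \<epsilon> / 2" using that by simp
    from L1_small[OF this, where 'b='b] obtain \<eta> where \<eta>: "0 < \<eta>"
      "\<And>v::real^'n \<Rightarrow> 'b. v \<in> borel_measurable L \<Longrightarrow> mH v \<le> ennreal \<eta> \<Longrightarrow> (\<integral>\<^sup>+x. ennreal (norm (v x)) \<partial>L) \<le>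
          ennreal (\<epsilon> / 2)"
      by blast
    obtain N where N: "\<forall>m\<ge>N. \<forall>n\<ge>N. mH (\<lambda>x. w m x - w n x) \<le> ennreal \<eta>" using cauchy[OF \<eta>(1)] by blast
    have "(LINT x|L. norm (w i x - w j x)) < \<epsilon>" if ij: "i \<ge> N" "j \<ge> N" for i j
    proof -
      have "ennreal (LINT x|L. norm (w i x - w j x)) = (\<integral>\<^sup>+x. ennreal (norm (w i x - w j x)) \<partial>L)"
        using int by (intro nn_integral_eq_integral[symmetric] integrable_norm
            Bochner_Integration.integrable_diff) auto
      also have "\<dots> \<le> ennreal (\<epsilon> / 2)" using N ij by (intro \<eta>(2)) auto
      finally have "(LINT x|L. norm (w i x - w j x)) \<le> \<epsilon> / 2" using \<open>0 < \<epsilon>\<close> by (simp add: ennreal_le_iff)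
      then show ?thesis using \<open>0 < \<epsilon>\<close> by simp
    qed
    then show ?thesis by blast
  qed
  obtain r where r: "strict_mono r" and ae: "AE x in L. Cauchy (\<lambda>i. w (r i) x)"
    using cauchy_L1_AE_cauchy_subseq[OF int L1] by blast
  define v where "v x = lim (\<lambda>i. w (r i) x)" for x
  have [measurable]: "v \<in> borel_measurable L" unfolding v_def [abs_def]
      by (rule borel_measurable_lim_metric) measurable
  have lim: "AE x in L. (\<lambda>n. w (r n) x) \<longlonglongrightarrow> v x"
    using ae by eventually_elim (simp add: v_def Cauchy_convergent_iff convergent_LIMSEQ_iff)
  have "\<exists>N. \<forall>n\<ge>N. mH (\<lambda>x. w n x - v x) \<le> ennreal \<epsilon>" if \<epsilon>: "0 < \<epsilon>" for \<epsilon>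
  proof -
    obtain N where N: "\<forall>m\<ge>N. \<forall>n\<ge>N. mH (\<lambda>x. w m x - w n x) \<le> ennreal \<epsilon>" using cauchy[OF \<epsilon>] by blast
    have "mH (\<lambda>x. w n x - v x) \<le> ennreal \<epsilon>" if n: "n \<ge> N" for n
    proof -
      have "mH (\<lambda>x. w n x - v x) = (\<integral>\<^sup>+x. liminf (\<lambda>k. ennreal (H x (norm (w n x - w (r k) x)))) \<partial>L)"
        unfolding mH_def
      proof (rule nn_integral_cong_AE)
        show "AE x in L. ennreal (H x (norm (w n x - v x))) =
            liminf (\<lambda>k. ennreal (H x (norm (w n x - w (r k) x))))"
          using lim AE_space
        proof eventually_elim
          case (elim x)
          then have x: "x \<in> \<Omega>" by simp
          have t: "(\<lambda>k. norm (w n x - w (r k) x)) \<longlonglongrightarrow> norm (w n x - v x)" using elim(1) by (intro tendsto_intros)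
          have "(\<lambda>k. H x (norm (w n x - w (r k) x))) \<longlonglongrightarrow> H x (norm (w n x - v x))"
            unfolding double_phase_def using exps'[OF x]
            by (intro tendsto_add tendsto_mult tendsto_const tendsto_powr'[OF t tendsto_const]) auto
          then have "(\<lambda>k. ennreal (H x (norm (w n x - w (r k) x)))) \<longlonglongrightarrow> ennreal (H x (norm (w n x - v x)))"
            by (rule tendsto_ennrealI)
          then show ?case by (simp add: lim_imp_Liminf)
        qed
      qed
      also have "\<dots> \<le> liminf (\<lambda>k. \<integral>\<^sup>+x. ennreal (H x (norm (w n x - w (r k) x))) \<partial>L)"
        by (rule nn_integral_liminf) measurable
      also have "\<dots> \<le> ennreal \<epsilon>"
      proof (rule Liminf_le)
        show "\<forall>\<^sub>F k in sequentially. (\<integral>\<^sup>+x. ennreal (H x (norm (w n x - w (r k) x))) \<partial>L) \<le> ennreal \<epsilon>"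
          using eventually_ge_at_top[of N]
        proof eventually_elim
          case (elim k)
          then have "N \<le> r k" using seq_suble[OF r, of k] by simp
          then show ?case using N n by (simp add: mH_def)
        qed
      qed simp
      finally show ?thesis .
    qed
    then show ?thesis by blast
  qed
  from that[OF r _ lim this] show ?thesis by simp
qed

end

section \<open>Schauder's fixed point theorem in \<open>L\<^sup>1\<close>\<close>

lemma bounded_coordinates_subseq:
  fixes Q :: "nat \<Rightarrow> nat \<Rightarrow> real"
  assumes "\<And>k j. j < m \<Longrightarrow> 0 \<le> Q k j \<and> Q k j \<le> 1"
  shows "\<exists>r l. strict_mono (r::nat\<Rightarrow>nat) \<and> (\<forall>j<m. (\<lambda>k. Q (r k) j) \<longlonglongrightarrow> l j)"
  using assms
proof (induction m)
  case 0
  show ?case by (rule exI[of _ id]) (auto simp: strict_mono_def)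
next
  case (Suc m)
  then obtain r l where r: "strict_mono (r::nat\<Rightarrow>nat)" "\<forall>j<m. (\<lambda>k. Q (r k) j) \<longlonglongrightarrow> l j" by force
  have "seq_compact {0..1::real}" using compact_Icc by (simp add: compact_eq_seq_compact_metric)
  moreover have "\<forall>k. Q (r k) m \<in> {0..1}" using Suc.prems by auto
  ultimately obtain y s where s: "strict_mono s" "((\<lambda>k. Q (r k) m) \<circ> s) \<longlonglongrightarrow> y"
    using seq_compactE[of "{0..1}" "\<lambda>k. Q (r k) m"] by metis
  have "(\<lambda>k. Q ((r \<circ> s) k) j) \<longlonglongrightarrow> (l(m := y)) j" if "j < Suc m" for j
  proof (cases "j = m")
    case True then show ?thesis using s(2) by (simp add: o_def)
  next
    case False
    then have "(\<lambda>k. Q (r k) j) \<longlonglongrightarrow> l j" using r(2) that by auto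
    from LIMSEQ_subseq_LIMSEQ[OF this s(1)] show ?thesis using False by (simp add: o_def)
  qed
  moreover have "strict_mono (r \<circ> s)" using r(1) s(1) by (rule strict_mono_o)
  ultimately show ?case by blast
qed

text \<open>Brouwer's theorem in a dimension that is a number rather than a type.\<close>
lemma brouwer_unit_cube:
  fixes h :: "(nat \<Rightarrow> real) \<Rightarrow> nat \<Rightarrow> real"
  assumes maps: "\<And>c i. (\<forall>j<m. 0 \<le> c j \<and> c j \<le> 1) \<Longrightarrow> i < m \<Longrightarrow> 0 \<le> h c i \<and> h c i \<le> 1"
    and cont: "\<And>c l i. (\<forall>k. \<forall>j<m. 0 \<le> c k j \<and> c k j \<le> 1) \<Longrightarrow> (\<forall>j<m. (\<lambda>k. c k j) \<longlonglongrightarrow> l j) \<Longrightarrow> i < m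
        \<Longrightarrow> (\<lambda>k. h (c k) i) \<longlonglongrightarrow> h l i"
  obtains c where "\<forall>j<m. 0 \<le> c j \<and> c j \<le> 1" "\<forall>j<m. h c j = c j"
proof -
  \<comment> \<open>On a grid of mesh 1 / (k + 1), Kuhn's lemma finds a cell that has for every
    coordinate a corner \<open>A\<close> where \<open>h\<close> does not lower it and a corner
    \<open>B\<close> where \<open>h\<close> does not raise it. Refining the grid sends all these
    corners to a common limit.\<close>
  have step: "\<exists>Q. (\<forall>j<m. 0 \<le> Q j \<and> Q j \<le> 1) \<and> (\<forall>i<m. \<exists>A B.
      (\<forall>j<m. 0 \<le> A j \<and> A j \<le> 1 \<and> \<bar>A j - Q j\<bar> \<le> 1 / Suc k) \<and>
      (\<forall>j<m. 0 \<le> B j \<and> B j \<le> 1 \<and> \<bar>B j - Q j\<bar> \<le> 1 / Suc k) \<and> A i \<le> h A i \<and> h B i \<le> B i)" for k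
  proof -
    define p where "p = Suc k"
    have p: "p > 0" by (simp add: p_def)
    define sc where "sc x j = real (x j) / real p" for x :: "nat \<Rightarrow> nat" and j
    \<comment> \<open>The clauses for 0 and \<open>p\<close> impose the labels that Kuhn's lemma
      prescribes on opposite faces; elsewhere the label tells whether \<open>h\<close> lowers the
      coordinate.\<close>
    define label :: "(nat \<Rightarrow> nat) \<Rightarrow> nat \<Rightarrow> nat" where
      "label x i = (if x i \<noteq> 0 \<and> (x i = p \<or> h (sc x) i < sc x i) then 1 else 0)" for x i
    have cube: "\<forall>j<m. 0 \<le> sc x j \<and> sc x j \<le> 1" if "\<forall>j<m. x j \<le> p" for x
      using that p by (auto simp: sc_def divide_le_eq)
    obtain q where q: "\<forall>i<m. q i < p"
      "\<forall>i<m. \<exists>r s. (\<forall>j<m. q j \<le> r j \<and> r j \<le> q j + 1) \<and> (\<forall>j<m. q j \<le> s j \<and> s j \<le>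
          q j + 1) \<and> label r i \<noteq> label s i"
      by (rule kuhn_lemma[of p m label]) (use p in \<open>auto simp: label_def\<close>)
    have "\<exists>A B.
      (\<forall>j<m. 0 \<le> A j \<and> A j \<le> 1 \<and> \<bar>A j - sc q j\<bar> \<le> 1 / Suc k) \<and>
      (\<forall>j<m. 0 \<le> B j \<and> B j \<le> 1 \<and> \<bar>B j - sc q j\<bar> \<le> 1 / Suc k) \<and> A i \<le> h A i \<and> h B i \<le> B i" if i: "i < m" for i
    proof -
      obtain r s where rs: "\<forall>j<m. q j \<le> r j \<and> r j \<le> q j + 1" "\<forall>j<m. q j \<le> s j \<and> s j \<le> q j + 1"
        "label r i \<noteq> label s i" using q(2) i by blast
      have "\<exists>a b. (\<forall>j<m. q j \<le> a j \<and> a j \<le> q j + 1) \<and> (\<forall>j<m. q j \<le> b j \<and> b j \<le> q j + 1) \<and>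
          label a i = 0 \<and> label b i = 1"
      proof (cases "label r i = 0")
        case True
        then have "label s i = 1" using rs(3) by (auto simp: label_def split: if_splits)
        with True rs show ?thesis by blast
      next
        case False
        then have "label r i = 1" "label s i = 0" using rs(3) by (auto simp: label_def split: if_splits)
        with rs show ?thesis by blast
      qed
      then obtain a b where ab: "\<forall>j<m. q j \<le> a j \<and> a j \<le> q j + 1" "\<forall>j<m. q j \<le> b j \<and> b j \<le> q j + 1"
          "label a i = 0" "label b i = 1" by blast
      have near: "(\<forall>j<m. 0 \<le> sc x j \<and> sc x j \<le> 1 \<and> \<bar>sc x j - sc q j\<bar> \<le> 1 / Suc k)"
        if "\<forall>j<m. q j \<le> x j \<and> x j \<le> q j + 1" for x
      proof (intro allI impI)
        fix j assume j: "j < m"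
        have x: "q j \<le> x j" "x j \<le> q j + 1" "x j \<le> p" using that[rule_format, OF j] q(1)[rule_format, OF j]
            by auto
        have "\<bar>sc x j - sc q j\<bar> = \<bar>real (x j) - real (q j)\<bar> / real p"
          using p by (simp add: sc_def diff_divide_distrib[symmetric])
        also have "\<dots> \<le> 1 / real p" using x by (intro divide_right_mono) auto
        finally show "0 \<le> sc x j \<and> sc x j \<le> 1 \<and> \<bar>sc x j - sc q j\<bar> \<le> 1 / Suc k"
          using x p by (auto simp: p_def sc_def divide_le_eq)
      qed
      have "sc a i \<le> h (sc a) i"
      \<comment> \<open>On a face the label carries no information on \<open>h\<close>, but there
        the inequality follows from \<open>h\<close> mapping the cube into itself.\<close>
      proof (cases "a i = 0")
        case True
        have "\<forall>j<m. 0 \<le> sc a j \<and> sc a j \<le> 1" using near[OF ab(1)] by blast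
        moreover have "sc a i = 0" using True by (simp add: sc_def)
        ultimately show ?thesis using maps[OF _ i, of "sc a"] by simp
      qed (use ab(3) in \<open>auto simp: label_def split: if_splits\<close>)
      moreover have "h (sc b) i \<le> sc b i"
      proof (cases "b i = p")
        case True
        have "\<forall>j<m. 0 \<le> sc b j \<and> sc b j \<le> 1" using near[OF ab(2)] by blast
        moreover have "sc b i = 1" using True p by (simp add: sc_def)
        ultimately show ?thesis using maps[OF _ i, of "sc b"] by simp
      qed (use ab(4) in \<open>auto simp: label_def split: if_splits\<close>)
      ultimately show ?thesis using near[OF ab(1)] near[OF ab(2)] by blast
    qed
    moreover have "\<forall>j<m. 0 \<le> sc q j \<and> sc q j \<le> 1" using q(1) by (intro cube) auto
    ultimately show ?thesis by blast
  qed
  obtain Q where Q: "\<And>k j. j < m \<Longrightarrow> 0 \<le> Q k j \<and> Q k j \<le> 1"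
    "\<And>k i. i < m \<Longrightarrow> \<exists>A B.
      (\<forall>j<m. 0 \<le> A j \<and> A j \<le> 1 \<and> \<bar>A j - Q k j\<bar> \<le> 1 / Suc k) \<and>
      (\<forall>j<m. 0 \<le> B j \<and> B j \<le> 1 \<and> \<bar>B j - Q k j\<bar> \<le> 1 / Suc k) \<and> A i \<le> h A i \<and> h B i \<le> B i"
    using step by metis
  obtain r l where r: "strict_mono (r::nat\<Rightarrow>nat)" and l: "\<And>j. j < m \<Longrightarrow> (\<lambda>k. Q (r k) j) \<longlonglongrightarrow> l j"
    using bounded_coordinates_subseq[of m Q] Q(1) by blast
  have lim: "(\<lambda>k. A k j) \<longlonglongrightarrow> l j" if "j < m" "\<And>k. \<bar>A k j - Q (r k) j\<bar> \<le> 1 / Suc (r k)"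
      for A :: "nat \<Rightarrow> nat \<Rightarrow> real" and j
  proof -
    have "(\<lambda>k. 1 / real (Suc (r k))) \<longlonglongrightarrow> 0"
      using LIMSEQ_subseq_LIMSEQ[OF LIMSEQ_inverse_real_of_nat r] by (simp add: o_def inverse_eq_divide)
    then have "(\<lambda>k. A k j - Q (r k) j) \<longlonglongrightarrow> 0"
      by (rule Lim_null_comparison[rotated]) (use that(2) in auto)
    from tendsto_add[OF this l[OF that(1)]] show ?thesis by simp
  qed
  have l01: "0 \<le> l j \<and> l j \<le> 1" if "j < m" for j
    using LIMSEQ_le_const[OF l[OF that], of 0] LIMSEQ_le_const2[OF l[OF that], of 1] Q(1)[OF that] by auto
  have "h l i = l i" if i: "i < m" for i
  proof -
    obtain A B where A: "\<And>k j. j < m \<Longrightarrow> 0 \<le> A k j \<and> A k j \<le> 1 \<and> \<bar>A k j - Q k j\<bar> \<le> 1 / Suc k"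
      and B: "\<And>k j. j < m \<Longrightarrow> 0 \<le> B k j \<and> B k j \<le> 1 \<and> \<bar>B k j - Q k j\<bar> \<le> 1 / Suc k"
      and AB: "\<And>k. A k i \<le> h (A k) i" "\<And>k. h (B k) i \<le> B k i"
      using Q(2)[OF i] by metis
    have lA: "(\<lambda>k. A (r k) j) \<longlonglongrightarrow> l j" and lB: "(\<lambda>k. B (r k) j) \<longlonglongrightarrow> l j" if "j < m" for j
      using A B that by (auto intro!: lim[of j "\<lambda>k. A (r k)"] lim[of j "\<lambda>k. B (r k)"])
    have "(\<lambda>k. h (A (r k)) i) \<longlonglongrightarrow> h l i" "(\<lambda>k. h (B (r k)) i) \<longlonglongrightarrow> h l i"
      using A B lA lB i by (auto intro!: cont)
    then have "l i \<le> h l i" "h l i \<le> l i"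
      using AB lA[OF i] lB[OF i] by (auto intro: LIMSEQ_le)
    then show ?thesis by simp
  qed
  with l01 show ?thesis by (intro that[of l]) auto
qed

text \<open>Schauder's theorem: the fixed points of the finite-dimensional approximations of \<open>T\<close> by convex
  combinations of a finite \<open>\<epsilon>\<close>-net of \<open>T ` K\<close> accumulate at a fixed point of \<open>T\<close>.\<close>
lemma schauder_L1:
  fixes T :: "('a \<Rightarrow> 'b::{banach, second_countable_topology}) \<Rightarrow> ('a \<Rightarrow> 'b)" and M :: "'a measure"
  defines "d \<equiv> (\<lambda>F G. LINT x|M. norm (F x - G x))"
  assumes int: "\<And>F. F \<in> K \<Longrightarrow> integrable M F"
    and conv: "\<And>(c::nat \<Rightarrow> real) F m. (\<And>j. j < m \<Longrightarrow> 0 \<le> c j \<and> F j \<in> K) \<Longrightarrow> (\<Sum>j<m. c j) \<le> 1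
        \<Longrightarrow> (\<lambda>x. \<Sum>j<m. c j *\<^sub>R F j x) \<in> K"
    and TK: "\<And>F. F \<in> K \<Longrightarrow> T F \<in> K"
    and cpt: "\<And>F. (\<And>n::nat. F n \<in> K) \<Longrightarrow> \<exists>r G. strict_mono r \<and> G \<in> K \<and> (\<lambda>n. d (T (F (r n))) G) \<longlonglongrightarrow> 0"
    and cont: "\<And>F G. (\<And>n::nat. F n \<in> K) \<Longrightarrow> G \<in> K \<Longrightarrow> (\<lambda>n. d (F n) G) \<longlonglongrightarrow> 0 \<Longrightarrow> (\<lambda>n. d (T (F n)) (T G)) \<longlonglongrightarrow> 0"
  obtains F where "F \<in> K" "d F (T F) = 0"
proof -
  have d0: "0 \<le> d F G" for F G by (simp add: d_def)
  have sym: "d F G = d G F" for F G by (simp add: d_def norm_minus_commute)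
  have tri: "d F H \<le> d F G + d G H" if "F \<in> K" "G \<in> K" "H \<in> K" for F G H
  proof -
    have "d F H \<le> (LINT x|M. norm (F x - G x) + norm (G x - H x))"
      unfolding d_def using that int
      by (intro integral_mono Bochner_Integration.integrable_add integrable_norm
          Bochner_Integration.integrable_diff)
        (auto intro: norm_triangle_sub order_trans[OF _ norm_triangle_ineq])
    also have "\<dots> = d F G + d G H"
      unfolding d_def using that int
      by (intro Bochner_Integration.integral_add integrable_norm Bochner_Integration.integrable_diff)
    finally show ?thesis .
  qed
  have net: "\<exists>m::nat. \<exists>G. (\<forall>j<m. G j \<in> K) \<and> (\<forall>F\<in>K. \<exists>j<m. d (T F) (G j) < \<epsilon>)" if e: "\<epsilon> > 0" for \<epsilon>
  proof (rule ccontr)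
    assume no: "\<not> ?thesis"
    \<comment> \<open>Without a finite net, a sequence with \<epsilon>-separated images can be
      picked one by one, which contradicts \<open>cpt\<close>.\<close>
    have "\<exists>f. \<forall>n::nat. f n \<in> K \<and> (\<forall>j<n. \<epsilon> \<le> d (T (f n)) (T (f j)))"
    proof (rule dependent_wf_choice[of less_than "\<lambda>f n r. r \<in> K \<and> (\<forall>j<n. \<epsilon> \<le> d (T r) (T (f j)))"])
      fix n and f :: "nat \<Rightarrow> 'a \<Rightarrow> 'b"
      assume *: "\<And>y. (y, n) \<in> less_than \<Longrightarrow> f y \<in> K \<and> (\<forall>j<y. \<epsilon> \<le> d (T (f y)) (T (f j)))"
      then have "\<forall>j<n. T (f j) \<in> K" using TK by auto
      have "\<not> (\<forall>F\<in>K. \<exists>j<n. d (T F) (T (f j)) < \<epsilon>)"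
      proof
        assume "\<forall>F\<in>K. \<exists>j<n. d (T F) (T (f j)) < \<epsilon>"
        then have "\<exists>m::nat. \<exists>G. (\<forall>j<m. G j \<in> K) \<and> (\<forall>F\<in>K. \<exists>j<m. d (T F) (G j) < \<epsilon>)"
          using \<open>\<forall>j<n. T (f j) \<in> K\<close> by (intro exI[of _ n] exI[of _ "\<lambda>j. T (f j)"] conjI)
        with no show False by (rule notE)
      qed
      then obtain F where "F \<in> K" "\<And>j. j < n \<Longrightarrow> \<not> d (T F) (T (f j)) < \<epsilon>" by blast
      then show "\<exists>r. r \<in> K \<and> (\<forall>j<n. \<epsilon> \<le> d (T r) (T (f j)))" by (intro exI[of _ F]) (auto simp: not_less)
    qed auto
    then obtain f where f: "\<And>n::nat. f n \<in> K" "\<And>n j. j < n \<Longrightarrow> \<epsilon> \<le> d (T (f n)) (T (f j))" by blast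
    obtain r G where r: "strict_mono r" "G \<in> K" "(\<lambda>n. d (T (f (r n))) G) \<longlonglongrightarrow> 0"
      using cpt[of f, OF f(1)] by blast
    from order_tendstoD(2)[OF r(3), of "\<epsilon> / 2"] e obtain N where N: "\<And>n. n \<ge> N \<Longrightarrow> d (T (f (r n))) G < \<epsilon> / 2"
      by (auto simp: eventually_sequentially)
    have "d (T (f (r (Suc N)))) (T (f (r N))) \<le> d (T (f (r (Suc N)))) G + d G (T (f (r N)))"
      using f(1) r(2) TK by (intro tri) auto
    also have "\<dots> < \<epsilon>" using N[of N] N[of "Suc N"] sym[of G "T (f (r N))"] by simp
    finally show False using f(2)[of "r N" "r (Suc N)"] r(1) by (simp add: strict_mono_Suc_iff)
  qed
  have approx: "\<exists>F\<in>K. d F (T F) \<le> \<epsilon>" if e: "\<epsilon> > 0" for \<epsilon>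
  proof -
    obtain m :: nat and G where G: "\<And>j. j < m \<Longrightarrow> G j \<in> K" "\<And>F. F \<in> K \<Longrightarrow> \<exists>j<m. d (T F) (G j) < \<epsilon>"
      using net[OF e] by blast
    \<comment> \<open>Points of the cube whose coordinates sum to more than 1 are scaled back. Since
      \<open>K\<close> also admits sums below 1, the whole cube can stand in for the
      simplex.\<close>
    define co where "co c j = c j / max 1 (\<Sum>i<m. c i)" for c :: "nat \<Rightarrow> real" and j
    define Fc where "Fc c x = (\<Sum>j<m. co c j *\<^sub>R G j x)" for c x
    have FcK: "Fc c \<in> K" if c: "\<forall>j<m. 0 \<le> c j \<and> c j \<le> 1" for c
      unfolding Fc_def [abs_def]
    proof (rule conv)
      show "0 \<le> co c j \<and> G j \<in> K" if "j < m" for j using c G(1) that by (auto simp: co_def)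
      have "(\<Sum>j<m. co c j) = (\<Sum>j<m. c j) / max 1 (\<Sum>i<m. c i)" by (simp add: co_def sum_divide_distrib)
      then show "(\<Sum>j<m. co c j) \<le> 1" by (simp add: divide_le_eq)
    qed
    \<comment> \<open>Schauder's weights: positive only for net points within \<epsilon> of
      \<open>T (Fc c)\<close>, and not all 0 because the net covers the image.\<close>
    define lam where "lam c j = max 0 (\<epsilon> - d (T (Fc c)) (G j))" for c j
    define h where "h c j = lam c j / (\<Sum>i<m. lam c i)" for c j
    have S: "0 < (\<Sum>i<m. lam c i)" if c01: "\<forall>j<m. 0 \<le> c j \<and> c j \<le> 1" for c
    proof -
      obtain j where "j < m" "d (T (Fc c)) (G j) < \<epsilon>" using G(2)[OF FcK[OF c01]] by blast
      then show ?thesis by (intro sum_pos2[of _ j]) (auto simp: lam_def)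
    qed
    obtain c where c: "\<forall>j<m. 0 \<le> c j \<and> c j \<le> 1" "\<forall>j<m. h c j = c j"
    proof (rule brouwer_unit_cube[of m h])
      fix c i assume c: "\<forall>j<m. 0 \<le> c j \<and> c j \<le> (1::real)" and i: "i < (m::nat)"
      have "lam c i \<le> (\<Sum>i<m. lam c i)" using i by (intro member_le_sum) (auto simp: lam_def)
      then show "0 \<le> h c i \<and> h c i \<le> 1" using S[OF c] by (auto simp: h_def lam_def)
    next
      fix c :: "nat \<Rightarrow> nat \<Rightarrow> real" and l i
      assume c: "\<forall>k. \<forall>j<m. 0 \<le> c k j \<and> c k j \<le> 1" and l: "\<forall>j<m. (\<lambda>k. c k j) \<longlonglongrightarrow> l j" and i: "i < m"
      have l01: "\<forall>j<m. 0 \<le> l j \<and> l j \<le> 1"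
      proof (intro allI impI)
        fix j assume "j < m"
        then show "0 \<le> l j \<and> l j \<le> 1"
          using LIMSEQ_le_const[of "\<lambda>k. c k j" "l j" 0] LIMSEQ_le_const2[of "\<lambda>k. c k j" "l j" 1] c l by auto
      qed
      have co: "(\<lambda>k. co (c k) j) \<longlonglongrightarrow> co l j" if "j < m" for j
      proof -
        have "(\<lambda>k. \<Sum>i<m. c k i) \<longlonglongrightarrow> (\<Sum>i<m. l i)" using l by (intro tendsto_sum) auto
        then show ?thesis unfolding co_def using that l by (intro tendsto_intros) (auto simp: max_def)
      qed
      have bound: "d (Fc (c k)) (Fc l) \<le> (\<Sum>j<m. \<bar>co (c k) j - co l j\<bar> * (LINT x|M. norm (G j x)))" for k
      proof -
        have "d (Fc (c k)) (Fc l) \<le> (LINT x|M. (\<Sum>j<m. \<bar>co (c k) j - co l j\<bar> * norm (G j x)))"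
          unfolding d_def
        proof (intro integral_mono)
          show "integrable M (\<lambda>x. norm (Fc (c k) x - Fc l x))"
            using int[OF FcK[OF l01]] int[OF FcK, of "c k"] c by auto
          show "integrable M (\<lambda>x. \<Sum>j<m. \<bar>co (c k) j - co l j\<bar> * norm (G j x))"
            using int G(1) by (intro Bochner_Integration.integrable_sum integrable_mult_right
                integrable_norm) auto
          fix x
          have "Fc (c k) x - Fc l x = (\<Sum>j<m. (co (c k) j - co l j) *\<^sub>R G j x)"
            by (simp add: Fc_def sum_subtractf scaleR_left_diff_distrib)
          then show "norm (Fc (c k) x - Fc l x) \<le> (\<Sum>j<m. \<bar>co (c k) j - co l j\<bar> * norm (G j x))"
            using norm_sum[of "\<lambda>j. (co (c k) j - co l j) *\<^sub>R G j x" "{..<m}"] by simp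
        qed
        also have "\<dots> = (\<Sum>j<m. \<bar>co (c k) j - co l j\<bar> * (LINT x|M. norm (G j x)))"
          using int G(1) by (subst Bochner_Integration.integral_sum) auto
        finally show ?thesis .
      qed
      have "(\<lambda>k. \<Sum>j<m. \<bar>co (c k) j - co l j\<bar> * (LINT x|M. norm (G j x))) \<longlonglongrightarrow>
          (\<Sum>j<m. \<bar>co l j - co l j\<bar> * (LINT x|M. norm (G j x)))"
        using co by (intro tendsto_sum tendsto_mult tendsto_rabs tendsto_diff tendsto_const) auto
      then have "(\<lambda>k. \<Sum>j<m. \<bar>co (c k) j - co l j\<bar> * (LINT x|M. norm (G j x))) \<longlonglongrightarrow> 0" by simp
      then have "(\<lambda>k. d (Fc (c k)) (Fc l)) \<longlonglongrightarrow> 0"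
        by (rule Lim_null_comparison[rotated]) (use bound d0 in auto)
      then have Tc: "(\<lambda>k. d (T (Fc (c k))) (T (Fc l))) \<longlonglongrightarrow> 0"
        using FcK c l01 by (intro cont) auto
      have lam: "(\<lambda>k. lam (c k) j) \<longlonglongrightarrow> lam l j" if j: "j < m" for j
      proof -
        have "\<bar>d (T (Fc (c k))) (G j) - d (T (Fc l)) (G j)\<bar> \<le> d (T (Fc (c k))) (T (Fc l))" for k
          using tri[of "T (Fc (c k))" "T (Fc l)" "G j"] tri[of "T (Fc l)" "T (Fc (c k))" "G j"]
            sym[of "T (Fc (c k))" "T (Fc l)"] G(1)[OF j] TK FcK c l01 by auto
        then have "(\<lambda>k. d (T (Fc (c k))) (G j) - d (T (Fc l)) (G j)) \<longlonglongrightarrow> 0"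
          by (intro Lim_null_comparison[OF _ Tc]) auto
        then have "(\<lambda>k. d (T (Fc (c k))) (G j)) \<longlonglongrightarrow> d (T (Fc l)) (G j)" by (simp add: LIM_zero_iff)
        then show ?thesis unfolding lam_def by (intro tendsto_intros)
      qed
      show "(\<lambda>k. h (c k) i) \<longlonglongrightarrow> h l i"
        unfolding h_def using S[OF l01] lam i by (intro tendsto_divide tendsto_sum) auto
    qed
    \<comment> \<open>The coordinates of the fixed point are normalized weights, so the rescaling in
      \<open>co\<close> is inactive at it.\<close>
    have sum1: "(\<Sum>j<m. c j) = 1"
    proof -
      have "(\<Sum>j<m. c j) = (\<Sum>j<m. h c j)" using c(2) by simp
      also have "\<dots> = 1" using S[OF c(1)] by (simp add: h_def sum_divide_distrib[symmetric])
      finally show ?thesis .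
    qed
    then have Fc: "Fc c x = (\<Sum>j<m. c j *\<^sub>R G j x)" for x by (simp add: Fc_def co_def)
    let ?F = "Fc c"
    have FK: "?F \<in> K" by (rule FcK[OF c(1)])
    have "d ?F (T ?F) \<le> (LINT x|M. (\<Sum>j<m. c j * norm (T ?F x - G j x)))"
      unfolding d_def
    proof (intro integral_mono)
      show "integrable M (\<lambda>x. norm (?F x - T ?F x))" using int[OF FK] int[OF TK[OF FK]] by auto
      show "integrable M (\<lambda>x. \<Sum>j<m. c j * norm (T ?F x - G j x))"
        using int int[OF TK[OF FK]] G(1)
        by (intro Bochner_Integration.integrable_sum integrable_mult_right integrable_norm
            Bochner_Integration.integrable_diff) auto
      fix x
      have "?F x - T ?F x = (\<Sum>j<m. c j *\<^sub>R G j x) - (\<Sum>j<m. c j) *\<^sub>R T ?F x" using Fc sum1 by simp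
      also have "\<dots> = (\<Sum>j<m. c j *\<^sub>R (G j x - T ?F x))"
        by (simp add: scaleR_sum_left sum_subtractf scaleR_right_diff_distrib)
      finally have eq: "?F x - T ?F x = (\<Sum>j<m. c j *\<^sub>R (G j x - T ?F x))" .
      have "norm (?F x - T ?F x) \<le> (\<Sum>j<m. norm (c j *\<^sub>R (G j x - T ?F x)))" unfolding eq by (rule norm_sum)
      also have "\<dots> = (\<Sum>j<m. c j * norm (T ?F x - G j x))"
        using c(1) by (intro sum.cong) (auto simp: norm_minus_commute)
      finally show "norm (?F x - T ?F x) \<le> (\<Sum>j<m. c j * norm (T ?F x - G j x))" .
    qed
    also have "\<dots> = (\<Sum>j<m. c j * d (T ?F) (G j))"
      unfolding d_def using int int[OF TK[OF FK]] G(1) by (subst Bochner_Integration.integral_sum) auto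
    also have "\<dots> \<le> (\<Sum>j<m. c j * \<epsilon>)"
    proof (intro sum_mono)
      fix j assume "j \<in> {..<m}"
      then have cj: "h c j = c j" "0 \<le> c j" using c by auto
      show "c j * d (T ?F) (G j) \<le> c j * \<epsilon>"
      proof (cases "d (T ?F) (G j) < \<epsilon>")
        case True then show ?thesis using cj by (intro mult_left_mono) auto
      next
        case False
        then have "c j = 0" using cj(1) by (simp add: h_def lam_def)
        then show ?thesis by simp
      qed
    qed
    also have "\<dots> = \<epsilon>" using sum1 by (simp add: sum_distrib_right[symmetric])
    finally show ?thesis using FK by blast
  qed
  have "\<forall>n. \<exists>F\<in>K. d F (T F) \<le> inverse (real (Suc n))" by (intro allI approx) simp
  then obtain F where F: "\<And>n. F n \<in> K" "\<And>n. d (F n) (T (F n)) \<le> inverse (real (Suc n))" by metis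
  obtain r G where r: "strict_mono r" "G \<in> K" "(\<lambda>n. d (T (F (r n))) G) \<longlonglongrightarrow> 0"
    using cpt[of F, OF F(1)] by blast
  have inv0: "(\<lambda>n. inverse (real (Suc (r n)))) \<longlonglongrightarrow> 0"
    using LIMSEQ_subseq_LIMSEQ[OF LIMSEQ_inverse_real_of_nat r(1)] by (simp add: o_def)
  have "(\<lambda>n. d (F (r n)) G) \<longlonglongrightarrow> 0"
  proof (rule Lim_null_comparison)
    show "\<forall>\<^sub>F n in sequentially. norm (d (F (r n)) G) \<le> inverse (real (Suc (r n))) + d (T (F (r n))) G"
    proof (intro always_eventually allI)
      fix n
      have "d (F (r n)) G \<le> d (F (r n)) (T (F (r n))) + d (T (F (r n))) G" using F(1) TK r(2)
          by (intro tri) auto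
      then show "norm (d (F (r n)) G) \<le> inverse (real (Suc (r n))) + d (T (F (r n))) G"
        using F(2)[of "r n"] d0[of "F (r n)" G] by simp
    qed
    show "(\<lambda>n. inverse (real (Suc (r n))) + d (T (F (r n))) G) \<longlonglongrightarrow> 0"
      using tendsto_add[OF inv0 r(3)] by simp
  qed
  from cont[of "\<lambda>n. F (r n)", OF F(1) r(2) this] have T: "(\<lambda>n. d (T (F (r n))) (T G)) \<longlonglongrightarrow> 0" .
  have "d G (T G) \<le> d (T (F (r n))) G + d (T (F (r n))) (T G)" for n
    using tri[of G "T (F (r n))" "T G"] sym[of G "T (F (r n))"] F(1) TK r(2) by auto
  moreover have "(\<lambda>n. d (T (F (r n))) G + d (T (F (r n))) (T G)) \<longlonglongrightarrow> 0"
    using tendsto_add[OF r(3) T] by simp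
  ultimately have "d G (T G) \<le> 0" by (intro LIMSEQ_le_const) auto
  then show ?thesis using d0[of G "T G"] r(2) by (intro that[of G]) auto
qed

section \<open>Zero boundary values\<close>

context double_phase_setup
begin

section \<open>Convergence in the modular\<close>

definition mconv :: "(nat \<Rightarrow> real^'n \<Rightarrow> 'b::euclidean_space) \<Rightarrow> (real^'n \<Rightarrow> 'b) \<Rightarrow> bool" where
  "mconv w v \<longleftrightarrow> (\<forall>\<epsilon>>0. \<exists>N. \<forall>n\<ge>N. mH (\<lambda>x. w n x - v x) \<le> ennreal \<epsilon>)"

definition mcauchy :: "(nat \<Rightarrow> real^'n \<Rightarrow> 'b::euclidean_space) \<Rightarrow> bool" where
  "mcauchy w \<longleftrightarrow> (\<forall>\<epsilon>>0. \<exists>N. \<forall>m\<ge>N. \<forall>n\<ge>N. mH (\<lambda>x. w m x - w n x) \<le> ennreal \<epsilon>)"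

lemma mconvD: "mconv w v \<Longrightarrow> 0 < \<epsilon> \<Longrightarrow> \<exists>N. \<forall>n\<ge>N. mH (\<lambda>x. w n x - v x) \<le> ennreal \<epsilon>"
  by (simp add: mconv_def)

lemma mcauchyD: "mcauchy w \<Longrightarrow> 0 < \<epsilon> \<Longrightarrow> \<exists>N. \<forall>m\<ge>N. \<forall>n\<ge>N. mH (\<lambda>x. w m x - w n x) \<le> ennreal \<epsilon>"
  by (simp add: mcauchy_def)

lemma mconv_subseq:
  assumes "mconv w v" "strict_mono r"
  shows "mconv (\<lambda>n. w (r n)) v"
  unfolding mconv_def
proof (intro allI impI)
  fix \<epsilon> :: real assume "0 < \<epsilon>"
  from mconvD[OF assms(1) this] obtain N where N: "\<forall>n\<ge>N. mH (\<lambda>x. w n x - v x) \<le> ennreal \<epsilon>" ..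
  have "N \<le> r n" if "N \<le> n" for n using seq_suble[OF assms(2), of n] that by simp
  with N show "\<exists>N. \<forall>n\<ge>N. mH (\<lambda>x. w (r n) x - v x) \<le> ennreal \<epsilon>" by (intro exI[of _ N]) simp
qed

lemma mcauchy_limit:
  fixes w :: "nat \<Rightarrow> real^'n \<Rightarrow> 'b::euclidean_space"
  assumes "\<And>n. w n \<in> borel_measurable L" "\<And>n. mH (w n) < \<infinity>" "mcauchy w"
  obtains v where "v \<in> borel_measurable L" "mconv w v"
proof -
  show ?thesis
  proof (rule mH_complete[OF assms(1,2) mcauchyD[OF assms(3)]])
    fix r v
    assume "v \<in> borel_measurable L" "\<And>\<epsilon>. 0 < \<epsilon> \<Longrightarrow> \<exists>N. \<forall>n\<ge>N. mH (\<lambda>x. w n x - v x) \<le> ennreal \<epsilon>"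
    then show ?thesis by (intro that[of v]) (auto simp: mconv_def)
  qed
qed

lemma mH_finite_if_close:
  assumes [measurable]: "u \<in> borel_measurable L" "v \<in> borel_measurable L"
    and "mH (\<lambda>x. u x - v x) < \<infinity>" "mH v < \<infinity>"
  shows "mH u < \<infinity>"
proof -
  have "mH u \<le> ennreal (2 powr P) * (mH (\<lambda>x. u x - v x) + mH v)"
    using mH_add[of "\<lambda>x. u x - v x" v] by simp
  also have "\<dots> < \<infinity>" using assms by (simp add: ennreal_mult_less_top)
  finally show ?thesis .
qed

text \<open>The detour is through L1: a small modular gives a small L1 distance by
  \<open>L1_small\<close>, and L1 convergence gives a subsequence that converges almost
  everywhere.\<close>

lemma mconv_AE_subseq:
  fixes w :: "nat \<Rightarrow> real^'n \<Rightarrow> 'b::euclidean_space"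
  assumes [measurable]: "\<And>n. w n \<in> borel_measurable L" "v \<in> borel_measurable L"
    and fin: "\<And>n. mH (w n) < \<infinity>" and conv: "mconv w v"
  obtains r where "strict_mono (r::nat\<Rightarrow>nat)" "AE x in L. (\<lambda>n. w (r n) x) \<longlonglongrightarrow> v x"
proof -
  from mconvD[OF conv zero_less_one] obtain N where "mH (\<lambda>x. w N x - v x) \<le> ennreal 1" by blast
  then have "mH (\<lambda>x. v x - w N x) < \<infinity>"
    by (subst mH_diff_commute) (auto simp: order_le_less_trans)
  then have finv: "mH v < \<infinity>" using fin[of N] by (rule mH_finite_if_close[rotated 2]) measurable
  have int: "integrable L (\<lambda>x. w n x - v x)" for n
    using integrable_if_mH[OF assms(1) fin] integrable_if_mH[OF assms(2) finv] by simp
  have "(\<lambda>n. LINT x|L. norm (w n x - v x)) \<longlonglongrightarrow> 0"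
  proof (rule LIMSEQ_I)
    fix \<epsilon> :: real assume \<epsilon>: "0 < \<epsilon>"
    then have "0 < \<epsilon> / 2" by simp
    from L1_small[OF this, where 'b='b] obtain \<eta> where \<eta>: "0 < \<eta>"
      "\<And>v::real^'n \<Rightarrow> 'b. v \<in> borel_measurable L \<Longrightarrow> mH v \<le> ennreal \<eta> \<Longrightarrow> (\<integral>\<^sup>+x. ennreal (norm (v x)) \<partial>L) \<le>
          ennreal (\<epsilon> / 2)"
      by blast
    obtain N where N: "\<And>n. n \<ge> N \<Longrightarrow> mH (\<lambda>x. w n x - v x) \<le> ennreal \<eta>" using mconvD[OF conv \<eta>(1)] by blast
    have "norm ((LINT x|L. norm (w n x - v x)) - 0) < \<epsilon>" if n: "n \<ge> N" for n
    proof -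
      have "ennreal (LINT x|L. norm (w n x - v x)) = (\<integral>\<^sup>+x. ennreal (norm (w n x - v x)) \<partial>L)"
        using int by (intro nn_integral_eq_integral[symmetric] integrable_norm) auto
      also have "\<dots> \<le> ennreal (\<epsilon> / 2)" using N n by (intro \<eta>(2)) auto
      finally have "(LINT x|L. norm (w n x - v x)) \<le> \<epsilon> / 2" using \<epsilon> by (simp add: ennreal_le_iff)
      then show ?thesis using \<epsilon> by simp
    qed
    then show "\<exists>N. \<forall>n\<ge>N. norm ((LINT x|L. norm (w n x - v x)) - 0) < \<epsilon>" by blast
  qed
  from tendsto_L1_AE_subseq[OF int this] obtain r where "strict_mono (r::nat\<Rightarrow>nat)"
      "AE x in L. (\<lambda>n. w (r n) x - v x) \<longlonglongrightarrow> 0"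
    by blast
  then show ?thesis by (intro that[of r]) (auto simp: LIM_zero_iff)
qed

section \<open>The zero trace space\<close>

lemma test_measurable:
  assumes "\<phi> \<in> test_functions \<Omega>"
  shows "\<phi> \<in> borel_measurable L" "gradient \<phi> \<in> borel_measurable L"
  using test_borel[OF assms] gradient_borel[OF open_dom assms] by (auto intro: borel_imp_lebesgue_on)

lemma test_mH_finite:
  assumes "\<phi> \<in> test_functions \<Omega>"
  shows "mH \<phi> < \<infinity>" "mH (gradient \<phi>) < \<infinity>"
proof -
  obtain B where "\<And>x. \<bar>\<phi> x\<bar> \<le> B" using test_bounded[OF open_dom assms] by blast
  then show "mH \<phi> < \<infinity>" by (intro mH_bounded[of _ B] test_measurable assms) simp
  obtain B where "\<And>x. norm (gradient \<phi> x) \<le> B" using gradient_bounded[OF open_dom assms] by blast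
  then show "mH (gradient \<phi>) < \<infinity>" by (intro mH_bounded[of _ B] test_measurable assms) simp
qed

text \<open>The zero trace space as a set of pairs of a function and its gradient, which avoids a choice of
  representatives of weak gradients.\<close>
definition W0 :: "(real^'n \<Rightarrow> real) \<Rightarrow> (real^'n \<Rightarrow> real^'n) \<Rightarrow> bool" where
  "W0 u g \<longleftrightarrow> u \<in> borel_measurable L \<and> g \<in> borel_measurable L \<and>
    (\<forall>\<epsilon>>0. \<exists>\<phi>\<in>test_functions \<Omega>. mH (\<lambda>x. u x - \<phi> x) \<le> ennreal \<epsilon> \<and> mH (\<lambda>x. g x - gradient \<phi> x) \<le> ennreal \<epsilon>)"

lemma W0_measurable: "W0 u g \<Longrightarrow> u \<in> borel_measurable L" "W0 u g \<Longrightarrow> g \<in> borel_measurable L"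
  by (auto simp: W0_def)

lemma W0_approx:
  assumes "W0 u g" "0 < \<epsilon>"
  obtains \<phi> where "\<phi> \<in> test_functions \<Omega>" "mH (\<lambda>x. u x - \<phi> x) \<le> ennreal \<epsilon>" "mH (\<lambda>x. g x - gradient \<phi> x) \<le>
      ennreal \<epsilon>"
  using assms by (auto simp: W0_def)

lemma W0_test: "\<phi> \<in> test_functions \<Omega> \<Longrightarrow> W0 \<phi> (gradient \<phi>)"
  unfolding W0_def by (auto simp: test_measurable intro!: bexI[of _ \<phi>])

lemma W0_finite:
  assumes "W0 u g"
  shows "mH u < \<infinity>" "mH g < \<infinity>"
proof -
  obtain \<phi> where \<phi>: "\<phi> \<in> test_functions \<Omega>" "mH (\<lambda>x. u x - \<phi> x) \<le> ennreal 1" "mH (\<lambda>x. g x - gradient \<phi> x) \<le>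
      ennreal 1"
    using W0_approx[OF assms zero_less_one] .
  show "mH u < \<infinity>"
    by (rule mH_finite_if_close[OF W0_measurable(1)[OF assms] test_measurable(1)[OF \<phi>(1)] _
        test_mH_finite(1)[OF \<phi>(1)]])
      (use \<phi>(2) in \<open>auto simp: order_le_less_trans\<close>)
  show "mH g < \<infinity>"
    by (rule mH_finite_if_close[OF W0_measurable(2)[OF assms] test_measurable(2)[OF \<phi>(1)] _
        test_mH_finite(2)[OF \<phi>(1)]])
      (use \<phi>(3) in \<open>auto simp: order_le_less_trans\<close>)
qed

lemma mH_combination_le:
  assumes [measurable]: "v \<in> borel_measurable L" "w \<in> borel_measurable L"
    and "mH v \<le> ennreal \<eta>" "mH w \<le> ennreal \<eta>" "0 \<le> \<eta>"
  shows "mH (\<lambda>x. a *\<^sub>R v x + b *\<^sub>R w x) \<le> ennreal (2 powr P * ((1 + \<bar>a\<bar>) powr P + (1 + \<bar>b\<bar>) powr P) * \<eta>)"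
proof -
  have "mH (\<lambda>x. a *\<^sub>R v x + b *\<^sub>R w x) \<le> ennreal (2 powr P) * (mH (\<lambda>x. a *\<^sub>R v x) + mH (\<lambda>x. b *\<^sub>R w x))"
    by (rule mH_add) measurable
  also have "\<dots> \<le> ennreal (2 powr P) * (ennreal ((1 + \<bar>a\<bar>) powr P) * ennreal \<eta> + ennreal
      ((1 + \<bar>b\<bar>) powr P) * ennreal \<eta>)"
    using assms by (intro mult_left_mono add_mono order_trans[OF mH_scale]) auto
  also have "\<dots> = ennreal (2 powr P * ((1 + \<bar>a\<bar>) powr P + (1 + \<bar>b\<bar>) powr P) * \<eta>)"
    using assms(5) by (simp add: ennreal_plus[symmetric] ennreal_mult[symmetric] algebra_simps del:
        ennreal_plus)
  finally show ?thesis .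
qed

lemma W0_combination:
  assumes u: "W0 u g" and v: "W0 v h"
  shows "W0 (\<lambda>x. a * u x + b * v x) (\<lambda>x. a *\<^sub>R g x + b *\<^sub>R h x)"
  unfolding W0_def
proof (intro conjI allI impI)
  note [measurable] = W0_measurable[OF u] W0_measurable[OF v]
  show "(\<lambda>x. a * u x + b * v x) \<in> borel_measurable L" "(\<lambda>x. a *\<^sub>R g x + b *\<^sub>R h x) \<in> borel_measurable L"
      by measurable
  fix \<epsilon> :: real assume \<epsilon>: "0 < \<epsilon>"
  define K where "K = 2 powr P * ((1 + \<bar>a\<bar>) powr P + (1 + \<bar>b\<bar>) powr P)"
  have K: "0 < K" by (auto simp: K_def intro!: mult_pos_pos add_pos_pos)
  then have \<eta>: "0 < \<epsilon> / K" using \<epsilon> by simp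
  obtain \<phi> where \<phi>: "\<phi> \<in> test_functions \<Omega>" "mH (\<lambda>x. u x - \<phi> x) \<le>
      ennreal (\<epsilon> / K)" "mH (\<lambda>x. g x - gradient \<phi> x) \<le> ennreal (\<epsilon> / K)"
    using W0_approx[OF u \<eta>] .
  obtain \<psi> where \<psi>: "\<psi> \<in> test_functions \<Omega>" "mH (\<lambda>x. v x - \<psi> x) \<le>
      ennreal (\<epsilon> / K)" "mH (\<lambda>x. h x - gradient \<psi> x) \<le> ennreal (\<epsilon> / K)"
    using W0_approx[OF v \<eta>] .
  note [measurable] = test_measurable[OF \<phi>(1)] test_measurable[OF \<psi>(1)]
  let ?\<theta> = "\<lambda>x. a * \<phi> x + b * \<psi> x"
  have "mH (\<lambda>x. a *\<^sub>R (u x - \<phi> x) + b *\<^sub>R (v x - \<psi> x)) \<le> ennreal (K * (\<epsilon> / K))"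
    unfolding K_def by (rule mH_combination_le) (use \<phi> \<psi> \<eta> in \<open>auto simp: K_def\<close>)
  then have 1: "mH (\<lambda>x. a * u x + b * v x - ?\<theta> x) \<le> ennreal \<epsilon>" using K by (simp add: algebra_simps)
  have "mH (\<lambda>x. a *\<^sub>R (g x - gradient \<phi> x) + b *\<^sub>R (h x - gradient \<psi> x)) \<le> ennreal (K * (\<epsilon> / K))"
    unfolding K_def by (rule mH_combination_le) (use \<phi> \<psi> \<eta> in \<open>auto simp: K_def\<close>)
  then have 2: "mH (\<lambda>x. a *\<^sub>R g x + b *\<^sub>R h x - gradient ?\<theta> x) \<le> ennreal \<epsilon>"
    using K by (simp add: algebra_simps gradient_combination[OF \<phi>(1) \<psi>(1)])
  show "\<exists>\<theta>\<in>test_functions \<Omega>. mH (\<lambda>x. a * u x + b * v x - \<theta> x) \<le>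
      ennreal \<epsilon> \<and> mH (\<lambda>x. a *\<^sub>R g x + b *\<^sub>R h x - gradient \<theta> x) \<le> ennreal \<epsilon>"
    using 1 2 test_combination[OF open_dom \<phi>(1) \<psi>(1)] by (intro bexI[of _ ?\<theta>]) auto
qed

text \<open>\<open>sobolev_test\<close> needs only the p-part of the gradient and controls
  |\<phi>|^q. As t^p is at most 1 + t^q and \<mu> is bounded, the full modular of \<phi> follows,
  even where \<mu> vanishes.\<close>

lemma poincare_unit: "\<exists>C\<ge>0. \<forall>\<phi>\<in>test_functions \<Omega>. mH (gradient \<phi>) \<le> 1 \<longrightarrow> mH \<phi> \<le> ennreal C"
proof -
  have "\<exists>C\<ge>0. \<forall>\<phi>\<in>test_functions \<Omega>. (\<integral>\<^sup>+x. ennreal (norm (gradient \<phi> x) powr p x) \<partial>L) \<le> 1 \<longrightarrow>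
      (\<integral>\<^sup>+x. ennreal (\<bar>\<phi> x\<bar> powr q x) \<partial>L) \<le> ennreal C"
  proof (rule sobolev_test[OF open_dom bounded_dom p_cont _ _ e \<delta>])
    show "1 \<le> p x" if "x \<in> \<Omega>" for x using exps'[OF that] by simp
    show "1 \<le> q x \<and> q x \<le> P" if "x \<in> \<Omega>" for x using exps'[OF that] by simp
  qed (use subcritical in auto)
  then obtain C where C: "0 \<le> C" "\<And>\<phi>. \<phi> \<in> test_functions \<Omega> \<Longrightarrow>
      (\<integral>\<^sup>+x. ennreal (norm (gradient \<phi> x) powr p x) \<partial>L) \<le> 1 \<Longrightarrow> (\<integral>\<^sup>+x. ennreal (\<bar>\<phi> x\<bar> powr q x) \<partial>L) \<le> ennreal C"
    by blast
  show ?thesis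
  proof (intro exI[of _ "measure L \<Omega> + (1 + \<bar>m0\<bar>) * C"] conjI ballI impI)
    show "0 \<le> measure L \<Omega> + (1 + \<bar>m0\<bar>) * C" using C(1) by simp
    fix \<phi> assume \<phi>: "\<phi> \<in> test_functions \<Omega>" and g: "mH (gradient \<phi>) \<le> 1"
    note [measurable] = test_measurable[OF \<phi>] p_meas q_meas
    have "(\<integral>\<^sup>+x. ennreal (norm (gradient \<phi> x) powr p x) \<partial>L) \<le> mH (gradient \<phi>)"
      unfolding mH_def by (intro nn_integral_mono ennreal_leI powr_le_H) simp
    then have q: "(\<integral>\<^sup>+x. ennreal (\<bar>\<phi> x\<bar> powr q x) \<partial>L) \<le> ennreal C" using C(2)[OF \<phi>] g by simp
    have qm: "(\<lambda>x. \<bar>\<phi> x\<bar> powr q x) \<in> borel_measurable L" by (rule powr_real_measurable) measurable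
    have "mH \<phi> \<le> (\<integral>\<^sup>+x. 1 + ennreal (1 + \<bar>m0\<bar>) * ennreal (\<bar>\<phi> x\<bar> powr q x) \<partial>L)"
      unfolding mH_def
    proof (rule nn_integral_mono)
      fix x assume "x \<in> space L"
      then have x: "x \<in> \<Omega>" by simp
      have "\<bar>\<phi> x\<bar> powr p x \<le> 1 + \<bar>\<phi> x\<bar> powr q x"
      proof (cases "\<bar>\<phi> x\<bar> \<le> 1")
        case True
        then have "\<bar>\<phi> x\<bar> powr p x \<le> 1" using exps'[OF x] by (simp add: powr_le1)
        then show ?thesis by (simp add: add_increasing2)
      next
        case False
        then have "\<bar>\<phi> x\<bar> powr p x \<le> \<bar>\<phi> x\<bar> powr q x" using exps[OF x] by (intro powr_mono) auto
        then show ?thesis by simp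
      qed
      moreover have "\<mu> x * \<bar>\<phi> x\<bar> powr q x \<le> \<bar>m0\<bar> * \<bar>\<phi> x\<bar> powr q x" using mu[OF x]
          by (intro mult_right_mono) auto
      ultimately have "H x (norm (\<phi> x)) \<le> 1 + (1 + \<bar>m0\<bar>) * \<bar>\<phi> x\<bar> powr q x"
        by (simp add: double_phase_def algebra_simps)
      then have "ennreal (H x (norm (\<phi> x))) \<le> ennreal (1 + (1 + \<bar>m0\<bar>) * \<bar>\<phi> x\<bar> powr q x)" by (rule ennreal_leI)
      also have "\<dots> = 1 + ennreal (1 + \<bar>m0\<bar>) * ennreal (\<bar>\<phi> x\<bar> powr q x)"
        by (subst ennreal_plus) (auto simp: ennreal_mult)
      finally show "ennreal (H x (norm (\<phi> x))) \<le> 1 + ennreal (1 + \<bar>m0\<bar>) * ennreal (\<bar>\<phi> x\<bar> powr q x)" .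
    qed
    also have "\<dots> = ennreal (measure L \<Omega>) + ennreal (1 + \<bar>m0\<bar>) * (\<integral>\<^sup>+x. ennreal (\<bar>\<phi> x\<bar> powr q x) \<partial>L)"
      using qm emeasure_L(1) by (subst nn_integral_add) (auto simp: nn_integral_cmult)
    also have "\<dots> \<le> ennreal (measure L \<Omega>) + ennreal (1 + \<bar>m0\<bar>) * ennreal C"
      using q by (intro add_left_mono mult_left_mono) auto
    also have "\<dots> = ennreal (measure L \<Omega> + (1 + \<bar>m0\<bar>) * C)"
      using C(1) by (simp add: ennreal_plus[symmetric] ennreal_mult[symmetric] del: ennreal_plus)
    finally show "mH \<phi> \<le> ennreal (measure L \<Omega> + (1 + \<bar>m0\<bar>) * C)" .
  qed
qed

lemma test_scale: "\<phi> \<in> test_functions \<Omega> \<Longrightarrow> (\<lambda>x. c *\<^sub>R \<phi> x) \<in> test_functions \<Omega>"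
  using test_combination[OF open_dom, of \<phi> \<phi> c 0] by simp

lemma gradient_scale: "\<phi> \<in> test_functions \<Omega> \<Longrightarrow> gradient (\<lambda>x. c *\<^sub>R \<phi> x) = (\<lambda>x. c *\<^sub>R gradient \<phi> x)"
  using gradient_combination[of \<phi> \<Omega> \<phi> c 0] by (simp add: fun_eq_iff)

lemma test_diff: "\<phi> \<in> test_functions \<Omega> \<Longrightarrow> \<psi> \<in> test_functions \<Omega> \<Longrightarrow> (\<lambda>x. \<phi> x - \<psi> x) \<in> test_functions \<Omega>"
  using test_combination[OF open_dom, of \<phi> \<psi> 1 "-1"] by simp

lemma gradient_diff: "\<phi> \<in> test_functions \<Omega> \<Longrightarrow> \<psi> \<in> test_functions \<Omega> \<Longrightarrow>
    gradient (\<lambda>x. \<phi> x - \<psi> x) = (\<lambda>x. gradient \<phi> x - gradient \<psi> x)"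
  using gradient_combination[of \<phi> \<Omega> \<psi> 1 "-1"] by (simp add: fun_eq_iff)

text \<open>The modular is not homogeneous, so smallness is obtained by scaling. Dividing \<phi> by
  \<open>c\<close> raises the gradient modular by at most c^(-P), hence to at most 1; multiplying
  back gains the factor c^p0 for the function.\<close>

lemma poincare_small:
  assumes \<epsilon>: "0 < \<epsilon>"
  shows "\<exists>\<eta>>0. \<forall>\<phi>\<in>test_functions \<Omega>. mH (gradient \<phi>) \<le> ennreal \<eta> \<longrightarrow> mH \<phi> \<le> ennreal \<epsilon>"
proof -
  obtain C where C: "0 \<le> C" "\<And>\<phi>. \<phi> \<in> test_functions \<Omega> \<Longrightarrow> mH (gradient \<phi>) \<le> 1 \<Longrightarrow> mH \<phi> \<le> ennreal C"
    using poincare_unit by blast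
  define c where "c = min 1 ((\<epsilon> / (C + 1)) powr (1 / p0))"
  have c: "0 < c" "c \<le> 1" using \<epsilon> C(1) by (auto simp: c_def)
  have cC: "c powr p0 * C \<le> \<epsilon>"
  proof -
    have "c powr p0 \<le> ((\<epsilon> / (C + 1)) powr (1 / p0)) powr p0" using c p0 by (intro powr_mono2) (auto simp: c_def)
    also have "\<dots> = \<epsilon> / (C + 1)" using p0 \<epsilon> C(1) by (simp add: powr_powr)
    finally have "c powr p0 * C \<le> \<epsilon> / (C + 1) * (C + 1)" using C(1) \<epsilon> by (intro mult_mono) auto
    also have "\<dots> = \<epsilon>" using C(1) by simp
    finally show ?thesis .
  qed
  show ?thesis
  proof (intro exI[of _ "c powr P"] conjI ballI impI)
    show "0 < c powr P" using c by simp
    fix \<phi> assume \<phi>: "\<phi> \<in> test_functions \<Omega>" and g: "mH (gradient \<phi>) \<le> ennreal (c powr P)"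
    let ?\<psi> = "\<lambda>x. (1 / c) *\<^sub>R \<phi> x"
    have "mH (gradient ?\<psi>) \<le> ennreal ((1 / c) powr P) * mH (gradient \<phi>)"
      unfolding gradient_scale[OF \<phi>] using c by (intro mH_scale_large test_measurable[OF \<phi>]) auto
    also have "\<dots> \<le> ennreal ((1 / c) powr P) * ennreal (c powr P)" by (rule mult_left_mono[OF g]) simp
    also have "\<dots> = 1" using c by (simp add: ennreal_mult[symmetric] powr_divide)
    finally have 1: "mH ?\<psi> \<le> ennreal C" by (rule C(2)[OF test_scale[OF \<phi>]])
    have "mH \<phi> = mH (\<lambda>x. c *\<^sub>R ?\<psi> x)" using c by simp
    also have "\<dots> \<le> ennreal (c powr p0) * mH ?\<psi>" using c
        by (intro mH_scale_small test_measurable test_scale \<phi>) auto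
    also have "\<dots> \<le> ennreal (c powr p0) * ennreal C" by (rule mult_left_mono[OF 1]) simp
    also have "\<dots> \<le> ennreal \<epsilon>" using cC C(1) by (simp add: ennreal_mult[symmetric] ennreal_leI)
    finally show "mH \<phi> \<le> ennreal \<epsilon>" .
  qed
qed

text \<open>For large gradients: \<phi> divided by M^(1/p0) has gradient modular at most 1. The
  growth exponent 1 / p0 lies below 1, and \<open>coercive\<close> relies on this.\<close>

lemma poincare_scaled:
  "\<exists>C\<ge>0. \<forall>\<phi>\<in>test_functions \<Omega>. \<forall>M\<ge>1. mH (gradient \<phi>) \<le> ennreal M \<longrightarrow> mH (\<lambda>x. (1 / M powr (1 / p0)) *\<^sub>R \<phi> x) \<le>
      ennreal C"
proof -
  obtain C where C: "0 \<le> C" "\<And>\<phi>. \<phi> \<in> test_functions \<Omega> \<Longrightarrow> mH (gradient \<phi>) \<le> 1 \<Longrightarrow> mH \<phi> \<le> ennreal C"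
    using poincare_unit by blast
  have "mH (\<lambda>x. (1 / M powr (1 / p0)) *\<^sub>R \<phi> x) \<le> ennreal C"
    if \<phi>: "\<phi> \<in> test_functions \<Omega>" and M: "1 \<le> M" and g: "mH (gradient \<phi>) \<le> ennreal M" for \<phi> M
  proof (rule C(2)[OF test_scale[OF \<phi>]])
    define c where "c = 1 / M powr (1 / p0)"
    have c: "0 \<le> c" "c \<le> 1" using M p0 by (auto simp: c_def divide_le_eq ge_one_powr_ge_zero)
    have "mH (gradient (\<lambda>x. c *\<^sub>R \<phi> x)) \<le> ennreal (c powr p0) * mH (gradient \<phi>)"
      unfolding gradient_scale[OF \<phi>] using c by (intro mH_scale_small test_measurable[OF \<phi>]) auto
    also have "\<dots> \<le> ennreal (c powr p0) * ennreal M" by (rule mult_left_mono[OF g]) simp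
    also have "c powr p0 = 1 / M" using M p0 by (simp add: c_def powr_divide powr_powr)
    also have "ennreal (1 / M) * ennreal M = 1" using M by (simp add: ennreal_mult[symmetric])
    finally show "mH (gradient (\<lambda>x. (1 / M powr (1 / p0)) *\<^sub>R \<phi> x)) \<le> 1" by (simp add: c_def)
  qed
  then show ?thesis using C(1) by blast
qed

lemma poincare_W0:
  assumes \<epsilon>: "0 < \<epsilon>"
  shows "\<exists>\<eta>>0. \<forall>u g. W0 u g \<longrightarrow> mH g \<le> ennreal \<eta> \<longrightarrow> mH u \<le> ennreal \<epsilon>"
proof -
  define K where "K = 2 powr P"
  have K: "0 < K" by (simp add: K_def)
  define \<epsilon>1 where "\<epsilon>1 = \<epsilon> / (2 * K)"
  have \<epsilon>1: "0 < \<epsilon>1" using \<epsilon> K by (simp add: \<epsilon>1_def)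
  obtain \<eta>1 where \<eta>1: "0 < \<eta>1" "\<And>\<phi>. \<phi> \<in> test_functions \<Omega> \<Longrightarrow> mH (gradient \<phi>) \<le> ennreal \<eta>1 \<Longrightarrow> mH \<phi> \<le> ennreal \<epsilon>1"
    using poincare_small[OF \<epsilon>1] by blast
  define \<eta> where "\<eta> = \<eta>1 / (2 * K)"
  have \<eta>: "0 < \<eta>" using \<eta>1 K by (simp add: \<eta>_def)
  have "mH u \<le> ennreal \<epsilon>" if u: "W0 u g" and g: "mH g \<le> ennreal \<eta>" for u g
  proof -
    have "0 < min \<epsilon>1 \<eta>" using \<epsilon>1 \<eta> by simp
    from W0_approx[OF u this] obtain \<phi> where \<phi>: "\<phi> \<in> test_functions \<Omega>"
      "mH (\<lambda>x. u x - \<phi> x) \<le> ennreal (min \<epsilon>1 \<eta>)" "mH (\<lambda>x. g x - gradient \<phi> x) \<le> ennreal (min \<epsilon>1 \<eta>)" .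
    note [measurable] = W0_measurable[OF u] test_measurable[OF \<phi>(1)]
    have "mH (gradient \<phi>) \<le> ennreal K * (mH (\<lambda>x. gradient \<phi> x - g x) + mH g)"
      using mH_add[of "\<lambda>x. gradient \<phi> x - g x" g] by (simp add: K_def)
    also have "\<dots> \<le> ennreal K * (ennreal \<eta> + ennreal \<eta>)"
    proof (intro mult_left_mono add_mono g)
      have "mH (\<lambda>x. g x - gradient \<phi> x) \<le> ennreal \<eta>" using \<phi>(3) by (rule order_trans) (auto intro!: ennreal_leI)
      then show "mH (\<lambda>x. gradient \<phi> x - g x) \<le> ennreal \<eta>" by (subst mH_diff_commute)
    qed auto
    also have "\<dots> = ennreal \<eta>1"
      using K \<eta> by (simp add: ennreal_plus[symmetric] ennreal_mult[symmetric] \<eta>_def del: ennreal_plus)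
    finally have \<phi>1: "mH \<phi> \<le> ennreal \<epsilon>1" by (rule \<eta>1(2)[OF \<phi>(1)])
    have "mH (\<lambda>x. u x - \<phi> x) \<le> ennreal \<epsilon>1" using \<phi>(2) by (rule order_trans) (auto intro!: ennreal_leI)
    then have "ennreal K * (mH (\<lambda>x. u x - \<phi> x) + mH \<phi>) \<le> ennreal K * (ennreal \<epsilon>1 + ennreal \<epsilon>1)"
      using \<phi>1 by (intro mult_left_mono add_mono) auto
    also have "\<dots> = ennreal \<epsilon>"
      using K \<epsilon>1 by (simp add: ennreal_plus[symmetric] ennreal_mult[symmetric] \<epsilon>1_def del: ennreal_plus)
    finally show ?thesis using mH_add[of "\<lambda>x. u x - \<phi> x" \<phi>] by (simp add: K_def)
  qed
  then show ?thesis using \<eta> by blast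
qed

text \<open>Cauchy gradients suffice, because \<open>poincare_small\<close> applied to differences
  makes the functions Cauchy too.\<close>

lemma W0_limit:
  assumes \<phi>: "\<And>n. \<phi> n \<in> test_functions \<Omega>" and c: "mcauchy (\<lambda>n. gradient (\<phi> n))"
  obtains u g where "W0 u g" "mconv \<phi> u" "mconv (\<lambda>n. gradient (\<phi> n)) g"
proof -
  obtain g where g: "g \<in> borel_measurable L" "mconv (\<lambda>n. gradient (\<phi> n)) g"
    using mcauchy_limit[OF _ _ c] test_measurable[OF \<phi>] test_mH_finite[OF \<phi>] by blast
  have "mcauchy \<phi>"
    unfolding mcauchy_def
  proof (intro allI impI)
    fix \<epsilon> :: real assume "0 < \<epsilon>"
    from poincare_small[OF this] obtain \<eta> where \<eta>: "0 < \<eta>" "\<And>\<phi>. \<phi> \<in> test_functions \<Omega> \<Longrightarrow> mH (gradient \<phi>) \<le>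
        ennreal \<eta> \<Longrightarrow> mH \<phi> \<le> ennreal \<epsilon>"
      by blast
    obtain N where N: "\<And>m n. m \<ge> N \<Longrightarrow> n \<ge> N \<Longrightarrow> mH (\<lambda>x. gradient (\<phi> m) x - gradient (\<phi> n) x) \<le> ennreal \<eta>"
      using mcauchyD[OF c \<eta>(1)] by blast
    have "mH (\<lambda>x. \<phi> m x - \<phi> n x) \<le> ennreal \<epsilon>" if "m \<ge> N" "n \<ge> N" for m n
      using N[OF that] by (intro \<eta>(2) test_diff \<phi>) (simp add: gradient_diff[OF \<phi> \<phi>])
    then show "\<exists>N. \<forall>m\<ge>N. \<forall>n\<ge>N. mH (\<lambda>x. \<phi> m x - \<phi> n x) \<le> ennreal \<epsilon>" by blast
  qed
  then obtain u where u: "u \<in> borel_measurable L" "mconv \<phi> u"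
    using mcauchy_limit[of \<phi>] test_measurable[OF \<phi>] test_mH_finite[OF \<phi>] by blast
  have "W0 u g"
    unfolding W0_def
  proof (intro conjI allI impI u g)
    fix \<epsilon> :: real assume \<epsilon>: "0 < \<epsilon>"
    obtain N1 where N1: "\<And>n. n \<ge> N1 \<Longrightarrow> mH (\<lambda>x. \<phi> n x - u x) \<le> ennreal \<epsilon>" using mconvD[OF u(2) \<epsilon>] by blast
    obtain N2 where N2: "\<And>n. n \<ge> N2 \<Longrightarrow> mH (\<lambda>x. gradient (\<phi> n) x - g x) \<le> ennreal \<epsilon>" using mconvD[OF g(2) \<epsilon>]
        by blast
    show "\<exists>\<phi>\<in>test_functions \<Omega>. mH (\<lambda>x. u x - \<phi> x) \<le> ennreal \<epsilon> \<and> mH (\<lambda>x. g x - gradient \<phi> x) \<le> ennreal \<epsilon>"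
      using N1[of "max N1 N2"] N2[of "max N1 N2"] \<phi>[of "max N1 N2"]
      by (intro bexI[of _ "\<phi> (max N1 N2)"]) (auto simp: mH_diff_commute[of u] mH_diff_commute[of g])
  qed
  then show ?thesis using u g by (intro that)
qed

text \<open>The modular bounds the L1 norm of the gradient, which is all that the Rellich argument
  asks for. Only the Cauchy property in L1 is recorded; \<open>pair_mod_split\<close> upgrades it
  later.\<close>

lemma compact_embedding_test:
  assumes \<phi>: "\<And>n. \<phi> n \<in> test_functions \<Omega>" and M: "\<And>n. mH (gradient (\<phi> n)) \<le> ennreal M" "0 \<le> M"
  obtains r where "strict_mono (r::nat\<Rightarrow>nat)"
    "\<And>\<epsilon>. 0 < \<epsilon> \<Longrightarrow> \<exists>N. \<forall>m\<ge>N. \<forall>n\<ge>N. (\<integral>\<^sup>+x. ennreal \<bar>\<phi> (r m) x - \<phi> (r n) x\<bar> \<partial>L) \<le> ennreal \<epsilon>"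
proof -
  have b: "(\<integral>\<^sup>+x. ennreal (norm (gradient (\<phi> n) x)) \<partial>lborel) \<le> ennreal (measure L \<Omega> + M)" for n
  proof -
    have "(\<integral>\<^sup>+x. ennreal (norm (gradient (\<phi> n) x)) \<partial>lborel) = (\<integral>\<^sup>+x. ennreal (norm (gradient (\<phi> n) x)) \<partial>L)"
      unfolding nn_integral_lebesgue_on[OF dom_sets(2)]
      by (intro nn_integral_cong) (auto simp: indicator_def gradient_outside[OF open_dom \<phi>])
    also have "\<dots> \<le> (\<integral>\<^sup>+x. 1 + ennreal (H x (norm (gradient (\<phi> n) x))) \<partial>L)"
    proof (rule nn_integral_mono)
      fix x assume "x \<in> space L"
      then have x: "x \<in> \<Omega>" by simp
      have "norm (gradient (\<phi> n) x) \<le> 1 + H x (norm (gradient (\<phi> n) x))" using le_H[OF x norm_ge_zero, of 1]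
          by simp
      then have "ennreal (norm (gradient (\<phi> n) x)) \<le> ennreal (1 + H x (norm (gradient (\<phi> n) x)))"
          by (rule ennreal_leI)
      then show "ennreal (norm (gradient (\<phi> n) x)) \<le> 1 + ennreal (H x (norm (gradient (\<phi> n) x)))"
        using H_nonneg[OF x] by (subst (asm) ennreal_plus) auto
    qed
    also have "\<dots> = ennreal (measure L \<Omega>) + mH (gradient (\<phi> n))"
      using test_measurable[OF \<phi>[of n]] emeasure_L(1) by (subst nn_integral_add) (auto simp: mH_def)
    also have "\<dots> \<le> ennreal (measure L \<Omega>) + ennreal M" using M(1) by (rule add_left_mono)
    also have "\<dots> = ennreal (measure L \<Omega> + M)" using M(2) by simp
    finally show ?thesis .
  qed
  have "0 \<le> measure L \<Omega> + M" using M(2) by simp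
  from rellich_test[where \<phi>=\<phi>, OF open_dom bounded_dom \<phi> b this] obtain r where r: "strict_mono (r::nat\<Rightarrow>nat)"
    "\<forall>\<epsilon>>0. \<exists>N. \<forall>m\<ge>N. \<forall>n\<ge>N. (\<integral>\<^sup>+x. ennreal \<bar>\<phi> (r m) x - \<phi> (r n) x\<bar> \<partial>lborel) \<le> ennreal \<epsilon>"
    by (elim exE conjE) (rule that)
  have le: "(\<integral>\<^sup>+x. ennreal \<bar>\<phi> (r m) x - \<phi> (r n) x\<bar> \<partial>L) \<le> (\<integral>\<^sup>+x. ennreal \<bar>\<phi> (r m) x - \<phi> (r n) x\<bar> \<partial>lborel)"
      for m n
    unfolding nn_integral_lebesgue_on[OF dom_sets(2)] by (intro nn_integral_mono) (auto simp: indicator_def)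
  show ?thesis
  proof (rule that[OF r(1)])
    fix \<epsilon> :: real assume "0 < \<epsilon>"
    from r(2) this have "\<exists>N. \<forall>m\<ge>N. \<forall>n\<ge>N. (\<integral>\<^sup>+x. ennreal \<bar>\<phi> (r m) x - \<phi> (r n) x\<bar> \<partial>lborel) \<le> ennreal \<epsilon>"
      by (elim allE impE)
    then obtain N where "\<forall>m\<ge>N. \<forall>n\<ge>N. (\<integral>\<^sup>+x. ennreal \<bar>\<phi> (r m) x - \<phi> (r n) x\<bar> \<partial>lborel) \<le> ennreal \<epsilon>" ..
    then show "\<exists>N. \<forall>m\<ge>N. \<forall>n\<ge>N. (\<integral>\<^sup>+x. ennreal \<bar>\<phi> (r m) x - \<phi> (r n) x\<bar> \<partial>L) \<le> ennreal \<epsilon>"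
      by (intro exI[of _ N] allI impI order_trans[OF le]) auto
  qed
qed

end

section \<open>The energy\<close>

text \<open>Continuity of a modular in the form that \<open>powr_add_le_weighted\<close> permits:
  first \<kappa> is taken so small that (1 + \<kappa>)^P is nearly 1, then \<open>n\<close> so large
  that the big factor in front of \<open>d n\<close> no longer matters.\<close>

lemma weighted_bounds_imp_tendsto:
  fixes a :: "nat \<Rightarrow> real"
  assumes a: "\<And>n. 0 \<le> a n" "0 \<le> b" and d: "d \<longlonglongrightarrow> 0" and P: "0 \<le> P"
    and up: "\<And>\<kappa> n. 0 < \<kappa> \<Longrightarrow> a n \<le> (1 + \<kappa>) powr P * b + (1 + 1 / \<kappa>) powr P * d n"
    and lo: "\<And>\<kappa> n. 0 < \<kappa> \<Longrightarrow> b \<le> (1 + \<kappa>) powr P * a n + (1 + 1 / \<kappa>) powr P * d n"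
  shows "a \<longlonglongrightarrow> b"
proof (rule LIMSEQ_I)
  fix \<epsilon> :: real assume \<epsilon>: "0 < \<epsilon>"
  have "((\<lambda>\<kappa>. (1 + \<kappa>) powr P) \<longlongrightarrow> (1 + 0) powr P) (at_right (0::real))"
    by (intro tendsto_intros) auto
  \<comment> \<open>The excess over 1 will be multiplied by \<open>b\<close> in one inequality and
    by \<open>a n\<close> in the other; b + \<epsilon> + 1 dominates both.\<close>
  then have "\<forall>\<^sub>F \<kappa> in at_right (0::real). (1 + \<kappa>) powr P < 1 + \<epsilon> / (2 * (b + \<epsilon> + 1))"
    using \<epsilon> a(2) by (intro order_tendstoD(2)) auto
  moreover have "\<forall>\<^sub>F \<kappa> in at_right (0::real). 0 < \<kappa>" by (simp add: eventually_at_right_less)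
  ultimately have "\<forall>\<^sub>F \<kappa> in at_right (0::real). (1 + \<kappa>) powr P < 1 + \<epsilon> / (2 * (b + \<epsilon> + 1)) \<and> 0 < \<kappa>"
    by eventually_elim simp
  then obtain \<kappa> where \<kappa>: "(1 + \<kappa>) powr P < 1 + \<epsilon> / (2 * (b + \<epsilon> + 1))" "0 < \<kappa>"
    using eventually_happens'[of "at_right (0::real)"]
        by (metis (no_types, lifting) trivial_limit_at_right_real)
  define c where "c = (1 + 1 / \<kappa>) powr P"
  define s where "s = (1 + \<kappa>) powr P - 1"
  have s: "0 \<le> s" using \<kappa>(2) P by (simp add: s_def ge_one_powr_ge_zero)
  have sb: "s * (b + \<epsilon> + 1) \<le> \<epsilon> / 2"
  proof -
    have "s * D \<le> \<epsilon> / (2 * D) * D" if "D = b + \<epsilon> + 1" for D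
      using \<kappa>(1) that \<epsilon> a(2) by (intro mult_right_mono) (auto simp: s_def)
    moreover have "\<epsilon> / (2 * D) * D = \<epsilon> / 2" if "0 < D" for D using that by simp
    ultimately show ?thesis using \<epsilon> a(2) by (metis add_pos_nonneg add_nonneg_pos zero_less_one add.commute
        less_add_one add_nonneg_nonneg less_imp_le)
  qed
  have "(\<lambda>n. c * d n) \<longlonglongrightarrow> c * 0" using d by (intro tendsto_intros)
  then have "\<forall>\<^sub>F n in sequentially. c * d n < min (\<epsilon> / 2) (1 / 2)" using \<epsilon> by (intro order_tendstoD(2)) auto
  then obtain N where N: "\<And>n. n \<ge> N \<Longrightarrow> c * d n < \<epsilon> / 2 \<and> c * d n < 1 / 2" by (auto simp: eventually_sequentially)
  have "norm (a n - b) < \<epsilon>" if n: "n \<ge> N" for n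
  proof -
    have u: "a n \<le> b + s * b + c * d n" using up[OF \<kappa>(2), of n] by (simp add: s_def c_def algebra_simps)
    have sb': "s * b \<le> \<epsilon> / 2" using sb s \<epsilon> mult_left_mono[of b "b + \<epsilon> + 1" s] by simp
    have an: "a n \<le> b + \<epsilon> + 1" using u sb' N[OF n] \<epsilon> by simp
    have "b \<le> a n + s * a n + c * d n" using lo[OF \<kappa>(2), of n] by (simp add: s_def c_def algebra_simps)
    moreover have "s * a n \<le> \<epsilon> / 2" using sb mult_left_mono[OF an s] by simp
    ultimately show ?thesis using u sb' N[OF n] by (simp add: abs_less_iff)
  qed
  then show "\<exists>N. \<forall>n\<ge>N. norm (a n - b) < \<epsilon>" by blast
qed

context double_phase_setup
begin

definition En :: "(real^'n \<Rightarrow> 'b::euclidean_space) \<Rightarrow> real" where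
  "En g = (LINT x|L. E x (norm (g x)))"

definition hm :: "(real^'n \<Rightarrow> 'b::euclidean_space) \<Rightarrow> real" where
  "hm g = (LINT x|L. H x (norm (g x)))"

lemma hm_nonneg: "0 \<le> hm g"
  unfolding hm_def by (rule Bochner_Integration.integral_nonneg_AE) (rule AE_I2, simp add: H_nonneg)

lemma En_nonneg: "0 \<le> En g"
  unfolding En_def by (rule Bochner_Integration.integral_nonneg_AE) (rule AE_I2, simp add: E_nonneg)

lemma mH_eq_hm: "g \<in> borel_measurable L \<Longrightarrow> mH g < \<infinity> \<Longrightarrow> mH g = ennreal (hm g)"
  unfolding hm_def by (rule H_integrable(2))

lemma hm_le: "g \<in> borel_measurable L \<Longrightarrow> mH g \<le> ennreal M \<Longrightarrow> 0 \<le> M \<Longrightarrow> hm g \<le> M"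
  using mH_eq_hm[of g] by (simp add: order_le_less_trans[OF _ ennreal_less_top] ennreal_le_iff)

lemma E_integrable:
  assumes [measurable]: "g \<in> borel_measurable L" and "mH g < \<infinity>"
  shows "integrable L (\<lambda>x. E x (norm (g x)))"
proof (rule Bochner_Integration.integrable_bound[OF H_integrable(1)[OF assms]])
  show "AE x in L. norm (E x (norm (g x))) \<le> norm (H x (norm (g x)))"
    by (rule AE_I2) (simp add: E_nonneg H_nonneg E_le_H)
qed measurable

lemma En_le_hm: assumes "g \<in> borel_measurable L" "mH g < \<infinity>" shows "En g \<le> hm g"
  unfolding En_def hm_def using assms
  by (intro integral_mono E_integrable H_integrable(1)) (simp_all add: E_le_H)

lemma hm_le_En: assumes "g \<in> borel_measurable L" "mH g < \<infinity>" shows "hm g \<le> P * En g"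
proof -
  have "hm g \<le> (LINT x|L. P * E x (norm (g x)))"
    unfolding hm_def using assms
    by (intro integral_mono integrable_mult_right E_integrable H_integrable(1)) (simp_all add: H_le_E)
  then show ?thesis by (simp add: En_def)
qed

lemma mH_diff_finite:
  assumes [measurable]: "u \<in> borel_measurable L" "v \<in> borel_measurable L" and "mH u < \<infinity>" "mH v < \<infinity>"
  shows "mH (\<lambda>x. u x - v x) < \<infinity>"
proof -
  have "mH (\<lambda>x. u x - v x) \<le> ennreal (2 powr P) * (mH u + mH v)"
    using mH_add[of u "\<lambda>x. - v x"] by simp
  also have "\<dots> < \<infinity>" using assms by (simp add: ennreal_mult_less_top)
  finally show ?thesis .
qed

lemma mH_comb_finite:
  assumes [measurable]: "u \<in> borel_measurable L" "v \<in> borel_measurable L" and "mH u < \<infinity>" "mH v < \<infinity>"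
  shows "mH (\<lambda>x. a *\<^sub>R u x + b *\<^sub>R v x) < \<infinity>"
proof -
  have "mH (\<lambda>x. a *\<^sub>R u x + b *\<^sub>R v x) \<le> ennreal (2 powr P) * (ennreal ((1 + \<bar>a\<bar>) powr P) * mH u + ennreal
      ((1 + \<bar>b\<bar>) powr P) * mH v)"
    by (rule order_trans[OF mH_add]) (measurable, intro mult_left_mono add_mono mH_scale, auto)
  also have "\<dots> < \<infinity>" using assms by (simp add: ennreal_mult_less_top)
  finally show ?thesis .
qed

lemma En_add:
  assumes [measurable]: "u \<in> borel_measurable L" "v \<in> borel_measurable L" and fin: "mH u < \<infinity>" "mH v < \<infinity>"
      and k: "0 < \<kappa>"
  shows "En u \<le> (1 + \<kappa>) powr P * En v + (1 + 1 / \<kappa>) powr P * En (\<lambda>x. u x - v x)"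
proof -
  have d: "integrable L (\<lambda>x. E x (norm (u x - v x)))"
    using mH_diff_finite[OF assms(1,2) fin] by (intro E_integrable) auto
  have "En u \<le> (LINT x|L. (1 + \<kappa>) powr P * E x (norm (v x)) + (1 + 1 / \<kappa>) powr P * E x (norm (u x - v x)))"
    unfolding En_def
  proof (rule integral_mono)
    fix x assume "x \<in> space L"
    then have x: "x \<in> \<Omega>" by simp
    have "E x (norm (u x)) \<le> E x (norm (v x) + norm (u x - v x))"
      using norm_triangle_sub[of "u x" "v x"] by (intro E_mono[OF x]) auto
    also have "\<dots> \<le> (1 + \<kappa>) powr P * E x (norm (v x)) + (1 + 1 / \<kappa>) powr P * E x (norm (u x - v x))"
      by (rule E_add[OF x _ _ k]) auto
    finally show "E x (norm (u x)) \<le> (1 + \<kappa>) powr P * E x (norm (v x)) + (1 + 1 / \<kappa>) powr P * E x (norm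
        (u x - v x))" .
  qed (use E_integrable[OF assms(1) fin(1)] E_integrable[OF assms(2) fin(2)] d in simp_all)
  also have "\<dots> = (1 + \<kappa>) powr P * En v + (1 + 1 / \<kappa>) powr P * En (\<lambda>x. u x - v x)"
    unfolding En_def using E_integrable[OF assms(2) fin(2)] d by simp
  finally show ?thesis .
qed

lemma mconv_imp_hm:
  assumes [measurable]: "\<And>n. w n \<in> borel_measurable L" "v \<in> borel_measurable L" and conv: "mconv w v"
  shows "(\<lambda>n. hm (\<lambda>x. w n x - v x)) \<longlonglongrightarrow> 0"
proof (rule LIMSEQ_I)
  fix \<epsilon> :: real assume "0 < \<epsilon>"
  then have \<epsilon>: "0 < \<epsilon> / 2" by simp
  from mconvD[OF conv this] obtain N where N: "\<forall>n\<ge>N. mH (\<lambda>x. w n x - v x) \<le> ennreal (\<epsilon> / 2)" ..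
  have "hm (\<lambda>x. w n x - v x) \<le> \<epsilon> / 2" if "n \<ge> N" for n using N that \<epsilon> by (intro hm_le) auto
  then have "norm (hm (\<lambda>x. w n x - v x) - 0) < \<epsilon>" if "n \<ge> N" for n
    using that hm_nonneg[of "\<lambda>x. w n x - v x"] \<epsilon> by fastforce
  then show "\<exists>N. \<forall>n\<ge>N. norm (hm (\<lambda>x. w n x - v x) - 0) < \<epsilon>" by blast
qed

lemma En_tendsto:
  assumes [measurable]: "\<And>n. w n \<in> borel_measurable L" "v \<in> borel_measurable L"
    and fin: "\<And>n. mH (w n) < \<infinity>" "mH v < \<infinity>" and conv: "mconv w v"
  shows "(\<lambda>n. En (w n)) \<longlonglongrightarrow> En v"
proof (rule weighted_bounds_imp_tendsto[where d="\<lambda>n. En (\<lambda>x. w n x - v x)" and P=P])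
  show "(\<lambda>n. En (\<lambda>x. w n x - v x)) \<longlonglongrightarrow> 0"
  proof (rule Lim_null_comparison)
    show "\<forall>\<^sub>F n in sequentially. norm (En (\<lambda>x. w n x - v x)) \<le> hm (\<lambda>x. w n x - v x)"
    proof (rule always_eventually, rule allI)
      fix n
      have "mH (\<lambda>x. w n x - v x) < \<infinity>" using fin by (intro mH_diff_finite) auto
      then show "norm (En (\<lambda>x. w n x - v x)) \<le> hm (\<lambda>x. w n x - v x)"
        using En_le_hm[of "\<lambda>x. w n x - v x"] En_nonneg[of "\<lambda>x. w n x - v x"] by simp
    qed
    show "(\<lambda>n. hm (\<lambda>x. w n x - v x)) \<longlonglongrightarrow> 0" by (rule mconv_imp_hm[OF assms(1,2) conv])
  qed
  fix \<kappa> :: real and n assume k: "0 < \<kappa>"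
  show "En (w n) \<le> (1 + \<kappa>) powr P * En v + (1 + 1 / \<kappa>) powr P * En (\<lambda>x. w n x - v x)"
    by (rule En_add[OF assms(1,2) fin k])
  have "En (\<lambda>x. v x - w n x) = En (\<lambda>x. w n x - v x)" by (simp add: En_def norm_minus_commute)
  then show "En v \<le> (1 + \<kappa>) powr P * En (w n) + (1 + 1 / \<kappa>) powr P * En (\<lambda>x. w n x - v x)"
    using En_add[OF assms(2,1) fin(2,1) k, of n] by simp
qed (use En_nonneg p0 in auto)

definition defect :: "(real^'n \<Rightarrow> 'b::euclidean_space) \<Rightarrow> (real^'n \<Rightarrow> 'b) \<Rightarrow> real" where
  "defect g h = En g + En h - 2 * En (\<lambda>x. (1 / 2) *\<^sub>R g x + (1 / 2) *\<^sub>R h x)"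

lemma hm_diff_le_defect:
  assumes \<epsilon>: "0 < \<epsilon>"
  shows "\<exists>C\<ge>0. \<forall>g h::real^'n \<Rightarrow> 'b::euclidean_space. g \<in> borel_measurable L \<longrightarrow> h \<in> borel_measurable L \<longrightarrow>
      mH g < \<infinity> \<longrightarrow> mH h < \<infinity> \<longrightarrow>
    hm (\<lambda>x. g x - h x) \<le> \<epsilon> * (hm g + hm h) + C * defect g h"
proof -
  obtain C where C: "0 \<le> C" "\<And>x (a::'b) b. x \<in> \<Omega> \<Longrightarrow>
    H x (norm (a - b)) \<le> \<epsilon> * (H x (norm a) + H x (norm b)) + C * (E x (norm a) + E x (norm b) - 2 * E x
        (norm ((a + b) /\<^sub>R 2)))"
    using H_uniformly_convex[OF \<epsilon>, where 'b='b] by blast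
  have "hm (\<lambda>x. g x - h x) \<le> \<epsilon> * (hm g + hm h) + C * defect g h"
    if [measurable]: "g \<in> borel_measurable L" "h \<in> borel_measurable L" and fin: "mH g < \<infinity>" "mH h < \<infinity>"
        for g h :: "real^'n \<Rightarrow> 'b"
  proof -
    note i1 = H_integrable(1)[OF that(1) fin(1)] H_integrable(1)[OF that(2) fin(2)]
    note i2 = E_integrable[OF that(1) fin(1)] E_integrable[OF that(2) fin(2)]
    have i3: "integrable L (\<lambda>x. E x (norm ((1 / 2) *\<^sub>R g x + (1 / 2) *\<^sub>R h x)))"
      using mH_comb_finite[OF that(1,2) fin, of "1/2" "1/2"] by (intro E_integrable) auto
    have i4: "integrable L (\<lambda>x. H x (norm (g x - h x)))"
      using mH_diff_finite[OF that(1,2) fin] by (intro H_integrable(1)) auto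
    have "hm (\<lambda>x. g x - h x) \<le> (LINT x|L. \<epsilon> * (H x (norm (g x)) + H x (norm (h x))) +
        C * (E x (norm (g x)) + E x (norm (h x)) - 2 * E x (norm ((1 / 2) *\<^sub>R g x + (1 / 2) *\<^sub>R h x))))"
      unfolding hm_def
    proof (rule integral_mono[OF i4])
      show "integrable L (\<lambda>x. \<epsilon> * (H x (norm (g x)) + H x (norm (h x))) +
        C * (E x (norm (g x)) + E x (norm (h x)) - 2 * E x (norm ((1 / 2) *\<^sub>R g x + (1 / 2) *\<^sub>R h x))))"
        using i1 i2 i3 by (intro Bochner_Integration.integrable_add Bochner_Integration.integrable_diff
            integrable_mult_right)
      fix x assume "x \<in> space L"
      then show "H x (norm (g x - h x)) \<le> \<epsilon> * (H x (norm (g x)) + H x (norm (h x))) +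
        C * (E x (norm (g x)) + E x (norm (h x)) - 2 * E x (norm ((1 / 2) *\<^sub>R g x + (1 / 2) *\<^sub>R h x)))"
        using C(2)[of x "g x" "h x"] by (simp add: scaleR_add_right)
    qed
    also have "\<dots> = \<epsilon> * (hm g + hm h) + C * defect g h"
      unfolding hm_def defect_def En_def using i1 i2 i3 by simp
    finally show ?thesis .
  qed
  with C(1) show ?thesis by blast
qed

end

section \<open>Source terms\<close>

lemma mult_fraction_le:
  fixes a \<epsilon> k :: real
  assumes "0 \<le> a" "0 \<le> \<epsilon>" "0 < k"
  shows "a * (\<epsilon> / (k * (a + 1))) \<le> \<epsilon> / k"
proof -
  have "a * (\<epsilon> / (k * (a + 1))) = (a / (a + 1)) * (\<epsilon> / k)" by simp
  also have "\<dots> \<le> 1 * (\<epsilon> / k)" using assms by (intro mult_right_mono) auto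
  finally show ?thesis by simp
qed

locale double_phase_source = double_phase_setup \<Omega> p q \<mu> p0 P m0 e \<delta>
  for \<Omega> :: "(real^'n::finite) set" and p q \<mu> :: "real^'n \<Rightarrow> real" and p0 P m0 e \<delta> :: real +
  fixes \<psi> :: "real^'n \<Rightarrow> real"
  assumes psi_meas [measurable]: "\<psi> \<in> borel_measurable (lebesgue_on \<Omega>)"
    and psi_nonneg: "\<And>x. x \<in> \<Omega> \<Longrightarrow> 0 \<le> \<psi> x"
    and psi_fin: "(\<integral>\<^sup>+x. ennreal (\<psi> x powr (p x / (p x - 1))) \<partial>lebesgue_on \<Omega>) < \<infinity>"
begin

definition conj_mod :: "(real^'n \<Rightarrow> real) \<Rightarrow> ennreal" where
  "conj_mod d = (\<integral>\<^sup>+x. ennreal (\<bar>d x\<bar> powr (p x / (p x - 1))) \<partial>L)"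

lemma conj_powr_measurable [measurable (raw)]:
  assumes "d \<in> borel_measurable L"
  shows "(\<lambda>x. d x powr (p x / (p x - 1))) \<in> borel_measurable L"
  using assms by (intro powr_real_measurable borel_measurable_divide borel_measurable_diff p_meas
      borel_measurable_const)

lemma conj_mod_psi: "conj_mod \<psi> < \<infinity>"
proof -
  have "conj_mod \<psi> = (\<integral>\<^sup>+x. ennreal (\<psi> x powr (p x / (p x - 1))) \<partial>L)"
    unfolding conj_mod_def by (rule nn_integral_cong) (simp add: psi_nonneg)
  with psi_fin show ?thesis by simp
qed

text \<open>Extended-valued, so that it can be estimated before the product is known to be
  integrable; afterwards it bounds \<open>pairing\<close>.\<close>

definition pair_mod :: "(real^'n \<Rightarrow> real) \<Rightarrow> (real^'n \<Rightarrow> real) \<Rightarrow> ennreal" where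
  "pair_mod d u = (\<integral>\<^sup>+x. ennreal (\<bar>d x\<bar> * \<bar>u x\<bar>) \<partial>L)"

lemma pair_mod_le_aux:
  assumes [measurable]: "d \<in> borel_measurable L" "u \<in> borel_measurable L" and a: "0 \<le> a" "0 \<le> b"
    and le: "\<And>x. x \<in> \<Omega> \<Longrightarrow> \<bar>d x\<bar> * \<bar>u x\<bar> \<le> a * \<bar>u x\<bar> powr p x + b * \<bar>d x\<bar> powr (p x / (p x - 1))"
  shows "pair_mod d u \<le> ennreal a * mH u + ennreal b * conj_mod d"
proof -
  have "pair_mod d u \<le> (\<integral>\<^sup>+x. ennreal a * ennreal (H x (norm (u x))) + ennreal b * ennreal (\<bar>d x\<bar> powr
      (p x / (p x - 1))) \<partial>L)"
    unfolding pair_mod_def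
  proof (rule nn_integral_mono)
    fix x assume "x \<in> space L"
    then have x: "x \<in> \<Omega>" by simp
    have "a * \<bar>u x\<bar> powr p x \<le> a * H x (norm (u x))" using a powr_le_H[OF x] by (intro mult_left_mono) auto
    then have "\<bar>d x\<bar> * \<bar>u x\<bar> \<le> a * H x (norm (u x)) + b * \<bar>d x\<bar> powr (p x / (p x - 1))" using le[OF x] by simp
    then have "ennreal (\<bar>d x\<bar> * \<bar>u x\<bar>) \<le> ennreal (a * H x (norm (u x)) + b * \<bar>d x\<bar> powr (p x / (p x - 1)))"
        by (rule ennreal_leI)
    also have "\<dots> = ennreal a * ennreal (H x (norm (u x))) + ennreal b * ennreal (\<bar>d x\<bar> powr (p x / (p x - 1)))"
      using a H_nonneg[OF x, of "norm (u x)"] by (subst ennreal_plus) (auto simp: ennreal_mult)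
    finally show "ennreal (\<bar>d x\<bar> * \<bar>u x\<bar>) \<le>
        ennreal a * ennreal (H x (norm (u x))) + ennreal b * ennreal (\<bar>d x\<bar> powr (p x / (p x - 1)))" .
  qed
  also have "\<dots> = ennreal a * mH u + ennreal b * conj_mod d"
    unfolding mH_def conj_mod_def by (simp add: nn_integral_add nn_integral_cmult)
  finally show ?thesis .
qed

lemma pair_mod_young:
  assumes \<epsilon>: "0 < \<epsilon>"
  shows "\<exists>C\<ge>0. \<forall>d u. d \<in> borel_measurable L \<longrightarrow> u \<in> borel_measurable L \<longrightarrow> pair_mod d u \<le>
      ennreal \<epsilon> * mH u + ennreal C * conj_mod d"
proof -
  obtain C where C: "0 \<le> C" "\<And>r s t. r \<in> {p0..P} \<Longrightarrow> 0 \<le> s \<Longrightarrow> 0 \<le> t \<Longrightarrow> s * t \<le>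
      \<epsilon> * t powr r + C * s powr (r / (r - 1))"
    using young_small_power[OF p0(1) \<epsilon>, of P] by blast
  have "pair_mod d u \<le> ennreal \<epsilon> * mH u + ennreal C * conj_mod d"
      if "d \<in> borel_measurable L" "u \<in> borel_measurable L" for d u
    using that \<epsilon> C(1) exps' by (intro pair_mod_le_aux C(2)) auto
  with C(1) show ?thesis by blast
qed

text \<open>Here the small factor sits on the source. With the source fixed, its term is made small
  first and the modular of \<open>u\<close> afterwards, as \<open>pair_mod_small\<close>
  does.\<close>

lemma pair_mod_young_conj:
  assumes \<epsilon>: "0 < \<epsilon>"
  shows "\<exists>C\<ge>0. \<forall>d u. d \<in> borel_measurable L \<longrightarrow> u \<in> borel_measurable L \<longrightarrow> pair_mod d u \<le>
      ennreal C * mH u + ennreal \<epsilon> * conj_mod d"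
proof -
  obtain C where C: "0 \<le> C" "\<And>r s t. r \<in> {p0..P} \<Longrightarrow> 0 \<le> s \<Longrightarrow> 0 \<le> t \<Longrightarrow> s * t \<le>
      C * t powr r + \<epsilon> * s powr (r / (r - 1))"
    using young_small_conjugate[OF p0 \<epsilon>] by blast
  have "pair_mod d u \<le> ennreal C * mH u + ennreal \<epsilon> * conj_mod d"
      if "d \<in> borel_measurable L" "u \<in> borel_measurable L" for d u
    using that \<epsilon> C(1) exps' by (intro pair_mod_le_aux C(2)) auto
  with C(1) show ?thesis by blast
qed

definition \<Psi> :: real where "\<Psi> = enn2real (conj_mod \<psi>)"

lemma \<Psi>: "conj_mod \<psi> = ennreal \<Psi>" "0 \<le> \<Psi>"
  using conj_mod_psi by (auto simp: \<Psi>_def less_top)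

lemma pair_mod_finite:
  assumes "u \<in> borel_measurable L" "mH u < \<infinity>"
  shows "pair_mod \<psi> u < \<infinity>"
proof -
  obtain C where C: "0 \<le> C" "pair_mod \<psi> u \<le> ennreal 1 * mH u + ennreal C * conj_mod \<psi>"
    using pair_mod_young[OF zero_less_one] psi_meas assms(1) by blast
  have "ennreal 1 * mH u + ennreal C * conj_mod \<psi> < \<infinity>"
    using assms(2) conj_mod_psi by (simp add: ennreal_mult_less_top)
  with C(2) show ?thesis by (rule order_le_less_trans)
qed

lemma pair_mod_small:
  assumes \<epsilon>: "0 < \<epsilon>"
  shows "\<exists>\<eta>>0. \<forall>u::real^'n \<Rightarrow> real. u \<in> borel_measurable L \<longrightarrow> mH u \<le> ennreal \<eta> \<longrightarrow> pair_mod \<psi> u \<le> ennreal \<epsilon>"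
proof -
  define \<epsilon>1 where "\<epsilon>1 = \<epsilon> / (2 * (\<Psi> + 1))"
  have \<epsilon>1: "0 < \<epsilon>1" "\<epsilon>1 * \<Psi> \<le> \<epsilon> / 2"
  proof -
    show "0 < \<epsilon>1" using \<epsilon> \<Psi>(2) by (simp add: \<epsilon>1_def)
    show "\<epsilon>1 * \<Psi> \<le> \<epsilon> / 2" unfolding \<epsilon>1_def using mult_fraction_le[OF \<Psi>(2), of \<epsilon> 2] \<epsilon>
        by (subst mult.commute) simp
  qed
  obtain C where C: "0 \<le> C" "\<And>u. u \<in> borel_measurable L \<Longrightarrow> pair_mod \<psi> u \<le>
      ennreal C * mH u + ennreal \<epsilon>1 * conj_mod \<psi>"
    using pair_mod_young_conj[OF \<epsilon>1(1)] psi_meas by blast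
  show ?thesis
  proof (intro exI[of _ "\<epsilon> / (2 * (C + 1))"] conjI allI impI)
    show "0 < \<epsilon> / (2 * (C + 1))" using \<epsilon> C(1) by simp
    fix u :: "real^'n \<Rightarrow> real" assume u: "u \<in> borel_measurable L" "mH u \<le> ennreal (\<epsilon> / (2 * (C + 1)))"
    have "pair_mod \<psi> u \<le> ennreal C * mH u + ennreal \<epsilon>1 * ennreal \<Psi>" using C(2)[OF u(1)] \<Psi>(1) by simp
    also have "\<dots> \<le> ennreal C * ennreal (\<epsilon> / (2 * (C + 1))) + ennreal \<epsilon>1 * ennreal \<Psi>"
      using u(2) by (intro add_right_mono mult_left_mono) auto
    also have "\<dots> = ennreal (C * (\<epsilon> / (2 * (C + 1))) + \<epsilon>1 * \<Psi>)"
      using C(1) \<epsilon> \<epsilon>1(1) \<Psi>(2) by (simp add: ennreal_plus[symmetric] ennreal_mult[symmetric] del: ennreal_plus)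
    also have "\<dots> \<le> ennreal \<epsilon>"
    proof (rule ennreal_leI)
      have "C * (\<epsilon> / (2 * (C + 1))) \<le> \<epsilon> / 2" using C(1) \<epsilon> by (intro mult_fraction_le) auto
      then show "C * (\<epsilon> / (2 * (C + 1))) + \<epsilon>1 * \<Psi> \<le> \<epsilon>" using \<epsilon>1(2) by linarith
    qed
    finally show "pair_mod \<psi> u \<le> ennreal \<epsilon>" .
  qed
qed

text \<open>Truncation of \<psi> at a level \<open>K\<close>: the bounded part pairs with the L1
  norm of \<open>v\<close>, and the part where \<psi> exceeds \<open>K\<close> has small conjugate
  modular by dominated convergence. Thus L1 compactness together with bounded modulars gives
  convergence against \<psi>.\<close>

lemma pair_mod_split:
  assumes \<epsilon>: "0 < \<epsilon>" and M: "0 \<le> M"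
  shows "\<exists>\<eta>>0. \<forall>v::real^'n \<Rightarrow> real. v \<in> borel_measurable L \<longrightarrow> mH v \<le> ennreal M \<longrightarrow> (\<integral>\<^sup>+x. ennreal \<bar>v x\<bar> \<partial>L) \<le>
      ennreal \<eta> \<longrightarrow> pair_mod \<psi> v \<le> ennreal \<epsilon>"
proof -
  define \<epsilon>1 where "\<epsilon>1 = \<epsilon> / (3 * (M + 1))"
  have \<epsilon>1: "0 < \<epsilon>1" "\<epsilon>1 * M \<le> \<epsilon> / 3"
  proof -
    show "0 < \<epsilon>1" using \<epsilon> M by (simp add: \<epsilon>1_def)
    show "\<epsilon>1 * M \<le> \<epsilon> / 3" unfolding \<epsilon>1_def using mult_fraction_le[OF M, of \<epsilon> 3] \<epsilon> by (subst mult.commute) simp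
  qed
  obtain C where C: "0 \<le> C" "\<And>d u. d \<in> borel_measurable L \<Longrightarrow> u \<in> borel_measurable L \<Longrightarrow> pair_mod d u \<le>
      ennreal \<epsilon>1 * mH u + ennreal C * conj_mod d"
    using pair_mod_young[OF \<epsilon>1(1)] by blast
  define d where "d n x = indicator {x. real n < \<psi> x} x * \<psi> x" for n x
  have set [measurable]: "Measurable.pred L (\<lambda>x. real n < \<psi> x)" for n by measurable
  have d_meas [measurable]: "d n \<in> borel_measurable L" for n
    unfolding d_def [abs_def] indicator_def by measurable
  have "(\<lambda>n. \<integral>\<^sup>+x. ennreal (\<bar>d n x\<bar> powr (p x / (p x - 1))) \<partial>L) \<longlonglongrightarrow> (\<integral>\<^sup>+x. 0 \<partial>L)"
  proof (rule nn_integral_dominated_convergence[where w="\<lambda>x. ennreal (\<bar>\<psi> x\<bar> powr (p x / (p x - 1)))"])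
    show "(\<integral>\<^sup>+x. ennreal (\<bar>\<psi> x\<bar> powr (p x / (p x - 1))) \<partial>L) < \<infinity>" using conj_mod_psi by (simp add: conj_mod_def)
    show "AE x in L. (\<lambda>n. ennreal (\<bar>d n x\<bar> powr (p x / (p x - 1)))) \<longlonglongrightarrow> 0"
    proof (rule AE_I2)
      fix x
      obtain k where k: "\<psi> x \<le> real k" using real_arch_simple by blast
      have "\<forall>\<^sub>F n in sequentially. ennreal (\<bar>d n x\<bar> powr (p x / (p x - 1))) = 0"
        using eventually_ge_at_top[of k]
        by eventually_elim (use k in \<open>auto simp: d_def indicator_def\<close>)
      then show "(\<lambda>n. ennreal (\<bar>d n x\<bar> powr (p x / (p x - 1)))) \<longlonglongrightarrow> 0" by (rule tendsto_eventually)
    qed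
    show "AE x in L. ennreal (\<bar>d n x\<bar> powr (p x / (p x - 1))) \<le> ennreal (\<bar>\<psi> x\<bar> powr (p x / (p x - 1)))" for n
      by (rule AE_I2) (auto simp: d_def indicator_def)
  qed measurable
  then have "(\<lambda>n. ennreal C * conj_mod (d n)) \<longlonglongrightarrow> ennreal C * 0"
    unfolding conj_mod_def by (intro ennreal_tendsto_cmult) auto
  then have "(\<lambda>n. ennreal C * conj_mod (d n)) \<longlonglongrightarrow> 0" by simp
  moreover have "0 < ennreal (\<epsilon> / 3)" using \<epsilon> by simp
  ultimately have "\<forall>\<^sub>F n in sequentially. ennreal C * conj_mod (d n) < ennreal (\<epsilon> / 3)"
      by (rule order_tendstoD(2))
  then obtain K where K: "ennreal C * conj_mod (d K) < ennreal (\<epsilon> / 3)" by (auto simp: eventually_sequentially)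
  show ?thesis
  proof (intro exI[of _ "\<epsilon> / (3 * (real K + 1))"] conjI allI impI)
    show "0 < \<epsilon> / (3 * (real K + 1))" using \<epsilon> by simp
    fix v :: "real^'n \<Rightarrow> real" assume [measurable]: "v \<in> borel_measurable L"
        and v: "mH v \<le> ennreal M" "(\<integral>\<^sup>+x. ennreal \<bar>v x\<bar> \<partial>L) \<le> ennreal (\<epsilon> / (3 * (real K + 1)))"
    have "pair_mod \<psi> v \<le> (\<integral>\<^sup>+x. ennreal (real K) * ennreal \<bar>v x\<bar> + ennreal (\<bar>d K x\<bar> * \<bar>v x\<bar>) \<partial>L)"
      unfolding pair_mod_def
    proof (rule nn_integral_mono)
      fix x assume "x \<in> space L"
      then have x: "0 \<le> \<psi> x" by (simp add: psi_nonneg)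
      have "\<bar>\<psi> x\<bar> * \<bar>v x\<bar> \<le> real K * \<bar>v x\<bar> + \<bar>d K x\<bar> * \<bar>v x\<bar>"
        using x by (cases "real K < \<psi> x") (auto simp: d_def intro!: mult_right_mono)
      then have "ennreal (\<bar>\<psi> x\<bar> * \<bar>v x\<bar>) \<le> ennreal (real K * \<bar>v x\<bar> + \<bar>d K x\<bar> * \<bar>v x\<bar>)" by (rule ennreal_leI)
      also have "\<dots> = ennreal (real K) * ennreal \<bar>v x\<bar> + ennreal (\<bar>d K x\<bar> * \<bar>v x\<bar>)"
        by (subst ennreal_plus) (auto simp: ennreal_mult)
      finally show "ennreal (\<bar>\<psi> x\<bar> * \<bar>v x\<bar>) \<le> ennreal (real K) * ennreal \<bar>v x\<bar> + ennreal (\<bar>d K x\<bar> * \<bar>v x\<bar>)" .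
    qed
    also have "\<dots> = ennreal (real K) * (\<integral>\<^sup>+x. ennreal \<bar>v x\<bar> \<partial>L) + pair_mod (d K) v"
      unfolding pair_mod_def by (simp add: nn_integral_add nn_integral_cmult)
    also have "\<dots> \<le> ennreal (real K) * ennreal (\<epsilon> / (3 * (real K + 1))) + (ennreal \<epsilon>1 * ennreal M + ennreal
        (\<epsilon> / 3))"
    proof (intro add_mono mult_left_mono v(2))
      have "pair_mod (d K) v \<le> ennreal \<epsilon>1 * mH v + ennreal C * conj_mod (d K)" by (rule C(2)) measurable
      also have "\<dots> \<le> ennreal \<epsilon>1 * ennreal M + ennreal (\<epsilon> / 3)"
        using v(1) K by (intro add_mono mult_left_mono) auto
      finally show "pair_mod (d K) v \<le> ennreal \<epsilon>1 * ennreal M + ennreal (\<epsilon> / 3)" .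
    qed auto
    also have "\<dots> = ennreal (real K * (\<epsilon> / (3 * (real K + 1))) + (\<epsilon>1 * M + \<epsilon> / 3))"
      using \<epsilon> \<epsilon>1(1) M by (simp add: ennreal_plus[symmetric] ennreal_mult[symmetric] del: ennreal_plus)
    also have "\<dots> \<le> ennreal \<epsilon>"
    proof (rule ennreal_leI)
      have "real K * (\<epsilon> / (3 * (real K + 1))) \<le> \<epsilon> / 3" using \<epsilon> by (intro mult_fraction_le) auto
      with \<epsilon>1(2) show "real K * (\<epsilon> / (3 * (real K + 1))) + (\<epsilon>1 * M + \<epsilon> / 3) \<le> \<epsilon>" by linarith
    qed
    finally show "pair_mod \<psi> v \<le> ennreal \<epsilon>" .
  qed
qed

text \<open>The bounds hold at every point of \<Omega> instead of almost every one;
  \<open>truncated_source\<close> delivers such representatives.\<close>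

definition adm :: "(real^'n \<Rightarrow> real) \<Rightarrow> bool" where
  "adm F \<longleftrightarrow> F \<in> borel_measurable L \<and> (\<forall>x\<in>\<Omega>. 0 \<le> F x \<and> F x \<le> \<psi> x)"

definition pairing :: "(real^'n \<Rightarrow> real) \<Rightarrow> (real^'n \<Rightarrow> real) \<Rightarrow> real" where
  "pairing F u = (LINT x|L. F x * u x)"

lemma pairing_bound:
  assumes F: "F \<in> borel_measurable L" "\<And>x. x \<in> \<Omega> \<Longrightarrow> \<bar>F x\<bar> \<le> \<psi> x" and u: "u \<in> borel_measurable L" "mH u < \<infinity>"
  shows "integrable L (\<lambda>x. F x * u x)" "ennreal \<bar>pairing F u\<bar> \<le> pair_mod F u" "pair_mod F u \<le> pair_mod \<psi> u"
proof -
  note [measurable] = F(1) u(1)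
  show le: "pair_mod F u \<le> pair_mod \<psi> u"
    unfolding pair_mod_def
  proof (intro nn_integral_mono ennreal_leI mult_right_mono)
    fix x assume "x \<in> space L"
    then show "\<bar>F x\<bar> \<le> \<bar>\<psi> x\<bar>" using F(2)[of x] by simp
  qed simp
  show i: "integrable L (\<lambda>x. F x * u x)"
  proof (rule integrableI_bounded)
    have "(\<integral>\<^sup>+x. ennreal (norm (F x * u x)) \<partial>L) = pair_mod F u" by (simp add: pair_mod_def abs_mult)
    also have "\<dots> < \<infinity>" using order_le_less_trans[OF le pair_mod_finite[OF u]] .
    finally show "(\<integral>\<^sup>+x. ennreal (norm (F x * u x)) \<partial>L) < \<infinity>" .
  qed measurable
  have "ennreal (norm (LINT x|L. F x * u x)) \<le> (\<integral>\<^sup>+x. ennreal (norm (F x * u x)) \<partial>L)"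
    using i by (rule integral_norm_bound_ennreal)
  then show "ennreal \<bar>pairing F u\<bar> \<le> pair_mod F u" by (simp add: pairing_def pair_mod_def abs_mult)
qed

lemma adm_abs: "adm F \<Longrightarrow> x \<in> \<Omega> \<Longrightarrow> \<bar>F x\<bar> \<le> \<psi> x" and adm_meas: "adm F \<Longrightarrow> F \<in> borel_measurable L"
  by (auto simp: adm_def)

lemma adm_integrable: "adm F \<Longrightarrow> u \<in> borel_measurable L \<Longrightarrow> mH u < \<infinity> \<Longrightarrow> integrable L (\<lambda>x. F x * u x)"
  using pairing_bound(1)[of F u] adm_meas adm_abs by blast

lemma adm_pairing_le:
  assumes "adm F" "u \<in> borel_measurable L" "mH u < \<infinity>" "pair_mod \<psi> u \<le> ennreal b" "0 \<le> b"
  shows "\<bar>pairing F u\<bar> \<le> b"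
proof -
  have "ennreal \<bar>pairing F u\<bar> \<le> ennreal b"
    using pairing_bound(2,3)[OF adm_meas[OF assms(1)] adm_abs[OF assms(1)] assms(2,3)] assms(4)
        by (blast intro: order_trans)
  then show ?thesis using assms(5) by (simp add: ennreal_le_iff)
qed

lemma pairing_diff:
  assumes "adm F" "u \<in> borel_measurable L" "mH u < \<infinity>" "v \<in> borel_measurable L" "mH v < \<infinity>"
  shows "pairing F (\<lambda>x. u x - v x) = pairing F u - pairing F v"
  unfolding pairing_def using adm_integrable[OF assms(1,2,3)] adm_integrable[OF assms(1,4,5)]
  by (simp add: right_diff_distrib)

lemma pairing_comb:
  assumes "adm F" "u \<in> borel_measurable L" "mH u < \<infinity>" "v \<in> borel_measurable L" "mH v < \<infinity>"
  shows "pairing F (\<lambda>x. a * u x + b * v x) = a * pairing F u + b * pairing F v"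
proof -
  have "pairing F (\<lambda>x. a * u x + b * v x) = (LINT x|L. a * (F x * u x) + b * (F x * v x))"
    unfolding pairing_def by (simp add: algebra_simps)
  then show ?thesis
    unfolding pairing_def using adm_integrable[OF assms(1,2,3)] adm_integrable[OF assms(1,4,5)] by simp
qed

lemma pairing_tendsto:
  assumes F: "adm F" and w [measurable]: "\<And>n. w n \<in> borel_measurable L" "v \<in> borel_measurable L"
    and fin: "\<And>n. mH (w n) < \<infinity>" "mH v < \<infinity>" and conv: "mconv w v"
  shows "(\<lambda>n. pairing F (w n)) \<longlonglongrightarrow> pairing F v"
proof (rule LIMSEQ_I)
  fix \<epsilon> :: real assume "0 < \<epsilon>"
  then have \<epsilon>: "0 < \<epsilon> / 2" by simp
  from pair_mod_small[OF \<epsilon>] obtain \<eta> where \<eta>: "0 < \<eta>" "\<And>u. u \<in> borel_measurable L \<Longrightarrow> mH u \<le> ennreal \<eta> \<Longrightarrow>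
      pair_mod \<psi> u \<le> ennreal (\<epsilon> / 2)" by blast
  from mconvD[OF conv \<eta>(1)] obtain N where N: "\<forall>n\<ge>N. mH (\<lambda>x. w n x - v x) \<le> ennreal \<eta>" ..
  have "norm (pairing F (w n) - pairing F v) < \<epsilon>" if n: "n \<ge> N" for n
  proof -
    have "\<bar>pairing F (\<lambda>x. w n x - v x)\<bar> \<le> \<epsilon> / 2"
      using N n fin \<epsilon> by (intro adm_pairing_le[OF F] mH_diff_finite \<eta>(2)) auto
    then show ?thesis using pairing_diff[OF F w(1) fin(1) w(2) fin(2), of n] \<epsilon> by simp
  qed
  then show "\<exists>N. \<forall>n\<ge>N. norm (pairing F (w n) - pairing F v) < \<epsilon>" by blast
qed

definition J :: "(real^'n \<Rightarrow> real) \<Rightarrow> (real^'n \<Rightarrow> real) \<Rightarrow> (real^'n \<Rightarrow> real^'n) \<Rightarrow> real" where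
  "J F u g = En g - pairing F u"

lemma W0_sequence:
  assumes "W0 v h"
  obtains \<phi> where "\<And>n. \<phi> n \<in> test_functions \<Omega>" "mconv \<phi> v" "mconv (\<lambda>n. gradient (\<phi> n)) h"
    "\<And>n. mH (\<lambda>x. v x - \<phi> n x) \<le> ennreal (inverse (real (Suc n)))" "\<And>n. mH (\<lambda>x. h x - gradient (\<phi> n) x) \<le>
        ennreal (inverse (real (Suc n)))"
proof -
  have "\<forall>n. \<exists>\<phi>. \<phi> \<in> test_functions \<Omega> \<and> mH (\<lambda>x. v x - \<phi> x) \<le>
      ennreal (inverse (real (Suc n))) \<and> mH (\<lambda>x. h x - gradient \<phi> x) \<le> ennreal (inverse (real (Suc n)))"
  proof
    fix n
    have "0 < inverse (real (Suc n))" by simp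
    from W0_approx[OF assms this] show "\<exists>\<phi>. \<phi> \<in> test_functions \<Omega> \<and> mH (\<lambda>x. v x - \<phi> x) \<le>
        ennreal (inverse (real (Suc n))) \<and> mH (\<lambda>x. h x - gradient \<phi> x) \<le> ennreal (inverse (real (Suc n)))"
      by blast
  qed
  then obtain \<phi> where \<phi>: "\<And>n. \<phi> n \<in> test_functions \<Omega>" "\<And>n. mH (\<lambda>x. v x - \<phi> n x) \<le>
      ennreal (inverse (real (Suc n)))"
    "\<And>n. mH (\<lambda>x. h x - gradient (\<phi> n) x) \<le> ennreal (inverse (real (Suc n)))" by metis
  have small: "\<exists>N. \<forall>n\<ge>N. ennreal (inverse (real (Suc n))) \<le> ennreal \<epsilon>" if "0 < \<epsilon>" for \<epsilon>
  proof -
    from reals_Archimedean[OF that] obtain N where N: "inverse (real (Suc N)) < \<epsilon>" ..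
    have "inverse (real (Suc n)) \<le> \<epsilon>" if "N \<le> n" for n
    proof -
      have "inverse (real (Suc n)) \<le> inverse (real (Suc N))" using that by (intro le_imp_inverse_le) auto
      with N show ?thesis by linarith
    qed
    then show ?thesis by (intro exI[of _ N]) (auto intro!: ennreal_leI simp del: of_nat_Suc)
  qed
  have "mconv \<phi> v" unfolding mconv_def
  proof (intro allI impI)
    fix \<epsilon> :: real assume "0 < \<epsilon>"
    from small[OF this] obtain N where N: "\<forall>n\<ge>N. ennreal (inverse (real (Suc n))) \<le> ennreal \<epsilon>" ..
    show "\<exists>N. \<forall>n\<ge>N. mH (\<lambda>x. \<phi> n x - v x) \<le> ennreal \<epsilon>"
      by (intro exI[of _ N] allI impI, subst mH_diff_commute) (use N \<phi>(2) order_trans in blast)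
  qed
  moreover have "mconv (\<lambda>n. gradient (\<phi> n)) h" unfolding mconv_def
  proof (intro allI impI)
    fix \<epsilon> :: real assume "0 < \<epsilon>"
    from small[OF this] obtain N where N: "\<forall>n\<ge>N. ennreal (inverse (real (Suc n))) \<le> ennreal \<epsilon>" ..
    show "\<exists>N. \<forall>n\<ge>N. mH (\<lambda>x. gradient (\<phi> n) x - h x) \<le> ennreal \<epsilon>"
      by (intro exI[of _ N] allI impI, subst mH_diff_commute) (use N \<phi>(3) order_trans in blast)
  qed
  ultimately show ?thesis using \<phi> by (intro that)
qed

lemma J_tendsto:
  assumes F: "adm F" and v: "W0 v h" and \<phi>: "\<And>n. \<phi> n \<in> test_functions \<Omega>" "mconv \<phi> v"
      "mconv (\<lambda>n. gradient (\<phi> n)) h"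
  shows "(\<lambda>n. J F (\<phi> n) (gradient (\<phi> n))) \<longlonglongrightarrow> J F v h"
  unfolding J_def
  using test_measurable[OF \<phi>(1)] test_mH_finite[OF \<phi>(1)] W0_measurable[OF v] W0_finite[OF v] \<phi>(2,3)
  by (intro tendsto_diff En_tendsto pairing_tendsto F)

text \<open>With \<open>m\<close> the modular of the gradient, the pairing is at most a multiple of
  m^(1/p0) once m exceeds 1, while the energy is at least m / P. As 1 / p0 < 1, a bound on
  \<open>J\<close> bounds m. The constants depend on \<psi> and not on the individual
  source.\<close>

lemma coercive:
  "\<exists>M\<ge>0. \<exists>D\<ge>0. \<forall>F \<phi>. adm F \<longrightarrow> \<phi> \<in> test_functions \<Omega> \<longrightarrow> J F \<phi> (gradient \<phi>) \<le> 1 \<longrightarrow> mH (gradient \<phi>) \<le>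
      ennreal M \<and> \<bar>pairing F \<phi>\<bar> \<le> D"
proof -
  obtain C where C: "0 \<le> C" "\<And>\<phi> M. \<phi> \<in> test_functions \<Omega> \<Longrightarrow> 1 \<le> M \<Longrightarrow> mH (gradient \<phi>) \<le> ennreal M \<Longrightarrow>
      mH (\<lambda>x. (1 / M powr (1 / p0)) *\<^sub>R \<phi> x) \<le> ennreal C"
    using poincare_scaled by blast
  obtain C1 where C1: "0 \<le> C1" "\<And>u. u \<in> borel_measurable L \<Longrightarrow> pair_mod \<psi> u \<le>
      ennreal 1 * mH u + ennreal C1 * conj_mod \<psi>"
    using pair_mod_young[OF zero_less_one] psi_meas by blast
  define D where "D = C + C1 * \<Psi>"
  have D: "0 \<le> D" using C(1) C1(1) \<Psi>(2) by (simp add: D_def)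
  have pair: "\<bar>pairing F \<phi>\<bar> \<le> M powr (1 / p0) * D" if F: "adm F" and \<phi>: "\<phi> \<in> test_functions \<Omega>"
      and M: "1 \<le> M" "mH (gradient \<phi>) \<le> ennreal M" for F \<phi> M
  proof -
    define t where "t = M powr (1 / p0)"
    have t: "0 < t" using M by (simp add: t_def)
    let ?v = "\<lambda>x. (1 / t) *\<^sub>R \<phi> x"
    note v = test_measurable(1)[OF test_scale[OF \<phi>, of "1 / t"]] test_mH_finite(1)[OF test_scale[OF \<phi>, of
        "1 / t"]]
    have "pair_mod \<psi> ?v \<le> ennreal 1 * mH ?v + ennreal C1 * conj_mod \<psi>" by (rule C1(2)[OF v(1)])
    also have "\<dots> \<le> ennreal 1 * ennreal C + ennreal C1 * ennreal \<Psi>"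
      unfolding \<Psi>(1) using C(2)[OF \<phi> M] by (intro add_right_mono mult_left_mono) (auto simp: t_def)
    also have "\<dots> = ennreal D" using C(1) C1(1) \<Psi>(2) by (simp add: D_def ennreal_mult)
    finally have "\<bar>pairing F ?v\<bar> \<le> D" using D by (intro adm_pairing_le[OF F v])
    moreover have "pairing F ?v = (1 / t) * pairing F \<phi>"
      using pairing_comb[OF F test_measurable(1)[OF \<phi>] test_mH_finite(1)[OF \<phi>] test_measurable(1)[OF \<phi>]
          test_mH_finite(1)[OF \<phi>], of "1/t" 0] by simp
    ultimately show ?thesis using t by (simp add: abs_mult field_simps t_def)
  qed
  \<comment> \<open>Solves m \<le> P (1 + D) m^(1/p0) for m > 1.\<close>
  define M where "M = max 1 ((P * (1 + D)) powr (1 / (1 - 1 / p0)))"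
  have "mH (gradient \<phi>) \<le> ennreal M" if F: "adm F" and \<phi>: "\<phi> \<in> test_functions \<Omega>"
      and J: "J F \<phi> (gradient \<phi>) \<le> 1" for F \<phi>
  proof -
    note g = test_measurable(2)[OF \<phi>] test_mH_finite(2)[OF \<phi>]
    define m where "m = hm (gradient \<phi>)"
    have mH: "mH (gradient \<phi>) = ennreal m" using mH_eq_hm[OF g] by (simp add: m_def)
    have "m \<le> M"
    proof (cases "m \<le> 1")
      case True then show ?thesis by (simp add: M_def)
    next
      case False
      then have m: "1 < m" by simp
      have pr: "\<bar>pairing F \<phi>\<bar> \<le> m powr (1 / p0) * D" using pair[OF F \<phi>, of m] m mH by simp
      have "m \<le> P * En (gradient \<phi>)" unfolding m_def by (rule hm_le_En[OF g])
      also have "\<dots> \<le> P * (1 + m powr (1 / p0) * D)" using J pr p0 by (intro mult_left_mono) (auto simp: J_def)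
      also have "\<dots> \<le> P * (m powr (1 / p0) + m powr (1 / p0) * D)"
        using m p0 by (intro mult_left_mono add_right_mono) (auto simp: ge_one_powr_ge_zero)
      finally have "m \<le> P * (1 + D) * m powr (1 / p0)" by (simp add: algebra_simps)
      moreover have "m = m powr (1 - 1 / p0) * m powr (1 / p0)" using m by (simp add: powr_add[symmetric])
      ultimately have "m powr (1 - 1 / p0) * m powr (1 / p0) \<le> P * (1 + D) * m powr (1 / p0)" by simp
      then have "m powr (1 - 1 / p0) \<le> P * (1 + D)" using m by (simp add: mult_le_cancel_right)
      then have "(m powr (1 - 1 / p0)) powr (1 / (1 - 1 / p0)) \<le> (P * (1 + D)) powr (1 / (1 - 1 / p0))"
        using p0 by (intro powr_mono2) auto
      moreover have "(m powr (1 - 1 / p0)) powr (1 / (1 - 1 / p0)) = m"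
        using p0 m by (simp add: powr_powr)
      ultimately show ?thesis by (simp add: M_def)
    qed
    then show ?thesis unfolding mH by (rule ennreal_leI)
  qed
  moreover have "1 \<le> M" by (simp add: M_def)
  ultimately show ?thesis using pair D
    by (intro exI[of _ M] conjI exI[of _ "M powr (1 / p0) * D"] allI impI) auto
qed

end

section \<open>Minimizers\<close>

context double_phase_setup
begin

lemma W0_diff:
  assumes "W0 u g" "W0 v h"
  shows "W0 (\<lambda>x. u x - v x) (\<lambda>x. g x - h x)"
  using W0_combination[OF assms, of 1 "-1"] by simp

text \<open>Boundedness instead of smallness: after passing to a test function at modular distance
  at most 1, the division in \<open>poincare_scaled\<close> is undone by
  \<open>mH_scale_large\<close>.\<close>

lemma poincare_bound:
  assumes M: "0 \<le> M"
  shows "\<exists>C\<ge>0. \<forall>u g. W0 u g \<longrightarrow> mH g \<le> ennreal M \<longrightarrow> mH u \<le> ennreal C"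
proof -
  obtain C where C: "0 \<le> C" "\<And>\<phi> M. \<phi> \<in> test_functions \<Omega> \<Longrightarrow> 1 \<le> M \<Longrightarrow> mH (gradient \<phi>) \<le> ennreal M \<Longrightarrow>
      mH (\<lambda>x. (1 / M powr (1 / p0)) *\<^sub>R \<phi> x) \<le> ennreal C"
    using poincare_scaled by blast
  define K where "K = 2 powr P"
  have K: "1 \<le> K" using p0 by (simp add: K_def ge_one_powr_ge_zero)
  define M1 where "M1 = K * (1 + M)"
  have M1: "1 \<le> M1" using mult_mono[OF K, of 1 "1 + M"] M K by (simp add: M1_def)
  define t where "t = M1 powr (1 / p0)"
  have t: "1 \<le> t" using M1 p0 by (simp add: t_def ge_one_powr_ge_zero)
  have "mH u \<le> ennreal (K * (1 + t powr P * C))" if u: "W0 u g" and g: "mH g \<le> ennreal M" for u g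
  proof -
    obtain \<phi> where \<phi>: "\<phi> \<in> test_functions \<Omega>" "mH (\<lambda>x. u x - \<phi> x) \<le> ennreal 1" "mH (\<lambda>x. g x - gradient \<phi> x) \<le>
        ennreal 1"
      using W0_approx[OF u zero_less_one] .
    note [measurable] = W0_measurable[OF u] test_measurable[OF \<phi>(1)]
    have "mH (gradient \<phi>) \<le> ennreal K * (mH (\<lambda>x. gradient \<phi> x - g x) + mH g)"
      using mH_add[of "\<lambda>x. gradient \<phi> x - g x" g] by (simp add: K_def)
    also have "\<dots> \<le> ennreal K * (ennreal 1 + ennreal M)"
      using \<phi>(3) g mH_diff_commute[of g "gradient \<phi>"] by (intro mult_left_mono add_mono) auto
    also have "\<dots> = ennreal M1" using K M by (simp add: M1_def ennreal_mult ennreal_plus del: ennreal_1 add: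
        ennreal_1[symmetric])
    finally have "mH (\<lambda>x. (1 / t) *\<^sub>R \<phi> x) \<le> ennreal C" unfolding t_def by (rule C(2)[OF \<phi>(1) M1])
    then have "ennreal (t powr P) * mH (\<lambda>x. (1 / t) *\<^sub>R \<phi> x) \<le> ennreal (t powr P) * ennreal C"
        by (rule mult_left_mono) simp
    moreover have "mH (\<lambda>x. t *\<^sub>R ((1 / t) *\<^sub>R \<phi> x)) \<le> ennreal (t powr P) * mH (\<lambda>x. (1 / t) *\<^sub>R \<phi> x)"
      using t by (intro mH_scale_large) auto
    ultimately have "mH \<phi> \<le> ennreal (t powr P) * ennreal C" using t by simp
    then have "ennreal K * (mH (\<lambda>x. u x - \<phi> x) + mH \<phi>) \<le>
        ennreal K * (ennreal 1 + ennreal (t powr P) * ennreal C)"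
      using \<phi>(2) by (intro mult_left_mono add_mono) auto
    also have "\<dots> = ennreal (K * (1 + t powr P * C))"
      using K C(1) by (simp add: ennreal_mult ennreal_plus del: ennreal_1 add: ennreal_1[symmetric])
    finally show ?thesis using mH_add[of "\<lambda>x. u x - \<phi> x" \<phi>] by (simp add: K_def)
  qed
  moreover have "0 \<le> K * (1 + t powr P * C)" using K C(1) by simp
  ultimately show ?thesis by blast
qed

text \<open>Uniform convexity in the form used for Cauchy sequences: \<epsilon>1 brings the
  contribution of the two bounded modulars below \<epsilon> / 2, and a small defect takes care of
  the rest.\<close>

lemma defect_small:
  assumes \<epsilon>: "0 < \<epsilon>" and M: "0 \<le> M"
  shows "\<exists>\<eta>>0. \<forall>g h::real^'n \<Rightarrow> 'b::euclidean_space. g \<in> borel_measurable L \<longrightarrow> h \<in> borel_measurable L \<longrightarrow> mH g \<le>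
      ennreal M \<longrightarrow> mH h \<le> ennreal M \<longrightarrow>
    defect g h \<le> \<eta> \<longrightarrow> mH (\<lambda>x. g x - h x) \<le> ennreal \<epsilon>"
proof -
  define \<epsilon>1 where "\<epsilon>1 = \<epsilon> / (4 * (M + 1))"
  have \<epsilon>1: "0 < \<epsilon>1" using \<epsilon> M by (simp add: \<epsilon>1_def)
  have \<epsilon>1M: "\<epsilon>1 * (M + M) \<le> \<epsilon> / 2"
  proof -
    have "\<epsilon> / (4 * D) * (M + M) \<le> \<epsilon> / 2" if "0 < D" "M \<le> D" for D
      using that \<epsilon> mult_left_mono[of M D \<epsilon>] by (simp add: field_simps)
    from this[of "M + 1"] M show ?thesis by (simp add: \<epsilon>1_def)
  qed
  obtain C where C: "0 \<le> C" "\<And>g h::real^'n \<Rightarrow> 'b. g \<in> borel_measurable L \<Longrightarrow> h \<in> borel_measurable L \<Longrightarrow> mH g < \<infinity> \<Longrightarrow>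
      mH h < \<infinity> \<Longrightarrow>
    hm (\<lambda>x. g x - h x) \<le> \<epsilon>1 * (hm g + hm h) + C * defect g h"
    using hm_diff_le_defect[OF \<epsilon>1, where 'b='b] by blast
  show ?thesis
  proof (intro exI[of _ "\<epsilon> / (2 * (C + 1))"] conjI allI impI)
    show "0 < \<epsilon> / (2 * (C + 1))" using \<epsilon> C(1) by simp
    fix g h :: "real^'n \<Rightarrow> 'b" assume m [measurable]: "g \<in> borel_measurable L" "h \<in> borel_measurable L"
      and b: "mH g \<le> ennreal M" "mH h \<le> ennreal M" and d: "defect g h \<le> \<epsilon> / (2 * (C + 1))"
    have fin: "mH g < \<infinity>" "mH h < \<infinity>" using b by (auto intro: order_le_less_trans)
    have "hm (\<lambda>x. g x - h x) \<le> \<epsilon>1 * (hm g + hm h) + C * defect g h" by (rule C(2)[OF m fin])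
    also have "\<dots> \<le> \<epsilon>1 * (M + M) + C * (\<epsilon> / (2 * (C + 1)))"
      using hm_le[OF m(1) b(1) M] hm_le[OF m(2) b(2) M] \<epsilon>1 C(1) d by (intro add_mono mult_left_mono) auto
    also have "\<dots> \<le> \<epsilon>"
    proof -
      have "C * (\<epsilon> / (2 * (C + 1))) \<le> \<epsilon> / 2" using C(1) \<epsilon> by (intro mult_fraction_le) auto
      then show ?thesis using \<epsilon>1M by linarith
    qed
    finally have "ennreal (hm (\<lambda>x. g x - h x)) \<le> ennreal \<epsilon>" by (rule ennreal_leI)
    then show "mH (\<lambda>x. g x - h x) \<le> ennreal \<epsilon>" using mH_diff_finite[OF m fin] by (simp add: mH_eq_hm)
  qed
qed

lemma mconv_AE_subseq2:
  fixes w :: "nat \<Rightarrow> real^'n \<Rightarrow> 'b::euclidean_space" and w' :: "nat \<Rightarrow> real^'n \<Rightarrow> 'c::euclidean_space"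
  assumes w: "\<And>n. w n \<in> borel_measurable L" "v \<in> borel_measurable L" "\<And>n. mH (w n) < \<infinity>" "mconv w v"
    and w': "\<And>n. w' n \<in> borel_measurable L" "v' \<in> borel_measurable L" "\<And>n. mH (w' n) < \<infinity>" "mconv w' v'"
  obtains r where "strict_mono (r::nat\<Rightarrow>nat)" "AE x in L. (\<lambda>n. w (r n) x) \<longlonglongrightarrow> v x \<and> (\<lambda>n. w' (r n) x) \<longlonglongrightarrow> v' x"
proof -
  obtain r where r: "strict_mono (r::nat\<Rightarrow>nat)" "AE x in L. (\<lambda>n. w (r n) x) \<longlonglongrightarrow> v x"
    using mconv_AE_subseq[OF w] by blast
  obtain s where s: "strict_mono (s::nat\<Rightarrow>nat)" "AE x in L. (\<lambda>n. w' (r (s n)) x) \<longlonglongrightarrow> v' x"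
    using mconv_AE_subseq[of "\<lambda>n. w' (r n)" v', OF w'(1,2,3) mconv_subseq[OF w'(4) r(1)]] by blast
  show ?thesis
  proof (rule that[of "\<lambda>n. r (s n)"])
    show "strict_mono (\<lambda>n. r (s n))" using strict_mono_o[OF r(1) s(1)] by (simp add: o_def)
    show "AE x in L. (\<lambda>n. w (r (s n)) x) \<longlonglongrightarrow> v x \<and> (\<lambda>n. w' (r (s n)) x) \<longlonglongrightarrow> v' x"
      using r(2) s(2)
    proof eventually_elim
      case (elim x)
      from LIMSEQ_subseq_LIMSEQ[OF elim(1) s(1)] elim(2) show ?case by (simp add: o_def)
    qed
  qed
qed

end

context double_phase_source
begin

text \<open>Nonnegativity is built in because it is inherited from a nonnegative minimizing
  sequence. As in \<open>W0\<close>, the gradient is carried along as a separate function.\<close>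

definition sol :: "(real^'n \<Rightarrow> real) \<Rightarrow> (real^'n \<Rightarrow> real) \<Rightarrow> (real^'n \<Rightarrow> real^'n) \<Rightarrow> bool" where
  "sol F u g \<longleftrightarrow> W0 u g \<and> (AE x in L. 0 \<le> u x) \<and> (\<forall>v h. W0 v h \<longrightarrow> J F u g \<le> J F v h)"

text \<open>The pairing is linear, so it cancels in the defect up to a cross term of the two
  sources. With F = G this makes minimizing sequences Cauchy; with different sources it compares
  their minimizers.\<close>

lemma J_midpoint:
  assumes F: "adm F" "adm G" and u: "W0 u g" and v: "W0 v h"
  defines "m \<equiv> \<lambda>x. (1/2) * u x + (1/2) * v x" and "k \<equiv> \<lambda>x. (1/2) *\<^sub>R g x + (1/2) *\<^sub>R h x"
  shows "defect g h = (J F u g - J F m k) + (J G v h - J G m k) + (1/2) * (pairing F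
      (\<lambda>x. u x - v x) - pairing G (\<lambda>x. u x - v x))"
proof -
  note uv = W0_measurable(1)[OF u] W0_finite(1)[OF u] W0_measurable(1)[OF v] W0_finite(1)[OF v]
  show ?thesis
    unfolding J_def defect_def m_def k_def pairing_comb[OF F(1) uv] pairing_comb[OF F(2) uv] pairing_diff[OF
        F(1) uv] pairing_diff[OF F(2) uv]
    by (simp add: field_simps)
qed

lemma gradient_zero: "gradient (\<lambda>x. 0) = (\<lambda>x. 0 :: real^'n)"
  using gradient_scale[OF test_zero, of 0] by simp

lemma J_zero: "J F (\<lambda>x. 0) (\<lambda>x. 0) = 0"
  by (simp add: J_def En_def pairing_def)

text \<open>\<open>smooth_abs s \<phi>\<close> stands in for the absolute value: its gradient is no
  larger, and since it is at least \<phi> - s and \<open>F\<close> is nonnegative, the pairing loses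
  at most s times the integral of \<open>F\<close>.\<close>

lemma nonneg_competitor:
  assumes F: "adm F" and \<phi>: "\<phi> \<in> test_functions \<Omega>" and \<epsilon>: "0 < \<epsilon>"
  obtains \<theta> where "\<theta> \<in> test_functions \<Omega>" "\<And>x. 0 \<le> \<theta> x" "J F \<theta> (gradient \<theta>) < J F \<phi> (gradient \<phi>) + \<epsilon>"
proof -
  have one: "(\<lambda>x. 1::real) \<in> borel_measurable L" "mH (\<lambda>x. 1::real) < \<infinity>"
    by (auto intro!: mH_bounded[of _ 1, simplified])
  define I where "I = pairing F (\<lambda>x. 1)"
  have I: "0 \<le> I" unfolding I_def pairing_def
    by (rule Bochner_Integration.integral_nonneg_AE, rule AE_I2) (use F in \<open>auto simp: adm_def\<close>)
  define s where "s = \<epsilon> / (I + 1)"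
  have s: "0 < s" using \<epsilon> I by (simp add: s_def)
  have sI: "s * I < \<epsilon>"
  proof -
    have "\<epsilon> / D * I < \<epsilon>" if "I < D" "0 < D" for D using that \<epsilon> by (simp add: field_simps)
    from this[of "I + 1"] I show ?thesis by (simp add: s_def)
  qed
  define \<theta> where "\<theta> = smooth_abs s \<phi>"
  have \<theta>: "\<theta> \<in> test_functions \<Omega>" unfolding \<theta>_def by (rule smooth_abs_test[OF open_dom \<phi> s])
  note \<phi>m = test_measurable[OF \<phi>] test_mH_finite[OF \<phi>]
  note \<theta>m = test_measurable[OF \<theta>] test_mH_finite[OF \<theta>]
  have "En (gradient \<theta>) \<le> En (gradient \<phi>)"
    unfolding En_def
    by (intro integral_mono E_integrable \<theta>m \<phi>m E_mono) (auto simp: \<theta>_def norm_gradient_smooth_abs_le[OF \<phi> s])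
  moreover have "pairing F \<phi> - s * I \<le> pairing F \<theta>"
  proof -
    have "pairing F \<phi> - s * I = pairing F (\<lambda>x. 1 * \<phi> x + (- s) * 1)"
      unfolding I_def by (subst pairing_comb[OF F \<phi>m(1,3) one]) simp
    also have "\<dots> \<le> pairing F \<theta>"
      unfolding pairing_def
    proof (rule integral_mono)
      have "integrable L (\<lambda>x. F x * \<phi> x - s * (F x * 1))"
        using adm_integrable[OF F \<phi>m(1,3)] adm_integrable[OF F one] by simp
      then show "integrable L (\<lambda>x. F x * (1 * \<phi> x + - s * 1))" by (simp add: algebra_simps)
      show "integrable L (\<lambda>x. F x * \<theta> x)" by (rule adm_integrable[OF F \<theta>m(1,3)])
      fix x assume "x \<in> space L"
      then show "F x * (1 * \<phi> x + - s * 1) \<le> F x * \<theta> x"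
        using F smooth_abs_ge[OF s, of \<phi> x] by (intro mult_left_mono) (auto simp: adm_def \<theta>_def)
    qed
    finally show ?thesis .
  qed
  ultimately have "J F \<theta> (gradient \<theta>) < J F \<phi> (gradient \<phi>) + \<epsilon>" using sI by (simp add: J_def)
  moreover have "0 \<le> \<theta> x" for x unfolding \<theta>_def by (rule smooth_abs_nonneg[OF s])
  ultimately show ?thesis using \<theta> by (intro that)
qed

text \<open>The direct method without weak convergence. The midpoint of two nearly minimizing test
  functions cannot fall below the infimum, so their convexity defect is small and
  \<open>defect_small\<close> makes the gradients Cauchy. An almost everywhere convergent
  subsequence passes nonnegativity to the limit.\<close>

lemma sol_exists:
  assumes F: "adm F"
  shows "\<exists>u g. sol F u g"
proof -
  obtain M D where M: "0 \<le> M" and D: "0 \<le> D"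
      and co: "\<And>\<phi>. \<phi> \<in> test_functions \<Omega> \<Longrightarrow> J F \<phi> (gradient \<phi>) \<le> 1 \<Longrightarrow> mH (gradient \<phi>) \<le>
      ennreal M \<and> \<bar>pairing F \<phi>\<bar> \<le> D"
    using coercive F by blast
  define S where "S = (\<lambda>\<phi>. J F \<phi> (gradient \<phi>)) ` test_functions \<Omega>"
  define m where "m = Inf S"
  have bdd: "bdd_below S"
  \<comment> \<open>The energy is nonnegative, so \<open>J\<close> is at least minus the pairing,
    and the pairing is bounded by \<open>D\<close> wherever \<open>J\<close> is at most 1.\<close>
  proof (rule bdd_belowI[of _ "- D"])
    fix y assume "y \<in> S"
    then obtain \<phi> where \<phi>: "\<phi> \<in> test_functions \<Omega>" "y = J F \<phi> (gradient \<phi>)" by (auto simp: S_def)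
    show "- D \<le> y"
    proof (cases "y \<le> 1")
      case True
      then show ?thesis using co[OF \<phi>(1)] \<phi>(2) En_nonneg[of "gradient \<phi>"] by (auto simp: J_def)
    qed (use D in simp)
  qed
  have ne: "S \<noteq> {}" using test_zero by (auto simp: S_def)
  have mle: "m \<le> J F \<phi> (gradient \<phi>)" if "\<phi> \<in> test_functions \<Omega>" for \<phi>
    unfolding m_def using that bdd by (intro cInf_lower) (auto simp: S_def)
  have m0: "m \<le> 0" using mle[OF test_zero] by (simp add: gradient_zero J_zero)
  have "\<exists>\<theta>. \<theta> \<in> test_functions \<Omega> \<and> (\<forall>x. 0 \<le> \<theta> x) \<and> J F \<theta> (gradient \<theta>) < m + inverse (real (Suc n))" for n
  proof -
    \<comment> \<open>One half for coming close to the infimum, the other for passing to a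
      nonnegative competitor.\<close>
    define \<epsilon> where "\<epsilon> = inverse (real (Suc n)) / 2"
    have \<epsilon>: "0 < \<epsilon>" by (simp add: \<epsilon>_def)
    then have "Inf S < m + \<epsilon>" by (simp add: m_def)
    then obtain y where "y \<in> S" "y < m + \<epsilon>" using cInf_lessD[OF ne] by blast
    then obtain \<phi> where \<phi>: "\<phi> \<in> test_functions \<Omega>" "J F \<phi> (gradient \<phi>) < m + \<epsilon>" by (auto simp: S_def)
    obtain \<theta> where \<theta>: "\<theta> \<in> test_functions \<Omega>" "\<And>x. 0 \<le> \<theta> x" "J F \<theta> (gradient \<theta>) < J F \<phi> (gradient \<phi>) + \<epsilon>"
      using nonneg_competitor[OF F \<phi>(1) \<epsilon>] by blast
    have "\<epsilon> + \<epsilon> = inverse (real (Suc n))" by (simp add: \<epsilon>_def)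
    with \<theta>(3) \<phi>(2) have "J F \<theta> (gradient \<theta>) < m + inverse (real (Suc n))" by linarith
    with \<theta> show ?thesis by blast
  qed
  then obtain \<phi> where \<phi>: "\<And>n. \<phi> n \<in> test_functions \<Omega>" "\<And>n x. 0 \<le>
      \<phi> n x" "\<And>n. J F (\<phi> n) (gradient (\<phi> n)) < m + inverse (real (Suc n))"
    by metis
  have inv1: "inverse (real (Suc n)) \<le> 1" for n by (simp add: inverse_le_1_iff)
  have gM: "mH (gradient (\<phi> n)) \<le> ennreal M" for n
    using co[OF \<phi>(1)[of n]] \<phi>(3)[of n] m0 inv1[of n] by linarith
  have def: "defect (gradient (\<phi> k)) (gradient (\<phi> l)) \<le> inverse (real (Suc k)) + inverse (real (Suc l))" for k l
  proof -
    let ?mid = "\<lambda>x. (1/2) * \<phi> k x + (1/2) * \<phi> l x"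
    have t: "?mid \<in> test_functions \<Omega>" by (rule test_combination[OF open_dom \<phi>(1) \<phi>(1)])
    have "gradient ?mid = (\<lambda>x. (1/2) *\<^sub>R gradient (\<phi> k) x + (1/2) *\<^sub>R gradient (\<phi> l) x)"
      by (rule ext) (rule gradient_combination[OF \<phi>(1) \<phi>(1)])
    with J_midpoint[OF F F W0_test[OF \<phi>(1)[of k]] W0_test[OF \<phi>(1)[of l]]]
    have "defect (gradient (\<phi> k)) (gradient (\<phi> l)) =
        (J F (\<phi> k) (gradient (\<phi> k)) - J F ?mid (gradient ?mid)) + (J F (\<phi> l) (gradient (\<phi> l)) - J F ?mid
        (gradient ?mid))"
      by simp
    then show ?thesis using mle[OF t] \<phi>(3)[of k] \<phi>(3)[of l] by linarith
  qed
  have cau: "mcauchy (\<lambda>n. gradient (\<phi> n))"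
    unfolding mcauchy_def
  proof (intro allI impI)
    fix \<epsilon> :: real assume \<epsilon>: "0 < \<epsilon>"
    from defect_small[OF \<epsilon> M, where 'b="real^'n"] obtain \<eta> where \<eta>: "0 < \<eta>"
      "\<And>g h::real^'n \<Rightarrow> real^'n. g \<in> borel_measurable L \<Longrightarrow> h \<in> borel_measurable L \<Longrightarrow> mH g \<le> ennreal M \<Longrightarrow> mH h \<le>
          ennreal M \<Longrightarrow>
        defect g h \<le> \<eta> \<Longrightarrow> mH (\<lambda>x. g x - h x) \<le> ennreal \<epsilon>" by blast
    have "0 < \<eta> / 2" using \<eta>(1) by simp
    from reals_Archimedean[OF this] obtain N where N: "inverse (real (Suc N)) < \<eta> / 2" ..
    have inv: "inverse (real (Suc k)) < \<eta> / 2" if "N \<le> k" for k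
    proof -
      have "inverse (real (Suc k)) \<le> inverse (real (Suc N))" using that by (intro le_imp_inverse_le) auto
      with N show ?thesis by linarith
    qed
    have "mH (\<lambda>x. gradient (\<phi> k) x - gradient (\<phi> l) x) \<le> ennreal \<epsilon>" if "N \<le> k" "N \<le> l" for k l
    proof (rule \<eta>(2)[OF test_measurable(2)[OF \<phi>(1)] test_measurable(2)[OF \<phi>(1)] gM gM])
      show "defect (gradient (\<phi> k)) (gradient (\<phi> l)) \<le> \<eta>" using def[of k l] inv[OF that(1)] inv[OF that(2)]
          by linarith
    qed
    then show "\<exists>N. \<forall>m\<ge>N. \<forall>n\<ge>N. mH (\<lambda>x. gradient (\<phi> m) x - gradient (\<phi> n) x) \<le> ennreal \<epsilon>" by blast
  qed
  obtain u g where u: "W0 u g" "mconv \<phi> u" "mconv (\<lambda>n. gradient (\<phi> n)) g" using W0_limit[OF \<phi>(1) cau] by blast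
  have "AE x in L. 0 \<le> u x"
  proof -
    obtain r where r: "strict_mono (r::nat\<Rightarrow>nat)" "AE x in L. (\<lambda>n. \<phi> (r n) x) \<longlonglongrightarrow> u x"
      using mconv_AE_subseq[OF test_measurable(1)[OF \<phi>(1)] W0_measurable(1)[OF u(1)] test_mH_finite(1)[OF
          \<phi>(1)] u(2)] by blast
    from r(2) show ?thesis
    proof eventually_elim
      case (elim x)
      then show ?case by (rule LIMSEQ_le_const) (use \<phi>(2) in auto)
    qed
  qed
  moreover have "J F u g \<le> J F v h" if v: "W0 v h" for v h
  proof -
    have "J F u g \<le> m"
    proof (rule LIMSEQ_le[OF J_tendsto[OF F u(1) \<phi>(1) u(2,3)]])
      show "(\<lambda>n. m + inverse (real (Suc n))) \<longlonglongrightarrow> m"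
          using tendsto_add[OF tendsto_const LIMSEQ_inverse_real_of_nat, of m] by simp
      show "\<exists>N. \<forall>n\<ge>N. J F (\<phi> n) (gradient (\<phi> n)) \<le> m + inverse (real (Suc n))" using \<phi>(3) less_imp_le by blast
    qed
    also have "m \<le> J F v h"
    proof (rule W0_sequence[OF v])
      fix \<phi>'
      assume \<phi>': "\<And>n. \<phi>' n \<in> test_functions \<Omega>" "mconv \<phi>' v" "mconv (\<lambda>n. gradient (\<phi>' n)) h"
      show "m \<le> J F v h"
        by (rule LIMSEQ_le_const[OF J_tendsto[OF F v \<phi>']]) (use mle \<phi>'(1) in auto)
    qed
    finally show ?thesis .
  qed
  ultimately show ?thesis using u(1) unfolding sol_def by blast
qed

lemma solD: assumes "sol F u g" shows "W0 u g" "AE x in L. 0 \<le> u x" "\<And>v h. W0 v h \<Longrightarrow> J F u g \<le> J F v h"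
  using assms by (auto simp: sol_def)

text \<open>Comparison with the zero function gives J \<le> 0, so approximating test functions
  eventually have J < 1 and \<open>coercive\<close> applies to them. \<open>M1\<close> allows for an
  approximation error of modular at most 1.\<close>

lemma sol_bound: "\<exists>M\<ge>0. \<forall>F u g. adm F \<longrightarrow> sol F u g \<longrightarrow> mH g \<le> ennreal M \<and> mH u \<le> ennreal M"
proof -
  obtain M where M: "0 \<le> M" "\<And>F \<phi>. adm F \<Longrightarrow> \<phi> \<in> test_functions \<Omega> \<Longrightarrow> J F \<phi> (gradient \<phi>) \<le> 1 \<Longrightarrow> mH (gradient \<phi>) \<le>
      ennreal M"
    using coercive by blast
  define M1 where "M1 = 2 powr P * (1 + M)"
  have M1: "0 \<le> M1" using M(1) by (simp add: M1_def)
  obtain C where C: "0 \<le> C" "\<And>u g. W0 u g \<Longrightarrow> mH g \<le> ennreal M1 \<Longrightarrow> mH u \<le> ennreal C"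
      using poincare_bound[OF M1] by blast
  have g: "mH g \<le> ennreal M1" if F: "adm F" and s: "sol F u g" for F u g
  proof (rule W0_sequence[OF solD(1)[OF s]])
    note W = solD(1)[OF s]
    fix \<phi>
    assume \<phi>: "\<And>n. \<phi> n \<in> test_functions \<Omega>" "mconv \<phi> u" "mconv (\<lambda>n. gradient (\<phi> n)) g"
      "\<And>n. mH (\<lambda>x. g x - gradient (\<phi> n) x) \<le> ennreal (inverse (real (Suc n)))"
    have "J F u g \<le> 0" using solD(3)[OF s W0_test[OF test_zero]] by (simp add: gradient_zero J_zero)
    then have "J F u g < 1" by simp
    from order_tendstoD(2)[OF J_tendsto[OF F W \<phi>(1,2,3)] this] obtain n where n:
        "J F (\<phi> n) (gradient (\<phi> n)) < 1"
      by (auto simp: eventually_sequentially)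
    note [measurable] = W0_measurable[OF W] test_measurable[OF \<phi>(1)[of n]]
    have "mH g \<le> ennreal (2 powr P) * (mH (\<lambda>x. g x - gradient (\<phi> n) x) + mH (gradient (\<phi> n)))"
      using mH_add[of "\<lambda>x. g x - gradient (\<phi> n) x" "gradient (\<phi> n)"] by simp
    also have "\<dots> \<le> ennreal (2 powr P) * (ennreal 1 + ennreal M)"
    proof (intro mult_left_mono add_mono)
      have "inverse (real (Suc n)) \<le> 1" by (simp add: inverse_le_1_iff)
      from order_trans[OF \<phi>(4)[of n] ennreal_leI[OF this]]
      show "mH (\<lambda>x. g x - gradient (\<phi> n) x) \<le> ennreal 1" .
      show "mH (gradient (\<phi> n)) \<le> ennreal M" using n by (intro M(2)[OF F \<phi>(1)]) simp
    qed auto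
    also have "\<dots> = ennreal M1" using M(1)
        by (simp add: M1_def ennreal_mult ennreal_plus del: ennreal_1 add: ennreal_1[symmetric])
    finally show ?thesis .
  qed
  have "mH g \<le> ennreal (max M1 C) \<and> mH u \<le> ennreal (max M1 C)" if F: "adm F" and s: "sol F u g" for F u g
    using order_trans[OF g[OF F s] ennreal_leI[OF max.cobounded1]] order_trans[OF C(2)[OF solD(1)[OF s] g[OF
        F s]] ennreal_leI[OF max.cobounded2]]
    by blast
  moreover have "0 \<le> max M1 C" using M1 by simp
  ultimately show ?thesis by blast
qed

text \<open>Each minimizer is compared with the common midpoint. The first two terms of
  \<open>J_midpoint\<close> are then nonpositive, and half the pairing of the differences
  remains.\<close>

lemma sol_defect:
  assumes F: "adm F" "adm G" and s: "sol F u g" "sol G v h"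
    and b: "pair_mod (\<lambda>x. F x - G x) (\<lambda>x. u x - v x) \<le> ennreal b" "0 \<le> b"
  shows "defect g h \<le> b"
proof -
  note W = solD(1)[OF s(1)] solD(1)[OF s(2)]
  let ?w = "\<lambda>x. u x - v x"
  have w: "?w \<in> borel_measurable L" "mH ?w < \<infinity>"
    using W0_measurable(1)[OF W0_diff[OF W]] W0_finite(1)[OF W0_diff[OF W]] by auto
  have m: "W0 (\<lambda>x. (1/2) * u x + (1/2) * v x) (\<lambda>x. (1/2) *\<^sub>R g x + (1/2) *\<^sub>R h x)"
      by (rule W0_combination[OF W])
  have "defect g h \<le> (1/2) * (pairing F ?w - pairing G ?w)"
    using J_midpoint[OF F W] solD(3)[OF s(1) m] solD(3)[OF s(2) m] by linarith
  also have "pairing F ?w - pairing G ?w = pairing (\<lambda>x. F x - G x) ?w"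
    unfolding pairing_def using adm_integrable[OF F(1) w] adm_integrable[OF F(2) w]
        by (simp add: left_diff_distrib)
  also have "\<dots> \<le> b"
  proof -
    have "(\<lambda>x. F x - G x) \<in> borel_measurable L" using adm_meas F by auto
    moreover have "\<bar>F x - G x\<bar> \<le> \<psi> x" if "x \<in> \<Omega>" for x using F that
        by (auto simp: adm_def abs_le_iff) (smt (verit))+
    ultimately have "ennreal \<bar>pairing (\<lambda>x. F x - G x) ?w\<bar> \<le> ennreal b"
      using pairing_bound(2)[of "\<lambda>x. F x - G x" ?w] w b(1) by (auto intro: order_trans)
    then show ?thesis using b(2) by (simp add: ennreal_le_iff)
  qed
  finally show ?thesis using b(2) by simp
qed

end

section \<open>The Euler-Lagrange equation and stability of minimizers\<close>

lemma norm_powr_mult_norm: "norm (a :: 'b::euclidean_space) powr (r - 2) * norm a = norm a powr (r - 1)"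
  using powr_mult_base[of "norm a" "r - 2"] by (simp add: mult.commute)

text \<open>The subgradient inequality for |.|^r / r. Cauchy-Schwarz reduces it to the tangent
  inequality for the lengths.\<close>

lemma norm_powr_gradient_ineq:
  fixes a b :: "'b::euclidean_space"
  assumes r: "1 < r"
  shows "norm a powr r / r + norm a powr (r - 2) * (a \<bullet> (b - a)) \<le> norm b powr r / r"
proof (cases "a = 0")
  case True
  then show ?thesis using r by simp
next
  case False
  have "a \<bullet> (b - a) \<le> norm a * (norm b - norm a)"
    using norm_cauchy_schwarz[of a b] by (simp add: inner_diff_right norm_eq_sqrt_inner[symmetric]
        power2_norm_eq_inner[symmetric] power2_eq_square right_diff_distrib)
  then have "norm a powr (r - 2) * (a \<bullet> (b - a)) \<le> norm a powr (r - 2) * (norm a * (norm b - norm a))"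
    by (rule mult_left_mono) simp
  also have "\<dots> = norm a powr (r - 1) * (norm b - norm a)" using norm_powr_mult_norm[of a r]
      by (simp add: mult.assoc[symmetric])
  finally have 1: "norm a powr (r - 2) * (a \<bullet> (b - a)) \<le> norm a powr (r - 1) * (norm b - norm a)" .
  have "norm a powr r + r * norm a powr (r - 1) * (norm b - norm a) \<le> norm b powr r"
    using powr_above_tangent[OF r, of "norm a" "norm b"] False by (cases "norm b = norm a") auto
  from divide_right_mono[OF this, of r]
  have "norm a powr r / r + norm a powr (r - 1) * (norm b - norm a) \<le> norm b powr r / r"
    using r by (simp add: add_divide_distrib)
  with 1 show ?thesis by linarith
qed

text \<open>For exponents below 2 the scalar factor blows up near 0, so at l = 0 convergence comes
  from the length |a|^(r-1) of the product.\<close>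

lemma norm_powr_scaleR_tendsto:
  fixes a :: "nat \<Rightarrow> 'b::euclidean_space"
  assumes r: "1 < r" and a: "a \<longlonglongrightarrow> l"
  shows "(\<lambda>n. norm (a n) powr (r - 2) *\<^sub>R a n) \<longlonglongrightarrow> norm l powr (r - 2) *\<^sub>R l"
proof (cases "l = 0")
  case False
  then show ?thesis using a by (intro tendsto_scaleR tendsto_powr tendsto_norm tendsto_const) auto
next
  case True
  have "(\<lambda>n. norm (a n) powr (r - 1)) \<longlonglongrightarrow> norm l powr (r - 1)"
    using r by (intro tendsto_powr' tendsto_norm a tendsto_const) auto
  then have "(\<lambda>n. norm (norm (a n) powr (r - 2) *\<^sub>R a n)) \<longlonglongrightarrow> 0"
    using True r by (simp add: norm_powr_mult_norm)
  from tendsto_norm_zero_cancel[OF this] show ?thesis using True by simp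
qed

context double_phase_setup
begin

abbreviation "flux \<equiv> double_phase_flux p q \<mu>"

lemma flux_measurable [measurable (raw)]:
  assumes [measurable]: "g \<in> borel_measurable L"
  shows "(\<lambda>x. flux x (g x)) \<in> borel_measurable L"
proof -
  have n: "(\<lambda>x. norm (g x)) \<in> borel_measurable L" by measurable
  show ?thesis
    unfolding double_phase_flux_def
    by (intro borel_measurable_add borel_measurable_scaleR powr_real_measurable borel_measurable_times
        borel_measurable_diff p_meas q_meas mu_meas n assms borel_measurable_const)
qed

lemma flux_gradient_ineq:
  assumes x: "x \<in> \<Omega>"
  shows "E x (norm a) + flux x a \<bullet> (b - a) \<le> E x (norm b)"
proof -
  have "norm a powr p x / p x + norm a powr (p x - 2) * (a \<bullet> (b - a)) \<le> norm b powr p x / p x"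
    using exps'[OF x] by (intro norm_powr_gradient_ineq)
  moreover have "\<mu> x * (norm a powr q x / q x + norm a powr (q x - 2) * (a \<bullet> (b - a))) \<le>
      \<mu> x * (norm b powr q x / q x)"
    using exps'[OF x] mu[OF x] by (intro mult_left_mono norm_powr_gradient_ineq) auto
  ultimately show ?thesis by (simp add: E_def double_phase_flux_def inner_add_left algebra_simps)
qed

lemma flux_inner_le:
  assumes x: "x \<in> \<Omega>" and s: "norm a \<le> s" "norm b \<le> s"
  shows "\<bar>flux x a \<bullet> b\<bar> \<le> H x s"
proof -
  have s0: "0 \<le> s" using s(1) norm_ge_zero order_trans by blast
  have *: "\<bar>norm a powr (r - 2) * (a \<bullet> b)\<bar> \<le> s powr r" if r: "1 < r" for r
  proof -
    have "\<bar>norm a powr (r - 2) * (a \<bullet> b)\<bar> \<le> norm a powr (r - 2) * (norm a * norm b)"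
      using Cauchy_Schwarz_ineq2[of a b] by (simp add: abs_mult mult_left_mono)
    also have "\<dots> = norm a powr (r - 1) * norm b" using norm_powr_mult_norm[of a r]
        by (simp add: mult.assoc[symmetric])
    also have "\<dots> \<le> s powr (r - 1) * s" using s s0 r by (intro mult_mono powr_mono2) auto
    also have "\<dots> = s powr r" using s0 powr_mult_base[of s "r - 1"] by (simp add: mult.commute)
    finally show ?thesis .
  qed
  have "\<bar>flux x a \<bullet> b\<bar> \<le> \<bar>norm a powr (p x - 2) * (a \<bullet> b)\<bar> + \<mu> x * \<bar>norm a powr (q x - 2) * (a \<bullet> b)\<bar>"
    using mu[OF x] abs_triangle_ineq[of "norm a powr (p x - 2) * (a \<bullet> b)"
        "\<mu> x * (norm a powr (q x - 2) * (a \<bullet> b))"]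
    by (simp add: double_phase_flux_def inner_add_left abs_mult mult.assoc)
  also have "\<dots> \<le> s powr p x + \<mu> x * s powr q x"
    using exps'[OF x] mu[OF x] * by (intro add_mono mult_left_mono) auto
  finally show ?thesis by (simp add: double_phase_def)
qed

lemma flux_tendsto:
  assumes x: "x \<in> \<Omega>" and a: "a \<longlonglongrightarrow> l"
  shows "(\<lambda>n. flux x (a n)) \<longlonglongrightarrow> flux x l"
proof -
  have "(\<lambda>n. norm (a n) powr (p x - 2) *\<^sub>R a n + \<mu> x *\<^sub>R (norm (a n) powr (q x - 2) *\<^sub>R a n)) \<longlonglongrightarrow>
      norm l powr (p x - 2) *\<^sub>R l + \<mu> x *\<^sub>R (norm l powr (q x - 2) *\<^sub>R l)"
    using exps'[OF x] by (intro tendsto_add tendsto_scaleR tendsto_const norm_powr_scaleR_tendsto a)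
  then show ?thesis by (simp add: double_phase_flux_def)
qed

text \<open>The majorant does not depend on \<open>s\<close>, as dominated convergence in
  \<open>euler_lagrange\<close> requires.\<close>

lemma flux_integrable:
  assumes g: "g \<in> borel_measurable L" "mH g < \<infinity>" and h: "h \<in> borel_measurable L" "mH h < \<infinity>" and s: "\<bar>s\<bar> \<le> 1"
  shows "integrable L (\<lambda>x. H x (norm (g x) + norm (h x)))"
    and "integrable L (\<lambda>x. flux x (g x + s *\<^sub>R h x) \<bullet> h x)"
    and "x \<in> \<Omega> \<Longrightarrow> \<bar>flux x (g x + s *\<^sub>R h x) \<bullet> h x\<bar> \<le> H x (norm (g x) + norm (h x))"
proof -
  note [measurable] = g(1) h(1)
  have "mH (\<lambda>x. norm (g x) + norm (h x)) \<le> ennreal (2 powr P) * (mH (\<lambda>x. norm (g x)) + mH (\<lambda>x. norm (h x)))"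
    by (rule mH_add) measurable
  also have "\<dots> < \<infinity>" using g(2) h(2) by (simp add: mH_def ennreal_mult_less_top)
  finally have "mH (\<lambda>x. norm (g x) + norm (h x)) < \<infinity>" .
  then have "integrable L (\<lambda>x. H x (norm (norm (g x) + norm (h x))))" by (intro H_integrable(1)) auto
  then show i: "integrable L (\<lambda>x. H x (norm (g x) + norm (h x)))" by simp
  show b: "\<bar>flux x (g x + s *\<^sub>R h x) \<bullet> h x\<bar> \<le> H x (norm (g x) + norm (h x))" if "x \<in> \<Omega>" for x
  proof (rule flux_inner_le[OF that])
    have "norm (g x + s *\<^sub>R h x) \<le> norm (g x) + \<bar>s\<bar> * norm (h x)"
        using norm_triangle_ineq[of "g x" "s *\<^sub>R h x"] by simp
    also have "\<bar>s\<bar> * norm (h x) \<le> 1 * norm (h x)" using s by (rule mult_right_mono) simp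
    finally show "norm (g x + s *\<^sub>R h x) \<le> norm (g x) + norm (h x)" by simp
  qed simp
  show "integrable L (\<lambda>x. flux x (g x + s *\<^sub>R h x) \<bullet> h x)"
  proof (rule Bochner_Integration.integrable_bound[OF i])
    show "AE x in L. norm (flux x (g x + s *\<^sub>R h x) \<bullet> h x) \<le> norm (H x (norm (g x) + norm (h x)))"
      using b H_nonneg by (intro AE_I2) auto
  qed measurable
qed

end

context double_phase_source
begin

text \<open>The energy is never differentiated. Convexity, with the tangent taken at the perturbed
  point g + t h, combines with minimality into t (A t - pairing F v) \<ge> 0, and dominated
  convergence lets t tend to 0 from both sides.\<close>

lemma euler_lagrange:
  assumes F: "adm F" and s: "sol F u g" and v: "W0 v h"
  shows "integrable L (\<lambda>x. flux x (g x) \<bullet> h x)" "(LINT x|L. flux x (g x) \<bullet> h x) = pairing F v"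
proof -
  note u = solD(1)[OF s]
  note g = W0_measurable(2)[OF u] W0_finite(2)[OF u] and h = W0_measurable(2)[OF v] W0_finite(2)[OF v]
  note [measurable] = g(1) h(1)
  define A where "A t = (LINT x|L. flux x (g x + t *\<^sub>R h x) \<bullet> h x)" for t
  have int: "integrable L (\<lambda>x. flux x (g x + t *\<^sub>R h x) \<bullet> h x)" if "\<bar>t\<bar> \<le> 1" for t
    by (rule flux_integrable(2)[OF g h that])
  show "integrable L (\<lambda>x. flux x (g x) \<bullet> h x)" using int[of 0] by simp
  have key: "0 \<le> t * (A t - pairing F v)" if t: "\<bar>t\<bar> \<le> 1" for t
  proof -
    have W: "W0 (\<lambda>x. 1 * u x + t * v x) (\<lambda>x. 1 *\<^sub>R g x + t *\<^sub>R h x)" by (rule W0_combination[OF u v])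
    have gm: "(\<lambda>x. g x + t *\<^sub>R h x) \<in> borel_measurable L" "mH (\<lambda>x. g x + t *\<^sub>R h x) < \<infinity>"
      using W0_measurable(2)[OF W] W0_finite(2)[OF W] by auto
    have "pairing F (\<lambda>x. 1 * u x + t * v x) = 1 * pairing F u + t * pairing F v"
      by (rule pairing_comb[OF F W0_measurable(1)[OF u] W0_finite(1)[OF u] W0_measurable(1)[OF v]
          W0_finite(1)[OF v]])
    then have 1: "t * pairing F v \<le> En (\<lambda>x. g x + t *\<^sub>R h x) - En g"
      using solD(3)[OF s W] by (simp add: J_def)
    have "En (\<lambda>x. g x + t *\<^sub>R h x) - t * A t =
        (LINT x|L. E x (norm (g x + t *\<^sub>R h x)) - t * (flux x (g x + t *\<^sub>R h x) \<bullet> h x))"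
      unfolding En_def A_def using E_integrable[OF gm] int[OF t] by simp
    also have "\<dots> \<le> En g"
      unfolding En_def
    proof (rule integral_mono)
      show "integrable L (\<lambda>x. E x (norm (g x + t *\<^sub>R h x)) - t * (flux x (g x + t *\<^sub>R h x) \<bullet> h x))"
        using E_integrable[OF gm] int[OF t] by simp
      fix x assume "x \<in> space L"
      then have x: "x \<in> \<Omega>" by simp
      show "E x (norm (g x + t *\<^sub>R h x)) - t * (flux x (g x + t *\<^sub>R h x) \<bullet> h x) \<le> E x (norm (g x))"
        using flux_gradient_ineq[OF x, of "g x + t *\<^sub>R h x" "g x"] by simp
    qed (rule E_integrable[OF g])
    finally show ?thesis using 1 by (simp add: right_diff_distrib)
  qed
  \<comment> \<open>Used with c = 1 and c = -1, one sign for each of the two inequalities.\<close>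
  have lim: "(\<lambda>n. A (c * inverse (real (Suc n)))) \<longlonglongrightarrow> A 0" if c: "\<bar>c\<bar> \<le> 1" for c
    unfolding A_def
  proof (rule integral_dominated_convergence[where w="\<lambda>x. H x (norm (g x) + norm (h x))"])
    have small: "\<bar>c * inverse (real (Suc n))\<bar> \<le> 1" for n
    proof -
      have "\<bar>c\<bar> * inverse (real (Suc n)) \<le> 1 * 1" using c by (intro mult_mono) (auto simp: inverse_le_1_iff)
      then show ?thesis by (simp add: abs_mult)
    qed
    show "integrable L (\<lambda>x. H x (norm (g x) + norm (h x)))" by (rule flux_integrable(1)[OF g h, of 0]) simp
    show "AE x in L. norm (flux x (g x + (c * inverse (real (Suc n))) *\<^sub>R h x) \<bullet> h x) \<le>
        H x (norm (g x) + norm (h x))" for n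
      using flux_integrable(3)[OF g h small[of n]] by (intro AE_I2) auto
    show "AE x in L. (\<lambda>n. flux x (g x + (c * inverse (real (Suc n))) *\<^sub>R h x) \<bullet> h x) \<longlonglongrightarrow> flux x
        (g x + 0 *\<^sub>R h x) \<bullet> h x"
    proof (rule AE_I2)
      fix x assume "x \<in> space L"
      then have x: "x \<in> \<Omega>" by simp
      have "(\<lambda>n. g x + (c * inverse (real (Suc n))) *\<^sub>R h x) \<longlonglongrightarrow> g x + (c * 0) *\<^sub>R h x"
        by (intro tendsto_intros LIMSEQ_inverse_real_of_nat)
      then have "(\<lambda>n. g x + (c * inverse (real (Suc n))) *\<^sub>R h x) \<longlonglongrightarrow> g x + 0 *\<^sub>R h x" by simp
      then show "(\<lambda>n. flux x (g x + (c * inverse (real (Suc n))) *\<^sub>R h x) \<bullet> h x) \<longlonglongrightarrow> flux x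
          (g x + 0 *\<^sub>R h x) \<bullet> h x"
        by (intro tendsto_inner flux_tendsto[OF x] tendsto_const)
    qed
  qed measurable
  have pos: "0 < inverse (real (Suc n))" "inverse (real (Suc n)) \<le> 1" for n by (auto simp: inverse_le_1_iff)
  have "pairing F v \<le> A 0"
  proof (rule LIMSEQ_le_const[OF lim[of 1]])
    have "pairing F v \<le> A (1 * inverse (real (Suc n)))" for n
      using key[of "inverse (real (Suc n))"] pos[of n] by (simp add: zero_le_mult_iff)
    then show "\<exists>N. \<forall>n\<ge>N. pairing F v \<le> A (1 * inverse (real (Suc n)))" by blast
  qed simp
  moreover have "A 0 \<le> pairing F v"
  proof (rule LIMSEQ_le_const2[OF lim[of "-1"]])
    have "A (- 1 * inverse (real (Suc n))) \<le> pairing F v" for n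
      using key[of "- inverse (real (Suc n))"] pos[of n] by (simp add: zero_le_mult_iff mult_le_0_iff)
    then show "\<exists>N. \<forall>n\<ge>N. A (- 1 * inverse (real (Suc n))) \<le> pairing F v" by blast
  qed simp
  ultimately show "(LINT x|L. flux x (g x) \<bullet> h x) = pairing F v" by (simp add: A_def)
qed

section \<open>Compactness and continuity of the solution operator\<close>

lemma pair_mod_add:
  assumes [measurable]: "d \<in> borel_measurable L" "u \<in> borel_measurable L" "v \<in> borel_measurable L"
  shows "pair_mod d (\<lambda>x. u x + v x) \<le> pair_mod d u + pair_mod d v"
proof -
  have "pair_mod d (\<lambda>x. u x + v x) \<le> (\<integral>\<^sup>+x. ennreal (\<bar>d x\<bar> * \<bar>u x\<bar>) + ennreal (\<bar>d x\<bar> * \<bar>v x\<bar>) \<partial>L)"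
    unfolding pair_mod_def
  proof (rule nn_integral_mono)
    fix x
    have "\<bar>d x\<bar> * \<bar>u x + v x\<bar> \<le> \<bar>d x\<bar> * \<bar>u x\<bar> + \<bar>d x\<bar> * \<bar>v x\<bar>"
      using mult_left_mono[OF abs_triangle_ineq[of "u x" "v x"], of "\<bar>d x\<bar>"] by (simp add: distrib_left)
    then have "ennreal (\<bar>d x\<bar> * \<bar>u x + v x\<bar>) \<le> ennreal (\<bar>d x\<bar> * \<bar>u x\<bar> + \<bar>d x\<bar> * \<bar>v x\<bar>)" by (rule ennreal_leI)
    also have "\<dots> = ennreal (\<bar>d x\<bar> * \<bar>u x\<bar>) + ennreal (\<bar>d x\<bar> * \<bar>v x\<bar>)" by (rule ennreal_plus) auto
    finally show "ennreal (\<bar>d x\<bar> * \<bar>u x + v x\<bar>) \<le> ennreal (\<bar>d x\<bar> * \<bar>u x\<bar>) + ennreal (\<bar>d x\<bar> * \<bar>v x\<bar>)" .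
  qed
  also have "\<dots> = pair_mod d u + pair_mod d v" unfolding pair_mod_def by (rule nn_integral_add) measurable
  finally show ?thesis .
qed

lemma pair_mod_mono:
  assumes "\<And>x. x \<in> \<Omega> \<Longrightarrow> \<bar>d x\<bar> \<le> \<bar>d' x\<bar>"
  shows "pair_mod d u \<le> pair_mod d' u"
  unfolding pair_mod_def by (intro nn_integral_mono ennreal_leI mult_right_mono) (use assms in auto)

lemma adm_diff_le:
  assumes "adm F" "adm G" "x \<in> \<Omega>"
  shows "\<bar>F x - G x\<bar> \<le> \<bar>\<psi> x\<bar>"
proof -
  have "0 \<le> F x" "F x \<le> \<psi> x" "0 \<le> G x" "G x \<le> \<psi> x" using assms by (auto simp: adm_def)
  then show ?thesis by arith
qed

text \<open>The sources are only dominated, not convergent. Test functions near the minimizers have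
  a subsequence that is Cauchy in L1, so by \<open>pair_mod_split\<close> the differences of the
  minimizers become small against \<psi>. Since differences of sources are bounded by \<psi>,
  \<open>sol_defect\<close> makes the gradients Cauchy, and \<open>poincare_W0\<close> then the
  functions.\<close>

lemma sol_compact:
  assumes F: "\<And>n::nat. adm (F n)" and s: "\<And>n. sol (F n) (u n) (g n)"
  obtains r u' g' where "strict_mono (r::nat\<Rightarrow>nat)" "u' \<in> borel_measurable L" "g' \<in> borel_measurable L"
    "AE x in L. (\<lambda>n. u (r n) x) \<longlonglongrightarrow> u' x \<and> (\<lambda>n. g (r n) x) \<longlonglongrightarrow> g' x"
proof -
  obtain M where M: "0 \<le> M" "\<And>F u g. adm F \<Longrightarrow> sol F u g \<Longrightarrow> mH g \<le> ennreal M \<and> mH u \<le> ennreal M"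
    using sol_bound by blast
  note W = solD(1)[OF s]
  note [measurable] = W0_measurable[OF W]
  have "\<forall>n. \<exists>\<phi>. \<phi> \<in> test_functions \<Omega> \<and> mH (\<lambda>x. u n x - \<phi> x) \<le>
      ennreal (inverse (real (Suc n))) \<and> mH (\<lambda>x. g n x - gradient \<phi> x) \<le> ennreal (inverse (real (Suc n)))"
  proof
    fix n
    have "0 < inverse (real (Suc n))" by simp
    from W0_approx[OF W[of n] this] show "\<exists>\<phi>. \<phi> \<in> test_functions \<Omega> \<and> mH (\<lambda>x. u n x - \<phi> x) \<le>
        ennreal (inverse (real (Suc n))) \<and> mH (\<lambda>x. g n x - gradient \<phi> x) \<le> ennreal (inverse (real (Suc n)))"
      by blast
  qed
  from choice[OF this] obtain \<phi> where \<phi>':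
    "\<forall>n. \<phi> n \<in> test_functions \<Omega> \<and> mH (\<lambda>x. u n x - \<phi> n x) \<le>
        ennreal (inverse (real (Suc n))) \<and> mH (\<lambda>x. g n x - gradient (\<phi> n) x) \<le> ennreal (inverse (real (Suc
        n)))" ..
  then have \<phi>: "\<And>n. \<phi> n \<in> test_functions \<Omega>" "\<And>n. mH (\<lambda>x. u n x - \<phi> n x) \<le> ennreal (inverse (real (Suc n)))"
    "\<And>n. mH (\<lambda>x. g n x - gradient (\<phi> n) x) \<le> ennreal (inverse (real (Suc n)))" by simp_all
  note [measurable] = test_measurable[OF \<phi>(1)]
  define M1 where "M1 = 2 powr P * (1 + M)"
  have M1: "0 \<le> M1" using M(1) by (simp add: M1_def)
  have inv1: "ennreal (inverse (real (Suc n))) \<le> ennreal 1" for n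
      by (intro ennreal_leI) (simp add: inverse_le_1_iff)
  have bnd: "mH w \<le> ennreal M1" if [measurable]: "w \<in> borel_measurable L" "z \<in> borel_measurable L"
      and "mH (\<lambda>x. z x - w x) \<le> ennreal 1" "mH z \<le> ennreal M"
    for w z :: "real^'n \<Rightarrow> 'c::euclidean_space"
  proof -
    have "mH w \<le> ennreal (2 powr P) * (mH (\<lambda>x. w x - z x) + mH z)" using mH_add[of "\<lambda>x. w x - z x" z] by simp
    also have "\<dots> \<le> ennreal (2 powr P) * (ennreal 1 + ennreal M)"
      using that(3,4) mH_diff_commute[of z w] by (intro mult_left_mono add_mono) auto
    also have "\<dots> = ennreal M1" using M(1)
        by (simp add: M1_def ennreal_mult ennreal_plus del: ennreal_1 add: ennreal_1[symmetric])
    finally show ?thesis .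
  qed
  have g\<phi>: "mH (gradient (\<phi> n)) \<le> ennreal M1" for n
    using M(2)[OF F s] \<phi>(3)[of n] inv1[of n] by (intro bnd[of _ "g n"]) (auto intro: order_trans)
  have u\<phi>: "mH (\<phi> n) \<le> ennreal M1" for n
    using M(2)[OF F s] \<phi>(2)[of n] inv1[of n] by (intro bnd[of _ "u n"]) (auto intro: order_trans)
  define M2 where "M2 = 2 powr P * (M1 + M1)"
  have M2: "0 \<le> M2" using M1 by (simp add: M2_def)
  have d\<phi>: "mH (\<lambda>x. \<phi> k x - \<phi> l x) \<le> ennreal M2" for k l
  proof -
    have "mH (\<lambda>x. \<phi> k x - \<phi> l x) \<le> ennreal (2 powr P) * (mH (\<phi> k) + mH (\<phi> l))"
        using mH_add[of "\<phi> k" "\<lambda>x. - \<phi> l x"] by simp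
    also have "\<dots> \<le> ennreal (2 powr P) * (ennreal M1 + ennreal M1)" using u\<phi>
        by (intro mult_left_mono add_mono) auto
    also have "\<dots> = ennreal M2" using M1 by (simp add: M2_def ennreal_plus[symmetric] ennreal_mult[symmetric]
        del: ennreal_plus)
    finally show ?thesis .
  qed
  obtain r where r: "strict_mono (r::nat\<Rightarrow>nat)"
    "\<And>\<epsilon>. 0 < \<epsilon> \<Longrightarrow> \<exists>N. \<forall>m\<ge>N. \<forall>n\<ge>N. (\<integral>\<^sup>+x. ennreal \<bar>\<phi> (r m) x - \<phi> (r n) x\<bar> \<partial>L) \<le> ennreal \<epsilon>"
  proof (rule compact_embedding_test[OF \<phi>(1) g\<phi> M1])
    fix r :: "nat \<Rightarrow> nat"
    assume r1: "strict_mono r"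
      and r2: "\<And>\<epsilon>. 0 < \<epsilon> \<Longrightarrow> \<exists>N. \<forall>m\<ge>N. \<forall>n\<ge>N. (\<integral>\<^sup>+x. ennreal \<bar>\<phi> (r m) x - \<phi> (r n) x\<bar> \<partial>L) \<le> ennreal \<epsilon>"
    show ?thesis by (rule that[OF r1 r2])
  qed
  have B: "\<exists>N. \<forall>k\<ge>N. \<forall>l\<ge>N. pair_mod \<psi> (\<lambda>x. u (r k) x - u (r l) x) \<le> ennreal \<epsilon>" if \<epsilon>: "0 < \<epsilon>" for \<epsilon>
  proof -
    have \<epsilon>3: "0 < \<epsilon> / 3" using \<epsilon> by simp
    from pair_mod_small[OF \<epsilon>3] obtain \<eta> where \<eta>: "0 < \<eta>" "\<And>u. u \<in> borel_measurable L \<Longrightarrow> mH u \<le> ennreal \<eta> \<Longrightarrow>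
        pair_mod \<psi> u \<le> ennreal (\<epsilon> / 3)" by blast
    from pair_mod_split[OF \<epsilon>3 M2] obtain \<eta>2 where \<eta>2: "0 < \<eta>2"
      "\<And>v. v \<in> borel_measurable L \<Longrightarrow> mH v \<le> ennreal M2 \<Longrightarrow> (\<integral>\<^sup>+x. ennreal \<bar>v x\<bar> \<partial>L) \<le> ennreal \<eta>2 \<Longrightarrow> pair_mod \<psi> v \<le>
          ennreal (\<epsilon> / 3)" by blast
    from reals_Archimedean[OF \<eta>(1)] obtain N1 where N1: "inverse (real (Suc N1)) < \<eta>" ..
    from r(2)[OF \<eta>2(1)] obtain N2 where N2: "\<forall>m\<ge>N2. \<forall>n\<ge>N2. (\<integral>\<^sup>+x. ennreal \<bar>\<phi> (r m) x - \<phi> (r n) x\<bar> \<partial>L) \<le>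
        ennreal \<eta>2" ..
    have near: "mH (\<lambda>x. u (r k) x - \<phi> (r k) x) \<le> ennreal \<eta>" if "N1 \<le> k" for k
    proof -
      have "Suc N1 \<le> Suc (r k)" using seq_suble[OF r(1), of k] that by simp
      then have "inverse (real (Suc (r k))) \<le> inverse (real (Suc N1))" by (intro le_imp_inverse_le) auto
      then have "ennreal (inverse (real (Suc (r k)))) \<le> ennreal \<eta>" using N1 by (intro ennreal_leI) linarith
      with \<phi>(2)[of "r k"] show ?thesis by (rule order_trans)
    qed
    have "pair_mod \<psi> (\<lambda>x. u (r k) x - u (r l) x) \<le> ennreal \<epsilon>" if kl: "max N1 N2 \<le> k" "max N1 N2 \<le> l" for k l
    proof -
      have "pair_mod \<psi> (\<lambda>x. u (r k) x - u (r l) x) =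
          pair_mod \<psi> (\<lambda>x. ((u (r k) x - \<phi> (r k) x) + (\<phi> (r k) x - \<phi> (r l) x)) + (\<phi> (r l) x - u (r l)
              x))" by simp
      also have "\<dots> \<le> pair_mod \<psi> (\<lambda>x. (u (r k) x - \<phi> (r k) x) + (\<phi> (r k) x - \<phi> (r l) x)) + pair_mod \<psi> (\<lambda>x. \<phi>
          (r l) x - u (r l) x)"
        by (rule pair_mod_add) measurable
      also have "\<dots> \<le> (pair_mod \<psi> (\<lambda>x. u (r k) x - \<phi> (r k) x) + pair_mod \<psi> (\<lambda>x. \<phi> (r k) x - \<phi>
          (r l) x)) + pair_mod \<psi> (\<lambda>x. \<phi> (r l) x - u (r l) x)"
        by (intro add_right_mono pair_mod_add) measurable
      also have "\<dots> \<le> (ennreal (\<epsilon> / 3) + ennreal (\<epsilon> / 3)) + ennreal (\<epsilon> / 3)"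
      proof (intro add_mono)
        show "pair_mod \<psi> (\<lambda>x. u (r k) x - \<phi> (r k) x) \<le> ennreal (\<epsilon> / 3)" using near[of k] kl by (intro \<eta>(2)) auto
        show "pair_mod \<psi> (\<lambda>x. \<phi> (r k) x - \<phi> (r l) x) \<le> ennreal (\<epsilon> / 3)" using N2 kl d\<phi> by (intro \<eta>2(2)) auto
        show "pair_mod \<psi> (\<lambda>x. \<phi> (r l) x - u (r l) x) \<le> ennreal (\<epsilon> / 3)"
          using near[of l] kl mH_diff_commute[of "u (r l)" "\<phi> (r l)"] by (intro \<eta>(2)) auto
      qed
      also have "\<dots> = ennreal \<epsilon>" using \<epsilon> by (simp add: ennreal_plus[symmetric] del: ennreal_plus)
      finally show ?thesis .
    qed
    then show ?thesis by blast
  qed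
  have cg: "mcauchy (\<lambda>n. g (r n))"
    unfolding mcauchy_def
  proof (intro allI impI)
    fix \<epsilon> :: real assume \<epsilon>: "0 < \<epsilon>"
    from defect_small[OF \<epsilon> M(1), where 'b="real^'n"] obtain \<eta> where \<eta>: "0 < \<eta>"
      "\<And>g h::real^'n \<Rightarrow> real^'n. g \<in> borel_measurable L \<Longrightarrow> h \<in> borel_measurable L \<Longrightarrow> mH g \<le> ennreal M \<Longrightarrow> mH h \<le>
          ennreal M \<Longrightarrow>
        defect g h \<le> \<eta> \<Longrightarrow> mH (\<lambda>x. g x - h x) \<le> ennreal \<epsilon>" by blast
    obtain N where N: "\<forall>k\<ge>N. \<forall>l\<ge>N. pair_mod \<psi> (\<lambda>x. u (r k) x - u (r l) x) \<le> ennreal \<eta>"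
        by (rule exE[OF B[OF \<eta>(1)]])
    have "mH (\<lambda>x. g (r k) x - g (r l) x) \<le> ennreal \<epsilon>" if "N \<le> k" "N \<le> l" for k l
    proof (rule \<eta>(2))
      have "pair_mod (\<lambda>x. F (r k) x - F (r l) x) (\<lambda>x. u (r k) x - u (r l) x) \<le> ennreal \<eta>"
        (is "pair_mod ?d ?w \<le> _")
      proof (rule order_trans)
        show "pair_mod ?d ?w \<le> pair_mod \<psi> ?w" by (rule pair_mod_mono) (rule adm_diff_le[OF F F])
        show "pair_mod \<psi> ?w \<le> ennreal \<eta>" using N that by blast
      qed
      then show "defect (g (r k)) (g (r l)) \<le> \<eta>" using \<eta>(1) by (intro sol_defect[OF F F s s]) auto
    qed (use M(2)[OF F s] in auto)
    then show "\<exists>N. \<forall>m\<ge>N. \<forall>n\<ge>N. mH (\<lambda>x. g (r m) x - g (r n) x) \<le> ennreal \<epsilon>" by blast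
  qed
  have cu: "mcauchy (\<lambda>n. u (r n))"
    unfolding mcauchy_def
  proof (intro allI impI)
    fix \<epsilon> :: real assume \<epsilon>: "0 < \<epsilon>"
    from poincare_W0[OF \<epsilon>] obtain \<eta> where \<eta>: "0 < \<eta>" "\<And>u g. W0 u g \<Longrightarrow> mH g \<le> ennreal \<eta> \<Longrightarrow> mH u \<le> ennreal \<epsilon>"
        by blast
    from mcauchyD[OF cg \<eta>(1)] obtain N where N: "\<forall>m\<ge>N. \<forall>n\<ge>N. mH (\<lambda>x. g (r m) x - g (r n) x) \<le> ennreal \<eta>" ..
    have "mH (\<lambda>x. u (r k) x - u (r l) x) \<le> ennreal \<epsilon>" if "N \<le> k" "N \<le> l" for k l
      using N that by (intro \<eta>(2)[OF W0_diff[OF W W]]) auto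
    then show "\<exists>N. \<forall>m\<ge>N. \<forall>n\<ge>N. mH (\<lambda>x. u (r m) x - u (r n) x) \<le> ennreal \<epsilon>" by blast
  qed
  obtain g' where g': "g' \<in> borel_measurable L" "mconv (\<lambda>n. g (r n)) g'"
    by (rule mcauchy_limit[OF W0_measurable(2)[OF W] W0_finite(2)[OF W] cg])
  obtain u' where u': "u' \<in> borel_measurable L" "mconv (\<lambda>n. u (r n)) u'"
    by (rule mcauchy_limit[OF W0_measurable(1)[OF W] W0_finite(1)[OF W] cu])
  obtain t where t: "strict_mono (t::nat\<Rightarrow>nat)" "AE x in L. (\<lambda>n. u (r (t n)) x) \<longlonglongrightarrow> u' x \<and> (\<lambda>n. g (r
      (t n)) x) \<longlonglongrightarrow> g' x"
    by (rule mconv_AE_subseq2[OF W0_measurable(1)[OF W] u'(1) W0_finite(1)[OF W] u'(2) W0_measurable(2)[OF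
        W] g'(1) W0_finite(2)[OF W] g'(2)])
  show ?thesis
  proof (rule that[OF _ u'(1) g'(1) t(2)])
    show "strict_mono (\<lambda>n. r (t n))" using strict_mono_o[OF r(1) t(1)] by (simp add: o_def)
  qed
qed

text \<open>Domination by \<psi> turns almost everywhere convergence of the sources into convergence
  of their difference in the conjugate modular. Young's inequality and the uniform bound on
  minimizers carry this to \<open>sol_defect\<close>, hence to modular convergence; the subsequence
  is only for convergence almost everywhere.\<close>

lemma sol_continuous:
  assumes F: "\<And>n::nat. adm (F n)" "adm G" and s: "\<And>n. sol (F n) (u n) (g n)" "sol G v h"
    and ae: "AE x in L. (\<lambda>n. F n x) \<longlonglongrightarrow> G x"
  obtains r where "strict_mono (r::nat\<Rightarrow>nat)" "AE x in L. (\<lambda>n. u (r n) x) \<longlonglongrightarrow> v x \<and> (\<lambda>n. g (r n) x) \<longlonglongrightarrow> h x"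
proof -
  obtain M where M: "0 \<le> M" "\<And>F u g. adm F \<Longrightarrow> sol F u g \<Longrightarrow> mH g \<le> ennreal M \<and> mH u \<le> ennreal M"
    using sol_bound by blast
  note W = solD(1)[OF s(1)] and Wv = solD(1)[OF s(2)]
  note [measurable] = W0_measurable[OF W] W0_measurable[OF Wv] adm_meas[OF F(1)] adm_meas[OF F(2)]
  define M2 where "M2 = 2 powr P * (M + M)"
  have M2: "0 \<le> M2" using M(1) by (simp add: M2_def)
  have d: "mH (\<lambda>x. u n x - v x) \<le> ennreal M2" for n
  proof -
    have "mH (\<lambda>x. u n x - v x) \<le> ennreal (2 powr P) * (mH (u n) + mH v)" using mH_add[of "u n" "\<lambda>x. - v x"]
        by simp
    also have "\<dots> \<le> ennreal (2 powr P) * (ennreal M + ennreal M)" using M(2)[OF F(1) s(1)] M(2)[OF F(2) s(2)]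
        by (intro mult_left_mono add_mono) auto
    also have "\<dots> = ennreal M2" using M(1)
        by (simp add: M2_def ennreal_plus[symmetric] ennreal_mult[symmetric] del: ennreal_plus)
    finally show ?thesis .
  qed
  have cm: "(\<lambda>n. conj_mod (\<lambda>x. F n x - G x)) \<longlonglongrightarrow> 0"
  proof -
    have "(\<lambda>n. \<integral>\<^sup>+x. ennreal (\<bar>F n x - G x\<bar> powr (p x / (p x - 1))) \<partial>L) \<longlonglongrightarrow> (\<integral>\<^sup>+x. 0 \<partial>L)"
    proof (rule nn_integral_dominated_convergence[where w="\<lambda>x. ennreal (\<bar>\<psi> x\<bar> powr (p x / (p x - 1)))"])
      show "(\<integral>\<^sup>+x. ennreal (\<bar>\<psi> x\<bar> powr (p x / (p x - 1))) \<partial>L) < \<infinity>" using conj_mod_psi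
          by (simp add: conj_mod_def)
      show "AE x in L. (\<lambda>n. ennreal (\<bar>F n x - G x\<bar> powr (p x / (p x - 1)))) \<longlonglongrightarrow> 0"
        using ae AE_space
      proof eventually_elim
        case (elim x)
        then have "(\<lambda>n. \<bar>F n x - G x\<bar>) \<longlonglongrightarrow> \<bar>G x - G x\<bar>" by (intro tendsto_intros)
        moreover have "0 < p x / (p x - 1)" using exps'(1)[of x] elim(2) by simp
        ultimately have "(\<lambda>n. \<bar>F n x - G x\<bar> powr (p x / (p x - 1))) \<longlonglongrightarrow> \<bar>G x - G x\<bar> powr (p x / (p x - 1))"
          by (intro tendsto_powr' tendsto_const) auto
        then have "(\<lambda>n. ennreal (\<bar>F n x - G x\<bar> powr (p x / (p x - 1)))) \<longlonglongrightarrow> ennreal (\<bar>G x - G x\<bar> powr (p x /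
            (p x - 1)))"
          by (rule tendsto_ennrealI)
        then show ?case by simp
      qed
      show "AE x in L. ennreal (\<bar>F n x - G x\<bar> powr (p x / (p x - 1))) \<le>
          ennreal (\<bar>\<psi> x\<bar> powr (p x / (p x - 1)))" for n
      proof (rule AE_I2)
        fix x assume "x \<in> space L"
        then have x: "x \<in> \<Omega>" by simp
        have "0 \<le> p x / (p x - 1)" using exps'(1)[OF x] by simp
        then show "ennreal (\<bar>F n x - G x\<bar> powr (p x / (p x - 1))) \<le> ennreal (\<bar>\<psi> x\<bar> powr (p x / (p x - 1)))"
          using adm_diff_le[OF F x, of n] by (intro ennreal_leI powr_mono2) auto
      qed
    qed measurable
    then show ?thesis by (simp add: conj_mod_def)
  qed
  have cg: "mconv g h"
    unfolding mconv_def
  proof (intro allI impI)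
    fix \<epsilon> :: real assume \<epsilon>: "0 < \<epsilon>"
    from defect_small[OF \<epsilon> M(1), where 'b="real^'n"] obtain \<eta> where \<eta>: "0 < \<eta>"
      "\<And>g h::real^'n \<Rightarrow> real^'n. g \<in> borel_measurable L \<Longrightarrow> h \<in> borel_measurable L \<Longrightarrow> mH g \<le> ennreal M \<Longrightarrow> mH h \<le>
          ennreal M \<Longrightarrow>
        defect g h \<le> \<eta> \<Longrightarrow> mH (\<lambda>x. g x - h x) \<le> ennreal \<epsilon>" by blast
    \<comment> \<open>\<open>M2\<close> bounds the modular of u n - v, so the first Young term is at
      most \<eta> / 2; the constant \<open>C\<close> of the second is fixed before
      \<open>n\<close>.\<close>
    define \<epsilon>1 where "\<epsilon>1 = \<eta> / (2 * (M2 + 1))"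
    have \<epsilon>1: "0 < \<epsilon>1" using \<eta>(1) M2 by (simp add: \<epsilon>1_def)
    have \<epsilon>1M: "M2 * \<epsilon>1 \<le> \<eta> / 2" unfolding \<epsilon>1_def using M2 \<eta>(1) by (intro mult_fraction_le) auto
    obtain C where C: "0 \<le> C" "\<And>d u. d \<in> borel_measurable L \<Longrightarrow> u \<in> borel_measurable L \<Longrightarrow> pair_mod d u \<le>
        ennreal \<epsilon>1 * mH u + ennreal C * conj_mod d"
      using pair_mod_young[OF \<epsilon>1] by blast
    have "(\<lambda>n. ennreal C * conj_mod (\<lambda>x. F n x - G x)) \<longlonglongrightarrow> ennreal C * 0" by (intro ennreal_tendsto_cmult cm) simp
    then have "(\<lambda>n. ennreal C * conj_mod (\<lambda>x. F n x - G x)) \<longlonglongrightarrow> 0" by simp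
    moreover have "0 < ennreal (\<eta> / 2)" using \<eta>(1) by simp
    ultimately have "\<forall>\<^sub>F n in sequentially. ennreal C * conj_mod (\<lambda>x. F n x - G x) < ennreal (\<eta> / 2)"
        by (rule order_tendstoD(2))
    then obtain N where N: "\<And>n. N \<le> n \<Longrightarrow> ennreal C * conj_mod (\<lambda>x. F n x - G x) < ennreal (\<eta> / 2)"
        by (auto simp: eventually_sequentially)
    have "mH (\<lambda>x. g n x - h x) \<le> ennreal \<epsilon>" if n: "N \<le> n" for n
    proof (rule \<eta>(2))
      have "pair_mod (\<lambda>x. F n x - G x) (\<lambda>x. u n x - v x) \<le>
          ennreal \<epsilon>1 * mH (\<lambda>x. u n x - v x) + ennreal C * conj_mod (\<lambda>x. F n x - G x)"
        by (rule C(2)) measurable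
      also have "\<dots> \<le> ennreal \<epsilon>1 * ennreal M2 + ennreal (\<eta> / 2)"
        using d N[OF n] by (intro add_mono mult_left_mono) auto
      also have "\<dots> = ennreal (M2 * \<epsilon>1 + \<eta> / 2)"
        using \<epsilon>1 M2 \<eta>(1) by (simp add: ennreal_plus[symmetric] ennreal_mult[symmetric] mult.commute del:
            ennreal_plus)
      also have "\<dots> \<le> ennreal \<eta>" using \<epsilon>1M by (intro ennreal_leI) linarith
      finally show "defect (g n) h \<le> \<eta>" using \<eta>(1) by (intro sol_defect[OF F s]) auto
    qed (use M(2)[OF F(1) s(1)] M(2)[OF F(2) s(2)] in auto)
    then show "\<exists>N. \<forall>n\<ge>N. mH (\<lambda>x. g n x - h x) \<le> ennreal \<epsilon>" by blast
  qed
  have cu: "mconv u v"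
    unfolding mconv_def
  proof (intro allI impI)
    fix \<epsilon> :: real assume \<epsilon>: "0 < \<epsilon>"
    from poincare_W0[OF \<epsilon>] obtain \<eta> where \<eta>: "0 < \<eta>" "\<And>u g. W0 u g \<Longrightarrow> mH g \<le> ennreal \<eta> \<Longrightarrow> mH u \<le> ennreal \<epsilon>"
        by blast
    from mconvD[OF cg \<eta>(1)] obtain N where N: "\<forall>n\<ge>N. mH (\<lambda>x. g n x - h x) \<le> ennreal \<eta>" ..
    have "mH (\<lambda>x. u n x - v x) \<le> ennreal \<epsilon>" if "N \<le> n" for n
      using N that by (intro \<eta>(2)[OF W0_diff[OF W Wv]]) auto
    then show "\<exists>N. \<forall>n\<ge>N. mH (\<lambda>x. u n x - v x) \<le> ennreal \<epsilon>" by blast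
  qed
  have m: "\<And>n. u n \<in> borel_measurable L" "v \<in> borel_measurable L" "\<And>n. g n \<in> borel_measurable L"
      "h \<in> borel_measurable L"
    and f: "\<And>n. mH (u n) < \<infinity>" "\<And>n. mH (g n) < \<infinity>"
    using W0_measurable[OF W] W0_measurable[OF Wv] W0_finite[OF W] by auto
  obtain r where r: "strict_mono (r::nat\<Rightarrow>nat)" "AE x in L. (\<lambda>n. u (r n) x) \<longlonglongrightarrow> v x \<and> (\<lambda>n. g (r n) x) \<longlonglongrightarrow> h x"
    by (rule mconv_AE_subseq2[where w=u and v=v and w'=g and v'=h, OF m(1,2) f(1) cu m(3,4) f(2) cg])
  show ?thesis by (rule that[OF r])
qed

end

section \<open>Musielak-Orlicz Sobolev spaces\<close>

text \<open>Rests on the completeness of Lebesgue measure; weak gradients are known only up to null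
  sets.\<close>

lemma borel_measurable_lebesgue_on_AE:
  fixes f g :: "'a::euclidean_space \<Rightarrow> 'b::euclidean_space"
  assumes S: "S \<in> sets lebesgue" and f: "f \<in> borel_measurable (lebesgue_on S)"
      and ae: "AE x in lebesgue_on S. f x = g x"
  shows "g \<in> borel_measurable (lebesgue_on S)"
proof -
  have "AE x in lebesgue. (if x \<in> S then f x else 0) = (if x \<in> S then g x else 0)"
    using ae S by (auto simp: AE_restrict_space_iff elim!: eventually_mono)
  with f show ?thesis
    unfolding borel_measurable_if[OF S, symmetric] by (rule borel_measurable_AE)
qed

text \<open>Local integrability speaks of compact subsets only; measurability is glued together from
  a countable cover by closed boxes.\<close>

lemma locally_integrable_measurable:
  fixes u :: "'a::euclidean_space \<Rightarrow> 'b::euclidean_space"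
  assumes "open \<Omega>" and u: "locally_integrable \<Omega> u"
  shows "u \<in> borel_measurable (lebesgue_on \<Omega>)"
proof -
  obtain \<D> where D: "countable \<D>" "\<D> \<subseteq> Pow \<Omega>" "\<And>X. X \<in> \<D> \<Longrightarrow> \<exists>a b. X = cbox a b" "\<Union>\<D> = \<Omega>"
    by (rule open_countable_Union_open_cbox[OF assms(1)]) (rule that)
  show ?thesis
  proof (rule measurable_piecewise_restrict[OF D(1)])
    show "space (lebesgue_on \<Omega>) \<subseteq> \<Union>\<D>" using D(4) by simp
    fix X assume X: "X \<in> \<D>"
    then have sub: "X \<subseteq> \<Omega>" using D(2) by auto
    from D(3)[OF X] have c: "compact X" "X \<in> sets lebesgue" by auto
    show "X \<inter> space (lebesgue_on \<Omega>) \<in> sets (lebesgue_on \<Omega>)"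
      using sub c(2) by (auto simp: sets_restrict_space image_iff intro!: bexI[of _ X])
    have "set_integrable lebesgue X u" using u c(1) sub by (auto simp: locally_integrable_def)
    then have "(\<lambda>x. indicator X x *\<^sub>R u x) \<in> borel_measurable lebesgue"
      unfolding set_integrable_def by auto
    then have "u \<in> borel_measurable (lebesgue_on X)"
      using c(2) by (subst borel_measurable_restrict_space_iff) auto
    moreover have "restrict_space (lebesgue_on \<Omega>) X = lebesgue_on X"
      using sub assms(1) c(2) by (simp add: restrict_restrict_space Int_absorb1)
    ultimately show "u \<in> borel_measurable (restrict_space (lebesgue_on \<Omega>) X)" by simp
  qed
qed

lemma integral_product_small:
  fixes w :: "'a \<Rightarrow> 'b::euclidean_space" and h :: "'a \<Rightarrow> real"
  assumes h: "integrable M h" and le: "\<And>x. \<bar>h x\<bar> \<le> C * norm (w x)" and C: "0 \<le> C"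
    and [measurable]: "w \<in> borel_measurable M" and w: "(\<integral>\<^sup>+x. ennreal (norm (w x)) \<partial>M) \<le> ennreal \<epsilon>" and "0 \<le> \<epsilon>"
  shows "\<bar>LINT x|M. h x\<bar> \<le> C * \<epsilon>"
proof -
  have "ennreal \<bar>LINT x|M. h x\<bar> \<le> (\<integral>\<^sup>+x. ennreal (norm (h x)) \<partial>M)"
    using integral_norm_bound_ennreal[OF h] by simp
  also have "\<dots> \<le> (\<integral>\<^sup>+x. ennreal C * ennreal (norm (w x)) \<partial>M)"
    using le C by (intro nn_integral_mono) (simp add: ennreal_mult[symmetric] ennreal_leI)
  also have "\<dots> \<le> ennreal C * ennreal \<epsilon>" using w by (simp add: nn_integral_cmult mult_left_mono)
  finally show ?thesis using C \<open>0 \<le> \<epsilon>\<close> by (simp add: ennreal_mult[symmetric])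
qed

context double_phase_setup
begin

text \<open>Integration by parts holds for approximating test functions, and both sides are stable
  in L1 because \<eta> and its partial derivative are bounded. The two sides therefore differ by at
  most a constant times any positive \<epsilon>.\<close>

lemma W0_has_weak_gradient:
  assumes W: "W0 u g"
  shows "has_weak_gradient \<Omega> u g"
  unfolding has_weak_gradient_def
proof (intro conjI ballI allI)
  note m [measurable] = W0_measurable[OF W]
  have iu: "integrable L u" and ig: "integrable L g"
    by (rule integrable_if_mH[OF m(1) W0_finite(1)[OF W]], rule integrable_if_mH[OF m(2) W0_finite(2)[OF W]])
  show "locally_integrable \<Omega> u" "locally_integrable \<Omega> g"
    using integrable_imp_locally_integrable[OF open_dom] iu ig by auto
  fix \<eta> i assume \<eta>: "\<eta> \<in> test_functions \<Omega>"
  note \<eta>' = test_partial[OF open_dom \<eta>, of i]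
  note [measurable] = test_measurable(1)[OF \<eta>] test_measurable(1)[OF \<eta>']
  obtain B1 where B1: "B1 \<ge> 0" "\<And>x. \<bar>\<eta> x\<bar> \<le> B1" by (rule test_bounded[OF open_dom \<eta>]) (rule that)
  obtain B2 where B2: "B2 \<ge> 0" "\<And>x. \<bar>partial_derivative i \<eta> x\<bar> \<le> B2"
      by (rule test_bounded[OF open_dom \<eta>']) (rule that)
  have int1: "integrable L (\<lambda>x. w x * partial_derivative i \<eta> x)" if "integrable L w" for w :: "real^'n \<Rightarrow> real"
    using that B2 by (intro Bochner_Integration.integrable_bound[where
        g="\<lambda>x. w x * partial_derivative i \<eta> x" and f="\<lambda>x. B2 * w x"])
      (auto simp: abs_mult mult.commute[of B2] intro!: AE_I2 mult_left_mono)
  have int2: "integrable L (\<lambda>x. w x $ i * \<eta> x)" if w: "integrable L w" for w :: "real^'n \<Rightarrow> real^'n"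
  proof -
    have "integrable L (\<lambda>x. w x $ i)" using integrable_inner_left[OF w, of "axis i 1"] by (simp add: inner_axis)
    then show ?thesis
      using B1 by (intro Bochner_Integration.integrable_bound[where g="\<lambda>x. w x $ i * \<eta> x" and
          f="\<lambda>x. B1 * w x $ i"])
        (auto simp: abs_mult mult.commute[of B1] intro!: AE_I2 mult_left_mono)
  qed
  have "\<bar>(LINT x|L. u x * partial_derivative i \<eta> x) + (LINT x|L. g x $ i * \<eta> x)\<bar> \<le> (B1 + B2) * \<epsilon>"
      if \<epsilon>: "0 < \<epsilon>" for \<epsilon>
  proof -
    from L1_small[OF \<epsilon>, where 'b=real] obtain \<eta>1 where \<eta>1: "0 < \<eta>1"
      "\<forall>w::real^'n \<Rightarrow> real. w \<in> borel_measurable L \<longrightarrow> mH w \<le> ennreal \<eta>1 \<longrightarrow> (\<integral>\<^sup>+x. ennreal (norm (w x)) \<partial>L) \<le>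
          ennreal \<epsilon>" by blast
    from L1_small[OF \<epsilon>, where 'b="real^'n"] obtain \<eta>2 where \<eta>2: "0 < \<eta>2"
      "\<forall>w::real^'n \<Rightarrow> real^'n. w \<in> borel_measurable L \<longrightarrow> mH w \<le> ennreal \<eta>2 \<longrightarrow> (\<integral>\<^sup>+x. ennreal (norm (w x)) \<partial>L) \<le>
          ennreal \<epsilon>" by blast
    have "0 < min \<eta>1 \<eta>2" using \<eta>1(1) \<eta>2(1) by simp
    from W0_approx[OF W this] obtain \<phi> where \<phi>: "\<phi> \<in> test_functions \<Omega>"
      "mH (\<lambda>x. u x - \<phi> x) \<le> ennreal (min \<eta>1 \<eta>2)" "mH (\<lambda>x. g x - gradient \<phi> x) \<le> ennreal (min \<eta>1 \<eta>2)" .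
    note m\<phi> [measurable] = test_measurable[OF \<phi>(1)]
    have i\<phi>: "integrable L \<phi>" and ig\<phi>: "integrable L (gradient \<phi>)"
      by (rule integrable_if_mH[OF m\<phi>(1) test_mH_finite(1)[OF \<phi>(1)]], rule integrable_if_mH[OF m\<phi>(2)
          test_mH_finite(2)[OF \<phi>(1)]])
    have s1: "(\<integral>\<^sup>+x. ennreal (norm (u x - \<phi> x)) \<partial>L) \<le> ennreal \<epsilon>"
    proof (rule \<eta>1(2)[rule_format])
      show "mH (\<lambda>x. u x - \<phi> x) \<le> ennreal \<eta>1" using order_trans[OF \<phi>(2) ennreal_leI[OF min.cobounded1]] .
    qed measurable
    have s2: "(\<integral>\<^sup>+x. ennreal (norm (g x - gradient \<phi> x)) \<partial>L) \<le> ennreal \<epsilon>"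
    proof (rule \<eta>2(2)[rule_format])
      show "mH (\<lambda>x. g x - gradient \<phi> x) \<le> ennreal \<eta>2"
          using order_trans[OF \<phi>(3) ennreal_leI[OF min.cobounded2]] .
    qed measurable
    \<comment> \<open>The subtracted bracket is 0 by \<open>test_integration_by_parts\<close>;
      subtracting it leaves approximation errors only.\<close>
    have "(LINT x|L. u x * partial_derivative i \<eta> x) + (LINT x|L. g x $ i * \<eta> x) =
        (LINT x|L. u x * partial_derivative i \<eta> x) + (LINT x|L. g x $ i * \<eta> x)
        - ((LINT x|L. \<phi> x * partial_derivative i \<eta> x) + (LINT x|L. gradient \<phi> x $ i * \<eta> x))"
      using test_integration_by_parts[OF open_dom bounded_dom \<phi>(1) \<eta>, of i] by simp
    also have "\<dots> = (LINT x|L. (u x - \<phi> x) * partial_derivative i \<eta> x) + (LINT x|L.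
        (g x - gradient \<phi> x) $ i * \<eta> x)"
    proof -
      have "(LINT x|L. (u x - \<phi> x) * partial_derivative i \<eta> x) =
          (LINT x|L. u x * partial_derivative i \<eta> x) - (LINT x|L. \<phi> x * partial_derivative i \<eta> x)"
        unfolding left_diff_distrib by (rule Bochner_Integration.integral_diff[OF int1[OF iu] int1[OF i\<phi>]])
      moreover have "(LINT x|L. (g x - gradient \<phi> x) $ i * \<eta> x) =
          (LINT x|L. g x $ i * \<eta> x) - (LINT x|L. gradient \<phi> x $ i * \<eta> x)"
        unfolding vector_minus_component left_diff_distrib
            by (rule Bochner_Integration.integral_diff[OF int2[OF ig] int2[OF ig\<phi>]])
      ultimately show ?thesis by simp
    qed
    also have "\<bar>\<dots>\<bar> \<le> B2 * \<epsilon> + B1 * \<epsilon>"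
    proof (intro order_trans[OF abs_triangle_ineq] add_mono)
      show "\<bar>LINT x|L. (u x - \<phi> x) * partial_derivative i \<eta> x\<bar> \<le> B2 * \<epsilon>"
      proof (rule integral_product_small[OF int1[OF Bochner_Integration.integrable_diff[OF iu i\<phi>]] _ B2(1) _
          s1])
        show "\<bar>(u x - \<phi> x) * partial_derivative i \<eta> x\<bar> \<le> B2 * norm (u x - \<phi> x)" for x
          using B2(2)[of x] by (simp add: abs_mult mult.commute[of B2] mult_left_mono)
      qed (use \<epsilon> in auto)
      show "\<bar>LINT x|L. (g x - gradient \<phi> x) $ i * \<eta> x\<bar> \<le> B1 * \<epsilon>"
      proof (rule integral_product_small[OF int2[OF Bochner_Integration.integrable_diff[OF ig ig\<phi>]] _ B1(1)
          _ s2])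
        show "\<bar>(g x - gradient \<phi> x) $ i * \<eta> x\<bar> \<le> B1 * norm (g x - gradient \<phi> x)" for x
          unfolding abs_mult mult.commute[of B1] using B1(2)[of x]
              by (intro mult_mono component_le_norm_cart) auto
      qed (use \<epsilon> in auto)
    qed
    finally show ?thesis by (simp add: algebra_simps)
  qed
  then have "\<bar>(LINT x|L. u x * partial_derivative i \<eta> x) + (LINT x|L. g x $ i * \<eta> x)\<bar> \<le> 0 + \<epsilon>" if "0 < \<epsilon>" for \<epsilon>
  proof -
    have "(B1 + B2) * (\<epsilon> / (B1 + B2 + 1)) \<le> \<epsilon>" using B1(1) B2(1) that by (simp add: field_simps)
    moreover have "0 < \<epsilon> / (B1 + B2 + 1)" using B1(1) B2(1) that by simp
    ultimately show ?thesis
      using \<open>\<And>\<epsilon>. 0 < \<epsilon> \<Longrightarrow> \<bar>(LINT x|L. u x * partial_derivative i \<eta> x) + (LINT x|L. g x $ i * \<eta> x)\<bar> \<le> (B1 +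
          B2) * \<epsilon>\<close>[of "\<epsilon> / (B1 + B2 + 1)"] by linarith
  qed
  then have "\<bar>(LINT x|L. u x * partial_derivative i \<eta> x) + (LINT x|L. g x $ i * \<eta> x)\<bar> \<le> 0"
    by (rule field_le_epsilon)
  then show "(LINT x|L. u x * partial_derivative i \<eta> x) = - (LINT x|L. g x $ i * \<eta> x)" by linarith
qed

section \<open>The Luxemburg norm and the modular\<close>

lemma modular_eq_mH: "modular \<Omega> H u = mH u" and modular_norm_eq_mH: "modular \<Omega> H (\<lambda>x. norm (g x)) = mH g"
  by (simp_all add: modular_def mH_def)

lemma modular_quotient: "0 < \<tau> \<Longrightarrow> modular \<Omega> H (\<lambda>x. norm (w x) / \<tau>) = mH (\<lambda>x. (1 / \<tau>) *\<^sub>R w x)"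
  by (simp add: modular_def mH_def)

lemma luxemburg_cong_AE:
  assumes "AE x in L. \<bar>u x\<bar> = \<bar>v x\<bar>"
  shows "luxemburg_norm \<Omega> \<Phi> u = luxemburg_norm \<Omega> \<Phi> v"
proof -
  have "modular \<Omega> \<Phi> (\<lambda>x. u x / \<tau>) = modular \<Omega> \<Phi> (\<lambda>x. v x / \<tau>)" for \<tau>
    unfolding modular_def using assms by (intro nn_integral_cong_AE) (auto elim!: eventually_mono)
  then show ?thesis by (simp add: luxemburg_norm_def)
qed

text \<open>Dividing by \<tau> costs at most \<tau>^(-P), which the hypothesis compensates. In the
  other direction, \<open>mH_le_luxemburg\<close> gains the power \<open>p0\<close>; together they
  identify modular convergence with norm convergence.\<close>

lemma luxemburg_le:
  assumes w: "w \<in> borel_measurable L" and \<tau>: "0 < \<tau>" "\<tau> \<le> 1" and le: "mH w \<le> ennreal (\<tau> powr P)"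
  shows "luxemburg_norm \<Omega> H (\<lambda>x. norm (w x)) \<le> \<tau>"
  unfolding luxemburg_norm_def
proof (rule cInf_lower)
  have "mH (\<lambda>x. (1 / \<tau>) *\<^sub>R w x) \<le> ennreal ((1 / \<tau>) powr P) * ennreal (\<tau> powr P)"
    using \<tau> by (intro order_trans[OF mH_scale_large[OF w] mult_left_mono[OF le]]) auto
  also have "\<dots> = 1" using \<tau> by (simp add: ennreal_mult[symmetric] powr_mult[symmetric])
  finally show "\<tau> \<in> {\<tau>. 0 < \<tau> \<and> modular \<Omega> H (\<lambda>x. norm (w x) / \<tau>) \<le> 1}"
    using \<tau> by (simp add: modular_quotient)
qed (auto intro!: bdd_belowI[of _ 0])

text \<open>The infimum of the empty set of reals carries no information, so a member is exhibited:
  for modular \<open>m\<close>, scaling by 1 / (1 + m) leaves at most m / (1 + m).\<close>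

lemma luxemburg_nonempty:
  assumes w: "w \<in> borel_measurable L" and fin: "mH w < \<infinity>"
  shows "{\<tau>. 0 < \<tau> \<and> modular \<Omega> H (\<lambda>x. norm (w x) / \<tau>) \<le> 1} \<noteq> {}"
proof -
  define m where "m = (LINT x|L. H x (norm (w x)))"
  have m: "mH w = ennreal m" using H_integrable(2)[OF w fin] by (simp add: m_def)
  have m0: "0 \<le> m" unfolding m_def by (rule integral_nonneg_AE) (rule AE_I2, simp add: H_nonneg)
  have "(1 / (1 + m)) powr p0 \<le> (1 / (1 + m)) powr 1" using m0 p0 by (intro powr_mono') auto
  then have c: "(1 / (1 + m)) powr p0 * m \<le> 1 / (1 + m) * m" using m0 by (intro mult_right_mono) auto
  have "mH (\<lambda>x. (1 / (1 + m)) *\<^sub>R w x) \<le> ennreal ((1 / (1 + m)) powr p0) * mH w"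
    using m0 by (intro mH_scale_small[OF w]) auto
  also have "\<dots> = ennreal ((1 / (1 + m)) powr p0 * m)" using m0 by (simp add: m ennreal_mult[symmetric])
  also have "\<dots> \<le> ennreal 1"
  proof (rule ennreal_leI)
    have "1 / (1 + m) * m \<le> 1" using m0 by (simp add: field_simps)
    with c show "(1 / (1 + m)) powr p0 * m \<le> 1" by linarith
  qed
  finally have "1 + m \<in> {\<tau>. 0 < \<tau> \<and> modular \<Omega> H (\<lambda>x. norm (w x) / \<tau>) \<le> 1}"
    using m0 by (simp add: modular_quotient)
  then show ?thesis by blast
qed

lemma luxemburg_nonneg:
  assumes "w \<in> borel_measurable L" "mH w < \<infinity>"
  shows "0 \<le> luxemburg_norm \<Omega> H (\<lambda>x. norm (w x))"
  unfolding luxemburg_norm_def by (rule cInf_greatest[OF luxemburg_nonempty[OF assms]]) auto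

lemma mH_le_luxemburg:
  assumes w: "w \<in> borel_measurable L" and fin: "mH w < \<infinity>"
    and lux: "luxemburg_norm \<Omega> H (\<lambda>x. norm (w x)) < \<tau>" and \<tau>: "\<tau> \<le> 1"
  shows "mH w \<le> ennreal (\<tau> powr p0)"
proof -
  from cInf_lessD[OF luxemburg_nonempty[OF w fin] lux[unfolded luxemburg_norm_def]]
  obtain \<sigma> where \<sigma>: "0 < \<sigma>" "modular \<Omega> H (\<lambda>x. norm (w x) / \<sigma>) \<le> 1" "\<sigma> < \<tau>" by blast
  have "mH w = mH (\<lambda>x. \<sigma> *\<^sub>R ((1 / \<sigma>) *\<^sub>R w x))" using \<sigma>(1) by simp
  also have "\<dots> \<le> ennreal (\<sigma> powr p0) * mH (\<lambda>x. (1 / \<sigma>) *\<^sub>R w x)"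
    using \<sigma> \<tau> w by (intro mH_scale_small) auto
  also have "\<dots> \<le> ennreal (\<sigma> powr p0) * 1"
    using \<sigma>(2) by (intro mult_left_mono) (simp_all add: modular_quotient[OF \<sigma>(1)])
  also have "\<dots> \<le> ennreal (\<tau> powr p0)" using \<sigma> p0 by (simp add: ennreal_leI powr_mono2)
  finally show ?thesis .
qed

lemma sobolev_norm_eq:
  assumes "has_weak_gradient \<Omega> u g"
  shows "sobolev_norm \<Omega> H u = luxemburg_norm \<Omega> H (\<lambda>x. norm (u x)) + luxemburg_norm \<Omega> H (\<lambda>x. norm (g x))"
proof -
  have "luxemburg_norm \<Omega> H u = luxemburg_norm \<Omega> H (\<lambda>x. norm (u x))" by (rule luxemburg_cong_AE) simp
  moreover have "luxemburg_norm \<Omega> H (\<lambda>x. norm (weak_gradient \<Omega> u x)) = luxemburg_norm \<Omega> H (\<lambda>x. norm (g x))"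
    by (rule luxemburg_cong_AE) (use weak_gradient_AE_eq[OF open_dom assms] in \<open>auto elim!: eventually_mono\<close>)
  ultimately show ?thesis by (simp add: sobolev_norm_def)
qed

lemma weak_gradient_W0: "W0 u g \<Longrightarrow> AE x in L. weak_gradient \<Omega> u x = g x"
  by (rule weak_gradient_AE_eq[OF open_dom W0_has_weak_gradient])

lemma W0_sobolev:
  assumes W: "W0 u g"
  shows "u \<in> musielak_sobolev_0 \<Omega> H"
proof -
  note [measurable] = W0_measurable[OF W]
  note ae = weak_gradient_W0[OF W]
  have "(\<lambda>x. norm (g x)) \<in> borel_measurable L" by measurable
  then have "(\<lambda>x. norm (weak_gradient \<Omega> u x)) \<in> borel_measurable L"
    by (rule borel_measurable_lebesgue_on_AE[OF dom_sets(1)]) (use ae in \<open>auto elim!: eventually_mono\<close>)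
  moreover have "modular \<Omega> H (\<lambda>x. norm (weak_gradient \<Omega> u x)) < \<infinity>"
    using mH_cong_AE[OF ae] W0_finite(2)[OF W] by (simp add: modular_norm_eq_mH)
  ultimately have "u \<in> musielak_sobolev \<Omega> H"
    unfolding musielak_sobolev_def musielak_orlicz_def
    using W0_has_weak_gradient[OF W] W0_measurable(1)[OF W] W0_finite(1)[OF W] by (auto simp: modular_eq_mH)
  moreover have "\<exists>\<phi>\<in>test_functions \<Omega>. sobolev_norm \<Omega> H (\<lambda>x. u x - \<phi> x) < \<epsilon>" if \<epsilon>: "0 < \<epsilon>" for \<epsilon>
  proof -
    define \<tau> where "\<tau> = min 1 (\<epsilon> / 3)"
    have \<tau>: "0 < \<tau>" "\<tau> \<le> 1" "\<tau> + \<tau> < \<epsilon>" using \<epsilon> by (auto simp: \<tau>_def min_def)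
    from \<tau>(1) have "0 < \<tau> powr P" by simp
    from W0_approx[OF W this] obtain \<phi> where \<phi>: "\<phi> \<in> test_functions \<Omega>"
      "mH (\<lambda>x. u x - \<phi> x) \<le> ennreal (\<tau> powr P)" "mH (\<lambda>x. g x - gradient \<phi> x) \<le> ennreal (\<tau> powr P)" .
    note W' = W0_diff[OF W W0_test[OF \<phi>(1)]]
    have "sobolev_norm \<Omega> H (\<lambda>x. u x - \<phi> x) \<le> \<tau> + \<tau>"
      unfolding sobolev_norm_eq[OF W0_has_weak_gradient[OF W']]
      by (intro add_mono luxemburg_le W0_measurable[OF W'] \<phi> \<tau>)
    with \<phi>(1) \<tau>(3) show ?thesis by (meson le_less_trans)
  qed
  ultimately show ?thesis by (simp add: musielak_sobolev_0_def)
qed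

text \<open>The partner of a function is its chosen \<open>weak_gradient\<close>. With
  \<open>W0_sobolev\<close>, the pairs of \<open>W0\<close> and the functions of
  \<open>musielak_sobolev_0\<close> describe the same space.\<close>

lemma sobolev_W0:
  assumes v: "v \<in> musielak_sobolev_0 \<Omega> H"
  shows "W0 v (weak_gradient \<Omega> v)"
proof -
  let ?G = "weak_gradient \<Omega> v"
  from v have "\<exists>g. has_weak_gradient \<Omega> v g" by (simp add: musielak_sobolev_0_def musielak_sobolev_def)
  then have G: "has_weak_gradient \<Omega> v ?G" unfolding weak_gradient_def by (rule someI_ex)
  then have m: "v \<in> borel_measurable L" "?G \<in> borel_measurable L"
    by (auto simp: has_weak_gradient_def intro: locally_integrable_measurable[OF open_dom])
  have f: "mH v < \<infinity>" "mH ?G < \<infinity>"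
    using v by (auto simp: musielak_sobolev_0_def musielak_sobolev_def musielak_orlicz_def
        modular_eq_mH[symmetric] modular_norm_eq_mH[symmetric])
  have "\<exists>\<phi>\<in>test_functions \<Omega>. mH (\<lambda>x. v x - \<phi> x) \<le> ennreal \<epsilon> \<and> mH (\<lambda>x. ?G x - gradient \<phi> x) \<le> ennreal \<epsilon>"
      if \<epsilon>: "0 < \<epsilon>" for \<epsilon>
  proof -
    define \<tau> where "\<tau> = min 1 \<epsilon>"
    have \<tau>: "0 < \<tau>" "\<tau> \<le> 1" "\<tau> \<le> \<epsilon>" using \<epsilon> by (auto simp: \<tau>_def)
    have "\<tau> powr p0 \<le> \<tau> powr 1" using \<tau> p0 by (intro powr_mono') auto
    then have \<tau>\<epsilon>: "ennreal (\<tau> powr p0) \<le> ennreal \<epsilon>" using \<tau> by (intro ennreal_leI) auto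
    from v \<tau>(1) obtain \<phi> where \<phi>: "\<phi> \<in> test_functions \<Omega>" "sobolev_norm \<Omega> H (\<lambda>x. v x - \<phi> x) < \<tau>"
      unfolding musielak_sobolev_0_def by blast
    note W\<phi> = W0_test[OF \<phi>(1)]
    note hd = has_weak_gradient_diff[OF open_dom G W0_has_weak_gradient[OF W\<phi>]]
    have m': "(\<lambda>x. v x - \<phi> x) \<in> borel_measurable L" "(\<lambda>x. ?G x - gradient \<phi> x) \<in> borel_measurable L"
      using m W0_measurable[OF W\<phi>] by auto
    have f': "mH (\<lambda>x. v x - \<phi> x) < \<infinity>" "mH (\<lambda>x. ?G x - gradient \<phi> x) < \<infinity>"
      by (rule mH_diff_finite[OF m(1) W0_measurable(1)[OF W\<phi>] f(1) W0_finite(1)[OF W\<phi>]])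
        (rule mH_diff_finite[OF m(2) W0_measurable(2)[OF W\<phi>] f(2) W0_finite(2)[OF W\<phi>]])
    note nn = luxemburg_nonneg[OF m'(1) f'(1)] luxemburg_nonneg[OF m'(2) f'(2)]
    have l: "luxemburg_norm \<Omega> H (\<lambda>x. norm (v x - \<phi> x)) < \<tau>"
        "luxemburg_norm \<Omega> H (\<lambda>x. norm (?G x - gradient \<phi> x)) < \<tau>"
      using \<phi>(2) nn unfolding sobolev_norm_eq[OF hd] by linarith+
    show ?thesis
      using \<phi>(1) order_trans[OF mH_le_luxemburg[OF m'(1) f'(1) l(1) \<tau>(2)] \<tau>\<epsilon>]
        order_trans[OF mH_le_luxemburg[OF m'(2) f'(2) l(2) \<tau>(2)] \<tau>\<epsilon>] by blast
  qed
  with m show ?thesis by (simp add: W0_def)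
qed

end

section \<open>The truncated system\<close>

text \<open>Simple functions take finitely many values, and for constant arguments \<open>f\<close>
  is measurable by assumption. Continuity in these arguments passes to the limit at almost every
  point, and completeness of the measure covers the rest.\<close>

lemma superposition_measurable:
  fixes f :: "real^'n::finite \<Rightarrow> real \<Rightarrow> real \<Rightarrow> real^'n \<Rightarrow> real^'n \<Rightarrow> real"
  assumes \<Omega>: "\<Omega> \<in> sets lebesgue" and f: "caratheodory \<Omega> f"
    and [measurable]: "u \<in> borel_measurable (lebesgue_on \<Omega>)" "v \<in> borel_measurable (lebesgue_on \<Omega>)"
      "g \<in> borel_measurable (lebesgue_on \<Omega>)" "h \<in> borel_measurable (lebesgue_on \<Omega>)"
  shows "(\<lambda>x. f x (u x) (v x) (g x) (h x)) \<in> borel_measurable (lebesgue_on \<Omega>)"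
proof -
  define k where "k = (\<lambda>(s, t, \<xi>, \<zeta>) x. f x s t \<xi> \<zeta>)"
  define w where "w = (\<lambda>x. (u x, v x, g x, h x))"
  have "w \<in> borel_measurable (lebesgue_on \<Omega>)" unfolding w_def by measurable
  then obtain F where F: "\<forall>i. simple_function (lebesgue_on \<Omega>) (F i)" "\<forall>x\<in>\<Omega>. (\<lambda>i. F i x) \<longlonglongrightarrow> w x"
    by (auto dest!: borel_measurable_implies_sequence_metric[where z=0])
  have "(\<lambda>x. k (F i x) x) \<in> borel_measurable (lebesgue_on \<Omega>)" for i
  proof (rule measurable_compose_countable'[where I="F i ` space (lebesgue_on \<Omega>)"])
    show "F i \<in> lebesgue_on \<Omega> \<rightarrow>\<^sub>M count_space (F i ` space (lebesgue_on \<Omega>))"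
      using F(1)[rule_format, of i] by (subst measurable_count_space_eq2) (auto simp: simple_function_def)
    show "countable (F i ` space (lebesgue_on \<Omega>))"
      using F(1)[rule_format, of i] by (intro countable_finite) (simp add: simple_function_def)
    show "(\<lambda>x. k j x) \<in> borel_measurable (lebesgue_on \<Omega>)" for j
      using f by (simp add: caratheodory_def k_def split: prod.split)
  qed
  then have m: "(\<lambda>x. lim (\<lambda>i. k (F i x) x)) \<in> borel_measurable (lebesgue_on \<Omega>)" by measurable
  show ?thesis
  proof (rule borel_measurable_lebesgue_on_AE[OF \<Omega> m])
    have "AE x in lebesgue_on \<Omega>. continuous_on UNIV (\<lambda>(s, t, \<xi>, \<zeta>). f x s t \<xi> \<zeta>)"
      using f by (simp add: caratheodory_def)
    then show "AE x in lebesgue_on \<Omega>. lim (\<lambda>i. k (F i x) x) = f x (u x) (v x) (g x) (h x)"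
      using AE_space
    proof eventually_elim
      case (elim x)
      then have "continuous_on UNIV (\<lambda>y. k y x)" "(\<lambda>i. F i x) \<longlonglongrightarrow> w x"
        using F(2) by (auto simp: k_def split_def)
      then have "(\<lambda>i. k (F i x) x) \<longlonglongrightarrow> k (w x) x"
        by (rule continuous_on_tendsto_compose) auto
      then show ?case by (simp add: limI k_def w_def)
    qed
  qed
qed

text \<open>Positive parts keep the arguments of \<open>f\<close> in the range where its bounds are
  assumed. The outer cut makes the value admissible at every point, also on the exceptional null set
  of those bounds.\<close>

definition truncated_source ::
    "(real^'n::finite \<Rightarrow> real \<Rightarrow> real \<Rightarrow> real^'n \<Rightarrow> real^'n \<Rightarrow> real) \<Rightarrow> (real^'n \<Rightarrow> real) \<Rightarrow>
     (real^'n \<Rightarrow> real) \<Rightarrow> (real^'n \<Rightarrow> real) \<Rightarrow> (real^'n \<Rightarrow> real^'n) \<Rightarrow> (real^'n \<Rightarrow> real^'n) \<Rightarrow> real^'n \<Rightarrow> real" where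
  "truncated_source f \<psi> u v g h x = max 0 (min (f x (max 0 (u x)) (max 0 (v x)) (g x) (h x)) (\<psi> x))"

lemma truncated_source_bounds: "0 \<le> \<psi> x \<Longrightarrow> 0 \<le>
    truncated_source f \<psi> u v g h x \<and> truncated_source f \<psi> u v g h x \<le> \<psi> x"
  by (simp add: truncated_source_def)

lemma truncated_source_measurable:
  assumes "\<Omega> \<in> sets lebesgue" "caratheodory \<Omega> f" and [measurable]: "\<psi> \<in> borel_measurable (lebesgue_on \<Omega>)"
    and [measurable]: "u \<in> borel_measurable (lebesgue_on \<Omega>)" "v \<in> borel_measurable (lebesgue_on \<Omega>)"
      "g \<in> borel_measurable (lebesgue_on \<Omega>)" "h \<in> borel_measurable (lebesgue_on \<Omega>)"
  shows "truncated_source f \<psi> u v g h \<in> borel_measurable (lebesgue_on \<Omega>)"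
proof -
  have [measurable]: "(\<lambda>x. f x (max 0 (u x)) (max 0 (v x)) (g x) (h x)) \<in> borel_measurable (lebesgue_on \<Omega>)"
    by (rule superposition_measurable[OF assms(1,2)]) measurable
  show ?thesis unfolding truncated_source_def by measurable
qed

lemma truncated_source_tendsto:
  assumes f: "caratheodory \<Omega> f"
    and ae: "AE x in lebesgue_on \<Omega>. ((\<lambda>n. u n x) \<longlonglongrightarrow> u' x \<and> (\<lambda>n. g n x) \<longlonglongrightarrow> g' x) \<and> (\<lambda>n. v n x) \<longlonglongrightarrow> v' x \<and>
        (\<lambda>n. h n x) \<longlonglongrightarrow> h' x"
  shows "AE x in lebesgue_on \<Omega>. (\<lambda>n. truncated_source f \<psi> (u n) (v n) (g n)
      (h n) x) \<longlonglongrightarrow> truncated_source f \<psi> u' v' g' h' x"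
proof -
  have "AE x in lebesgue_on \<Omega>. continuous_on UNIV (\<lambda>(s, t, \<xi>, \<zeta>). f x s t \<xi> \<zeta>)"
    using f by (simp add: caratheodory_def)
  with ae show ?thesis
  proof eventually_elim
    case (elim x)
    then have "(\<lambda>n. (max 0 (u n x), max 0 (v n x), g n x, h n x)) \<longlonglongrightarrow> (max 0 (u' x), max 0 (v' x), g' x, h' x)"
      by (intro tendsto_intros) auto
    from continuous_on_tendsto_compose[OF elim(2) this]
    have "(\<lambda>n. f x (max 0 (u n x)) (max 0 (v n x)) (g n x) (h n x)) \<longlonglongrightarrow> f x (max 0 (u' x)) (max 0 (v' x))
        (g' x) (h' x)" by simp
    then show ?case unfolding truncated_source_def by (intro tendsto_intros)
  qed
qed

lemma LIMSEQ_of_subseq_LIMSEQ: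
  fixes a :: "nat \<Rightarrow> real"
  assumes "\<And>r. strict_mono (r::nat\<Rightarrow>nat) \<Longrightarrow> \<exists>s. strict_mono (s::nat\<Rightarrow>nat) \<and> (\<lambda>n. a (r (s n))) \<longlonglongrightarrow> l"
  shows "a \<longlonglongrightarrow> l"
proof (rule ccontr)
  assume "\<not> a \<longlonglongrightarrow> l"
  then obtain \<epsilon> where \<epsilon>: "0 < \<epsilon>" "\<forall>N. \<exists>n\<ge>N. \<epsilon> \<le> dist (a n) l"
    unfolding lim_sequentially by (meson not_le)
  then have "infinite {n. \<epsilon> \<le> dist (a n) l}"
    unfolding infinite_nat_iff_unbounded_le by simp
  then obtain r :: "nat \<Rightarrow> nat" where r: "strict_mono r" "\<And>n. r n \<in> {n. \<epsilon> \<le> dist (a n) l}"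
    using infinite_enumerate by blast
  from assms[OF r(1)] obtain s where "(\<lambda>n. a (r (s n))) \<longlonglongrightarrow> l" by blast
  from tendstoD[OF this \<epsilon>(1)] have "\<forall>\<^sub>F n in sequentially. dist (a (r (s n))) l < \<epsilon>" .
  then obtain n where "dist (a (r (s n))) l < \<epsilon>" by (auto simp: eventually_sequentially)
  with r(2)[of "s n"] show False by simp
qed

section \<open>The convex set of sources and the fixed point\<close>

lemma (in double_phase_source) adm_integrable_self:
  assumes "adm F"
  shows "integrable L F"
proof -
  have "mH (\<lambda>x. 1::real) < \<infinity>" by (rule mH_bounded[where B=1]) auto
  from adm_integrable[OF assms _ this] show ?thesis by simp
qed

lemma (in double_phase_source) adm_psi: "adm \<psi>"
  using psi_nonneg psi_meas by (simp add: adm_def)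

lemma (in double_phase_source) adm_subconvex:
  assumes "\<And>j. j < m \<Longrightarrow> 0 \<le> c j \<and> adm (F j)" "(\<Sum>j<m. c j) \<le> 1"
  shows "adm (\<lambda>x. \<Sum>j<m. c j * F j x)"
  unfolding adm_def
proof (intro conjI ballI)
  have "F j \<in> borel_measurable L" if "j < m" for j using assms(1)[OF that] by (simp add: adm_def)
  then show "(\<lambda>x. \<Sum>j<m. c j * F j x) \<in> borel_measurable L"
    by (intro borel_measurable_sum borel_measurable_times) auto
  fix x assume x: "x \<in> \<Omega>"
  have b: "0 \<le> F j x \<and> F j x \<le> \<psi> x" if "j < m" for j using assms(1)[OF that] x by (simp add: adm_def)
  show "0 \<le> (\<Sum>j<m. c j * F j x)" using b assms(1) by (intro sum_nonneg) auto
  have "(\<Sum>j<m. c j * F j x) \<le> (\<Sum>j<m. c j * \<psi> x)" using b assms(1) by (intro sum_mono mult_left_mono) auto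
  also have "\<dots> \<le> 1 * \<psi> x" unfolding sum_distrib_right[symmetric] using assms(2) psi_nonneg[OF x]
      by (intro mult_right_mono)
  finally show "(\<Sum>j<m. c j * F j x) \<le> \<psi> x" by simp
qed

locale double_phase_system =
  S1: double_phase_source \<Omega> p1 q1 \<mu>1 a1 b1 m1 e1 d1 \<psi>1 +
  S2: double_phase_source \<Omega> p2 q2 \<mu>2 a2 b2 m2 e2 d2 \<psi>2
  for \<Omega> :: "(real^'n::finite) set" and p1 q1 \<mu>1 :: "real^'n \<Rightarrow> real" and a1 b1 m1 e1 d1 :: real
      and \<psi>1 :: "real^'n \<Rightarrow> real"
    and p2 q2 \<mu>2 :: "real^'n \<Rightarrow> real" and a2 b2 m2 e2 d2 :: real and \<psi>2 :: "real^'n \<Rightarrow> real" +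
  fixes f1 f2 :: "real^'n \<Rightarrow> real \<Rightarrow> real \<Rightarrow> real^'n \<Rightarrow> real^'n \<Rightarrow> real"
  assumes f_caratheodory: "caratheodory \<Omega> f1" "caratheodory \<Omega> f2"
begin

abbreviation "L \<equiv> lebesgue_on \<Omega>"

definition K :: "(real^'n \<Rightarrow> real \<times> real) set" where
  "K = {F. S1.adm (\<lambda>x. fst (F x)) \<and> S2.adm (\<lambda>x. snd (F x))}"

lemma K_norm_le: "F \<in> K \<Longrightarrow> x \<in> \<Omega> \<Longrightarrow> norm (F x) \<le> \<psi>1 x + \<psi>2 x"
  using norm_Pair_le[of "fst (F x)" "snd (F x)"] unfolding K_def S1.adm_def S2.adm_def
  by (force intro: order_trans)

lemma K_measurable: assumes "F \<in> K" shows "F \<in> borel_measurable L"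
proof -
  have "(\<lambda>x. (fst (F x), snd (F x))) \<in> borel_measurable L"
    using assms S1.adm_meas S2.adm_meas unfolding K_def by (intro borel_measurable_Pair) auto
  then show ?thesis by simp
qed

lemma psi_sum_integrable: "integrable L (\<lambda>x. \<psi>1 x + \<psi>2 x)"
  using S1.adm_integrable_self[OF S1.adm_psi] S2.adm_integrable_self[OF S2.adm_psi] by simp

lemma K_integrable: "F \<in> K \<Longrightarrow> integrable L F"
  by (rule Bochner_Integration.integrable_bound[OF psi_sum_integrable])
    (auto intro!: AE_I2 K_measurable order_trans[OF K_norm_le])

lemma K_L1_tendsto:
  assumes F: "\<And>n::nat. F n \<in> K" and G: "G \<in> K" and ae: "AE x in L. (\<lambda>n. F n x) \<longlonglongrightarrow> G x"
  shows "(\<lambda>n. LINT x|L. norm (F n x - G x)) \<longlonglongrightarrow> 0"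
proof -
  note [measurable] = K_measurable[OF F] K_measurable[OF G]
  have "(\<lambda>n. LINT x|L. norm (F n x - G x)) \<longlonglongrightarrow> (LINT x|L. 0)"
  proof (rule integral_dominated_convergence[where w="\<lambda>x. 2 * (\<psi>1 x + \<psi>2 x)"])
    show "AE x in L. (\<lambda>n. norm (F n x - G x)) \<longlonglongrightarrow> 0"
      using ae by eventually_elim (simp add: LIM_zero tendsto_norm_zero)
    show "AE x in L. norm (norm (F n x - G x)) \<le> 2 * (\<psi>1 x + \<psi>2 x)" for n
    proof (rule AE_I2)
      fix x assume "x \<in> space L"
      then have x: "x \<in> \<Omega>" by simp
      show "norm (norm (F n x - G x)) \<le> 2 * (\<psi>1 x + \<psi>2 x)"
        using norm_triangle_ineq4[of "F n x" "G x"] K_norm_le[OF F x, of n] K_norm_le[OF G x] by simp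
    qed
    show "integrable L (\<lambda>x. 2 * (\<psi>1 x + \<psi>2 x))" by (rule integrable_mult_right[OF psi_sum_integrable])
  qed measurable
  then show ?thesis by simp
qed

text \<open>\<open>T\<close> sends a pair of sources to its minimizers and these to the truncated
  sources. Compactness and continuity of \<open>T\<close> both come from almost everywhere
  convergence of minimizers and gradients along subsequences; the superposition operators preserve
  it, and domination by \<psi>1 + \<psi>2 makes it L1 convergence.\<close>

lemma truncated_system_solution:
  obtains F1 u1 g1 F2 u2 g2 where "S1.adm F1" "S1.sol F1 u1 g1" "S2.adm F2" "S2.sol F2 u2 g2"
    "AE x in L. F1 x = truncated_source f1 \<psi>1 u1 u2 g1 g2 x \<and> F2 x = truncated_source f2 \<psi>2 u1 u2 g1 g2 x"
proof -
  \<comment> \<open>One minimizer is fixed for each source. By \<open>sol_continuous\<close> with a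
    constant sequence of sources, any other minimizer agrees with it almost everywhere.\<close>
  from S1.sol_exists obtain U1 G1 where s1: "\<And>F. S1.adm F \<Longrightarrow> S1.sol F (U1 F) (G1 F)" by metis
  from S2.sol_exists obtain U2 G2 where s2: "\<And>F. S2.adm F \<Longrightarrow> S2.sol F (U2 F) (G2 F)" by metis
  define N where "N u g v h = (\<lambda>x. (truncated_source f1 \<psi>1 u v g h x, truncated_source f2 \<psi>2 u v g h x))"
      for u g v h
  define T1 where "T1 F = (\<lambda>x. fst (F x))" for F :: "real^'n \<Rightarrow> real \<times> real"
  define T2 where "T2 F = (\<lambda>x. snd (F x))" for F :: "real^'n \<Rightarrow> real \<times> real"
  define T where "T F = N (U1 (T1 F)) (G1 (T1 F)) (U2 (T2 F)) (G2 (T2 F))" for F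
  have KD: "S1.adm (T1 F)" "S2.adm (T2 F)" if "F \<in> K" for F using that by (simp_all add: K_def T1_def T2_def)
  have N_K: "N u g v h \<in> K" if m: "u \<in> borel_measurable L" "g \<in> borel_measurable L" "v \<in> borel_measurable L"
      "h \<in> borel_measurable L" for u g v h
    unfolding K_def S1.adm_def S2.adm_def N_def mem_Collect_eq fst_conv snd_conv
    by (intro conjI ballI truncated_source_measurable[OF S1.dom_sets(1) _ _ m(1,3,2,4)] f_caratheodory
        S1.psi_meas S2.psi_meas)
      (auto simp: truncated_source_bounds S1.psi_nonneg S2.psi_nonneg)
  have mU: "U1 (T1 F) \<in> borel_measurable L" "G1 (T1 F) \<in> borel_measurable L"
      "U2 (T2 F) \<in> borel_measurable L" "G2 (T2 F) \<in> borel_measurable L"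
    if "F \<in> K" for F
    using S1.W0_measurable[OF S1.solD(1)[OF s1[OF KD(1)[OF that]]]] S2.W0_measurable[OF S2.solD(1)[OF s2[OF
        KD(2)[OF that]]]] by auto
  have T_K: "T F \<in> K" if "F \<in> K" for F unfolding T_def by (rule N_K; rule mU[OF that])
  have N_tendsto: "(\<lambda>n. LINT x|L. norm (N (u n) (g n) (v n) (h n) x - N u' g' v' h' x)) \<longlonglongrightarrow> 0"
    if K: "\<And>n::nat. N (u n) (g n) (v n) (h n) \<in> K" "N u' g' v' h' \<in> K"
      and ae: "AE x in L. (\<lambda>n. u n x) \<longlonglongrightarrow> u' x \<and> (\<lambda>n. g n x) \<longlonglongrightarrow> g' x"
        "AE x in L. (\<lambda>n. v n x) \<longlonglongrightarrow> v' x \<and> (\<lambda>n. h n x) \<longlonglongrightarrow> h' x" for u g v h u' g' v' h'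
  proof (rule K_L1_tendsto[OF K])
    have c: "AE x in L. ((\<lambda>n. u n x) \<longlonglongrightarrow> u' x \<and> (\<lambda>n. g n x) \<longlonglongrightarrow> g' x) \<and> (\<lambda>n. v n x) \<longlonglongrightarrow> v' x \<and> (\<lambda>n. h n x) \<longlonglongrightarrow> h' x"
      using ae by (rule AE_conjI)
    from truncated_source_tendsto[OF f_caratheodory(1) c] truncated_source_tendsto[OF f_caratheodory(2) c]
    show "AE x in L. (\<lambda>n. N (u n) (g n) (v n) (h n) x) \<longlonglongrightarrow> N u' g' v' h' x"
      unfolding N_def by eventually_elim (rule tendsto_Pair)
  qed
  have AE_subseq: "AE x in L. (\<lambda>n. u (r n) x) \<longlonglongrightarrow> u' x \<and> (\<lambda>n. g (r n) x) \<longlonglongrightarrow> g' x"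
    if r: "strict_mono (r :: nat \<Rightarrow> nat)" and ae: "AE x in L. (\<lambda>n. u n x) \<longlonglongrightarrow> u' x \<and> (\<lambda>n. g n x) \<longlonglongrightarrow> g' x"
    for r and u :: "nat \<Rightarrow> real^'n \<Rightarrow> real" and u' and g :: "nat \<Rightarrow> real^'n \<Rightarrow> real^'n" and g'
    using ae by eventually_elim (elim conjE, intro conjI; erule filterlim_compose[OF _ filterlim_subseq[OF r]])
  obtain F where F: "F \<in> K" and d0: "(LINT x|L. norm (F x - T F x)) = 0"
  proof (rule schauder_L1[of K L T])
    show "integrable L F" if "F \<in> K" for F using that by (rule K_integrable)
    show "(\<lambda>x. \<Sum>j<m. c j *\<^sub>R F j x) \<in> K"
      if c: "\<And>j. j < m \<Longrightarrow> 0 \<le> c j \<and> F j \<in> K" "(\<Sum>j<m. c j) \<le> 1" for c :: "nat \<Rightarrow> real" and F m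
    proof -
      have "S1.adm (\<lambda>x. \<Sum>j<m. c j * T1 (F j) x)" "S2.adm (\<lambda>x. \<Sum>j<m. c j * T2 (F j) x)"
        by (rule S1.adm_subconvex[OF _ c(2)], use c(1) KD(1) in blast, rule S2.adm_subconvex[OF _ c(2)], use
            c(1) KD(2) in blast)
      then show ?thesis by (simp add: K_def T1_def T2_def fst_sum snd_sum)
    qed
    show "T F \<in> K" if "F \<in> K" for F using that by (rule T_K)
    show "\<exists>r G. strict_mono r \<and> G \<in> K \<and> (\<lambda>n. LINT x|L. norm (T (F (r n)) x - G x)) \<longlonglongrightarrow> 0"
      if F: "\<And>n::nat. F n \<in> K" for F
    proof -
      obtain r1 u1 g1 where r1: "strict_mono (r1::nat\<Rightarrow>nat)" "u1 \<in> borel_measurable L" "g1 \<in> borel_measurable L"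
        "AE x in L. (\<lambda>n. U1 (T1 (F (r1 n))) x) \<longlonglongrightarrow> u1 x \<and> (\<lambda>n. G1 (T1 (F (r1 n))) x) \<longlonglongrightarrow> g1 x"
        by (rule S1.sol_compact[OF KD(1)[OF F] s1[OF KD(1)[OF F]]])
      \<comment> \<open>The second component is treated along the subsequence \<open>r1\<close>;
        convergence of the first survives by \<open>AE_subseq\<close>.\<close>
      obtain r2 u2 g2 where r2: "strict_mono (r2::nat\<Rightarrow>nat)" "u2 \<in> borel_measurable L" "g2 \<in> borel_measurable L"
        "AE x in L. (\<lambda>n. U2 (T2 (F (r1 (r2 n)))) x) \<longlonglongrightarrow> u2 x \<and> (\<lambda>n. G2 (T2 (F (r1 (r2 n)))) x) \<longlonglongrightarrow> g2 x"
        by (rule S2.sol_compact[of "\<lambda>n. T2 (F (r1 n))", OF KD(2)[OF F] s2[OF KD(2)[OF F]]])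
      have "strict_mono (\<lambda>n. r1 (r2 n))" using strict_mono_o[OF r1(1) r2(1)] by (simp add: o_def)
      \<comment> \<open>The truncation maps arbitrary measurable arguments into \<open>K\<close>, so
        the limits enter without being identified as minimizers.\<close>
      moreover have "N u1 g1 u2 g2 \<in> K" by (rule N_K) fact+
      moreover have "(\<lambda>n. LINT x|L. norm (T (F (r1 (r2 n))) x - N u1 g1 u2 g2 x)) \<longlonglongrightarrow> 0"
        unfolding T_def
        by (rule N_tendsto[OF T_K[OF F, unfolded T_def] \<open>N u1 g1 u2 g2 \<in> K\<close> AE_subseq[OF r2(1) r1(4)] r2(4)])
      ultimately show ?thesis by (intro exI[of _ "\<lambda>n. r1 (r2 n)"] exI[of _ "N u1 g1 u2 g2"]) simp
    qed
    show "(\<lambda>n. LINT x|L. norm (T (F n) x - T G x)) \<longlonglongrightarrow> 0"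
      if F: "\<And>n::nat. F n \<in> K" and G: "G \<in> K" and lim: "(\<lambda>n. LINT x|L. norm (F n x - G x)) \<longlonglongrightarrow> 0" for F G
    \<comment> \<open>L1 convergence of the sources gives almost everywhere convergence only along a
      subsequence, so convergence of the images is tested on subsequences.\<close>
    proof (rule LIMSEQ_of_subseq_LIMSEQ)
      fix r :: "nat \<Rightarrow> nat" assume r: "strict_mono r"
      have i: "integrable L (\<lambda>x. F (r n) x - G x)" for n using K_integrable[OF F] K_integrable[OF G] by simp
      have "(\<lambda>n. LINT x|L. norm (F (r n) x - G x)) \<longlonglongrightarrow> 0" using LIMSEQ_subseq_LIMSEQ[OF lim r]
          by (simp add: o_def)
      from tendsto_L1_AE_subseq[OF i this] obtain s where s: "strict_mono (s::nat\<Rightarrow>nat)"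
        "AE x in L. (\<lambda>n. F (r (s n)) x - G x) \<longlonglongrightarrow> 0" by blast
      have ae1: "AE x in L. (\<lambda>n. T1 (F (r (s n))) x) \<longlonglongrightarrow> T1 G x"
        using s(2) unfolding T1_def by eventually_elim (rule tendsto_fst, rule LIM_zero_cancel)
      have ae2: "AE x in L. (\<lambda>n. T2 (F (r (s n))) x) \<longlonglongrightarrow> T2 G x"
        using s(2) unfolding T2_def by eventually_elim (rule tendsto_snd, rule LIM_zero_cancel)
      obtain t1 where t1: "strict_mono (t1::nat\<Rightarrow>nat)"
        "AE x in L. (\<lambda>n. U1 (T1 (F (r (s (t1 n))))) x) \<longlonglongrightarrow> U1 (T1 G) x \<and> (\<lambda>n. G1 (T1 (F (r (s
            (t1 n))))) x) \<longlonglongrightarrow> G1 (T1 G) x"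
        by (rule S1.sol_continuous[of "\<lambda>n. T1 (F (r (s n)))", OF KD(1)[OF F] KD(1)[OF G] s1[OF KD(1)[OF F]]
            s1[OF KD(1)[OF G]] ae1])
      have ae2': "AE x in L. (\<lambda>n. T2 (F (r (s (t1 n)))) x) \<longlonglongrightarrow> T2 G x"
        using ae2 by eventually_elim (erule filterlim_compose[OF _ filterlim_subseq[OF t1(1)]])
      obtain t2 where t2: "strict_mono (t2::nat\<Rightarrow>nat)"
        "AE x in L. (\<lambda>n. U2 (T2 (F (r (s (t1 (t2 n)))))) x) \<longlonglongrightarrow> U2 (T2 G) x \<and> (\<lambda>n. G2 (T2 (F (r (s (t1
            (t2 n)))))) x) \<longlonglongrightarrow> G2 (T2 G) x"
        by (rule S2.sol_continuous[of "\<lambda>n. T2 (F (r (s (t1 n))))", OF KD(2)[OF F] KD(2)[OF G] s2[OF KD(2)[OF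
            F]] s2[OF KD(2)[OF G]] ae2'])
      have "strict_mono (\<lambda>n. s (t1 (t2 n)))"
        using strict_mono_o[OF s(1) strict_mono_o[OF t1(1) t2(1)]] by (simp add: o_def)
      moreover have "(\<lambda>n. LINT x|L. norm (T (F (r (s (t1 (t2 n))))) x - T G x)) \<longlonglongrightarrow> 0"
        unfolding T_def
        by (rule N_tendsto[OF T_K[OF F, unfolded T_def] T_K[OF G, unfolded T_def] AE_subseq[OF t2(1) t1(2)]
            t2(2)])
      ultimately show "\<exists>s. strict_mono s \<and> (\<lambda>n. LINT x|L. norm (T (F (r (s n))) x - T G x)) \<longlonglongrightarrow> 0"
          by (intro exI[of _ "\<lambda>n. s (t1 (t2 n))"]) simp
    qed
  qed
  have "AE x in L. norm (F x - T F x) = 0"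
    using d0 K_integrable[OF F] K_integrable[OF T_K[OF F]]
    by (subst (asm) integral_nonneg_eq_0_iff_AE) auto
  then have ae: "AE x in L. T1 F x = truncated_source f1 \<psi>1 (U1 (T1 F)) (U2 (T2 F)) (G1 (T1 F)) (G2 (T2 F)) x
      \<and> T2 F x = truncated_source f2 \<psi>2 (U1 (T1 F)) (U2 (T2 F)) (G1 (T1 F)) (G2 (T2 F)) x"
    by eventually_elim (simp add: T_def N_def T1_def T2_def prod_eq_iff)
  show ?thesis
    by (rule that[OF KD(1)[OF F] s1[OF KD(1)[OF F]] KD(2)[OF F] s2[OF KD(2)[OF F]] ae])
qed

end

section \<open>Existence for the Dirichlet system\<close>

lemma integral_lebesgue_on_cong_AE:
  fixes f g :: "'a::euclidean_space \<Rightarrow> real"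
  assumes S: "S \<in> sets lebesgue" and f: "integrable (lebesgue_on S) f"
      and ae: "AE x in lebesgue_on S. f x = g x"
  shows "integrable (lebesgue_on S) g" "(LINT x|lebesgue_on S. g x) = (LINT x|lebesgue_on S. f x)"
proof -
  have m: "f \<in> borel_measurable (lebesgue_on S)" "g \<in> borel_measurable (lebesgue_on S)"
    using f borel_measurable_lebesgue_on_AE[OF S _ ae] by auto
  show "integrable (lebesgue_on S) g" using integrable_cong_AE_imp[OF f m(2)] ae
      by (auto elim!: eventually_mono)
  show "(LINT x|lebesgue_on S. g x) = (LINT x|lebesgue_on S. f x)"
    by (rule integral_cong_AE[OF m(2,1)]) (use ae in \<open>auto elim!: eventually_mono\<close>)
qed

lemma weak_equation_cong_AE:
  assumes S: "\<Omega> \<in> sets lebesgue" and eq: "weak_equation \<Omega> p q \<mu> F u v"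
    and \<mu>: "AE x in lebesgue_on \<Omega>. \<mu> x = \<nu> x" and F: "AE x in lebesgue_on \<Omega>. F x = G x"
  shows "weak_equation \<Omega> p q \<nu> G u v"
proof -
  have l: "AE x in lebesgue_on \<Omega>. double_phase_flux p q \<mu> x (weak_gradient \<Omega> u x) \<bullet> weak_gradient \<Omega> v x =
      double_phase_flux p q \<nu> x (weak_gradient \<Omega> u x) \<bullet> weak_gradient \<Omega> v x"
    using \<mu> by eventually_elim (simp add: double_phase_flux_def)
  have r: "AE x in lebesgue_on \<Omega>. F x * v x = G x * v x" using F by eventually_elim simp
  note eq' = eq[unfolded weak_equation_def]
  show ?thesis
    unfolding weak_equation_def
    using integral_lebesgue_on_cong_AE[OF S conjunct1[OF eq'] l]
      integral_lebesgue_on_cong_AE[OF S conjunct1[OF conjunct2[OF eq']] r] conjunct2[OF conjunct2[OF eq']]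
          by simp
qed

lemma musielak_sobolev_0_cong_AE:
  assumes "AE x in lebesgue_on \<Omega>. \<mu> x = \<nu> x"
  shows "musielak_sobolev_0 \<Omega> (double_phase p q \<mu>) = musielak_sobolev_0 \<Omega> (double_phase p q \<nu>)"
proof -
  have "modular \<Omega> (double_phase p q \<mu>) = modular \<Omega> (double_phase p q \<nu>)"
    unfolding modular_def fun_eq_iff
    using assms by (intro allI nn_integral_cong_AE) (auto simp: double_phase_def elim!: eventually_mono)
  then show ?thesis
    by (simp add: musielak_sobolev_0_def musielak_sobolev_def musielak_orlicz_def sobolev_norm_def
        luxemburg_norm_def)
qed

lemma (in double_phase_source) sol_weak_equation:
  assumes F: "adm F" and s: "sol F u g" and v: "v \<in> musielak_sobolev_0 \<Omega> H"
  shows "weak_equation \<Omega> p q \<mu> F u v"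
proof -
  note Wv = sobolev_W0[OF v]
  note el = euler_lagrange[OF F s Wv]
  have "AE x in L. flux x (g x) \<bullet> weak_gradient \<Omega> v x = flux x (weak_gradient \<Omega> u x) \<bullet> weak_gradient \<Omega> v x"
    using weak_gradient_W0[OF solD(1)[OF s]] by eventually_elim simp
  note c = integral_lebesgue_on_cong_AE[OF dom_sets(1) el(1) this]
  show ?thesis
    unfolding weak_equation_def
    using c el(2) adm_integrable[OF F W0_measurable(1)[OF Wv] W0_finite(1)[OF Wv]] by (simp add: pairing_def)
qed

theorem (in double_phase_system) system_solution:
  assumes b1: "AE x in L. \<forall>s\<ge>0. \<forall>t\<ge>0. \<forall>\<xi> \<zeta>. 0 \<le> f1 x s t \<xi> \<zeta> \<and> f1 x s t \<xi> \<zeta> \<le> \<psi>1 x"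
    and b2: "AE x in L. \<forall>s\<ge>0. \<forall>t\<ge>0. \<forall>\<xi> \<zeta>. 0 \<le> f2 x s t \<xi> \<zeta> \<and> f2 x s t \<xi> \<zeta> \<le> \<psi>2 x"
  obtains u1 u2 where "u1 \<in> musielak_sobolev_0 \<Omega> S1.H" "u2 \<in> musielak_sobolev_0 \<Omega> S2.H"
    "\<And>v. v \<in> musielak_sobolev_0 \<Omega> S1.H \<Longrightarrow>
      weak_equation \<Omega> p1 q1 \<mu>1 (\<lambda>x. f1 x (u1 x) (u2 x) (weak_gradient \<Omega> u1 x) (weak_gradient \<Omega> u2 x)) u1 v"
    "\<And>v. v \<in> musielak_sobolev_0 \<Omega> S2.H \<Longrightarrow>
      weak_equation \<Omega> p2 q2 \<mu>2 (\<lambda>x. f2 x (u1 x) (u2 x) (weak_gradient \<Omega> u1 x) (weak_gradient \<Omega> u2 x)) u2 v"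
proof -
  obtain F1 u1 g1 F2 u2 g2 where s: "S1.adm F1" "S1.sol F1 u1 g1" "S2.adm F2" "S2.sol F2 u2 g2"
    and ae: "AE x in L. F1 x = truncated_source f1 \<psi>1 u1 u2 g1 g2 x \<and> F2 x =
        truncated_source f2 \<psi>2 u1 u2 g1 g2 x"
    by (rule truncated_system_solution)
  note d1 = S1.solD[OF s(2)] and d2 = S2.solD[OF s(4)]
  \<comment> \<open>The truncation is undone: the minimizers are nonnegative almost everywhere, so
    positive parts change nothing, and for such arguments the values already lie between 0 and the
    bounds.\<close>
  have "AE x in L. F1 x = f1 x (u1 x) (u2 x) (weak_gradient \<Omega> u1 x) (weak_gradient \<Omega> u2 x) \<and>
      F2 x = f2 x (u1 x) (u2 x) (weak_gradient \<Omega> u1 x) (weak_gradient \<Omega> u2 x)"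
    using ae d1(2) d2(2) b1 b2 S1.weak_gradient_W0[OF d1(1)] S2.weak_gradient_W0[OF d2(1)]
    by eventually_elim (simp add: truncated_source_def)
  then have ae1: "AE x in L. F1 x = f1 x (u1 x) (u2 x) (weak_gradient \<Omega> u1 x) (weak_gradient \<Omega> u2 x)"
    and ae2: "AE x in L. F2 x = f2 x (u1 x) (u2 x) (weak_gradient \<Omega> u1 x) (weak_gradient \<Omega> u2 x)"
    by (auto elim: eventually_mono)
  show ?thesis
  proof (rule that)
    show "u1 \<in> musielak_sobolev_0 \<Omega> S1.H" by (rule S1.W0_sobolev[OF d1(1)])
    show "u2 \<in> musielak_sobolev_0 \<Omega> S2.H" by (rule S2.W0_sobolev[OF d2(1)])
    show "weak_equation \<Omega> p1 q1 \<mu>1 (\<lambda>x. f1 x (u1 x) (u2 x) (weak_gradient \<Omega> u1 x) (weak_gradient \<Omega> u2 x)) u1 v"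
      if "v \<in> musielak_sobolev_0 \<Omega> S1.H" for v
      by (rule weak_equation_cong_AE[OF S1.dom_sets(1) S1.sol_weak_equation[OF s(1,2) that] _ ae1]) simp
    show "weak_equation \<Omega> p2 q2 \<mu>2 (\<lambda>x. f2 x (u1 x) (u2 x) (weak_gradient \<Omega> u1 x) (weak_gradient \<Omega> u2 x)) u2 v"
      if "v \<in> musielak_sobolev_0 \<Omega> S2.H" for v
      by (rule weak_equation_cong_AE[OF S2.dom_sets(1) S2.sol_weak_equation[OF s(3,4) that] _ ae2]) simp
  qed
qed

text \<open>The bound of \<open>q\<close> by the Sobolev conjugate says that n (1/p - 1/q) < 1 at
  each point. Compactness turns this into a margin \<open>c\<close>, and uniform continuity of 1 / p
  spends half of it on moving \<open>y\<close> away from \<open>x\<close>.\<close>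

lemma subcritical_exponents:
  fixes \<Omega> :: "(real^'n::finite) set"
  assumes C: "compact C" "C \<noteq> {}" and p: "continuous_on C p" and q: "continuous_on C q"
    and pb: "\<And>x. x \<in> C \<Longrightarrow> 1 < p x \<and> p x < n" and qb: "\<And>x. x \<in> C \<Longrightarrow> p x < q x \<and> q x < n * p x / (n - p x)"
  obtains e \<delta> :: real where "0 < e" "e < 1" "0 < \<delta>"
    "\<And>x y. x \<in> C \<Longrightarrow> y \<in> C \<Longrightarrow> dist x y \<le> \<delta> \<Longrightarrow> n * (1 / p y - 1 / q x) \<le> 1 - e"
proof -
  have pq: "0 < p x" "0 < q x" if "x \<in> C" for x using pb[OF that] qb[OF that] by auto
  obtain x0 where x0: "x0 \<in> C" using C(2) by blast
  have n: "0 < n" using pb[OF x0] by simp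
  have sub: "n * (1 / p x - 1 / q x) < 1" if x: "x \<in> C" for x
  proof -
    have "q x * (n - p x) < n * p x" using qb[OF x] pb[OF x] by (simp add: pos_less_divide_eq)
    then show ?thesis using pq[OF x] by (simp add: field_simps)
  qed
  have cont: "continuous_on C (\<lambda>x. n * (1 / p x - 1 / q x))" and contp: "continuous_on C (\<lambda>x. 1 / p x)"
    using p q pq by (auto intro!: continuous_intros simp: less_le)
  obtain z where z: "z \<in> C" "\<forall>x\<in>C. n * (1 / p x - 1 / q x) \<le> n * (1 / p z - 1 / q z)"
    using continuous_attains_sup[OF C cont] by blast
  define c where "c = 1 - n * (1 / p z - 1 / q z)"
  have c: "0 < c" using sub[OF z(1)] by (simp add: c_def)
  have "uniformly_continuous_on C (\<lambda>x. 1 / p x)" by (rule compact_uniformly_continuous[OF contp C(1)])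
  moreover have cn: "0 < c / (2 * n)" using c n by simp
  ultimately obtain d where d: "0 < d" "\<And>x y. x \<in> C \<Longrightarrow> y \<in> C \<Longrightarrow> dist y x < d \<Longrightarrow>
      dist (1 / p y) (1 / p x) < c / (2 * n)"
    unfolding uniformly_continuous_on_def by metis
  show ?thesis
  \<comment> \<open>Half of the margin remains as \<open>e\<close>; the minimum with 1/2 keeps it
    below 1, and d / 2 turns the strict bound on the distance into a weak one.\<close>
  proof (rule that[of "min (c / 2) (1 / 2)" "d / 2"])
    fix x y assume xy: "x \<in> C" "y \<in> C" "dist x y \<le> d / 2"
    then have "dist (1 / p y) (1 / p x) < c / (2 * n)" using d by (intro d(2)) (auto simp: dist_commute)
    then have "1 / p y - 1 / p x \<le> c / (2 * n)" by (simp add: dist_real_def)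
    then have "n * (1 / p y - 1 / p x) \<le> n * (c / (2 * n))" using n by (intro mult_left_mono) auto
    then have "n * (1 / p y - 1 / p x) \<le> c / 2" using n by simp
    moreover have "n * (1 / p x - 1 / q x) \<le> 1 - c" using z(2) xy(1) by (simp add: c_def)
    moreover have "n * (1 / p y - 1 / q x) = n * (1 / p y - 1 / p x) + n * (1 / p x - 1 / q x)"
        by (simp add: algebra_simps)
    ultimately show "n * (1 / p y - 1 / q x) \<le> 1 - min (c / 2) (1 / 2)" by linarith
  qed (use c d in auto)
qed

text \<open>The weight and the source bound are only controlled almost everywhere; they are replaced by
  representatives for which the bounds hold at every point.\<close>
lemma double_phase_source_exists:
  fixes \<Omega> :: "(real^'n::finite) set"
  assumes \<Omega>: "open \<Omega>" "bounded \<Omega>" "\<Omega> \<noteq> {}"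
    and p: "continuous_on (closure \<Omega>) p" and q: "continuous_on (closure \<Omega>) q"
    and pb: "\<And>x. x \<in> closure \<Omega> \<Longrightarrow> 1 < p x \<and> p x < real CARD('n)"
    and qb: "\<And>x. x \<in> closure \<Omega> \<Longrightarrow> p x < q x \<and> q x < real CARD('n) * p x / (real CARD('n) - p x)"
    and \<mu>: "\<mu> \<in> L_infinity \<Omega>" "AE x in lebesgue_on \<Omega>. 0 \<le> \<mu> x"
    and \<psi>: "\<psi> \<in> variable_lebesgue \<Omega> (conjugate_exponent p)" "AE x in lebesgue_on \<Omega>. 0 \<le> \<psi> x"
  obtains \<nu> \<eta> p0 P m e \<delta> where "double_phase_source \<Omega> p q \<nu> p0 P m e \<delta> \<eta>"
    "AE x in lebesgue_on \<Omega>. \<nu> x = \<mu> x" "AE x in lebesgue_on \<Omega>. \<eta> x = \<psi> x"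
proof -
  have C: "compact (closure \<Omega>)" "closure \<Omega> \<noteq> {}" using \<Omega> by (auto simp: compact_closure)
  obtain y where y: "y \<in> closure \<Omega>" "\<And>x. x \<in> closure \<Omega> \<Longrightarrow> p y \<le> p x" using continuous_attains_inf[OF C p]
      by blast
  obtain z where z: "z \<in> closure \<Omega>" "\<And>x. x \<in> closure \<Omega> \<Longrightarrow> q x \<le> q z" using continuous_attains_sup[OF C q]
      by blast
  obtain e \<delta> where e: "0 < e" "e < 1" "0 < \<delta>"
    "\<And>x y. x \<in> closure \<Omega> \<Longrightarrow> y \<in> closure \<Omega> \<Longrightarrow> dist x y \<le> \<delta> \<Longrightarrow> real CARD('n) * (1 / p y - 1 / q x) \<le> 1 - e"
    by (rule subcritical_exponents[OF C p q pb qb]) (blast, blast, rule that)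
  from \<mu>(1) obtain M where M: "AE x in lebesgue_on \<Omega>. \<bar>\<mu> x\<bar> \<le> M"
      and [measurable]: "\<mu> \<in> borel_measurable (lebesgue_on \<Omega>)"
    by (auto simp: L_infinity_def)
  from \<psi>(1) have [measurable]: "\<psi> \<in> borel_measurable (lebesgue_on \<Omega>)"
    and fin: "(\<integral>\<^sup>+x. ennreal (\<bar>\<psi> x\<bar> powr (p x / (p x - 1))) \<partial>lebesgue_on \<Omega>) < \<infinity>"
    by (auto simp: variable_lebesgue_def musielak_orlicz_def modular_def conjugate_exponent_def)
  define \<nu> where "\<nu> x = max 0 (min (\<mu> x) \<bar>M\<bar>)" for x
  define \<eta> where "\<eta> x = max 0 (\<psi> x)" for x
  have sub: "x \<in> closure \<Omega>" if "x \<in> \<Omega>" for x using that closure_subset by blast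
  have \<nu>: "AE x in lebesgue_on \<Omega>. \<nu> x = \<mu> x"
    using M \<mu>(2) by eventually_elim (auto simp: \<nu>_def)
  have \<eta>: "AE x in lebesgue_on \<Omega>. \<eta> x = \<psi> x" using \<psi>(2) by eventually_elim (simp add: \<eta>_def)
  have "double_phase_source \<Omega> p q \<nu> (p y) (q z) \<bar>M\<bar> e \<delta> \<eta>"
  proof
    show "open \<Omega>" "bounded \<Omega>" "0 < e" "e < 1" "0 < \<delta>" by fact+
    show "continuous_on \<Omega> p" "continuous_on \<Omega> q" using p q continuous_on_subset closure_subset by blast+
    show "\<nu> \<in> borel_measurable (lebesgue_on \<Omega>)" unfolding \<nu>_def by measurable
    show "\<eta> \<in> borel_measurable (lebesgue_on \<Omega>)" unfolding \<eta>_def by measurable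
    show "1 < p y" using pb[OF y(1)] by simp
    show "p y \<le> q z" using y(2)[OF z(1)] qb[OF z(1)] by simp
    show "p y \<le> p x \<and> p x \<le> q x \<and> q x \<le> q z" if "x \<in> \<Omega>" for x
      using y(2) z(2) qb sub[OF that] by (auto intro: less_imp_le)
    show "0 \<le> \<nu> x \<and> \<nu> x \<le> \<bar>M\<bar>" for x by (auto simp: \<nu>_def)
    show "0 \<le> \<eta> x" for x by (simp add: \<eta>_def)
    show "real CARD('n) * (1 / p y - 1 / q x) \<le> 1 - e" if "x \<in> \<Omega>" "y \<in> \<Omega>" "dist x y \<le> \<delta>" for x y
      using e(4) sub that by blast
    have "(\<integral>\<^sup>+x. ennreal (\<eta> x powr (p x / (p x - 1))) \<partial>lebesgue_on \<Omega>) =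
        (\<integral>\<^sup>+x. ennreal (\<bar>\<psi> x\<bar> powr (p x / (p x - 1))) \<partial>lebesgue_on \<Omega>)"
      using \<psi>(2) by (intro nn_integral_cong_AE) (auto simp: \<eta>_def elim!: eventually_mono)
    with fin show "(\<integral>\<^sup>+x. ennreal (\<eta> x powr (p x / (p x - 1))) \<partial>lebesgue_on \<Omega>) < \<infinity>" by simp
  qed
  then show ?thesis using \<nu> \<eta> by (rule that)
qed

theorem theorem5p4:
  fixes \<Omega> :: "(real^'n::finite) set"
    and p q \<mu> \<phi> \<psi> :: "nat \<Rightarrow> real^'n \<Rightarrow> real"
    and f :: "nat \<Rightarrow> real^'n \<Rightarrow> real \<Rightarrow> real \<Rightarrow> real^'n \<Rightarrow> real^'n \<Rightarrow> real"
  assumes dim: "CARD('n) \<ge> 2"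
    and domain: "bounded_lipschitz_domain \<Omega>"
    and p_cont: "\<And>i. i \<in> {1, 2} \<Longrightarrow> continuous_on (closure \<Omega>) (p i)"
    and q_cont: "\<And>i. i \<in> {1, 2} \<Longrightarrow> continuous_on (closure \<Omega>) (q i)"
    and p_bounds: "\<And>i x. i \<in> {1, 2} \<Longrightarrow> x \<in> closure \<Omega> \<Longrightarrow> 1 < p i x \<and> p i x < real CARD('n)"
    and q_bounds: "\<And>i x. i \<in> {1, 2} \<Longrightarrow> x \<in> closure \<Omega> \<Longrightarrow>
          p i x < q i x \<and> q i x < real CARD('n) * p i x / (real CARD('n) - p i x)"
    and mu_bounded: "\<And>i. i \<in> {1, 2} \<Longrightarrow> \<mu> i \<in> L_infinity \<Omega>"
    and mu_nonneg: "\<And>i. i \<in> {1, 2} \<Longrightarrow> AE x in lebesgue_on \<Omega>. 0 \<le> \<mu> i x"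
    and f_caratheodory: "\<And>i. i \<in> {1, 2} \<Longrightarrow> caratheodory \<Omega> (f i)"
    and phi_space: "\<And>i. i \<in> {1, 2} \<Longrightarrow> \<phi> i \<in> variable_lebesgue \<Omega> (conjugate_exponent (p i))"
    and psi_space: "\<And>i. i \<in> {1, 2} \<Longrightarrow> \<psi> i \<in> variable_lebesgue \<Omega> (conjugate_exponent (p i))"
    and phi_psi: "\<And>i. i \<in> {1, 2} \<Longrightarrow> AE x in lebesgue_on \<Omega>. 0 \<le> \<phi> i x \<and> \<phi> i x \<le> \<psi> i x"
    and phi_nonzero: "\<And>i. i \<in> {1, 2} \<Longrightarrow> \<not> (AE x in lebesgue_on \<Omega>. \<phi> i x = 0)"
    and f_bounds: "\<And>i. i \<in> {1, 2} \<Longrightarrow>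
          AE x in lebesgue_on \<Omega>. \<forall>s\<^sub>1 \<ge> 0. \<forall>s\<^sub>2 \<ge> 0. \<forall>\<xi>\<^sub>1 \<xi>\<^sub>2.
            \<phi> i x \<le> f i x s\<^sub>1 s\<^sub>2 \<xi>\<^sub>1 \<xi>\<^sub>2 \<and> f i x s\<^sub>1 s\<^sub>2 \<xi>\<^sub>1 \<xi>\<^sub>2 \<le> \<psi> i x"
  shows "\<exists>u\<^sub>1 u\<^sub>2. weak_solution \<Omega> p q \<mu> f u\<^sub>1 u\<^sub>2"
proof -
  have \<Omega>: "open \<Omega>" "bounded \<Omega>" "\<Omega> \<noteq> {}" using domain by (auto simp: bounded_lipschitz_domain_def)
  have I: "(1::nat) \<in> {1, 2}" "(2::nat) \<in> {1, 2}" by auto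
  have psi_nonneg: "AE x in lebesgue_on \<Omega>. 0 \<le> \<psi> i x" if "i \<in> {1, 2}" for i
    using phi_psi[OF that] by eventually_elim auto
  have source: "\<exists>\<nu> \<eta> p0 P m e \<delta>. double_phase_source \<Omega> (p i) (q i) \<nu> p0 P m e \<delta> \<eta> \<and>
      (AE x in lebesgue_on \<Omega>. \<nu> x = \<mu> i x) \<and> (AE x in lebesgue_on \<Omega>. \<eta> x = \<psi> i x)" if i: "i \<in> {1, 2}" for i
    by (rule double_phase_source_exists[OF \<Omega> p_cont[OF i] q_cont[OF i] p_bounds[OF i] q_bounds[OF i]
          mu_bounded[OF i] mu_nonneg[OF i] psi_space[OF i] psi_nonneg[OF i]]) blast+
  from source[OF I(1)] obtain \<nu>1 \<eta>1 a1 b1 m1 e1 d1 where S1: "double_phase_source \<Omega> (p 1) (q 1) \<nu>1 a1 b1 m1 e1 d1 \<eta>1"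
    and \<nu>1: "AE x in lebesgue_on \<Omega>. \<nu>1 x = \<mu> 1 x" and \<eta>1: "AE x in lebesgue_on \<Omega>. \<eta>1 x = \<psi> 1 x" by blast
  from source[OF I(2)] obtain \<nu>2 \<eta>2 a2 b2 m2 e2 d2 where S2: "double_phase_source \<Omega> (p 2) (q 2) \<nu>2 a2 b2 m2 e2 d2 \<eta>2"
    and \<nu>2: "AE x in lebesgue_on \<Omega>. \<nu>2 x = \<mu> 2 x" and \<eta>2: "AE x in lebesgue_on \<Omega>. \<eta>2 x = \<psi> 2 x" by blast
  interpret double_phase_system \<Omega> "p 1" "q 1" \<nu>1 a1 b1 m1 e1 d1 \<eta>1 "p 2" "q 2" \<nu>2 a2 b2 m2 e2 d2 \<eta>2 "f 1" "f 2"
    using S1 S2 f_caratheodory I by (intro double_phase_system.intro double_phase_system_axioms.intro) auto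
  have bnd1: "AE x in L. \<forall>s\<ge>0. \<forall>t\<ge>0. \<forall>\<xi> \<zeta>. 0 \<le> f 1 x s t \<xi> \<zeta> \<and> f 1 x s t \<xi> \<zeta> \<le> \<eta>1 x"
    using f_bounds[OF I(1)] phi_psi[OF I(1)] \<eta>1 by eventually_elim (metis order_trans)
  have bnd2: "AE x in L. \<forall>s\<ge>0. \<forall>t\<ge>0. \<forall>\<xi> \<zeta>. 0 \<le> f 2 x s t \<xi> \<zeta> \<and> f 2 x s t \<xi> \<zeta> \<le> \<eta>2 x"
    using f_bounds[OF I(2)] phi_psi[OF I(2)] \<eta>2 by eventually_elim (metis order_trans)
  \<comment> \<open>The weights were changed on null sets only, which alters neither the spaces nor
    the weak equations.\<close>
  note spaces = musielak_sobolev_0_cong_AE[OF \<nu>1, of "p 1" "q 1"] musielak_sobolev_0_cong_AE[OF \<nu>2, of "p 2" "q 2"]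
  from bnd1 bnd2 show ?thesis
  proof (rule system_solution)
    fix u v
    assume uv: "u \<in> musielak_sobolev_0 \<Omega> S1.H" "v \<in> musielak_sobolev_0 \<Omega> S2.H"
      and e1: "\<And>w. w \<in> musielak_sobolev_0 \<Omega> S1.H \<Longrightarrow>
        weak_equation \<Omega> (p 1) (q 1) \<nu>1 (\<lambda>x. f 1 x (u x) (v x) (weak_gradient \<Omega> u x) (weak_gradient \<Omega> v x)) u w"
      and e2: "\<And>w. w \<in> musielak_sobolev_0 \<Omega> S2.H \<Longrightarrow>
        weak_equation \<Omega> (p 2) (q 2) \<nu>2 (\<lambda>x. f 2 x (u x) (v x) (weak_gradient \<Omega> u x) (weak_gradient \<Omega> v x)) v w"
    have "weak_solution \<Omega> p q \<mu> f u v"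
      unfolding weak_solution_def system_space_def spaces[symmetric]
      using uv weak_equation_cong_AE[OF S1.dom_sets(1) e1 \<nu>1 AE_I2] weak_equation_cong_AE[OF S1.dom_sets(1) e2 \<nu>2 AE_I2]
      by auto
    then show ?thesis by blast
  qed
qed

end
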